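(* In the setting described in the context, the Markov process $X$ solving $dX_t+[AX_t+N(X_t)]\,dt=dL_t$ admits a unique invariant measure if $\alpha\in(3/2,2)$ and $\frac12+\frac1{2\alpha}<\beta<\frac32-\frac1\alpha$.
   Context: Let $\mathbb T=\mathbb R/\mathbb Z$ with Lebesgue measure $d\xi$, and let $H=\{x\in L^2(\mathbb T,\mathbb R):\int_{\mathbb T}x(\xi)\,d\xi=0\}$ with inner product $\langle x,y\rangle_H=\int_{\mathbb T}x(\xi)y(\xi)\,d\xi$. $A$ is the closure in $H$ of $-\frac{d^2}{d\xi^2}$ on $C^2(\mathbb T)\cap H$, a positive definite self-adjoint operator. Let $\mathbb Z_*=\mathbb Z\setminus\{0\}$, $\gamma_k=4\pi^2|k|^2$ and $e_k(\xi)=e^{i2\pi k\xi}$ for $k\in\mathbb Z_*$; $\{e_k\}_{k\in\mathbb Z_*}$ is the orthonormal basis used for $H$, each $x\in H$ being represented as $x=\sum_{k\in\mathbb Z_*}x_ke_k$ with $x_k\in\mathbb C$, $x_{-k}=\overline{x_k}$, and $Ae_k=\gamma_ke_k$. $V=\mathcal D(A^{1/2})$ with $\|x\|_V^2=\sum_{k\in\mathbb Z_*}\gamma_k|x_k|^2$. Noise: $(l_k(t))_{t\ge0}$, $k\in\mathbb Z_*$, are i.i.d. one-dimensional symmetric $\alpha$-stable processes on a probability space $(\Omega,\mathcal F,\mathbb P)$ with $\mathbb E[e^{i\lambda l_k(t)}]=e^{-t|\lambda|^\alpha}$. $L_t=\sum_{k\in\mathbb Z_*}\beta_kl_k(t)e_k$,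 where $C_1\gamma_k^{-\beta}\le|\beta_k|\le C_2\gamma_k^{-\beta}$ for some constants $C_1,C_2>0$. Nonlinearity: $N(u)=-(u-u^3)$. For $x\in H$, $X=X^x$ denotes the (almost surely unique) mild solution with $X_0=x$ whose paths are right continuous with left limits in $H$ on $[0,\infty)$ and in $V$ on $(0,\infty)$: $X_t=e^{-At}x-\int_0^te^{-A(t-s)}N(X_s)\,ds+\int_0^te^{-A(t-s)}\,dL_s$. It is a Markov process on $H$ with semigroup $P_tf(x)=\mathbb E[f(X_t^x)]$. A Borel probability measure $\mu$ on $H$ is invariant if $\int P_tf\,d\mu=\int f\,d\mu$ for all $t\ge0$ and all bounded measurable $f:H\to\mathbb R$.
   Formalization: In the noise, e_k is read as the real basis √2cos(2πkξ) (k>0), √2sin(2πkξ) (k<0) with real β_k, since independent real l_k with complex e_k do not give an element of the real space H; N(u)=-(u-u³) is projected onto mean-zero functions, as it need not lie in H. *)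

theory Defs
  imports "HOL-Probability.Probability"
begin

section \<open>The space of square-integrable mean-zero functions on the circle\<close>

text \<open>The circle is identified with its fundamental domain \<open>[0,1)\<close>; the values of a function
  outside of it are irrelevant.\<close>

definition circle :: "real measure" where
  "circle = restrict_space lborel {0..<1}"

definition square_integrable :: "(real \<Rightarrow> real) \<Rightarrow> bool" where
  "square_integrable f \<longleftrightarrow> f \<in> borel_measurable circle \<and> integrable circle (\<lambda>\<xi>. (f \<xi>)\<^sup>2)"

definition mean_zero :: "(real \<Rightarrow> real) \<Rightarrow> bool" where
  "mean_zero f \<longleftrightarrow> (LINT \<xi>|circle. f \<xi>) = 0"

lemma prob_space_circle: "prob_space circle"
  unfolding circle_def by (rule prob_space_restrict_space) auto

lemma integrable_circle_const [simp]: "integrable circle (\<lambda>_. c :: real)"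
  using prob_space_circle by (simp add: prob_space.finite_measure finite_measure.integrable_const)

lemma measure_circle [simp]: "measure circle (space circle) = 1"
  by (rule prob_space.prob_space[OF prob_space_circle])

lemma integral_circle_const [simp]: "(LINT \<xi>|circle. c) = (c :: real)"
  by simp

lemma square_integrable_measurable [measurable_dest]:
  "square_integrable f \<Longrightarrow> f \<in> borel_measurable circle"
  by (simp add: square_integrable_def)

lemma square_integrable_mult:
  assumes "square_integrable f" "square_integrable g"
  shows "integrable circle (\<lambda>\<xi>. f \<xi> * g \<xi>)"
proof (rule Bochner_Integration.integrable_bound)
  show "integrable circle (\<lambda>\<xi>. (f \<xi>)\<^sup>2 + (g \<xi>)\<^sup>2)"
    using assms by (auto simp: square_integrable_def)
  show "(\<lambda>\<xi>. f \<xi> * g \<xi>) \<in> borel_measurable circle"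
    using assms by (auto simp: square_integrable_def)
  have "\<bar>a * b\<bar> \<le> a\<^sup>2 + b\<^sup>2" for a b :: real
  proof -
    have "2 * \<bar>a\<bar> * \<bar>b\<bar> \<le> \<bar>a\<bar>\<^sup>2 + \<bar>b\<bar>\<^sup>2" by (rule sum_squares_bound)
    moreover have "0 \<le> \<bar>a\<bar> * \<bar>b\<bar>" by simp
    ultimately have "\<bar>a\<bar> * \<bar>b\<bar> \<le> a\<^sup>2 + b\<^sup>2"
      unfolding power2_abs mult.assoc by linarith
    then show ?thesis by (simp add: abs_mult)
  qed
  then show "AE \<xi> in circle. norm (f \<xi> * g \<xi>) \<le> norm ((f \<xi>)\<^sup>2 + (g \<xi>)\<^sup>2)"
    by simp
qed

lemma square_integrable_const [simp]: "square_integrable (\<lambda>_. c)"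
  by (simp add: square_integrable_def)

lemma square_integrable_integrable:
  assumes "square_integrable f"
  shows "integrable circle f"
  using square_integrable_mult[OF assms square_integrable_const[of 1]] by simp

lemma square_integrable_add [intro]:
  assumes "square_integrable f" "square_integrable g"
  shows "square_integrable (\<lambda>\<xi>. f \<xi> + g \<xi>)"
proof -
  have "integrable circle (\<lambda>\<xi>. (f \<xi>)\<^sup>2 + (g \<xi>)\<^sup>2 + 2 * (f \<xi> * g \<xi>))"
    using assms square_integrable_mult[OF assms]
    by (auto simp: square_integrable_def)
  moreover have "(\<lambda>\<xi>. (f \<xi> + g \<xi>)\<^sup>2) = (\<lambda>\<xi>. (f \<xi>)\<^sup>2 + (g \<xi>)\<^sup>2 + 2 * (f \<xi> * g \<xi>))"
    by (auto simp: power2_sum)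
  ultimately show ?thesis
    using assms by (auto simp: square_integrable_def)
qed

lemma square_integrable_cmult [intro]:
  "square_integrable f \<Longrightarrow> square_integrable (\<lambda>\<xi>. c * f \<xi>)"
  by (auto simp: square_integrable_def power_mult_distrib)

lemma square_integrable_minus [intro]:
  "square_integrable f \<Longrightarrow> square_integrable (\<lambda>\<xi>. - f \<xi>)"
  by (auto simp: square_integrable_def)

lemma square_integrable_diff [intro]:
  assumes "square_integrable f" "square_integrable g"
  shows "square_integrable (\<lambda>\<xi>. f \<xi> - g \<xi>)"
  using square_integrable_add[OF assms(1) square_integrable_minus[OF assms(2)]] by simp

definition hrel :: "(real \<Rightarrow> real) \<Rightarrow> (real \<Rightarrow> real) \<Rightarrow> bool" where
  "hrel f g \<longleftrightarrow> square_integrable f \<and> mean_zero f \<and> square_integrable g \<and> mean_zero g \<and>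
     (AE \<xi> in circle. f \<xi> = g \<xi>)"

lemma part_equivp_hrel: "part_equivp hrel"
proof (rule part_equivpI)
  show "\<exists>x. hrel x x" by (intro exI[of _ "\<lambda>_. 0"]) (simp add: hrel_def mean_zero_def)
  show "symp hrel" by (auto simp: symp_def hrel_def)
  show "transp hrel" by (auto simp: transp_def hrel_def)
qed

quotient_type hspace = "real \<Rightarrow> real" / partial: hrel
  by (rule part_equivp_hrel)

instantiation hspace :: real_vector
begin

lift_definition zero_hspace :: hspace is "\<lambda>_. 0"
  by (simp add: hrel_def mean_zero_def)

lift_definition plus_hspace :: "hspace \<Rightarrow> hspace \<Rightarrow> hspace" is "\<lambda>f g \<xi>. f \<xi> + g \<xi>"
  by (auto simp: hrel_def mean_zero_def square_integrable_integrable)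

lift_definition uminus_hspace :: "hspace \<Rightarrow> hspace" is "\<lambda>f \<xi>. - f \<xi>"
  by (auto simp: hrel_def mean_zero_def)

lift_definition minus_hspace :: "hspace \<Rightarrow> hspace \<Rightarrow> hspace" is "\<lambda>f g \<xi>. f \<xi> - g \<xi>"
  by (auto simp: hrel_def mean_zero_def square_integrable_integrable)

lift_definition scaleR_hspace :: "real \<Rightarrow> hspace \<Rightarrow> hspace" is "\<lambda>c f \<xi>. c * f \<xi>"
  by (auto simp: hrel_def mean_zero_def)

instance
proof
  fix x y z :: hspace and a b :: real
  show "x + y + z = x + (y + z)" 
    by transfer (auto simp: hrel_def mean_zero_def square_integrable_integrable)
  show "x + y = y + x"
    by transfer (auto simp: hrel_def mean_zero_def square_integrable_integrable)
  show "0 + x = x"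
    by transfer (auto simp: hrel_def mean_zero_def square_integrable_integrable)
  show "- x + x = 0"
    by transfer (auto simp: hrel_def mean_zero_def square_integrable_integrable)
  show "x - y = x + - y"
    by transfer (auto simp: hrel_def mean_zero_def square_integrable_integrable)
  show "a *\<^sub>R (x + y) = a *\<^sub>R x + a *\<^sub>R y"
    by transfer (auto simp: hrel_def mean_zero_def square_integrable_integrable distrib_left)
  show "(a + b) *\<^sub>R x = a *\<^sub>R x + b *\<^sub>R x"
    by transfer (auto simp: hrel_def mean_zero_def square_integrable_integrable distrib_right)
  show "a *\<^sub>R b *\<^sub>R x = (a * b) *\<^sub>R x"
    by transfer (auto simp: hrel_def mean_zero_def square_integrable_integrable)
  show "1 *\<^sub>R x = x"
    by transfer (auto simp: hrel_def mean_zero_def square_integrable_integrable)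
qed

end

instantiation hspace :: real_inner
begin

lift_definition inner_hspace :: "hspace \<Rightarrow> hspace \<Rightarrow> real" is "\<lambda>f g. LINT \<xi>|circle. f \<xi> * g \<xi>"
proof -
  fix f f' g g' assume a: "hrel f f'" "hrel g g'"
  then have [measurable]: "f \<in> borel_measurable circle" "f' \<in> borel_measurable circle"
     "g \<in> borel_measurable circle" "g' \<in> borel_measurable circle"
    by (auto simp: hrel_def square_integrable_def)
  show "(LINT \<xi>|circle. f \<xi> * g \<xi>) = (LINT \<xi>|circle. f' \<xi> * g' \<xi>)"
    using a by (intro integral_cong_AE) (auto simp: hrel_def)
qed

definition norm_hspace :: "hspace \<Rightarrow> real" where
  "norm_hspace x = sqrt (inner x x)"

definition sgn_hspace :: "hspace \<Rightarrow> hspace" where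
  "sgn_hspace x = x /\<^sub>R norm x"

definition dist_hspace :: "hspace \<Rightarrow> hspace \<Rightarrow> real" where
  "dist_hspace x y = norm (x - y)"

definition uniformity_hspace :: "(hspace \<times> hspace) filter" where
  "uniformity_hspace = (INF e\<in>{0 <..}. principal {(x, y). dist x y < e})"

definition open_hspace :: "hspace set \<Rightarrow> bool" where
  "open_hspace U \<longleftrightarrow> (\<forall>x\<in>U. eventually (\<lambda>(x', y). x' = x \<longrightarrow> y \<in> U) uniformity)"

instance
proof
  fix x y z :: hspace and r :: real
  show "dist x y = norm (x - y)" by (rule dist_hspace_def)
  show "sgn x = x /\<^sub>R norm x" by (rule sgn_hspace_def)
  show "(uniformity :: (hspace \<times> hspace) filter) = (INF e\<in>{0 <..}. principal {(x, y). dist x y < e})"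
    by (rule uniformity_hspace_def)
  show "open U \<longleftrightarrow> (\<forall>x\<in>U. eventually (\<lambda>(x', y). x' = x \<longrightarrow> y \<in> U) uniformity)" for U :: "hspace set"
    by (rule open_hspace_def)
  show "norm x = sqrt (inner x x)" by (rule norm_hspace_def)
  show "inner x y = inner y x"
    by transfer (simp add: mult.commute)
  show "inner (x + y) z = inner x z + inner y z"
    by transfer (auto simp: hrel_def distrib_right square_integrable_mult)
  show "inner (r *\<^sub>R x) y = r * inner x y"
    by transfer (auto simp: mult.assoc)
  show "0 \<le> inner x x"
    by transfer simp
  show "inner x x = 0 \<longleftrightarrow> x = 0"
  proof transfer
    fix f assume f: "hrel f f"
    then have "integrable circle (\<lambda>\<xi>. f \<xi> * f \<xi>)"
      by (auto simp: hrel_def square_integrable_mult)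
    then have "(LINT \<xi>|circle. f \<xi> * f \<xi>) = 0 \<longleftrightarrow> (AE \<xi> in circle. f \<xi> * f \<xi> = 0)"
      by (intro integral_nonneg_eq_0_iff_AE) auto
    also have "\<dots> \<longleftrightarrow> hrel f (\<lambda>_. 0)"
      using f by (auto simp: hrel_def mean_zero_def)
    finally show "(LINT \<xi>|circle. f \<xi> * f \<xi>) = 0 \<longleftrightarrow> hrel f (\<lambda>_. 0)" .
  qed
qed

end

text \<open>Orthogonal projection of square-integrable functions onto the mean-zero ones.\<close>

lift_definition hproj :: "(real \<Rightarrow> real) \<Rightarrow> hspace" is
  "\<lambda>f. if square_integrable f then (\<lambda>\<xi>. f \<xi> - (LINT \<eta>|circle. f \<eta>)) else (\<lambda>_. 0)"
  by (auto simp: hrel_def mean_zero_def square_integrable_integrable )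

abbreviation fun_of :: "hspace \<Rightarrow> real \<Rightarrow> real" where
  "fun_of \<equiv> rep_hspace"

lemma hrel_fun_of: "hrel (fun_of x) (fun_of x)"
  by (rule Quotient3_rep_reflp[OF Quotient3_hspace])

lemma square_integrable_fun_of: "square_integrable (fun_of x)"
  using hrel_fun_of[of x] by (simp add: hrel_def)

lemma mean_zero_fun_of: "mean_zero (fun_of x)"
  using hrel_fun_of[of x] by (simp add: hrel_def)

lemma hproj_fun_of: "hproj (fun_of x) = x"
proof -
  have "hproj (fun_of x) = abs_hspace (fun_of x)"
    using square_integrable_fun_of[of x] mean_zero_fun_of[of x]
    by (simp add: hproj.abs_eq mean_zero_def)
  then show ?thesis
    using Quotient3_abs_rep[OF Quotient3_hspace] by simp
qed

lemma hproj_diff: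
  assumes "square_integrable f" "square_integrable g"
  shows "hproj f - hproj g = hproj (\<lambda>\<xi>. f \<xi> - g \<xi>)"
proof -
  have m: "(LINT \<xi>|circle. f \<xi> - g \<xi>) = (LINT \<xi>|circle. f \<xi>) - (LINT \<xi>|circle. g \<xi>)"
    using assms by (simp add: square_integrable_integrable)
  have z: "hrel (\<lambda>\<xi>. f \<xi> - (LINT \<eta>|circle. f \<eta>)) (\<lambda>\<xi>. f \<xi> - (LINT \<eta>|circle. f \<eta>))"
    if "square_integrable f" for f
    using that square_integrable_integrable[OF that] square_integrable_diff[OF that]
    by (simp add: hrel_def mean_zero_def)
  show ?thesis
    using assms square_integrable_diff[OF assms] z[OF assms(1)] z[OF assms(2)]
    by (simp add: hproj.abs_eq minus_hspace.abs_eq m algebra_simps)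
qed

lemma norm_hproj_le:
  assumes "square_integrable f"
  shows "(norm (hproj f))\<^sup>2 \<le> (LINT \<xi>|circle. (f \<xi>)\<^sup>2)"
proof -
  define m where "m = (LINT \<eta>|circle. f \<eta>)"
  have i: "integrable circle f" "integrable circle (\<lambda>\<xi>. (f \<xi>)\<^sup>2)"
    using assms by (auto intro: square_integrable_integrable simp: square_integrable_def)
  have "(norm (hproj f))\<^sup>2 = inner (hproj f) (hproj f)"
    by (simp add: power2_norm_eq_inner)
  also have "\<dots> = (LINT \<xi>|circle. (f \<xi> - m) * (f \<xi> - m))"
    using assms unfolding m_def by transfer simp
  also have "\<dots> = (LINT \<xi>|circle. (f \<xi>)\<^sup>2 - 2 * m * f \<xi> + m\<^sup>2)"
    by (intro Bochner_Integration.integral_cong) (auto simp: power2_eq_square algebra_simps)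
  also have "\<dots> = (LINT \<xi>|circle. (f \<xi>)\<^sup>2) - 2 * m * m + m\<^sup>2"
    using i by (simp add:  m_def)
  also have "\<dots> \<le> (LINT \<xi>|circle. (f \<xi>)\<^sup>2)"
    by (simp add: power2_eq_square)
  finally show ?thesis .
qed

lemma norm_hspace_sq: "(norm x)\<^sup>2 = (LINT \<xi>|circle. (fun_of x \<xi>)\<^sup>2)"
proof -
  have "inner x x = (LINT \<xi>|circle. fun_of x \<xi> * fun_of x \<xi>)"
    by (simp add: inner_hspace.rep_eq)
  then show ?thesis unfolding power2_norm_eq_inner by (simp add: power2_eq_square)
qed

lemma fun_of_diff: "AE \<xi> in circle. fun_of (x - y) \<xi> = fun_of x \<xi> - fun_of y \<xi>"
proof -
  have "hrel (fun_of (x - y)) (\<lambda>\<xi>. fun_of x \<xi> - fun_of y \<xi>)"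
  proof -
    have 1: "x - y = abs_hspace (\<lambda>\<xi>. fun_of x \<xi> - fun_of y \<xi>)"
      by (simp add: minus_hspace_def)
    have 2: "hrel (\<lambda>\<xi>. fun_of x \<xi> - fun_of y \<xi>) (\<lambda>\<xi>. fun_of x \<xi> - fun_of y \<xi>)"
      using square_integrable_fun_of mean_zero_fun_of
      by (auto simp: hrel_def mean_zero_def square_integrable_integrable)
    show ?thesis unfolding 1
      using 2 by (rule Quotient3_rep_abs[OF Quotient3_hspace])
  qed
  then show ?thesis by (simp add: hrel_def)
qed

lemma norm_diff_hspace_sq:
  "(norm (x - y))\<^sup>2 = (LINT \<xi>|circle. (fun_of x \<xi> - fun_of y \<xi>)\<^sup>2)"
proof -
  have [measurable]: "fun_of z \<in> borel_measurable circle" for z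
    using square_integrable_fun_of by (simp add: square_integrable_def)
  show ?thesis
    unfolding norm_hspace_sq using fun_of_diff[of x y] by (intro integral_cong_AE) auto
qed

lemma fun_of_measurable [measurable]: "fun_of x \<in> borel_measurable circle"
  using square_integrable_fun_of by (simp add: square_integrable_def)

instance hspace :: complete_space
proof
  fix X :: "nat \<Rightarrow> hspace" assume C: "Cauchy X"
  have "\<exists>N. \<forall>m\<ge>N. \<forall>n\<ge>N. dist (X m) (X n) < (1/2)^k" for k :: nat
    using C unfolding Cauchy_def by simp
  then obtain N where N: "dist (X m) (X n) < (1/2)^k" if "m \<ge> N k" "n \<ge> N k" for k m n
    by metis
  define r where "r n = (\<Sum>i\<le>n. N i) + n" for n :: nat
  have r_mono: "strict_mono r"
    by (rule strict_monoI_Suc) (simp add: r_def)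
  have r_ge: "r n \<ge> N n" for n
  proof -
    have "N n \<le> (\<Sum>i\<le>n. N i)" by (rule member_le_sum) auto
    then show ?thesis by (simp add: r_def)
  qed
  have r_step: "norm (X (r (Suc n)) - X (r n)) < (1/2)^n" for n
  proof -
    have "r (Suc n) \<ge> r n" using r_mono by (simp add: strict_mono_leD)
    then show ?thesis using N[of n "r (Suc n)" "r n"] r_ge[of n] by (simp add: dist_norm)
  qed
  define f where "f n = fun_of (X (r n))" for n
  have f_meas [measurable]: "f n \<in> borel_measurable circle" for n
    by (simp add: f_def)
  have f_sq: "square_integrable (f n)" for n
    by (simp add: f_def square_integrable_fun_of)
  have f_norm: "(LINT \<xi>|circle. (f m \<xi> - f n \<xi>)\<^sup>2) = (norm (X (r m) - X (r n)))\<^sup>2" for m n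
    by (simp add: f_def norm_diff_hspace_sq)
  define d where "d n \<xi> = f (Suc n) \<xi> - f n \<xi>" for n \<xi>
  have d_meas [measurable]: "d n \<in> borel_measurable circle" for n
    unfolding d_def by measurable
  have d_sq: "square_integrable (d n)" for n
    unfolding d_def by (intro square_integrable_diff f_sq)
  have d_int: "(LINT \<xi>|circle. \<bar>d n \<xi>\<bar>) \<le> (1/2)^n" for n
  proof -
    define c :: real where "c = (1/2)^n"
    have c: "c > 0" by (simp add: c_def)
    have i: "integrable circle (\<lambda>\<xi>. (d n \<xi>)\<^sup>2)" using d_sq by (simp add: square_integrable_def)
    have "(norm (X (r (Suc n)) - X (r n)))\<^sup>2 \<le> c\<^sup>2"
      using r_step[of n] unfolding c_def by (intro power_mono) auto
    then have le: "(LINT \<xi>|circle. (d n \<xi>)\<^sup>2) \<le> c\<^sup>2"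
      unfolding d_def f_norm .
    have pt: "\<bar>h\<bar> \<le> (h\<^sup>2 + c\<^sup>2) / (2 * c)" for h
    proof -
      have "2 * \<bar>h\<bar> * c \<le> \<bar>h\<bar>\<^sup>2 + c\<^sup>2" by (rule sum_squares_bound)
      then show ?thesis using c by (simp add: field_simps)
    qed
    have "(LINT \<xi>|circle. \<bar>d n \<xi>\<bar>) \<le> (LINT \<xi>|circle. ((d n \<xi>)\<^sup>2 + c\<^sup>2) / (2 * c))"
      using i square_integrable_integrable[OF d_sq]
      by (intro integral_mono pt) auto
    also have "\<dots> = ((LINT \<xi>|circle. (d n \<xi>)\<^sup>2) + c\<^sup>2) / (2 * c)"
      using i by simp
    also have "\<dots> \<le> (c\<^sup>2 + c\<^sup>2) / (2 * c)"
      using le c by (intro divide_right_mono) auto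
    also have "\<dots> = c" using c by (simp add: power2_eq_square)
    finally show ?thesis by (simp add: c_def)
  qed
  have "(\<integral>\<^sup>+ \<xi>. (\<Sum>n. ennreal \<bar>d n \<xi>\<bar>) \<partial>circle) = (\<Sum>n. \<integral>\<^sup>+ \<xi>. ennreal \<bar>d n \<xi>\<bar> \<partial>circle)"
    by (rule nn_integral_suminf) simp
  also have "\<dots> = (\<Sum>n. ennreal (LINT \<xi>|circle. \<bar>d n \<xi>\<bar>))"
    using square_integrable_integrable[OF d_sq]
    by (intro suminf_cong nn_integral_eq_integral) auto
  also have "\<dots> \<le> (\<Sum>n. ennreal ((1/2)^n))"
    using d_int by (intro suminf_le ennreal_leI) auto
  also have "\<dots> = ennreal (\<Sum>n. (1/2)^n)"
    by (intro suminf_ennreal2) (auto intro: summable_geometric)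
  finally have "(\<integral>\<^sup>+ \<xi>. (\<Sum>n. ennreal \<bar>d n \<xi>\<bar>) \<partial>circle) \<noteq> \<infinity>"
    by (auto simp: top_unique)
  then have "AE \<xi> in circle. (\<Sum>n. ennreal \<bar>d n \<xi>\<bar>) \<noteq> \<infinity>"
    by (intro nn_integral_noteq_infinite) auto
  then have conv: "AE \<xi> in circle. convergent (\<lambda>n. f n \<xi>)"
  proof eventually_elim
    case (elim \<xi>)
    have "summable (\<lambda>n. \<bar>d n \<xi>\<bar>)"
      by (rule summable_suminf_not_top) (use elim in auto)
    then have "summable (\<lambda>n. d n \<xi>)"
      by (rule summable_rabs_cancel)
    then have "convergent (\<lambda>n. f 0 \<xi> + (\<Sum>i<n. d i \<xi>))"
      by (intro convergent_add convergent_const) (simp add: summable_iff_convergent)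
    moreover have "f 0 \<xi> + (\<Sum>i<n. d i \<xi>) = f n \<xi>" for n
      using sum_lessThan_telescope[of "\<lambda>n. f n \<xi>" n] by (simp add: d_def)
    ultimately show ?case by simp
  qed
  define g where "g \<xi> = lim (\<lambda>n. f n \<xi>)" for \<xi>
  have g_meas [measurable]: "g \<in> borel_measurable circle"
    unfolding g_def by measurable
  have lim: "AE \<xi> in circle. (\<lambda>n. f n \<xi>) \<longlonglongrightarrow> g \<xi>"
    using conv by eventually_elim (simp add: g_def convergent_LIMSEQ_iff)
  have main: "square_integrable (\<lambda>\<xi>. g \<xi> - f n \<xi>) \<and> (LINT \<xi>|circle. (g \<xi> - f n \<xi>)\<^sup>2) \<le> e\<^sup>2"
    if e: "e > 0" and n: "\<And>m. m \<ge> n \<Longrightarrow> norm (X (r m) - X (r n)) \<le> e" for e n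
  proof -
    have "(\<integral>\<^sup>+ \<xi>. ennreal ((g \<xi> - f n \<xi>)\<^sup>2) \<partial>circle)
        = (\<integral>\<^sup>+ \<xi>. liminf (\<lambda>m. ennreal ((f m \<xi> - f n \<xi>)\<^sup>2)) \<partial>circle)"
    proof (intro nn_integral_cong_AE)
      show "AE \<xi> in circle. ennreal ((g \<xi> - f n \<xi>)\<^sup>2) = liminf (\<lambda>m. ennreal ((f m \<xi> - f n \<xi>)\<^sup>2))"
        using lim
      proof eventually_elim
        case (elim \<xi>)
        have "(\<lambda>m. ennreal ((f m \<xi> - f n \<xi>)\<^sup>2)) \<longlonglongrightarrow> ennreal ((g \<xi> - f n \<xi>)\<^sup>2)"
          by (intro tendsto_ennrealI tendsto_intros elim)
        from lim_imp_Liminf[OF trivial_limit_sequentially this] show ?case by (rule sym)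
      qed
    qed
    also have "\<dots> \<le> liminf (\<lambda>m. \<integral>\<^sup>+ \<xi>. ennreal ((f m \<xi> - f n \<xi>)\<^sup>2) \<partial>circle)"
      by (intro nn_integral_liminf) measurable
    also have "\<dots> \<le> liminf (\<lambda>m. ennreal (e\<^sup>2))"
    proof (rule Liminf_mono)
      show "\<forall>\<^sub>F m in sequentially. (\<integral>\<^sup>+ \<xi>. ennreal ((f m \<xi> - f n \<xi>)\<^sup>2) \<partial>circle) \<le> ennreal (e\<^sup>2)"
        using eventually_ge_at_top[of n]
      proof eventually_elim
        case (elim m)
        have "square_integrable (\<lambda>\<xi>. f m \<xi> - f n \<xi>)" by (intro square_integrable_diff f_sq)
        then have "(\<integral>\<^sup>+ \<xi>. ennreal ((f m \<xi> - f n \<xi>)\<^sup>2) \<partial>circle)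
            = ennreal (LINT \<xi>|circle. (f m \<xi> - f n \<xi>)\<^sup>2)"
          by (intro nn_integral_eq_integral) (auto simp: square_integrable_def)
        also have "\<dots> \<le> ennreal (e\<^sup>2)"
          unfolding f_norm by (intro ennreal_leI power_mono n elim) auto
        finally show ?case .
      qed
    qed
    also have "\<dots> = ennreal (e\<^sup>2)"
      by (simp add: Liminf_const)
    finally have le: "(\<integral>\<^sup>+ \<xi>. ennreal ((g \<xi> - f n \<xi>)\<^sup>2) \<partial>circle) \<le> ennreal (e\<^sup>2)" .
    then have i: "integrable circle (\<lambda>\<xi>. (g \<xi> - f n \<xi>)\<^sup>2)"
      by (intro integrableI_nonneg) (auto simp: top_unique less_top[symmetric])
    then have "ennreal (LINT \<xi>|circle. (g \<xi> - f n \<xi>)\<^sup>2) \<le> ennreal (e\<^sup>2)"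
      using le by (subst (asm) nn_integral_eq_integral) auto
    then show ?thesis using i by (auto simp: square_integrable_def)
  qed
  have tail: "\<exists>n0. \<forall>n\<ge>n0. \<forall>m\<ge>n. norm (X (r m) - X (r n)) \<le> e" if e: "e > 0" for e :: real
  proof -
    obtain M where M: "\<And>m n. m \<ge> M \<Longrightarrow> n \<ge> M \<Longrightarrow> dist (X m) (X n) < e"
      using C e unfolding Cauchy_def by blast
    have "norm (X (r m) - X (r n)) \<le> e" if "n \<ge> M" "m \<ge> n" for m n
      using M[of "r m" "r n"] seq_suble[OF r_mono, of m] seq_suble[OF r_mono, of n] that
      by (simp add: dist_norm less_imp_le)
    then show ?thesis by blast
  qed
  have g_sq: "square_integrable g"
  proof -
    obtain n0 where "\<And>m. m \<ge> n0 \<Longrightarrow> norm (X (r m) - X (r n0)) \<le> 1"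
      using tail[of 1] by auto
    from main[OF _ this] have "square_integrable (\<lambda>\<xi>. g \<xi> - f n0 \<xi>)" by simp
    from square_integrable_add[OF this f_sq[of n0]] show ?thesis by simp
  qed
  have "(X \<circ> r) \<longlonglongrightarrow> hproj g"
  proof (rule metric_LIMSEQ_I)
    fix e :: real assume e: "e > 0"
    obtain n0 where n0: "\<And>n m. n \<ge> n0 \<Longrightarrow> m \<ge> n \<Longrightarrow> norm (X (r m) - X (r n)) \<le> e / 2"
      using tail[of "e/2"] e by auto
    have "dist ((X \<circ> r) n) (hproj g) < e" if n: "n \<ge> n0" for n
    proof -
      have m: "square_integrable (\<lambda>\<xi>. g \<xi> - f n \<xi>)" "(LINT \<xi>|circle. (g \<xi> - f n \<xi>)\<^sup>2) \<le> (e/2)\<^sup>2"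
        using main[of "e/2" n] n0[OF n] e by auto
      have "hproj g - X (r n) = hproj (\<lambda>\<xi>. g \<xi> - f n \<xi>)"
        using hproj_diff[OF g_sq f_sq[of n]] by (simp add: f_def hproj_fun_of)
      then have "(norm (hproj g - X (r n)))\<^sup>2 \<le> (e/2)\<^sup>2"
        using norm_hproj_le[OF m(1)] m(2) by simp
      then have "norm (hproj g - X (r n)) \<le> e/2"
        by (rule power2_le_imp_le) (use e in simp)
      then show ?thesis using e by (simp add: dist_norm norm_minus_commute)
    qed
    then show "\<exists>no. \<forall>n\<ge>no. dist ((X \<circ> r) n) (hproj g) < e" by blast
  qed
  from Cauchy_converges_subseq[OF C r_mono this]
  show "convergent X" by (auto simp: convergent_def)
qed

instance hspace :: banach ..

lemma sets_circle [measurable_cong]: "sets circle = sets (restrict_space borel {0..<1})"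
  by (simp add: circle_def sets_restrict_space)

lemma space_circle: "space circle = {0..<1}"
  by (simp add: circle_def)

lemma borel_measurable_circle:
  "f \<in> borel_measurable borel \<Longrightarrow> f \<in> borel_measurable circle"
  unfolding circle_def by (rule measurable_restrict_space1) simp

lemma dist_hproj_less:
  assumes "square_integrable f" "square_integrable g"
    and "(LINT \<xi>|circle. (f \<xi> - g \<xi>)\<^sup>2) < e\<^sup>2" "e > 0"
  shows "dist (hproj f) (hproj g) < e"
proof -
  have "(norm (hproj f - hproj g))\<^sup>2 < e\<^sup>2"
    using norm_hproj_le[OF square_integrable_diff[OF assms(1,2)]] assms(3)
    by (simp add: hproj_diff[OF assms(1,2)])
  then have "norm (hproj f - hproj g) < e"
    by (rule power2_less_imp_less) (use assms(4) in simp)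
  then show ?thesis
    by (simp add: dist_norm)
qed

lemma square_integrable_bounded:
  assumes [measurable]: "f \<in> borel_measurable circle" and "\<And>\<xi>. \<xi> \<in> {0..<1} \<Longrightarrow> \<bar>f \<xi>\<bar> \<le> B"
  shows "square_integrable f"
proof -
  interpret prob_space circle by (rule prob_space_circle)
  have "integrable circle (\<lambda>\<xi>. (f \<xi>)\<^sup>2)"
  proof (rule integrable_const_bound)
    show "AE \<xi> in circle. norm ((f \<xi>)\<^sup>2) \<le> B\<^sup>2"
    proof (rule AE_I2)
      fix \<xi> assume "\<xi> \<in> space circle"
      then have "\<bar>f \<xi>\<bar> \<le> B" by (intro assms(2)) (simp add: space_circle)
      then have "\<bar>f \<xi>\<bar> \<le> \<bar>B\<bar>" by simp
      then show "norm ((f \<xi>)\<^sup>2) \<le> B\<^sup>2" by (simp add: abs_le_square_iff)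
    qed
  qed simp
  then show ?thesis by (simp add: square_integrable_def)
qed

lemma L2_dominated:
  fixes f w :: "real \<Rightarrow> real" and s :: "nat \<Rightarrow> real \<Rightarrow> real"
  assumes [measurable]: "f \<in> borel_measurable circle" "\<And>n. s n \<in> borel_measurable circle"
    and "AE \<xi> in circle. (\<lambda>n. s n \<xi>) \<longlonglongrightarrow> f \<xi>"
    and "integrable circle w" "\<And>n. AE \<xi> in circle. (f \<xi> - s n \<xi>)\<^sup>2 \<le> w \<xi>"
    and "e > 0"
  shows "\<exists>n. (LINT \<xi>|circle. (f \<xi> - s n \<xi>)\<^sup>2) < e"
proof -
  have "(\<lambda>n. LINT \<xi>|circle. (f \<xi> - s n \<xi>)\<^sup>2) \<longlonglongrightarrow> (LINT \<xi>|circle. (0 :: real))"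
  proof (rule integral_dominated_convergence[where w = w])
    show "AE \<xi> in circle. (\<lambda>n. (f \<xi> - s n \<xi>)\<^sup>2) \<longlonglongrightarrow> 0"
      using assms(3)
    proof eventually_elim
      case (elim \<xi>)
      then have "(\<lambda>n. (f \<xi> - s n \<xi>)\<^sup>2) \<longlonglongrightarrow> (f \<xi> - f \<xi>)\<^sup>2"
        by (intro tendsto_intros)
      then show ?case by simp
    qed
  qed (use assms in auto)
  then have "\<forall>\<^sub>F n in sequentially. (LINT \<xi>|circle. (f \<xi> - s n \<xi>)\<^sup>2) < e"
    using assms(6) by (intro order_tendstoD(2)[where y = 0]) auto
  then show ?thesis by (auto simp: eventually_sequentially)
qed

text \<open>The projections of the polynomials with rational coefficients are dense.\<close>

definition rat_poly :: "rat list \<Rightarrow> real \<Rightarrow> real" where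
  "rat_poly cs \<xi> = (\<Sum>i<length cs. of_rat (cs ! i) * \<xi> ^ i)"

lemma continuous_on_rat_poly: "continuous_on S (rat_poly cs)"
  unfolding rat_poly_def by (intro continuous_intros)

lemma continuous_on_square_integrable:
  assumes "continuous_on UNIV f"
  shows "square_integrable f"
proof -
  have [measurable]: "f \<in> borel_measurable borel"
    using assms by (simp add: borel_measurable_continuous_onI)
  have "compact (f ` {0..1})"
    using assms continuous_on_subset by (intro compact_continuous_image) auto
  then obtain B where "\<And>y. y \<in> f ` {0..1} \<Longrightarrow> norm y \<le> B"
    using compact_imp_bounded bounded_iff by metis
  moreover have "f \<in> borel_measurable circle"
    by (rule borel_measurable_circle) fact
  ultimately show ?thesis
    by (intro square_integrable_bounded[of f B]) auto
qed

lemma rat_poly_dense_continuous: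
  assumes "continuous_on UNIV f" "e > 0"
  shows "\<exists>cs. \<forall>\<xi>\<in>{0..1}. \<bar>f \<xi> - rat_poly cs \<xi>\<bar> < e"
proof -
  obtain g where g: "real_polynomial_function g" "\<And>\<xi>. \<xi> \<in> {0..1} \<Longrightarrow> \<bar>f \<xi> - g \<xi>\<bar> < e/2"
    using Stone_Weierstrass_real_polynomial_function[of "{0..1::real}" f "e/2"] assms
      continuous_on_subset by (metis compact_Icc half_gt_zero subset_UNIV)
  obtain a n where a: "g = (\<lambda>\<xi>. \<Sum>i\<le>n. a i * \<xi> ^ i)"
    using g(1) by (auto simp: real_polynomial_function_iff_sum)
  have "\<exists>q. \<bar>a i - of_rat q\<bar> < e / (2 * (real n + 1))" for i
  proof -
    have "a i < a i + e / (2 * (real n + 1))" using assms by simp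
    then obtain q where "a i < of_rat q" "of_rat q < a i + e / (2 * (real n + 1))"
      using of_rat_dense by blast
    then show ?thesis by (intro exI[of _ q]) simp
  qed
  then obtain q where q: "\<bar>a i - of_rat (q i)\<bar> < e / (2 * (real n + 1))" for i by metis
  define cs where "cs = map q [0..<Suc n]"
  have "\<bar>f \<xi> - rat_poly cs \<xi>\<bar> < e" if \<xi>: "\<xi> \<in> {0..1}" for \<xi>
  proof -
    have "rat_poly cs \<xi> = (\<Sum>i\<le>n. of_rat (q i) * \<xi> ^ i)"
      unfolding rat_poly_def cs_def by (intro sum.cong) (auto simp del: upt_Suc)
    then have "g \<xi> - rat_poly cs \<xi> = (\<Sum>i\<le>n. (a i - of_rat (q i)) * \<xi> ^ i)"
      by (simp add: a sum_subtractf left_diff_distrib)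
    also have "\<bar>\<dots>\<bar> \<le> (\<Sum>i\<le>n. \<bar>(a i - of_rat (q i)) * \<xi> ^ i\<bar>)"
      by (rule sum_abs)
    also have "\<dots> \<le> (\<Sum>i\<le>n. e / (2 * (real n + 1)))"
    proof (rule sum_mono)
      fix i
      have "\<bar>\<xi> ^ i\<bar> \<le> 1" using \<xi> by (simp add: power_abs power_le_one)
      then have "\<bar>a i - of_rat (q i)\<bar> * \<bar>\<xi> ^ i\<bar> \<le> e / (2 * (real n + 1)) * 1"
        using q[of i] assms(2) by (intro mult_mono) auto
      then show "\<bar>(a i - of_rat (q i)) * \<xi> ^ i\<bar> \<le> e / (2 * (real n + 1))"
        by (simp add: abs_mult)
    qed
    also have "\<dots> = e / 2" by (simp add: field_simps)
    finally show ?thesis using g(2)[OF \<xi>] by linarith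
  qed
  then show ?thesis by blast
qed

lemma AE_circle_lborel:
  "(AE \<xi> in circle. P \<xi>) \<longleftrightarrow> (AE \<xi> in lborel. \<xi> \<in> {0..<1} \<longrightarrow> P \<xi>)"
  unfolding circle_def by (subst AE_restrict_space_iff) auto

lemma bounded_approx_continuous:
  fixes h :: "real \<Rightarrow> real"
  assumes [measurable]: "h \<in> borel_measurable circle"
    and h: "\<And>\<xi>. \<bar>h \<xi>\<bar> \<le> B" and e: "e > 0"
  shows "\<exists>g. continuous_on UNIV g \<and> (LINT \<xi>|circle. (h \<xi> - g \<xi>)\<^sup>2) < e"
proof -
  have "h \<in> borel_measurable (restrict_space borel {0..<1})"
    by measurable
  then have "(\<lambda>\<xi>. indicator {0..<1} \<xi> *\<^sub>R h \<xi>) \<in> borel_measurable borel"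
    by (subst (asm) borel_measurable_restrict_space_iff) auto
  then have "(\<lambda>\<xi>. indicator {0..<1} \<xi> *\<^sub>R h \<xi>) \<in> borel_measurable (lebesgue_on UNIV)"
    by (simp add: lebesgue_on_UNIV_eq measurable_completion)
  then have "(\<lambda>\<xi>. indicator {0..<1} \<xi> *\<^sub>R h \<xi>) measurable_on UNIV"
    by (simp add: measurable_on_iff_borel_measurable)
  then obtain N s where N: "negligible N" and s: "\<And>n. continuous_on UNIV (s n)"
    and lim: "\<And>\<xi>. \<xi> \<notin> N \<Longrightarrow> (\<lambda>n. s n \<xi>) \<longlonglongrightarrow> indicator {0..<1} \<xi> *\<^sub>R h \<xi>"
    unfolding measurable_on_def by auto
  define t where "t n \<xi> = max (- B) (min B (s n \<xi>))" for n :: nat and \<xi>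
  have t_cont: "continuous_on UNIV (t n)" for n
    unfolding t_def by (intro continuous_intros s)
  have t_meas [measurable]: "t n \<in> borel_measurable borel" for n
    using t_cont by (simp add: borel_measurable_continuous_onI)
  have B: "B \<ge> 0" using h[of 0] by linarith
  have "AE \<xi> in lebesgue. \<xi> \<notin> N"
    using N by (simp add: negligible_iff_null_sets AE_not_in)
  then have "AE \<xi> in lborel. \<xi> \<notin> N"
    by (simp add: AE_completion_iff)
  then have ae: "AE \<xi> in circle. (\<lambda>n. t n \<xi>) \<longlonglongrightarrow> h \<xi>"
    unfolding AE_circle_lborel
  proof eventually_elim
    case (elim \<xi>)
    have "(\<lambda>n. t n \<xi>) \<longlonglongrightarrow> max (- B) (min B (h \<xi>))" if "\<xi> \<in> {0..<1}"
      unfolding t_def using lim[OF elim] that by (intro tendsto_intros) auto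
    moreover have "max (- B) (min B (h \<xi>)) = h \<xi>" using h[of \<xi>] by auto
    ultimately show ?case by simp
  qed
  have "\<exists>n. (LINT \<xi>|circle. (h \<xi> - t n \<xi>)\<^sup>2) < e"
  proof (rule L2_dominated[where w = "\<lambda>_. (2 * B)\<^sup>2"])
    show "t n \<in> borel_measurable circle" for n
      by (rule borel_measurable_circle) simp
    show "AE \<xi> in circle. (h \<xi> - t n \<xi>)\<^sup>2 \<le> (2 * B)\<^sup>2" for n
    proof (rule AE_I2)
      fix \<xi>
      have "\<bar>h \<xi> - t n \<xi>\<bar> \<le> \<bar>2 * B\<bar>" using h[of \<xi>] B unfolding t_def by auto
      then show "(h \<xi> - t n \<xi>)\<^sup>2 \<le> (2 * B)\<^sup>2" by (simp only: abs_le_square_iff)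
    qed
  qed (use ae e in auto)
  then show ?thesis using t_cont by blast
qed

lemma rat_poly_dense:
  assumes "e > 0"
  shows "\<exists>cs. dist x (hproj (rat_poly cs)) < e"
proof -
  define f where "f = fun_of x"
  have f_sq: "square_integrable f" unfolding f_def by (rule square_integrable_fun_of)
  have [measurable]: "f \<in> borel_measurable circle" by (simp add: f_def)
  define t where "t n \<xi> = max (- real n) (min (real n) (f \<xi>))" for n \<xi>
  have t_meas [measurable]: "t n \<in> borel_measurable circle" for n unfolding t_def by measurable
  have "\<exists>n. (LINT \<xi>|circle. (f \<xi> - t n \<xi>)\<^sup>2) < (e/3)\<^sup>2"
  proof (rule L2_dominated[where w = "\<lambda>\<xi>. (f \<xi>)\<^sup>2"])
    show "AE \<xi> in circle. (\<lambda>n. t n \<xi>) \<longlonglongrightarrow> f \<xi>"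
    proof (rule AE_I2)
      fix \<xi>
      obtain n0 :: nat where n0: "real n0 \<ge> \<bar>f \<xi>\<bar>" using real_arch_simple by blast
      have "t n \<xi> = f \<xi>" if "n \<ge> n0" for n
        unfolding t_def using n0 that by auto
      then show "(\<lambda>n. t n \<xi>) \<longlonglongrightarrow> f \<xi>"
        by (intro tendsto_eventually) (auto simp: eventually_sequentially)
    qed
    show "AE \<xi> in circle. (f \<xi> - t n \<xi>)\<^sup>2 \<le> (f \<xi>)\<^sup>2" for n
    proof (rule AE_I2)
      fix \<xi>
      have "\<bar>f \<xi> - t n \<xi>\<bar> \<le> \<bar>f \<xi>\<bar>" unfolding t_def by auto
      then show "(f \<xi> - t n \<xi>)\<^sup>2 \<le> (f \<xi>)\<^sup>2" by (simp only: abs_le_square_iff)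
    qed
  qed (use f_sq assms in \<open>auto simp: square_integrable_def\<close>)
  then obtain n where n: "(LINT \<xi>|circle. (f \<xi> - t n \<xi>)\<^sup>2) < (e/3)\<^sup>2" by blast
  have t_le: "\<bar>t n \<xi>\<bar> \<le> real n" for \<xi> by (auto simp: t_def)
  have t_sq: "square_integrable (t n)"
    by (rule square_integrable_bounded[where B = "real n"]) (auto simp: t_def)
  have d1: "dist x (hproj (t n)) < e/3"
    using dist_hproj_less[OF f_sq t_sq n] assms by (simp add: f_def hproj_fun_of)
  obtain g where g: "continuous_on UNIV g" "(LINT \<xi>|circle. (t n \<xi> - g \<xi>)\<^sup>2) < (e/3)\<^sup>2"
    using bounded_approx_continuous[OF t_meas[of n] t_le, of "(e/3)\<^sup>2"] assms by auto
  have g_sq: "square_integrable g" by (rule continuous_on_square_integrable[OF g(1)])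
  have d2: "dist (hproj (t n)) (hproj g) < e/3"
    using dist_hproj_less[OF t_sq g_sq g(2)] assms by simp
  obtain cs where cs: "\<And>\<xi>. \<xi> \<in> {0..1} \<Longrightarrow> \<bar>g \<xi> - rat_poly cs \<xi>\<bar> < e/6"
    using rat_poly_dense_continuous[OF g(1), of "e/6"] assms by (meson divide_pos_pos zero_less_numeral)
  have p_sq: "square_integrable (rat_poly cs)"
    by (rule continuous_on_square_integrable[OF continuous_on_rat_poly])
  have "(LINT \<xi>|circle. (g \<xi> - rat_poly cs \<xi>)\<^sup>2) \<le> (LINT \<xi>|circle. (e/6)\<^sup>2)"
  proof (rule integral_mono)
    show "integrable circle (\<lambda>\<xi>. (g \<xi> - rat_poly cs \<xi>)\<^sup>2)"
      using square_integrable_diff[OF g_sq p_sq] by (simp add: square_integrable_def)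
    show "(g \<xi> - rat_poly cs \<xi>)\<^sup>2 \<le> (e/6)\<^sup>2" if "\<xi> \<in> space circle" for \<xi>
      using cs[of \<xi>] that assms by (intro abs_le_square_iff[THEN iffD1]) (auto simp: space_circle)
  qed simp
  also have "\<dots> < (e/3)\<^sup>2" using assms by (simp add: power2_eq_square)
  finally have d3: "dist (hproj g) (hproj (rat_poly cs)) < e/3"
    using assms by (intro dist_hproj_less[OF g_sq p_sq]) simp_all
  have "dist x (hproj (rat_poly cs)) < e"
    using d1 d2 d3 dist_triangle[of x "hproj (rat_poly cs)" "hproj (t n)"]
      dist_triangle[of "hproj (t n)" "hproj (rat_poly cs)" "hproj g"] by linarith
  then show ?thesis by blast
qed

instance hspace :: second_countable_topology
proof
  define B :: "hspace set set" where
    "B = (\<lambda>(cs, q). ball (hproj (rat_poly cs)) (of_rat q)) ` (UNIV :: (rat list \<times> rat) set)"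
  have "countable B" unfolding B_def by simp
  moreover have "topological_basis B"
  proof (rule topological_basisI)
    show "open U" if "U \<in> B" for U using that by (auto simp: B_def)
    fix U :: "hspace set" and x assume "open U" "x \<in> U"
    then obtain e where e: "e > 0" "ball x e \<subseteq> U" by (auto simp: open_contains_ball)
    obtain q where q: "0 < (of_rat q :: real)" "of_rat q < e / 2"
      using of_rat_dense[of 0 "e/2"] e by auto
    obtain cs where cs: "dist x (hproj (rat_poly cs)) < of_rat q"
      using rat_poly_dense[OF q(1)] by blast
    have "x \<in> ball (hproj (rat_poly cs)) (of_rat q)"
      using cs by (simp add: dist_commute)
    moreover have "ball (hproj (rat_poly cs)) (of_rat q) \<subseteq> ball x e"
    proof
      fix y assume "y \<in> ball (hproj (rat_poly cs)) (of_rat q)"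
      then have "dist (hproj (rat_poly cs)) y < of_rat q" by simp
      then show "y \<in> ball x e"
        using cs q(2) dist_triangle[of x y "hproj (rat_poly cs)"] by simp
    qed
    ultimately show "\<exists>B'\<in>B. x \<in> B' \<and> B' \<subseteq> U"
      using e(2) unfolding B_def by (intro bexI[of _ "ball (hproj (rat_poly cs)) (of_rat q)"]) auto
  qed
  ultimately show "\<exists>B::hspace set set. countable B \<and> open = generate_topology B"
    by (blast intro: topological_basis_imp_subbasis)
qed

instance hspace :: polish_space ..

section \<open>Fourier coefficients, the operator \<open>A\<close>, its semigroup, and the space \<open>V\<close>\<close>

abbreviation Zstar :: "int set" where
  "Zstar \<equiv> {k. k \<noteq> 0}"

definition fourier_e :: "int \<Rightarrow> real \<Rightarrow> complex" where
  "fourier_e k \<xi> = exp (\<i> * of_real (2 * pi * of_int k * \<xi>))"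

definition fourier_coeff :: "hspace \<Rightarrow> int \<Rightarrow> complex" where
  "fourier_coeff x k = (CLINT \<xi>|circle. of_real (fun_of x \<xi>) * cnj (fourier_e k \<xi>))"

definition eigval :: "int \<Rightarrow> real" where
  "eigval k = 4 * pi\<^sup>2 * (of_int \<bar>k\<bar>)\<^sup>2"

text \<open>The closure of \<open>- d\<^sup>2/d\<xi>\<^sup>2\<close> on the mean-zero \<open>C\<^sup>2\<close> functions on the circle, as a graph.\<close>

definition A_op :: "(hspace \<times> hspace) set" where
  "A_op = closure {(hproj u, hproj (\<lambda>\<xi>. - u'' \<xi>)) | u u' u''.
     (\<forall>\<xi>. u (\<xi> + 1) = u \<xi>) \<and> mean_zero u \<and>
     (\<forall>\<xi>. (u has_real_derivative u' \<xi>) (at \<xi>)) \<and>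
     (\<forall>\<xi>. (u' has_real_derivative u'' \<xi>) (at \<xi>)) \<and> continuous_on UNIV u''}"

text \<open>\<open>e\<^sup>-\<^sup>t\<^sup>A x = \<Sum>\<^sub>k e\<^sup>-\<^sup>t\<^sup>\<gamma> x\<^sub>k e\<^sub>k\<close> with \<open>\<gamma> = \<gamma>\<^sub>k\<close>. The terms for \<open>k\<close> and \<open>- k\<close> are complex conjugates, so taking
  the real part of every term does not change the sum; it makes the terms elements of the real space.
  The two lemmas \<open>A_op_fourier_coeff\<close> and \<open>A_op_basis\<close> below relate the eigenvalues to \<open>A\<close>.\<close>

definition heat :: "real \<Rightarrow> hspace \<Rightarrow> hspace" where
  "heat t x = (\<Sum>\<^sub>\<infinity>k\<in>Zstar.
     hproj (\<lambda>\<xi>. Re (of_real (exp (- eigval k * t)) * fourier_coeff x k * fourier_e k \<xi>)))"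

definition V_space :: "hspace set" where
  "V_space = {x. (\<lambda>k. eigval k * (cmod (fourier_coeff x k))\<^sup>2) summable_on Zstar}"

definition V_norm :: "hspace \<Rightarrow> real" where
  "V_norm x = sqrt (\<Sum>\<^sub>\<infinity>k\<in>Zstar. eigval k * (cmod (fourier_coeff x k))\<^sup>2)"

text \<open>Orthonormal basis of the real Hilbert space made of the real and imaginary parts of the \<open>e\<^sub>k\<close>:
  \<open>\<surd>2 cos (2\<pi>k\<xi>)\<close> for \<open>k > 0\<close> and \<open>\<surd>2 sin (2\<pi>k\<xi>)\<close> for \<open>k < 0\<close>.\<close>

definition real_basis :: "int \<Rightarrow> hspace" where
  "real_basis k = hproj (\<lambda>\<xi>. sqrt 2 * (if k > 0 then Re (fourier_e k \<xi>) else Im (fourier_e k \<xi>)))"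

lemma fourier_e_meas [measurable]: "fourier_e k \<in> borel_measurable circle"
proof -
  have "continuous_on UNIV (fourier_e k)"
    unfolding fourier_e_def by (intro continuous_intros)
  then have "fourier_e k \<in> borel_measurable borel" by (rule borel_measurable_continuous_onI)
  then show ?thesis
    unfolding circle_def by (intro measurable_restrict_space1) simp
qed

lemma norm_fourier_e [simp]: "cmod (fourier_e k \<xi>) = 1"
  unfolding fourier_e_def by (simp only: norm_exp_i_times)

lemma fourier_e_integrable:
  assumes "integrable circle f"
  shows "integrable circle (\<lambda>\<xi>. of_real (f \<xi>) * cnj (fourier_e k \<xi>))"
proof (rule Bochner_Integration.integrable_bound[OF assms])
  have [measurable]: "f \<in> borel_measurable circle" using assms by simp
  have [measurable]: "(\<lambda>\<xi>. cnj (fourier_e k \<xi>)) \<in> borel_measurable circle"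
    by (rule borel_measurable_continuous_on[OF _ fourier_e_meas]) (intro continuous_intros)
  show "(\<lambda>\<xi>. of_real (f \<xi>) * cnj (fourier_e k \<xi>)) \<in> borel_measurable circle" by measurable
qed (auto simp: norm_mult)

lemma fourier_coeff_diff: "fourier_coeff (x - y) k = fourier_coeff x k - fourier_coeff y k"
proof -
  have i: "integrable circle (\<lambda>\<xi>. of_real (fun_of z \<xi>) * cnj (fourier_e k \<xi>))" for z
    by (intro fourier_e_integrable square_integrable_integrable square_integrable_fun_of)
  have "fourier_coeff (x - y) k = (CLINT \<xi>|circle. of_real (fun_of x \<xi>) * cnj (fourier_e k \<xi>)
      - of_real (fun_of y \<xi>) * cnj (fourier_e k \<xi>))"
    unfolding fourier_coeff_def
  proof (rule integral_cong_AE)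
    show "AE \<xi> in circle. of_real (fun_of (x - y) \<xi>) * cnj (fourier_e k \<xi>) =
      of_real (fun_of x \<xi>) * cnj (fourier_e k \<xi>) - of_real (fun_of y \<xi>) * cnj (fourier_e k \<xi>)"
      using fun_of_diff[of x y] by eventually_elim (simp only: of_real_diff left_diff_distrib)
  qed (use borel_measurable_integrable[OF i] in auto)
  then show ?thesis
    using i by (simp add: fourier_coeff_def)
qed

lemma norm_fourier_coeff_le: "cmod (fourier_coeff x k) \<le> norm x"
proof -
  have sq: "square_integrable (fun_of x)" by (rule square_integrable_fun_of)
  have "cmod (fourier_coeff x k) \<le> (LINT \<xi>|circle. cmod (of_real (fun_of x \<xi>) * cnj (fourier_e k \<xi>)))"
    unfolding fourier_coeff_def by (rule integral_norm_bound)
  also have "\<dots> = (LINT \<xi>|circle. \<bar>fun_of x \<xi>\<bar>)"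
    by (simp add: norm_mult)
  finally have 1: "cmod (fourier_coeff x k) \<le> (LINT \<xi>|circle. \<bar>fun_of x \<xi>\<bar>)" .
  define m where "m = (LINT \<xi>|circle. \<bar>fun_of x \<xi>\<bar>)"
  have i: "integrable circle (\<lambda>\<xi>. \<bar>fun_of x \<xi>\<bar>)" "integrable circle (\<lambda>\<xi>. (fun_of x \<xi>)\<^sup>2)"
    using sq square_integrable_integrable[OF sq] by (auto simp: square_integrable_def)
  have "0 \<le> (LINT \<xi>|circle. (\<bar>fun_of x \<xi>\<bar> - m)\<^sup>2)" by simp
  also have "\<dots> = (LINT \<xi>|circle. (fun_of x \<xi>)\<^sup>2 - 2 * m * \<bar>fun_of x \<xi>\<bar> + m\<^sup>2)"
    by (intro Bochner_Integration.integral_cong) (auto simp: power2_diff)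
  also have "\<dots> = (norm x)\<^sup>2 - m\<^sup>2"
    using i by (simp add: norm_hspace_sq m_def[symmetric]) (simp add: power2_eq_square)
  finally have "m\<^sup>2 \<le> (norm x)\<^sup>2" by simp
  then have "m \<le> norm x" by (rule power2_le_imp_le) simp
  then show ?thesis using 1 by (simp add: m_def)
qed

lemma continuous_fourier_coeff: "continuous_on UNIV (\<lambda>x. fourier_coeff x k)"
proof (rule continuous_onI)
  fix x :: hspace and e :: real assume "e > 0"
  then show "\<exists>d>0. \<forall>x'\<in>UNIV. dist x' x < d \<longrightarrow> dist (fourier_coeff x' k) (fourier_coeff x k) \<le> e"
    using norm_fourier_coeff_le[of _ k]
    by (intro exI[of _ e]) (auto simp: dist_norm fourier_coeff_diff[symmetric] intro: order_trans less_imp_le)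
qed

lemma fourier_coeff_hproj:
  assumes "square_integrable f" "mean_zero f"
  shows "fourier_coeff (hproj f) k = (CLINT \<xi>|circle. of_real (f \<xi>) * cnj (fourier_e k \<xi>))"
proof -
  have h: "hrel f f" using assms by (simp add: hrel_def)
  have "hproj f = abs_hspace f"
    using assms by (simp add: hproj.abs_eq mean_zero_def)
  then have "hrel (fun_of (hproj f)) f"
    using Quotient3_rep_abs[OF Quotient3_hspace, of f] h by simp
  then have ae: "AE \<xi> in circle. fun_of (hproj f) \<xi> = f \<xi>"
    by (simp add: hrel_def)
  have i: "integrable circle (\<lambda>\<xi>. of_real (g \<xi>) * cnj (fourier_e k \<xi>))" if "square_integrable g" for g
    using that by (intro fourier_e_integrable square_integrable_integrable)
  show ?thesis
    unfolding fourier_coeff_def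
  proof (rule integral_cong_AE)
    show "AE \<xi> in circle. of_real (fun_of (hproj f) \<xi>) * cnj (fourier_e k \<xi>) =
        of_real (f \<xi>) * cnj (fourier_e k \<xi>)"
      using ae by eventually_elim simp
  qed (use borel_measurable_integrable[OF i] assms(1) square_integrable_fun_of in auto)
qed

lemma integral_circle_FTC:
  fixes F :: "real \<Rightarrow> 'a :: euclidean_space"
  assumes "\<And>\<xi>. (F has_vector_derivative f \<xi>) (at \<xi>)" "continuous_on UNIV f"
  shows "(LINT \<xi>|circle. f \<xi>) = F 1 - F 0"
proof -
  have "(LINT \<xi>|circle. f \<xi>) = (LINT \<xi>:{0..<1}|lborel. f \<xi>)"
    unfolding circle_def set_lebesgue_integral_def by (subst integral_restrict_space) auto
  also have "\<dots> = (LINT \<xi>:{0..1}|lborel. f \<xi>)"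
  proof (rule set_integral_cong_set)
    show "set_borel_measurable lborel {0..1} f" "set_borel_measurable lborel {0..<1} f"
      using borel_measurable_continuous_onI[OF assms(2)] by (auto simp: set_borel_measurable_def)
    show "AE x in lborel. (x \<in> {0..1}) = (x \<in> {0..<1::real})"
      using AE_lborel_singleton[of "1::real"] by eventually_elim auto
  qed
  also have "\<dots> = F 1 - F 0"
    unfolding set_lebesgue_integral_def
    using assms by (intro integral_FTC_Icc) (auto intro: continuous_on_subset has_vector_derivative_at_within)
  finally show ?thesis .
qed

lemma fourier_e_cnj_deriv:
  "((\<lambda>\<xi>. cnj (fourier_e k \<xi>)) has_vector_derivative
     (- \<i> * of_real (2 * pi * of_int k) * cnj (fourier_e k \<xi>))) (at \<xi>)"
proof -
  have eq: "cnj (fourier_e k \<xi>) = exp (of_real \<xi> * (- \<i> * of_real (2 * pi * of_int k)))" for \<xi>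
    by (simp add: fourier_e_def exp_cnj algebra_simps)
  have "((\<lambda>z. exp (z * (- \<i> * of_real (2 * pi * of_int k)))) has_field_derivative
      (- \<i> * of_real (2 * pi * of_int k)) * exp (of_real \<xi> * (- \<i> * of_real (2 * pi * of_int k))))
      (at (of_real \<xi>))"
    by (auto intro!: derivative_eq_intros)
  from has_vector_derivative_real_field[OF this] show ?thesis
    unfolding eq .
qed

lemma fourier_e_periodic: "fourier_e k (\<xi> + 1) = fourier_e k \<xi>"
proof -
  have "fourier_e k (\<xi> + 1) = fourier_e k \<xi> * exp (2 * of_int k * of_real pi * \<i>)"
    unfolding fourier_e_def mult_exp_exp by (simp add: algebra_simps)
  also have "exp (2 * of_int k * of_real pi * \<i>) = (1 :: complex)"
    using exp_integer_2pi[of "of_int k"] by (simp add: mult_ac)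
  finally show ?thesis by simp
qed

lemma A_op_fourier_coeff:
  assumes "(x, y) \<in> A_op"
  shows "fourier_coeff y k = of_real (eigval k) * fourier_coeff x k"
proof -
  let ?S = "{p. fourier_coeff (snd p) k = of_real (eigval k) * fourier_coeff (fst p) k}"
  have "closed ?S"
    by (intro closed_Collect_eq continuous_intros continuous_on_compose2[OF continuous_fourier_coeff]) auto
  moreover have "fourier_coeff (hproj (\<lambda>\<xi>. - u'' \<xi>)) k = of_real (eigval k) * fourier_coeff (hproj u) k"
    if u: "\<forall>\<xi>. u (\<xi> + 1) = u \<xi>" "mean_zero u" "\<forall>\<xi>. (u has_real_derivative u' \<xi>) (at \<xi>)"
      "\<forall>\<xi>. (u' has_real_derivative u'' \<xi>) (at \<xi>)" "continuous_on UNIV u''" for u u' u''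
  proof -
    have cu: "continuous_on UNIV u" "continuous_on UNIV u'"
      using u(3,4) by (auto intro!: DERIV_isCont continuous_at_imp_continuous_on)
    have u'_per: "u' (\<xi> + 1) = u' \<xi>" for \<xi>
    proof -
      have "((\<lambda>\<xi>. u (\<xi> + 1)) has_real_derivative u' (\<xi> + 1)) (at \<xi>)"
        using u(3) DERIV_shift by blast
      moreover have "(\<lambda>\<xi>. u (\<xi> + 1)) = u" using u(1) by auto
      ultimately show ?thesis using u(3) DERIV_unique by metis
    qed
    have sq: "square_integrable u" "square_integrable (\<lambda>\<xi>. - u'' \<xi>)"
      using cu u(5) by (auto intro!: continuous_on_square_integrable continuous_intros)
    have vd: "(g has_vector_derivative g') (at \<xi>)" if "(g has_real_derivative g') (at \<xi>)" for g g' \<xi>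
      using that by (simp add: has_real_derivative_iff_has_vector_derivative)
    have "(LINT \<xi>|circle. - u'' \<xi>) = - u' 1 - (- u' 0)"
      using u(4,5) by (intro integral_circle_FTC has_vector_derivative_minus vd continuous_intros) auto
    then have mz: "mean_zero (\<lambda>\<xi>. - u'' \<xi>)"
      using u'_per[of 0] by (simp add: mean_zero_def)
    define c where "c = - \<i> * of_real (2 * pi * of_int k)"
    define E where "E \<xi> = cnj (fourier_e k \<xi>)" for \<xi>
    have E: "(E has_vector_derivative c * E \<xi>) (at \<xi>)" for \<xi>
      unfolding E_def c_def by (rule fourier_e_cnj_deriv)
    have cc: "c * c = - of_real (eigval k)"
      by (simp add: c_def eigval_def power2_eq_square algebra_simps)
    have E_cont: "continuous_on UNIV E"
      using E by (auto intro!: continuous_at_imp_continuous_on has_vector_derivative_continuous)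
    define F where "F \<xi> = - of_real (u' \<xi>) * E \<xi> + of_real (u \<xi>) * (c * E \<xi>)" for \<xi>
    define f where "f \<xi> = of_real (- u'' \<xi>) * E \<xi> - of_real (eigval k) * (of_real (u \<xi>) * E \<xi>)" for \<xi>
    have F: "(F has_vector_derivative f \<xi>) (at \<xi>)" for \<xi>
    proof -
      have "(F has_vector_derivative
        ((- of_real (u' \<xi>)) * (c * E \<xi>) + (- of_real (u'' \<xi>)) * E \<xi>) +
        (of_real (u \<xi>) * (c * (c * E \<xi>)) + of_real (u' \<xi>) * (c * E \<xi>))) (at \<xi>)"
        unfolding F_def
        by (intro has_vector_derivative_add has_vector_derivative_mult has_vector_derivative_minus
            has_vector_derivative_of_real has_vector_derivative_mult_right E vd u(3,4)[rule_format])
      moreover have "((- of_real (u' \<xi>)) * (c * E \<xi>) + (- of_real (u'' \<xi>)) * E \<xi>) +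
        (of_real (u \<xi>) * (c * (c * E \<xi>)) + of_real (u' \<xi>) * (c * E \<xi>)) = f \<xi>"
        unfolding f_def mult.assoc[of c c, symmetric] cc by (simp add: algebra_simps)
      ultimately show ?thesis by simp
    qed
    have f_cont: "continuous_on UNIV f"
      unfolding f_def by (intro continuous_intros cu u(5) E_cont)
    have "(CLINT \<xi>|circle. f \<xi>) = F 1 - F 0"
      by (rule integral_circle_FTC[OF F f_cont])
    also have "\<dots> = 0"
      using u(1)[rule_format, of 0] u'_per[of 0] fourier_e_periodic[of k 0] by (simp add: F_def E_def)
    finally have 0: "(CLINT \<xi>|circle. f \<xi>) = 0" .
    have i: "integrable circle (\<lambda>\<xi>. of_real (g \<xi>) * E \<xi>)" if "square_integrable g" for g
      unfolding E_def using that by (intro fourier_e_integrable square_integrable_integrable)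
    have "(CLINT \<xi>|circle. f \<xi>) = (CLINT \<xi>|circle. of_real (- u'' \<xi>) * E \<xi>)
        - of_real (eigval k) * (CLINT \<xi>|circle. of_real (u \<xi>) * E \<xi>)"
      unfolding f_def using i[OF sq(1)] i[OF sq(2)]
      by (subst Bochner_Integration.integral_diff) auto
    with 0 show ?thesis
      using fourier_coeff_hproj[OF sq(1) u(2)] fourier_coeff_hproj[OF sq(2) mz]
      by (simp add: E_def)
  qed
  then have "{(hproj u, hproj (\<lambda>\<xi>. - u'' \<xi>)) | u u' u''.
     (\<forall>\<xi>. u (\<xi> + 1) = u \<xi>) \<and> mean_zero u \<and>
     (\<forall>\<xi>. (u has_real_derivative u' \<xi>) (at \<xi>)) \<and>
     (\<forall>\<xi>. (u' has_real_derivative u'' \<xi>) (at \<xi>)) \<and> continuous_on UNIV u''} \<subseteq> ?S"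
    by auto
  ultimately have "A_op \<subseteq> ?S"
    unfolding A_op_def by (intro closure_minimal)
  then show ?thesis using assms by auto
qed

lemma hproj_cmult:
  assumes "square_integrable f"
  shows "hproj (\<lambda>\<xi>. c * f \<xi>) = c *\<^sub>R hproj f"
proof -
  have z: "hrel (\<lambda>\<xi>. f \<xi> - (LINT \<eta>|circle. f \<eta>)) (\<lambda>\<xi>. f \<xi> - (LINT \<eta>|circle. f \<eta>))"
    using assms square_integrable_integrable[OF assms] square_integrable_diff[OF assms]
    by (simp add: hrel_def mean_zero_def)
  show ?thesis
    using assms square_integrable_cmult[OF assms, of c] z
    by (simp add: hproj.abs_eq scaleR_hspace.abs_eq algebra_simps)
qed

lemma A_op_basis:
  assumes "k \<noteq> 0"
  shows "(real_basis k, eigval k *\<^sub>R real_basis k) \<in> A_op"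
proof -
  define w where "w = 2 * pi * of_int k"
  have w: "w \<noteq> 0" using assms by (simp add: w_def)
  have w2: "eigval k = w * w"
    by (simp add: w_def eigval_def power2_eq_square)
  have cs: "cos (w * (\<xi> + 1)) = cos (w * \<xi>)" "sin (w * (\<xi> + 1)) = sin (w * \<xi>)" for \<xi>
  proof -
    have s: "sin w = 0" "cos w = 1"
      using sin_int_2pin[of k] cos_int_2pin[of k] by (simp_all add: w_def mult.assoc)
    show "cos (w * (\<xi> + 1)) = cos (w * \<xi>)" "sin (w * (\<xi> + 1)) = sin (w * \<xi>)"
      by (simp_all add: distrib_left cos_add sin_add s)
  qed
  define u where "u \<xi> = sqrt 2 * (if k > 0 then cos (w * \<xi>) else sin (w * \<xi>))" for \<xi>
  define u' where "u' \<xi> = sqrt 2 * (if k > 0 then - w * sin (w * \<xi>) else w * cos (w * \<xi>))" for \<xi>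
  define U where "U \<xi> = sqrt 2 * (if k > 0 then sin (w * \<xi>) / w else - cos (w * \<xi>) / w)" for \<xi>
  have basis: "real_basis k = hproj u"
    unfolding real_basis_def u_def
    by (rule arg_cong[where f = hproj]) (auto simp: fourier_e_def Re_exp Im_exp w_def)
  have du: "(u has_real_derivative u' \<xi>) (at \<xi>)" for \<xi>
    unfolding u_def u'_def by (cases "k > 0") (auto intro!: derivative_eq_intros)
  have du': "(u' has_real_derivative - (eigval k * u \<xi>)) (at \<xi>)" for \<xi>
    unfolding u_def u'_def w2 by (cases "k > 0") (auto intro!: derivative_eq_intros)
  have dU: "(U has_real_derivative u \<xi>) (at \<xi>)" for \<xi>
    unfolding u_def U_def using w by (cases "k > 0") (auto intro!: derivative_eq_intros)
  have cu: "continuous_on UNIV u"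
    using du by (auto intro!: DERIV_isCont continuous_at_imp_continuous_on)
  have "(LINT \<xi>|circle. u \<xi>) = U 1 - U 0"
    using dU cu by (intro integral_circle_FTC) (auto simp: has_real_derivative_iff_has_vector_derivative)
  also have "\<dots> = 0" using cs[of 0] by (simp add: U_def)
  finally have mz: "mean_zero u" by (simp add: mean_zero_def)
  have per: "u (\<xi> + 1) = u \<xi>" for \<xi> by (simp add: u_def cs)
  have e: "eigval k *\<^sub>R real_basis k = hproj (\<lambda>\<xi>. - (- (eigval k * u \<xi>)))"
    unfolding basis using hproj_cmult[OF continuous_on_square_integrable[OF cu]] by simp
  have c: "continuous_on UNIV (\<lambda>\<xi>. - (eigval k * u \<xi>))"
    by (intro continuous_intros cu)
  show ?thesis
    unfolding A_op_def e unfolding basis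
    by (intro subsetD[OF closure_subset] CollectI exI[of _ u] exI[of _ u']
        exI[of _ "\<lambda>\<xi>. - (eigval k * u \<xi>)"]) (use per mz du du' c in auto)
qed

text \<open>The zero-mean part of \<open>- (u - u\<^sup>3)\<close>; junk value 0 if \<open>u\<close> is not in \<open>L\<^sup>6\<close>, which does not
  happen for \<open>u\<close> in \<open>V\<close>.\<close>

definition nonlin :: "hspace \<Rightarrow> hspace" where
  "nonlin u = hproj (\<lambda>\<xi>. - (fun_of u \<xi> - (fun_of u \<xi>) ^ 3))"

section \<open>The noise\<close>

definition cadlag :: "(real \<Rightarrow> 'a :: topological_space) \<Rightarrow> bool" where
  "cadlag f \<longleftrightarrow> (\<forall>t\<ge>0. (f \<longlongrightarrow> f t) (at_right t)) \<and> (\<forall>t>0. \<exists>y. (f \<longlongrightarrow> y) (at_left t))"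

definition symmetric_stable_process :: "'w measure \<Rightarrow> real \<Rightarrow> (real \<Rightarrow> 'w \<Rightarrow> real) \<Rightarrow> bool" where
  "symmetric_stable_process M \<alpha> l \<longleftrightarrow>
     (\<forall>t\<ge>0. l t \<in> borel_measurable M) \<and>
     (AE \<omega> in M. l 0 \<omega> = 0) \<and>
     (\<forall>s t. 0 \<le> s \<and> s \<le> t \<longrightarrow>
        distr M borel (\<lambda>\<omega>. l t \<omega> - l s \<omega>) = distr M borel (l (t - s))) \<and>
     (\<forall>n p. 0 \<le> p 0 \<and> (\<forall>i<n. p i \<le> p (Suc i)) \<longrightarrow>
        prob_space.indep_vars M (\<lambda>_. borel) (\<lambda>i \<omega>. l (p (Suc i)) \<omega> - l (p i) \<omega>) {..<n}) \<and>
     (AE \<omega> in M. cadlag (\<lambda>t. l t \<omega>)) \<and>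
     (\<forall>t\<ge>0. \<forall>\<theta>. char (distr M borel (l t)) \<theta> = of_real (exp (- t * \<bar>\<theta>\<bar> powr \<alpha>)))"

text \<open>Independence of the processes, seen as random elements of the path space with the product
  \<open>\<sigma>\<close>-algebra.\<close>

definition indep_processes :: "'w measure \<Rightarrow> (int \<Rightarrow> real \<Rightarrow> 'w \<Rightarrow> real) \<Rightarrow> bool" where
  "indep_processes M l \<longleftrightarrow>
     prob_space.indep_vars M (\<lambda>_. Pi\<^sub>M {0..} (\<lambda>_. borel)) (\<lambda>k \<omega>. \<lambda>t\<in>{0..}. l k t \<omega>) Zstar"

text \<open>\<open>L\<^sub>t = \<Sum>\<^sub>k \<beta>\<^sub>k l\<^sub>k(t) e\<^sub>k\<close>. As the \<open>l\<^sub>k\<close> are real and independent (so \<open>l\<^sub>-\<^sub>k\<close> is not the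
  conjugate of \<open>l\<^sub>k\<close>), this lies in the real space only if \<open>e\<^sub>k\<close> is read as the real basis.\<close>

definition noise :: "(int \<Rightarrow> real) \<Rightarrow> (int \<Rightarrow> real \<Rightarrow> 'w \<Rightarrow> real) \<Rightarrow> real \<Rightarrow> 'w \<Rightarrow> hspace" where
  "noise b l t \<omega> = (\<Sum>\<^sub>\<infinity>k\<in>Zstar. (b k * l k t \<omega>) *\<^sub>R real_basis k)"

text \<open>\<open>Z\<close> is (a version of) the stochastic integral \<open>\<integral>\<^sub>0\<^sup>t e\<^sup>-\<^sup>A\<^sup>(\<^sup>t\<^sup>-\<^sup>s\<^sup>) dL\<^sub>s\<close>: the limit in probability of the
  Riemann sums as the mesh of the partition of \<open>[0,t]\<close> tends to 0.\<close>

definition stoch_conv :: "'w measure \<Rightarrow> (real \<Rightarrow> 'w \<Rightarrow> hspace) \<Rightarrow> real \<Rightarrow> ('w \<Rightarrow> hspace) \<Rightarrow> bool" where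
  "stoch_conv M L t Z \<longleftrightarrow> Z \<in> borel_measurable M \<and>
     (\<forall>\<epsilon>>0. \<exists>\<delta>>0. \<forall>n p. p 0 = 0 \<and> p n = t \<and> (\<forall>i<n. p i \<le> p (Suc i) \<and> p (Suc i) - p i < \<delta>) \<longrightarrow>
        measure M {\<omega>\<in>space M.
          \<epsilon> \<le> dist (\<Sum>i<n. heat (t - p i) (L (p (Suc i)) \<omega> - L (p i) \<omega>)) (Z \<omega>)} < \<epsilon>)"

section \<open>Mild solutions and invariant measures\<close>

definition cadlag_V :: "(real \<Rightarrow> hspace) \<Rightarrow> bool" where
  "cadlag_V f \<longleftrightarrow> (\<forall>t>0. f t \<in> V_space \<and>
     ((\<lambda>s. V_norm (f s - f t)) \<longlongrightarrow> 0) (at_right t) \<and>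
     (\<exists>y\<in>V_space. ((\<lambda>s. V_norm (f s - y)) \<longlongrightarrow> 0) (at_left t)))"

definition mild_solution ::
    "'w measure \<Rightarrow> (real \<Rightarrow> 'w \<Rightarrow> hspace) \<Rightarrow> hspace \<Rightarrow> (real \<Rightarrow> 'w \<Rightarrow> hspace) \<Rightarrow> bool" where
  "mild_solution M L x X \<longleftrightarrow>
     (\<forall>t\<ge>0. X t \<in> borel_measurable M) \<and>
     (AE \<omega> in M. X 0 \<omega> = x) \<and>
     (AE \<omega> in M. cadlag (\<lambda>t. X t \<omega>) \<and> cadlag_V (\<lambda>t. X t \<omega>)) \<and>
     (\<exists>Z. (\<forall>t\<ge>0. stoch_conv M L t (Z t)) \<and>
        (AE \<omega> in M. \<forall>t\<ge>0.
           set_integrable lborel {0..t} (\<lambda>s. heat (t - s) (nonlin (X s \<omega>))) \<and>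
           X t \<omega> = heat t x - (LINT s:{0..t}|lborel. heat (t - s) (nonlin (X s \<omega>))) + Z t \<omega>))"

definition transition_op ::
    "'w measure \<Rightarrow> (hspace \<Rightarrow> real \<Rightarrow> 'w \<Rightarrow> hspace) \<Rightarrow> real \<Rightarrow> (hspace \<Rightarrow> real) \<Rightarrow> hspace \<Rightarrow> real" where
  "transition_op M X t f x = (LINT \<omega>|M. f (X x t \<omega>))"

definition invariant_measure ::
    "'w measure \<Rightarrow> (hspace \<Rightarrow> real \<Rightarrow> 'w \<Rightarrow> hspace) \<Rightarrow> hspace measure \<Rightarrow> bool" where
  "invariant_measure M X \<mu> \<longleftrightarrow> prob_space \<mu> \<and> sets \<mu> = sets borel \<and>
     (\<forall>t\<ge>0. \<forall>f\<in>borel_measurable borel. bounded (range f) \<longrightarrow>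
        (LINT x|\<mu>. transition_op M X t f x) = (LINT x|\<mu>. f x))"

end

theory Submission
  imports Defs
begin

text \<open>Since \<open>A \<ge> 4 \<pi>\<^sup>2 > 1\<close> and \<open>- N(u) = u - u\<^sup>3\<close>, the difference of two solutions driven by the same
  noise decays exponentially, and the cubic term bounds its squared norm by \<open>2 / t\<close>, whatever the
  initial values are. Both estimates hold exactly for an explicit splitting scheme, which converges
  to the mild solution pathwise; this avoids differentiating the norm of a merely cadlag path.
  The scheme also writes the solution as a function of independent noise increments, whence
  the Markov property. Composing independent copies of the time-one random map backwards in time
  gives a sequence that converges pointwise, and the law of the limit is invariant for \<open>P 1\<close>. By the
  contraction the iterates of \<open>P 1\<close> on Lipschitz functions converge uniformly to constants, which
  yields uniqueness and, as \<open>P t\<close> commutes with \<open>P 1\<close>, invariance for all \<open>t\<close>.\<close>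

section \<open>Completeness of the trigonometric basis\<close>

text \<open>The bound 2/t is the discrete form of a differential inequality. Since (a - b)(a^3 -
  b^3) >= (a - b)^4/4, Jensen's inequality gives z' <= -z^2/2 for the squared distance z of two
  solutions, once the linear terms are dropped, and hence z <= 2/t. This bound does not see the
  initial values and so takes the place of moment and tightness estimates: it makes the oscillation
  of the iterates of \<open>P 1\<close> finite on all of H and starts the convergence of the
  backward compositions. Three obstacles shape the rest. The stochastic convolution is given only as
  a limit in probability of Riemann sums, so laws and independence of its increments are carried to
  the limit by Lipschitz test functions. The paths may jump, so the local errors of the scheme are
  not uniformly small in time; their sum is an L^1 modulus of right continuity, which does tend to
  0, and nonexpansive steps merely add errors up. All path properties hold off null sets that depend
  on initial values and times, so only countably many of them are combined at once.\<close>

lemma fun_of_hproj: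
  assumes "square_integrable f"
  shows "AE \<xi> in circle. fun_of (hproj f) \<xi> = f \<xi> - (LINT \<eta>|circle. f \<eta>)"
proof -
  let ?g = "\<lambda>\<xi>. f \<xi> - (LINT \<eta>|circle. f \<eta>)"
  have h: "hrel ?g ?g"
    using assms square_integrable_integrable[OF assms] square_integrable_diff[OF assms]
    by (simp add: hrel_def mean_zero_def)
  have e: "hproj f = abs_hspace ?g"
    using assms by (simp add: hproj.abs_eq)
  have "hrel (fun_of (hproj f)) ?g"
    unfolding e using h by (rule Quotient3_rep_abs[OF Quotient3_hspace])
  then show ?thesis
    by (simp add: hrel_def)
qed

lemma fun_of_hproj_mean_zero:
  assumes "square_integrable f" "mean_zero f"
  shows "AE \<xi> in circle. fun_of (hproj f) \<xi> = f \<xi>"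
  using fun_of_hproj[OF assms(1)] assms(2) by (simp add: mean_zero_def)

lemma hproj_add:
  assumes "square_integrable f" "square_integrable g"
  shows "hproj (\<lambda>\<xi>. f \<xi> + g \<xi>) = hproj f + hproj g"
  using hproj_diff[OF square_integrable_add[OF assms] assms(2)] by (simp add: algebra_simps)

lemma fun_of_add: "AE \<xi> in circle. fun_of (x + y) \<xi> = fun_of x \<xi> + fun_of y \<xi>"
  using fun_of_diff[of "x + y" y] by (auto elim: eventually_mono)

lemma fun_of_scaleR: "AE \<xi> in circle. fun_of (c *\<^sub>R x) \<xi> = c * fun_of x \<xi>"
proof -
  have "mean_zero (\<lambda>\<xi>. c * fun_of x \<xi>)"
    using mean_zero_fun_of[of x] by (simp add: mean_zero_def)
  moreover have "c *\<^sub>R x = hproj (\<lambda>\<xi>. c * fun_of x \<xi>)"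
    by (simp add: hproj_cmult square_integrable_fun_of hproj_fun_of)
  ultimately show ?thesis
    using fun_of_hproj_mean_zero[OF square_integrable_cmult[OF square_integrable_fun_of]] by metis
qed

lemma fun_of_zero: "AE \<xi> in circle. fun_of 0 \<xi> = 0"
  using fun_of_scaleR[of 0 0] by simp

lemma fun_of_sum:
  "finite F \<Longrightarrow> AE \<xi> in circle. fun_of (\<Sum>k\<in>F. g k) \<xi> = (\<Sum>k\<in>F. fun_of (g k) \<xi>)"
proof (induction F rule: finite_induct)
  case empty
  show ?case using fun_of_zero by simp
next
  case (insert k F)
  from insert.IH fun_of_add[of "g k" "\<Sum>k\<in>F. g k"] show ?case
    by eventually_elim (simp add: insert.hyps)
qed

text \<open>The projection subtracts a constant, and constants are orthogonal to the mean-zero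
  representative of \<open>x\<close>.\<close>

lemma inner_hproj:
  assumes "square_integrable f"
  shows "inner x (hproj f) = (LINT \<xi>|circle. fun_of x \<xi> * f \<xi>)"
proof -
  have [measurable]: "f \<in> borel_measurable circle" using assms by simp
  define m where "m = (LINT \<eta>|circle. f \<eta>)"
  have "inner x (hproj f) = (LINT \<xi>|circle. fun_of x \<xi> * fun_of (hproj f) \<xi>)"
    by (simp add: inner_hspace.rep_eq)
  also have "\<dots> = (LINT \<xi>|circle. fun_of x \<xi> * f \<xi> - m * fun_of x \<xi>)"
  proof (rule integral_cong_AE)
    show "AE \<xi> in circle. fun_of x \<xi> * fun_of (hproj f) \<xi> = fun_of x \<xi> * f \<xi> - m * fun_of x \<xi>"
      using fun_of_hproj[OF assms] by eventually_elim (simp add: m_def right_diff_distrib)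
  qed measurable
  also have "\<dots> = (LINT \<xi>|circle. fun_of x \<xi> * f \<xi>) - m * (LINT \<xi>|circle. fun_of x \<xi>)"
    using square_integrable_mult[OF square_integrable_fun_of assms, of x]
      square_integrable_integrable[OF square_integrable_fun_of, of x]
    by (subst Bochner_Integration.integral_diff) auto
  finally show ?thesis
    using mean_zero_fun_of[of x] by (simp add: mean_zero_def)
qed

section \<open>Orthonormality of the real trigonometric basis\<close>

lemma continuous_fourier_e [continuous_intros]: "continuous_on S (fourier_e k)"
  unfolding fourier_e_def by (intro continuous_intros)

lemma fourier_e_mult: "fourier_e j \<xi> * fourier_e k \<xi> = fourier_e (j + k) \<xi>"
  by (simp add: fourier_e_def mult_exp_exp algebra_simps)

lemma fourier_e_minus: "fourier_e (- k) \<xi> = cnj (fourier_e k \<xi>)"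
  by (simp add: fourier_e_def exp_cnj)

lemma fourier_e_0 [simp]: "fourier_e 0 \<xi> = 1"
  by (simp add: fourier_e_def)

lemma Re_fourier_e: "Re (fourier_e k \<xi>) = cos (2 * pi * of_int k * \<xi>)"
  and Im_fourier_e: "Im (fourier_e k \<xi>) = sin (2 * pi * of_int k * \<xi>)"
  by (simp_all add: fourier_e_def Re_exp Im_exp)

lemma square_integrable_fourier [simp, intro]:
  "square_integrable (\<lambda>\<xi>. Re (fourier_e k \<xi>))" "square_integrable (\<lambda>\<xi>. Im (fourier_e k \<xi>))"
  by (intro continuous_on_square_integrable continuous_intros)+

lemma integral_fourier_e: "(CLINT \<xi>|circle. fourier_e k \<xi>) = (if k = 0 then 1 else 0)"
proof (cases "k = 0")
  case False
  define c where "c = \<i> * of_real (2 * pi * of_int k)"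
  have c: "c \<noteq> 0" using False by (simp add: c_def)
  have eq: "cnj (fourier_e (- k) \<xi>) = fourier_e k \<xi>" for \<xi>
    by (simp add: fourier_e_minus)
  have d: "((\<lambda>\<xi>. fourier_e k \<xi> / c) has_vector_derivative fourier_e k \<xi>) (at \<xi>)" for \<xi>
  proof -
    have "(fourier_e k has_vector_derivative c * fourier_e k \<xi>) (at \<xi>)"
      using fourier_e_cnj_deriv[of "- k" \<xi>] unfolding eq by (simp add: c_def)
    from has_vector_derivative_mult_left[OF this, of "1 / c"] show ?thesis
      using c by simp
  qed
  have "(CLINT \<xi>|circle. fourier_e k \<xi>) = fourier_e k 1 / c - fourier_e k 0 / c"
    by (rule integral_circle_FTC[OF d]) (intro continuous_intros)
  also have "\<dots> = 0" using fourier_e_periodic[of k 0] by simp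
  finally show ?thesis using False by simp
qed (simp add: measure_circle)

lemma integrable_fourier_e [simp]: "integrable circle (fourier_e k)"
  using fourier_e_integrable[of "\<lambda>_. 1" "- k"] by (simp add: fourier_e_minus)

lemma integral_Re_Im_fourier:
  "(LINT \<xi>|circle. Re (fourier_e k \<xi>)) = (if k = 0 then 1 else 0)"
  "(LINT \<xi>|circle. Im (fourier_e k \<xi>)) = 0"
  using integral_fourier_e[of k] integral_Re[OF integrable_fourier_e[of k]]
    integral_Im[OF integrable_fourier_e[of k]]
  by (auto split: if_splits)

definition basis_fun :: "int \<Rightarrow> real \<Rightarrow> real" where
  "basis_fun k \<xi> = sqrt 2 * (if k > 0 then Re (fourier_e k \<xi>) else Im (fourier_e k \<xi>))"

lemma real_basis_eq: "real_basis k = hproj (basis_fun k)"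
  by (simp add: real_basis_def basis_fun_def[abs_def])

lemma square_integrable_basis_fun [simp, intro]: "square_integrable (basis_fun k)"
  unfolding basis_fun_def[abs_def] by (cases "k > 0") auto

lemma basis_fun_bound: "\<bar>basis_fun k \<xi>\<bar> \<le> sqrt 2"
proof -
  have "\<bar>Re (fourier_e k \<xi>)\<bar> \<le> 1" "\<bar>Im (fourier_e k \<xi>)\<bar> \<le> 1"
    using abs_Re_le_cmod[of "fourier_e k \<xi>"] abs_Im_le_cmod[of "fourier_e k \<xi>"] by simp_all
  then show ?thesis
    by (simp add: basis_fun_def abs_mult)
qed

lemma mean_zero_basis_fun [simp]: "k \<noteq> 0 \<Longrightarrow> mean_zero (basis_fun k)"
  by (cases "k > 0") (simp_all add: mean_zero_def basis_fun_def integral_Re_Im_fourier)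

lemma fun_of_real_basis: "k \<noteq> 0 \<Longrightarrow> AE \<xi> in circle. fun_of (real_basis k) \<xi> = basis_fun k \<xi>"
  unfolding real_basis_eq by (intro fun_of_hproj_mean_zero) auto

text \<open>Product-to-sum formulas leave only the frequencies j - k and j + k. Mixed signs produce
  sines, whose integrals always vanish; equal signs produce cosines with j + k nonzero, so that only
  j = k contributes.\<close>

lemma inner_real_basis:
  assumes "j \<noteq> 0" "k \<noteq> 0"
  shows "inner (real_basis j) (real_basis k) = (if j = k then 1 else 0)"
proof -
  have [measurable]: "basis_fun k \<in> borel_measurable circle" for k
    by (intro square_integrable_measurable) simp
  have "inner (real_basis j) (real_basis k) = (LINT \<xi>|circle. fun_of (real_basis j) \<xi> * basis_fun k \<xi>)"
    unfolding real_basis_eq[of k] by (rule inner_hproj) simp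
  also have "\<dots> = (LINT \<xi>|circle. basis_fun j \<xi> * basis_fun k \<xi>)"
    using fun_of_real_basis[OF assms(1)] by (intro integral_cong_AE) auto
  also have "\<dots> = (if j = k then 1 else 0)"
  proof -
    define p where "p = (\<lambda>i \<xi>. Re (fourier_e i \<xi>))"
    define q where "q = (\<lambda>i \<xi>. Im (fourier_e i \<xi>))"
    have i: "integrable circle (p i)" "integrable circle (q i)" for i
      unfolding p_def q_def by (intro square_integrable_integrable; simp)+
    have I: "(LINT \<xi>|circle. p i \<xi>) = (if i = 0 then 1 else 0)" "(LINT \<xi>|circle. q i \<xi>) = 0" for i
      unfolding p_def q_def by (rule integral_Re_Im_fourier)+
    consider "j > 0" "k > 0" | "j > 0" "\<not> k > 0" | "\<not> j > 0" "k > 0" | "\<not> j > 0" "\<not> k > 0"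
      by blast
    then show ?thesis
    proof cases
      case 1
      then have "basis_fun j \<xi> * basis_fun k \<xi> = p (j - k) \<xi> + p (j + k) \<xi>" for \<xi>
        by (simp add: basis_fun_def p_def Re_fourier_e ring_distribs cos_add cos_diff)
      with 1 show ?thesis by (simp add: i I)
    next
      case 2
      then have "basis_fun j \<xi> * basis_fun k \<xi> = q (j + k) \<xi> - q (j - k) \<xi>" for \<xi>
        by (simp add: basis_fun_def q_def Re_fourier_e Im_fourier_e ring_distribs sin_add sin_diff)
      with 2 assms show ?thesis by (simp add: i I)
    next
      case 3
      then have "basis_fun j \<xi> * basis_fun k \<xi> = q (j + k) \<xi> + q (j - k) \<xi>" for \<xi>
        by (simp add: basis_fun_def q_def Re_fourier_e Im_fourier_e ring_distribs sin_add sin_diff)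
      with 3 assms show ?thesis by (simp add: i I)
    next
      case 4
      then have "basis_fun j \<xi> * basis_fun k \<xi> = p (j - k) \<xi> - p (j + k) \<xi>" for \<xi>
        by (simp add: basis_fun_def p_def Re_fourier_e Im_fourier_e ring_distribs cos_add cos_diff)
      with 4 assms show ?thesis by (simp add: i I)
    qed
  qed
  finally show ?thesis .
qed

section \<open>Trigonometric polynomials and completeness of the basis\<close>

inductive_set trig_polys :: "(real \<Rightarrow> complex) set" where
  monom: "(\<lambda>\<xi>. c * fourier_e k \<xi>) \<in> trig_polys"
| add: "f \<in> trig_polys \<Longrightarrow> g \<in> trig_polys \<Longrightarrow> (\<lambda>\<xi>. f \<xi> + g \<xi>) \<in> trig_polys"

lemma trig_polys_mult:
  assumes "f \<in> trig_polys" "g \<in> trig_polys"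
  shows "(\<lambda>\<xi>. f \<xi> * g \<xi>) \<in> trig_polys"
  using assms(1)
proof induction
  case (monom c k)
  show ?case
    using assms(2)
  proof induction
    case (monom d j)
    have "c * fourier_e k \<xi> * (d * fourier_e j \<xi>) = (c * d) * fourier_e (k + j) \<xi>" for \<xi>
      using fourier_e_mult[of k \<xi> j] by (simp only: mult_ac)
    then show ?case using trig_polys.monom[of "c * d" "k + j"] by (simp only:)
  qed (simp add: distrib_left trig_polys.add)
qed (simp add: distrib_right trig_polys.add)

text \<open>Real polynomial functions on the plane are generated by real-linear functionals and
  constants. Such a functional is a combination of z and its conjugate, and on the unit circle the
  conjugate of \<open>fourier_e 1\<close> is \<open>fourier_e (- 1)\<close>.\<close>

lemma trig_polys_of_polynomial:
  fixes g :: "complex \<Rightarrow> real"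
  assumes "real_polynomial_function g"
  shows "(\<lambda>\<xi>. of_real (g (fourier_e 1 \<xi>))) \<in> trig_polys"
  using assms
proof induction
  case (linear f)
  interpret f: bounded_linear f by fact
  have *: "of_real (f z) = (of_real (f 1) / 2 + of_real (f \<i>) / (2 * \<i>)) * z +
      (of_real (f 1) / 2 - of_real (f \<i>) / (2 * \<i>)) * cnj z" for z :: complex
  proof -
    have "z = Re z *\<^sub>R 1 + Im z *\<^sub>R \<i>" by (simp add: complex_eq_iff)
    then have "f z = Re z * f 1 + Im z * f \<i>"
      by (metis f.add f.scaleR real_scaleR_def)
    then show ?thesis by (simp add: complex_eq_iff field_simps)
  qed
  show ?case
    unfolding *[of "fourier_e 1 _"] fourier_e_minus[symmetric] by (intro trig_polys.intros)
next
  case (const c)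
  show ?case using trig_polys.monom[of "of_real c" 0] by simp
qed (simp_all add: trig_polys.add trig_polys_mult)

text \<open>The equality \<open>u 0 = u 1\<close> makes \<open>u\<close> a function on the unit
  circle in the plane, where the Stone-Weierstrass theorem for real polynomials applies.\<close>

lemma uniform_approx_trig:
  fixes u :: "real \<Rightarrow> real"
  assumes "continuous_on UNIV u" "u 0 = u 1" "e > 0"
  shows "\<exists>h\<in>trig_polys. \<forall>\<xi>\<in>{0..<1}. cmod (of_real (u \<xi>) - h \<xi>) < e \<and> Im (h \<xi>) = 0"
proof -
  define v where "v z = u (Arg2pi z / (2 * pi))" for z
  have v: "v (fourier_e 1 t) = u t" if "t \<in> {0..1}" for t
  proof (cases "t = 1")
    case True
    have "fourier_e 1 1 = 1" using fourier_e_periodic[of 1 0] by (simp add: fourier_e_def)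
    then show ?thesis using True assms(2) by (simp add: v_def Arg2pi_of_real[of 1, simplified])
  next
    case False
    then have "Arg2pi (fourier_e 1 t) = 2 * pi * t"
      using that by (intro Arg2pi_unique[of 1]) (auto simp: fourier_e_def)
    then show ?thesis by (simp add: v_def)
  qed
  have sph: "\<exists>t\<in>{0..1}. z = fourier_e 1 t" if "z \<in> sphere 0 1" for z
  proof (intro bexI)
    show "z = fourier_e 1 (Arg2pi z / (2 * pi))"
      using that complex_norm_eq_1_exp_eq[of z] Arg2pi_eq[of z] by (simp add: fourier_e_def)
    show "Arg2pi z / (2 * pi) \<in> {0..1}"
      using Arg2pi_ge_0[of z] Arg2pi_lt_2pi[of z] by (simp add: field_simps)
  qed
  \<comment> \<open>The argument function jumps at 1, so continuity is not obtained by composition.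
    Instead preimages of closed sets are seen to be closed: they are images of compact subsets of
    [0,1] under \<open>fourier_e 1\<close>.\<close>
  have "continuous_on (sphere 0 1) v"
    unfolding continuous_on_closed_vimage[OF closed_sphere]
  proof (intro allI impI)
    fix B :: "real set" assume B: "closed B"
    have "compact ({0..1} \<inter> u -` B)"
      by (intro compact_Int_closed compact_Icc closed_vimage B assms(1))
    then have "compact (fourier_e 1 ` ({0..1} \<inter> u -` B))"
      by (intro compact_continuous_image continuous_intros)
    moreover have "v -` B \<inter> sphere 0 1 = fourier_e 1 ` ({0..1} \<inter> u -` B)"
    proof (intro set_eqI iffI)
      fix z assume z: "z \<in> v -` B \<inter> sphere 0 1"
      then obtain t where "t \<in> {0..1}" "z = fourier_e 1 t" using sph[of z] by blast
      then show "z \<in> fourier_e 1 ` ({0..1} \<inter> u -` B)" using z v by auto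
    qed (use v in auto)
    ultimately show "closed (v -` B \<inter> sphere 0 1)" by (simp add: compact_imp_closed)
  qed
  then obtain g where g: "real_polynomial_function g" "\<And>z. z \<in> sphere 0 1 \<Longrightarrow> \<bar>v z - g z\<bar> < e"
    using Stone_Weierstrass_real_polynomial_function[OF compact_sphere _ assms(3)] by metis
  show ?thesis
  proof (intro bexI ballI conjI)
    fix \<xi> :: real assume "\<xi> \<in> {0..<1}"
    then show "cmod (of_real (u \<xi>) - of_real (g (fourier_e 1 \<xi>))) < e"
      using g(2)[of "fourier_e 1 \<xi>"] v[of \<xi>] by (simp flip: of_real_diff)
  qed (use trig_polys_of_polynomial[OF g(1)] in auto)
qed

lemma orthogonal_trig_polys:
  assumes orth: "\<And>k. k \<noteq> 0 \<Longrightarrow> inner x (real_basis k) = 0" and "h \<in> trig_polys"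
  shows "integrable circle (\<lambda>\<xi>. of_real (fun_of x \<xi>) * h \<xi>) \<and> (CLINT \<xi>|circle. of_real (fun_of x \<xi>) * h \<xi>) = 0"
  using assms(2)
proof induction
  case (monom c k)
  have i: "integrable circle (\<lambda>\<xi>. of_real (fun_of x \<xi>) * fourier_e k \<xi>)"
    using fourier_e_integrable[OF square_integrable_integrable[OF square_integrable_fun_of], of x "- k"]
    by (simp add: fourier_e_minus)
  have z: "(LINT \<xi>|circle. fun_of x \<xi> * basis_fun j \<xi>) = 0" if "j \<noteq> 0" for j
    using orth[OF that] unfolding real_basis_eq by (simp add: inner_hproj)
  have c: "(LINT \<xi>|circle. fun_of x \<xi> * Re (fourier_e j \<xi>)) = 0" if "j > 0" for j
    using z[of j] that by (simp add: basis_fun_def mult.left_commute[of _ "sqrt 2"])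
  have s: "(LINT \<xi>|circle. fun_of x \<xi> * Im (fourier_e j \<xi>)) = 0" if "j < 0" for j
    using z[of j] that by (simp add: basis_fun_def mult.left_commute[of _ "sqrt 2"])
  have "(CLINT \<xi>|circle. of_real (fun_of x \<xi>) * fourier_e k \<xi>) = 0"
  proof (rule complex_eqI)
    have "Re (CLINT \<xi>|circle. of_real (fun_of x \<xi>) * fourier_e k \<xi>) = (LINT \<xi>|circle. fun_of x \<xi> * Re (fourier_e k \<xi>))"
      by (subst integral_Re[OF i, symmetric]) simp
    \<comment> \<open>Cosines are even, so negative frequencies reduce to positive ones; frequency 0
      gives the mean of \<open>x\<close>, which is 0.\<close>
    also have "\<dots> = 0"
      using c[of k] c[of "- k"] mean_zero_fun_of[of x]
      by (cases "k > 0"; cases "k = 0") (auto simp: fourier_e_minus mean_zero_def)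
    finally show "Re (CLINT \<xi>|circle. of_real (fun_of x \<xi>) * fourier_e k \<xi>) = Re 0" by simp
    have "Im (CLINT \<xi>|circle. of_real (fun_of x \<xi>) * fourier_e k \<xi>) = (LINT \<xi>|circle. fun_of x \<xi> * Im (fourier_e k \<xi>))"
      by (subst integral_Im[OF i, symmetric]) simp
    also have "\<dots> = 0"
      using s[of k] s[of "- k"]
      by (cases "k < 0"; cases "k = 0") (auto simp: fourier_e_minus)
    finally show "Im (CLINT \<xi>|circle. of_real (fun_of x \<xi>) * fourier_e k \<xi>) = Im 0" by simp
  qed
  then show ?case
    using i by (simp add: mult.left_commute)
qed (simp add: distrib_left)

text \<open>The error of a uniform approximation of \<open>u\<close> is integrated against
  \<open>fun_of x\<close>, whose L^1 norm \<open>a\<close> is finite. An accuracy of e / (a + 1)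
  also covers the case a = 0.\<close>

lemma orthogonal_periodic:
  assumes "\<And>k. k \<noteq> 0 \<Longrightarrow> inner x (real_basis k) = 0"
    and u: "continuous_on UNIV u" "u 0 = u 1"
  shows "(LINT \<xi>|circle. fun_of x \<xi> * u \<xi>) = 0"
proof -
  define a where "a = (LINT \<xi>|circle. \<bar>fun_of x \<xi>\<bar>)"
  have ix: "integrable circle (fun_of x)"
    by (rule square_integrable_integrable[OF square_integrable_fun_of])
  have a: "a \<ge> 0" by (simp add: a_def)
  have iu: "integrable circle (\<lambda>\<xi>. fun_of x \<xi> * u \<xi>)"
    by (intro square_integrable_mult square_integrable_fun_of continuous_on_square_integrable u)
  have "\<bar>LINT \<xi>|circle. fun_of x \<xi> * u \<xi>\<bar> \<le> 0 + e" if e: "e > 0" for e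
  proof -
    define d where "d = e / (a + 1)"
    have d: "d > 0" using e a by (simp add: d_def)
    obtain h where h: "h \<in> trig_polys" "\<And>\<xi>. \<xi> \<in> {0..<1} \<Longrightarrow> cmod (of_real (u \<xi>) - h \<xi>) < d"
      using uniform_approx_trig[OF u d] by blast
    note o = orthogonal_trig_polys[OF assms(1) h(1)]
    have "of_real (LINT \<xi>|circle. fun_of x \<xi> * u \<xi>) =
        (CLINT \<xi>|circle. of_real (fun_of x \<xi> * u \<xi>) - of_real (fun_of x \<xi>) * h \<xi>)"
      using o integrable_of_real[OF iu, where 'a = complex]
      by (subst Bochner_Integration.integral_diff) (auto simp del: of_real_mult)
    also have "cmod \<dots> \<le> (LINT \<xi>|circle. cmod (of_real (fun_of x \<xi> * u \<xi>) - of_real (fun_of x \<xi>) * h \<xi>))"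
      by (rule integral_norm_bound)
    also have "\<dots> \<le> (LINT \<xi>|circle. d * \<bar>fun_of x \<xi>\<bar>)"
    proof (rule integral_mono)
      fix \<xi> assume "\<xi> \<in> space circle"
      then have "cmod (of_real (u \<xi>) - h \<xi>) \<le> d" using h(2)[of \<xi>] by (simp add: space_circle)
      then have "\<bar>fun_of x \<xi>\<bar> * cmod (of_real (u \<xi>) - h \<xi>) \<le> \<bar>fun_of x \<xi>\<bar> * d"
        by (rule mult_left_mono) simp
      moreover have "of_real (fun_of x \<xi> * u \<xi>) - of_real (fun_of x \<xi>) * h \<xi> =
          of_real (fun_of x \<xi>) * (of_real (u \<xi>) - h \<xi>)"
        by (simp add: right_diff_distrib)
      ultimately show "cmod (of_real (fun_of x \<xi> * u \<xi>) - of_real (fun_of x \<xi>) * h \<xi>) \<le> d * \<bar>fun_of x \<xi>\<bar>"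
        by (simp add: norm_mult mult.commute)
    qed (use o integrable_of_real[OF iu, where 'a = complex] ix in \<open>auto simp del: of_real_mult\<close>)
    also have "\<dots> = d * a" by (simp add: a_def)
    also have "\<dots> \<le> e" using e a by (simp add: d_def field_simps)
    finally show ?thesis by simp
  qed
  then have "\<bar>LINT \<xi>|circle. fun_of x \<xi> * u \<xi>\<bar> \<le> 0"
    by (rule field_le_epsilon)
  then show ?thesis by simp
qed

text \<open>The dense family at hand consists of projected polynomials, which are not periodic.
  Cutting them off near the endpoints makes them periodic at a vanishing L^2 cost, so
  \<open>x\<close> is orthogonal to a dense family and therefore to itself.\<close>

lemma real_basis_complete:
  assumes "\<And>k. k \<noteq> 0 \<Longrightarrow> inner x (real_basis k) = 0"
  shows "x = 0"
proof -
  have p: "inner x (hproj (rat_poly cs)) = 0" for cs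
  proof -
    define p where "p = rat_poly cs"
    have cp: "continuous_on S p" for S by (simp add: p_def continuous_on_rat_poly)
    have sp: "square_integrable p" by (rule continuous_on_square_integrable[OF cp])
    \<comment> \<open>A trapezoid that vanishes at 0 and 1 and equals 1 on [1/n, 1 - 1/n]; it tends
      to 1 everywhere except at the endpoints.\<close>
    define c where "c n \<xi> = max 0 (min 1 (min (real n * \<xi>) (real n * (1 - \<xi>))))" for n \<xi>
    have cc: "continuous_on UNIV (c n)" for n unfolding c_def by (intro continuous_intros)
    have [measurable]: "c n \<in> borel_measurable circle" for n
      by (intro borel_measurable_circle borel_measurable_continuous_onI cc)
    have [measurable]: "p \<in> borel_measurable circle" using sp by simp
    have c1: "0 \<le> c n \<xi>" "c n \<xi> \<le> 1" for n \<xi> by (auto simp: c_def)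
    have z: "(LINT \<xi>|circle. fun_of x \<xi> * (p \<xi> * c n \<xi>)) = 0" for n
      by (intro orthogonal_periodic assms continuous_intros cp cc) (auto simp: c_def)
    have "(\<lambda>n. LINT \<xi>|circle. fun_of x \<xi> * (p \<xi> * c n \<xi>)) \<longlonglongrightarrow> (LINT \<xi>|circle. fun_of x \<xi> * p \<xi>)"
    proof (rule integral_dominated_convergence[where w = "\<lambda>\<xi>. \<bar>fun_of x \<xi> * p \<xi>\<bar>"])
      show "integrable circle (\<lambda>\<xi>. \<bar>fun_of x \<xi> * p \<xi>\<bar>)"
        by (intro integrable_abs square_integrable_mult square_integrable_fun_of sp)
      have "AE \<xi> in lborel. \<xi> \<noteq> (0::real)" by (rule AE_lborel_singleton)
      then have "AE \<xi> in circle. \<xi> \<noteq> 0"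
        unfolding AE_circle_lborel by eventually_elim simp
      then show "AE \<xi> in circle. (\<lambda>n. fun_of x \<xi> * (p \<xi> * c n \<xi>)) \<longlonglongrightarrow> fun_of x \<xi> * p \<xi>"
      proof (rule AE_mp, intro AE_I2 impI)
        fix \<xi> assume "\<xi> \<in> space circle" "\<xi> \<noteq> 0"
        then have \<xi>: "0 < \<xi>" "\<xi> < 1" by (auto simp: space_circle)
        obtain n0 :: nat where n0: "real n0 \<ge> max (1/\<xi>) (1/(1-\<xi>))" using real_arch_simple by blast
        have "c n \<xi> = 1" if "n \<ge> n0" for n
        proof -
          have "1/\<xi> \<le> real n" "1/(1-\<xi>) \<le> real n" using n0 that by auto
          then show ?thesis using \<xi> by (simp add: c_def field_simps)
        qed
        then have "(\<lambda>n. c n \<xi>) \<longlonglongrightarrow> 1"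
          by (intro tendsto_eventually) (auto simp: eventually_sequentially)
        then have "(\<lambda>n. fun_of x \<xi> * (p \<xi> * c n \<xi>)) \<longlonglongrightarrow> fun_of x \<xi> * (p \<xi> * 1)"
          by (intro tendsto_intros)
        then show "(\<lambda>n. fun_of x \<xi> * (p \<xi> * c n \<xi>)) \<longlonglongrightarrow> fun_of x \<xi> * p \<xi>" by simp
      qed
      show "AE \<xi> in circle. norm (fun_of x \<xi> * (p \<xi> * c n \<xi>)) \<le> \<bar>fun_of x \<xi> * p \<xi>\<bar>" for n
        using c1[of n] mult_left_le[of "c n _" "\<bar>fun_of x _ * p _\<bar>"]
        by (auto simp: abs_mult mult.assoc)
    qed measurable
    then have "(LINT \<xi>|circle. fun_of x \<xi> * p \<xi>) = 0"
      unfolding z using LIMSEQ_unique tendsto_const by blast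
    then show ?thesis by (simp add: inner_hproj[OF sp] flip: p_def)
  qed
  have "norm x \<le> 0 + e" if e: "e > 0" for e
  proof -
    obtain cs where cs: "dist x (hproj (rat_poly cs)) < e" using rat_poly_dense[OF e] by blast
    have "(norm x)\<^sup>2 = inner x (x - hproj (rat_poly cs))"
      by (simp add: inner_diff_right p power2_norm_eq_inner)
    also have "\<dots> \<le> norm x * norm (x - hproj (rat_poly cs))" by (rule norm_cauchy_schwarz)
    also have "\<dots> \<le> norm x * e" using cs by (intro mult_left_mono) (auto simp: dist_norm)
    finally show ?thesis using e by (simp add: power2_eq_square) (metis mult_le_cancel_left_pos norm_ge_zero less_eq_real_def)
  qed
  then have "norm x \<le> 0" by (rule field_le_epsilon)
  then show ?thesis by simp
qed

section \<open>Coordinates, the heat semigroup and the space \<open>V\<close>\<close>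

text \<open>An increasing sequence that is cofinal among the finite subsets of \<open>Zstar\<close>;
  it turns the unordered sums of the definitions into limits of sequences, to which measurability
  and Cauchy arguments apply.\<close>

definition Zball :: "nat \<Rightarrow> int set" where
  "Zball n = {- int n..int n} - {0}"

lemma finite_Zball [simp]: "finite (Zball n)"
  by (simp add: Zball_def)

lemma Zball_subset: "Zball n \<subseteq> Zstar"
  by (auto simp: Zball_def)

lemma Zball_mono: "m \<le> n \<Longrightarrow> Zball m \<subseteq> Zball n"
  by (auto simp: Zball_def)

lemma filterlim_Zball: "filterlim Zball (finite_subsets_at_top Zstar) sequentially"
proof (rule filterlim_finite_subsets_at_top[THEN iffD2], intro allI impI)
  fix F :: "int set" assume F: "finite F \<and> F \<subseteq> Zstar"
  define N where "N = (\<Sum>k\<in>F. nat \<bar>k\<bar>)"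
  have "k \<in> Zball n" if "k \<in> F" "n \<ge> N" for k n
  proof -
    have "nat \<bar>k\<bar> \<le> N" unfolding N_def using F that by (intro member_le_sum) auto
    then show ?thesis using that F by (auto simp: Zball_def)
  qed
  then show "\<forall>\<^sub>F n in sequentially. finite (Zball n) \<and> F \<subseteq> Zball n \<and> Zball n \<subseteq> Zstar"
    using Zball_subset by (auto simp: eventually_sequentially intro!: exI[of _ N])
qed

lemma has_sum_Zball:
  assumes "(f has_sum x) Zstar"
  shows "(\<lambda>n. sum f (Zball n)) \<longlonglongrightarrow> x"
  using filterlim_compose[OF assms[unfolded has_sum_def] filterlim_Zball] by simp

definition coord :: "hspace \<Rightarrow> int \<Rightarrow> real" where
  "coord x k = inner x (real_basis k)"

lemma coord_add: "coord (x + y) k = coord x k + coord y k"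
  and coord_diff: "coord (x - y) k = coord x k - coord y k"
  and coord_scaleR: "coord (c *\<^sub>R x) k = c * coord x k"
  by (simp_all add: coord_def inner_add_left inner_diff_left)

lemma bounded_linear_coord: "bounded_linear (\<lambda>x. coord x k)"
  unfolding coord_def by (rule bounded_linear_inner_left)

lemma coord_real_basis: "j \<noteq> 0 \<Longrightarrow> k \<noteq> 0 \<Longrightarrow> coord (real_basis j) k = (if j = k then 1 else 0)"
  by (simp add: coord_def inner_real_basis)

lemma coord_eqI: "(\<And>k. k \<noteq> 0 \<Longrightarrow> coord x k = coord y k) \<Longrightarrow> x = y"
  using real_basis_complete[of "x - y"] by (simp add: coord_def inner_diff_left)

lemma coord_sum:
  assumes "finite F" "F \<subseteq> Zstar" "j \<noteq> 0"
  shows "coord (\<Sum>k\<in>F. c k *\<^sub>R real_basis k) j = (if j \<in> F then c j else 0)"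
proof -
  have "coord (\<Sum>k\<in>F. c k *\<^sub>R real_basis k) j = (\<Sum>k\<in>F. c k * (if j = k then 1 else 0))"
    unfolding coord_def inner_sum_left inner_scaleR_left
    using assms by (intro sum.cong) (auto simp: inner_real_basis)
  then show ?thesis
    using assms(1) by (simp add: if_distrib cong: if_cong)
qed

lemma inner_sum_basis:
  assumes "finite F" "F \<subseteq> Zstar"
  shows "inner x (\<Sum>k\<in>F. c k *\<^sub>R real_basis k) = (\<Sum>k\<in>F. c k * coord x k)"
  unfolding coord_def inner_sum_right inner_scaleR_right ..

lemma norm_sum_basis:
  assumes "finite F" "F \<subseteq> Zstar"
  shows "(norm (\<Sum>k\<in>F. c k *\<^sub>R real_basis k))\<^sup>2 = (\<Sum>k\<in>F. (c k)\<^sup>2)"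
proof -
  have "(norm (\<Sum>k\<in>F. c k *\<^sub>R real_basis k))\<^sup>2
      = (\<Sum>k\<in>F. c k * coord (\<Sum>k\<in>F. c k *\<^sub>R real_basis k) k)"
    unfolding power2_norm_eq_inner inner_sum_basis[OF assms] ..
  also have "\<dots> = (\<Sum>k\<in>F. (c k)\<^sup>2)"
    using assms by (intro sum.cong) (auto simp: coord_sum power2_eq_square subset_iff)
  finally show ?thesis .
qed

lemma norm_diff_partial_sum:
  assumes "finite F" "F \<subseteq> Zstar"
  shows "(norm (x - (\<Sum>k\<in>F. coord x k *\<^sub>R real_basis k)))\<^sup>2 = (norm x)\<^sup>2 - (\<Sum>k\<in>F. (coord x k)\<^sup>2)"
proof -
  let ?s = "\<Sum>k\<in>F. coord x k *\<^sub>R real_basis k"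
  have "(norm (x - ?s))\<^sup>2 = (norm x)\<^sup>2 - 2 * inner x ?s + (norm ?s)\<^sup>2"
    unfolding power2_norm_eq_inner by (simp add: inner_diff_left inner_diff_right inner_commute)
  then show ?thesis
    unfolding norm_sum_basis[OF assms] inner_sum_basis[OF assms] by (simp add: power2_eq_square)
qed

lemma bessel: "finite F \<Longrightarrow> F \<subseteq> Zstar \<Longrightarrow> (\<Sum>k\<in>F. (coord x k)\<^sup>2) \<le> (norm x)\<^sup>2"
  using norm_diff_partial_sum[of F x] zero_le_power2[of "norm (x - (\<Sum>k\<in>F. coord x k *\<^sub>R real_basis k))"]
  by linarith

text \<open>Riesz-Fischer: by orthonormality the squared distance of two partial sums is the
  difference of two terms of a bounded increasing real sequence, so the partial sums are
  Cauchy.\<close>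

lemma exists_partial_sums_limit:
  assumes B: "\<And>n. (\<Sum>k\<in>Zball n. (c k)\<^sup>2) \<le> B"
  shows "\<exists>x. (\<lambda>n. \<Sum>k\<in>Zball n. c k *\<^sub>R real_basis k) \<longlonglongrightarrow> x \<and> (\<forall>k. k \<noteq> 0 \<longrightarrow> coord x k = c k)"
proof -
  define s where "s n = (\<Sum>k\<in>Zball n. c k *\<^sub>R real_basis k)" for n
  define q where "q n = (\<Sum>k\<in>Zball n. (c k)\<^sup>2)" for n
  have q_mono: "q m \<le> q n" if "m \<le> n" for m n
    unfolding q_def using Zball_mono[OF that] by (intro sum_mono2) auto
  have "norm (q n) \<le> B" for n
    using B[of n] by (simp add: q_def sum_nonneg)
  then have "Bseq q" by (rule BseqI')
  then have "convergent q"
    by (rule Bseq_monoseq_convergent) (use q_mono in \<open>auto simp: monoseq_def\<close>)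
  then have Cq: "Cauchy q" by (rule convergent_Cauchy)
  have sd: "(norm (s n - s m))\<^sup>2 = q n - q m" if "m \<le> n" for m n
  proof -
    have "s n - s m = (\<Sum>k\<in>Zball n - Zball m. c k *\<^sub>R real_basis k)"
      using Zball_mono[OF that] by (simp add: s_def sum_diff)
    moreover have "q n - q m = (\<Sum>k\<in>Zball n - Zball m. (c k)\<^sup>2)"
      using Zball_mono[OF that] by (simp add: q_def sum_diff)
    ultimately show ?thesis
      using Zball_subset[of n] norm_sum_basis[of "Zball n - Zball m" c] by auto
  qed
  have "Cauchy s"
  proof (rule metric_CauchyI)
    fix e :: real assume e: "e > 0"
    then obtain N where N: "\<And>m n. m \<ge> N \<Longrightarrow> n \<ge> N \<Longrightarrow> dist (q m) (q n) < e\<^sup>2"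
      using Cq unfolding Cauchy_def by (meson zero_less_power)
    have *: "norm (s n - s m) < e" if "m \<ge> N" "n \<ge> m" for m n
    proof -
      have "(norm (s n - s m))\<^sup>2 < e\<^sup>2"
        unfolding sd[OF that(2)] using N[of n m] that by (simp add: dist_real_def)
      then show ?thesis by (rule power2_less_imp_less) (use e in simp)
    qed
    show "\<exists>N. \<forall>m\<ge>N. \<forall>n\<ge>N. dist (s m) (s n) < e"
    proof (intro exI allI impI)
      fix m n assume "m \<ge> N" "n \<ge> N"
      then show "dist (s m) (s n) < e"
        using *[of m n] *[of n m] by (cases "m \<le> n") (auto simp: dist_norm norm_minus_commute)
    qed
  qed
  then obtain x where x: "s \<longlonglongrightarrow> x" using Cauchy_convergent convergent_def by blast
  moreover have "coord x k = c k" if "k \<noteq> 0" for k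
  proof (rule LIMSEQ_unique)
    show "(\<lambda>n. coord (s n) k) \<longlonglongrightarrow> coord x k"
      by (rule bounded_linear.tendsto[OF bounded_linear_coord x])
    have "coord (s n) k = c k" if "n \<ge> nat \<bar>k\<bar>" for n
      using that \<open>k \<noteq> 0\<close> Zball_subset by (simp add: s_def coord_sum) (auto simp: Zball_def)
    then show "(\<lambda>n. coord (s n) k) \<longlonglongrightarrow> c k"
      by (intro tendsto_eventually) (auto simp: eventually_sequentially)
  qed
  ultimately show ?thesis unfolding s_def by blast
qed

text \<open>Parseval: the Riesz-Fischer limit built from the coordinates of \<open>x\<close> has the
  same coordinates as \<open>x\<close>, and completeness identifies the two.\<close>

lemma coord_sq_has_sum: "((\<lambda>k. (coord x k)\<^sup>2) has_sum (norm x)\<^sup>2) Zstar"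
proof -
  obtain y where y: "(\<lambda>n. \<Sum>k\<in>Zball n. coord x k *\<^sub>R real_basis k) \<longlonglongrightarrow> y" "\<forall>k. k \<noteq> 0 \<longrightarrow> coord y k = coord x k"
    using exists_partial_sums_limit[of "coord x" "(norm x)\<^sup>2"] bessel[OF finite_Zball Zball_subset, of x] by auto
  have "y = x" by (rule coord_eqI) (use y in auto)
  with y have "(\<lambda>n. \<Sum>k\<in>Zball n. coord x k *\<^sub>R real_basis k) \<longlonglongrightarrow> x" by simp
  then have "(\<lambda>n. (norm (\<Sum>k\<in>Zball n. coord x k *\<^sub>R real_basis k))\<^sup>2) \<longlonglongrightarrow> (norm x)\<^sup>2"
    by (intro tendsto_intros)
  then have 1: "(\<lambda>n. \<Sum>k\<in>Zball n. (coord x k)\<^sup>2) \<longlonglongrightarrow> (norm x)\<^sup>2"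
    by (simp add: norm_sum_basis Zball_subset)
  have "(\<lambda>k. (coord x k)\<^sup>2) summable_on Zstar"
    by (rule nonneg_bdd_above_summable_on) (auto intro!: bdd_aboveI[of _ "(norm x)\<^sup>2"] bessel)
  then have 2: "((\<lambda>k. (coord x k)\<^sup>2) has_sum (infsum (\<lambda>k. (coord x k)\<^sup>2) Zstar)) Zstar" by simp
  from LIMSEQ_unique[OF 1 has_sum_Zball[OF this]] 2 show ?thesis by simp
qed

lemma coord_sq_summable: "(\<lambda>k. (coord x k)\<^sup>2) summable_on Zstar"
  using coord_sq_has_sum has_sum_imp_summable by blast

text \<open>The squared remainder after a finite set is exactly the defect in Bessel's inequality,
  which tends to 0 by Parseval along all finite sets and not just along the sets
  \<open>Zball n\<close>.\<close>

lemma coord_has_sum: "((\<lambda>k. coord x k *\<^sub>R real_basis k) has_sum x) Zstar"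
proof -
  have "((\<lambda>F. (norm x)\<^sup>2 - (\<Sum>k\<in>F. (coord x k)\<^sup>2)) \<longlongrightarrow> (norm x)\<^sup>2 - (norm x)\<^sup>2) (finite_subsets_at_top Zstar)"
    using coord_sq_has_sum[of x] unfolding has_sum_def by (intro tendsto_intros)
  moreover have "\<forall>\<^sub>F F in finite_subsets_at_top Zstar. (norm x)\<^sup>2 - (\<Sum>k\<in>F. (coord x k)\<^sup>2) =
      (norm ((\<Sum>k\<in>F. coord x k *\<^sub>R real_basis k) - x))\<^sup>2"
    by (rule eventually_finite_subsets_at_top_weakI) (simp add: norm_diff_partial_sum norm_minus_commute)
  ultimately have "((\<lambda>F. (norm ((\<Sum>k\<in>F. coord x k *\<^sub>R real_basis k) - x))\<^sup>2) \<longlongrightarrow> (norm x)\<^sup>2 - (norm x)\<^sup>2) (finite_subsets_at_top Zstar)"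
    by (rule Lim_transform_eventually)
  then show ?thesis
    unfolding has_sum_def by (simp add: tendsto_norm_zero_iff LIM_zero_iff)
qed

lemma exists_coord:
  assumes "(\<lambda>k. (c k)\<^sup>2) summable_on Zstar"
  shows "\<exists>x. \<forall>k. k \<noteq> 0 \<longrightarrow> coord x k = c k"
proof -
  have "(\<Sum>k\<in>Zball n. (c k)\<^sup>2) \<le> infsum (\<lambda>k. (c k)\<^sup>2) Zstar" for n
    by (rule finite_sum_le_infsum[OF assms]) (use Zball_subset in auto)
  from exists_partial_sums_limit[OF this] show ?thesis by blast
qed

lemma has_sum_basis:
  assumes "\<And>k. k \<noteq> 0 \<Longrightarrow> coord x k = c k"
  shows "((\<lambda>k. c k *\<^sub>R real_basis k) has_sum x) Zstar"
  using coord_has_sum[of x] assms by (subst has_sum_cong[of _ _ "\<lambda>k. coord x k *\<^sub>R real_basis k"]) auto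

lemma summable_on_basis_iff:
  "(\<lambda>k. c k *\<^sub>R real_basis k) summable_on Zstar \<longleftrightarrow> (\<lambda>k. (c k)\<^sup>2) summable_on Zstar"
proof
  assume "(\<lambda>k. (c k)\<^sup>2) summable_on Zstar"
  then show "(\<lambda>k. c k *\<^sub>R real_basis k) summable_on Zstar"
    using exists_coord has_sum_basis has_sum_imp_summable by metis
next
  assume "(\<lambda>k. c k *\<^sub>R real_basis k) summable_on Zstar"
  then obtain x where x: "((\<lambda>k. c k *\<^sub>R real_basis k) has_sum x) Zstar" by (auto simp: summable_on_def)
  have "coord x k = c k" if k: "k \<noteq> 0" for k
  proof -
    have "((\<lambda>j. coord (c j *\<^sub>R real_basis j) k) has_sum coord x k) Zstar"
      using has_sum_bounded_linear[OF bounded_linear_coord x] by (simp add: o_def)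
    moreover have "((\<lambda>j. coord (c j *\<^sub>R real_basis j) k) has_sum c k) Zstar"
    proof (rule has_sum_finite_neutralI[where B = "{k}"])
    qed (use k in \<open>auto simp: coord_scaleR coord_real_basis\<close>)
    ultimately show ?thesis using has_sum_unique by blast
  qed
  then show "(\<lambda>k. (c k)\<^sup>2) summable_on Zstar"
    using coord_sq_summable[of x] by (subst summable_on_cong[of _ _ "\<lambda>k. (coord x k)\<^sup>2"]) auto
qed

lemma coord_infsum:
  assumes "(\<lambda>k. (c k)\<^sup>2) summable_on Zstar" "k \<noteq> 0"
  shows "coord (\<Sum>\<^sub>\<infinity>k\<in>Zstar. c k *\<^sub>R real_basis k) k = c k"
proof -
  obtain x where x: "\<And>k. k \<noteq> 0 \<Longrightarrow> coord x k = c k" using exists_coord[OF assms(1)] by blast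
  then show ?thesis using infsumI[OF has_sum_basis[OF x]] assms(2) by simp
qed

text \<open>By Parseval, norm bounds for operators diagonal in the basis reduce to scalar bounds on
  their multipliers; this serves all estimates of the heat semigroup.\<close>

lemma norm_le_coordI:
  assumes "\<And>k. k \<noteq> 0 \<Longrightarrow> \<bar>coord x k\<bar> \<le> a * \<bar>coord y k\<bar>" "0 \<le> a"
  shows "norm x \<le> a * norm y"
proof -
  have "(norm x)\<^sup>2 \<le> a\<^sup>2 * (norm y)\<^sup>2"
  proof (rule has_sum_mono[OF coord_sq_has_sum has_sum_cmult_right[OF coord_sq_has_sum]])
    show "(coord x k)\<^sup>2 \<le> a\<^sup>2 * (coord y k)\<^sup>2" if "k \<in> Zstar" for k
      using assms(1)[of k] that assms(2) power_mono[of "\<bar>coord x k\<bar>" "a * \<bar>coord y k\<bar>" 2]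
      by (simp add: power_mult_distrib)
  qed
  then have "(norm x)\<^sup>2 \<le> (a * norm y)\<^sup>2" by (simp only: power_mult_distrib)
  then show ?thesis
    by (rule power2_le_imp_le) (use assms(2) in simp)
qed

section \<open>Eigenvalues and the heat semigroup in real coordinates\<close>

lemma eigval_minus [simp]: "eigval (- k) = eigval k"
  by (simp add: eigval_def)

lemma eigval_ge: "k \<noteq> 0 \<Longrightarrow> eigval k \<ge> 4 * pi\<^sup>2"
proof -
  assume "k \<noteq> 0"
  then have "1 \<le> (of_int \<bar>k\<bar> :: real)" by linarith
  then have "1 \<le> (of_int \<bar>k\<bar> :: real)\<^sup>2" by (rule one_le_power)
  then show ?thesis by (simp add: eigval_def)
qed

lemma eigval_pos: "k \<noteq> 0 \<Longrightarrow> eigval k > 0"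
  by (simp add: eigval_def)

lemma eigval_nonneg [simp]: "eigval k \<ge> 0"
  by (simp add: eigval_def)

text \<open>The convenient bound 4 is weaker than 4 pi^2 but already makes the decay exp (- 4 h) of
  the heat step beat the growth sqrt (1 + 2 h) of the reaction step.\<close>

lemma eigval_ge_4: "k \<noteq> 0 \<Longrightarrow> eigval k \<ge> 4"
proof -
  assume "k \<noteq> 0"
  have "1 \<le> pi\<^sup>2" using pi_gt3 by (intro one_le_power) simp
  then show ?thesis using eigval_ge[OF \<open>k \<noteq> 0\<close>] by linarith
qed

text \<open>The dictionary between the complex coefficients, in which the semigroup and V are
  defined, and the real coordinates. The basis vector of index - k is minus a sine of frequency k,
  which accounts for the signs.\<close>

lemma fourier_coeff_coord:
  assumes k: "k > 0"
  shows "fourier_coeff x k = of_real (coord x k / sqrt 2) + \<i> * of_real (coord x (- k) / sqrt 2)"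
    and "fourier_coeff x (- k) = of_real (coord x k / sqrt 2) - \<i> * of_real (coord x (- k) / sqrt 2)"
proof -
  have c: "coord x k = sqrt 2 * (LINT \<xi>|circle. fun_of x \<xi> * Re (fourier_e k \<xi>))"
    using k unfolding coord_def real_basis_eq
    by (simp add: inner_hproj basis_fun_def mult.left_commute[of _ "sqrt 2"])
  have s: "coord x (- k) = - (sqrt 2 * (LINT \<xi>|circle. fun_of x \<xi> * Im (fourier_e k \<xi>)))"
    using k unfolding coord_def real_basis_eq
    by (simp add: inner_hproj basis_fun_def mult.left_commute[of _ "sqrt 2"] fourier_e_minus)
  have i: "integrable circle (\<lambda>\<xi>. of_real (fun_of x \<xi>) * cnj (fourier_e j \<xi>))" for j
    by (intro fourier_e_integrable square_integrable_integrable square_integrable_fun_of)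
  have R: "Re (fourier_coeff x j) = (LINT \<xi>|circle. fun_of x \<xi> * Re (fourier_e j \<xi>))" for j
    unfolding fourier_coeff_def by (subst integral_Re[OF i, symmetric]) simp
  have I: "Im (fourier_coeff x j) = - (LINT \<xi>|circle. fun_of x \<xi> * Im (fourier_e j \<xi>))" for j
    unfolding fourier_coeff_def by (subst integral_Im[OF i, symmetric]) simp
  show "fourier_coeff x k = of_real (coord x k / sqrt 2) + \<i> * of_real (coord x (- k) / sqrt 2)"
    "fourier_coeff x (- k) = of_real (coord x k / sqrt 2) - \<i> * of_real (coord x (- k) / sqrt 2)"
    by (auto simp: complex_eq_iff R I c s fourier_e_minus)
qed

lemma cmod_fourier_coeff_sq:
  assumes "k \<noteq> 0"
  shows "(cmod (fourier_coeff x k))\<^sup>2 = ((coord x k)\<^sup>2 + (coord x (- k))\<^sup>2) / 2"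
proof -
  have p: "(cmod (fourier_coeff x j))\<^sup>2 = ((coord x j)\<^sup>2 + (coord x (- j))\<^sup>2) / 2"
    "(cmod (fourier_coeff x (- j)))\<^sup>2 = ((coord x j)\<^sup>2 + (coord x (- j))\<^sup>2) / 2" if "j > 0" for j
    using fourier_coeff_coord[OF that, of x]
    by (simp_all add: cmod_power2 power_divide add_divide_distrib)
  show ?thesis using p(1)[of k] p(2)[of "- k"] assms by (cases "k > 0") auto
qed

text \<open>Taking real parts makes the terms of the heat series for k and - k equal to the same
  function, so each carries half of both real coordinates.\<close>

lemma heat_term:
  assumes "k \<noteq> 0"
  shows "hproj (\<lambda>\<xi>. Re (of_real r * fourier_coeff x k * fourier_e k \<xi>)) =
    (r * coord x k / 2) *\<^sub>R real_basis k + (r * coord x (- k) / 2) *\<^sub>R real_basis (- k)"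
proof -
  have p: "hproj (\<lambda>\<xi>. Re (of_real r * fourier_coeff x j * fourier_e j \<xi>)) =
     (r * coord x j / 2) *\<^sub>R real_basis j + (r * coord x (- j) / 2) *\<^sub>R real_basis (- j)"
    "hproj (\<lambda>\<xi>. Re (of_real r * fourier_coeff x (- j) * fourier_e (- j) \<xi>)) =
     (r * coord x j / 2) *\<^sub>R real_basis j + (r * coord x (- j) / 2) *\<^sub>R real_basis (- j)" if j: "j > 0" for j
  proof -
    have R: "(r * coord x j / 2) *\<^sub>R real_basis j + (r * coord x (- j) / 2) *\<^sub>R real_basis (- j) =
      hproj (\<lambda>\<xi>. r * coord x j / 2 * basis_fun j \<xi> + r * coord x (- j) / 2 * basis_fun (- j) \<xi>)"
      unfolding real_basis_eq
      by (simp only: hproj_add hproj_cmult square_integrable_cmult square_integrable_basis_fun)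
    have s: "a / sqrt 2 = a * sqrt 2 / 2" for a :: real
      by (simp add: field_simps)
    show "hproj (\<lambda>\<xi>. Re (of_real r * fourier_coeff x j * fourier_e j \<xi>)) =
     (r * coord x j / 2) *\<^sub>R real_basis j + (r * coord x (- j) / 2) *\<^sub>R real_basis (- j)"
    "hproj (\<lambda>\<xi>. Re (of_real r * fourier_coeff x (- j) * fourier_e (- j) \<xi>)) =
     (r * coord x j / 2) *\<^sub>R real_basis j + (r * coord x (- j) / 2) *\<^sub>R real_basis (- j)"
      unfolding R using j
      by (auto intro!: arg_cong[where f = hproj] ext
          simp: fourier_coeff_coord basis_fun_def fourier_e_minus s algebra_simps)
  qed
  show ?thesis using p(1)[of k] p(2)[of "- k"] assms by (cases "k > 0") (auto simp: add.commute)
qed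

lemma exists_coord_le:
  assumes "\<And>k. k \<noteq> 0 \<Longrightarrow> \<bar>c k\<bar> \<le> \<bar>coord x k\<bar>"
  shows "(\<lambda>k. (c k)\<^sup>2) summable_on Zstar"
  by (rule summable_on_comparison_test[OF coord_sq_summable[of x]])
    (use assms in \<open>auto simp: abs_le_square_iff\<close>)

lemma coord_heat:
  assumes t: "t \<ge> 0" and k: "k \<noteq> 0"
  shows "coord (heat t x) k = exp (- eigval k * t) * coord x k"
proof -
  define c where "c k = exp (- eigval k * t) * coord x k" for k
  have "(\<lambda>k. (c k)\<^sup>2) summable_on Zstar"
    by (rule exists_coord_le[of _ x]) (use t in \<open>simp add: c_def abs_mult mult_left_le_one_le\<close>)
  then obtain y where y: "\<And>k. k \<noteq> 0 \<Longrightarrow> coord y k = c k" using exists_coord by metis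
  have 1: "((\<lambda>k. (c k / 2) *\<^sub>R real_basis k) has_sum (1/2) *\<^sub>R y) Zstar"
    by (rule has_sum_basis) (simp add: coord_scaleR y)
  \<comment> \<open>The halves contributed by the opposite index are collected by the reindexing k
    to - k, under which the eigenvalues are invariant.\<close>
  have "((\<lambda>k. (c (- k) / 2) *\<^sub>R real_basis (- k)) has_sum (1/2) *\<^sub>R y) Zstar"
    using 1 by (subst has_sum_reindex_bij_witness[where T = Zstar and j = uminus and i = uminus
      and h = "\<lambda>k. (c k / 2) *\<^sub>R real_basis k"]) auto
  from has_sum_add[OF 1 this]
  have "((\<lambda>k. (c k / 2) *\<^sub>R real_basis k + (c (- k) / 2) *\<^sub>R real_basis (- k)) has_sum y) Zstar"
    by (simp flip: scaleR_add_left)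
  then have "((\<lambda>k. hproj (\<lambda>\<xi>. Re (of_real (exp (- eigval k * t)) * fourier_coeff x k * fourier_e k \<xi>))) has_sum y) Zstar"
    by (subst has_sum_cong[of _ _ "\<lambda>k. (c k / 2) *\<^sub>R real_basis k + (c (- k) / 2) *\<^sub>R real_basis (- k)"])
      (auto simp: heat_term[simplified] c_def simp del: of_real_exp)
  then have "heat t x = y" unfolding heat_def by (rule infsumI)
  then show ?thesis using y[OF k] by (simp add: c_def)
qed

lemma heat_add: "t \<ge> 0 \<Longrightarrow> heat t (x + y) = heat t x + heat t y"
  and heat_diff: "t \<ge> 0 \<Longrightarrow> heat t (x - y) = heat t x - heat t y"
  and heat_scaleR: "t \<ge> 0 \<Longrightarrow> heat t (c *\<^sub>R x) = c *\<^sub>R heat t x"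
  and heat_0: "heat 0 x = x"
  by (rule coord_eqI; simp add: coord_heat coord_add coord_diff coord_scaleR algebra_simps)+

lemma heat_heat: "s \<ge> 0 \<Longrightarrow> t \<ge> 0 \<Longrightarrow> heat s (heat t x) = heat (s + t) x"
  by (rule coord_eqI) (simp add: coord_heat distrib_left flip: exp_add mult.assoc)

lemma norm_heat_le_exp:
  assumes t: "t \<ge> 0"
  shows "norm (heat t x) \<le> exp (- 4 * t) * norm x"
proof (rule norm_le_coordI)
  fix k :: int assume k: "k \<noteq> 0"
  have "exp (- eigval k * t) \<le> exp (- 4 * t)"
    using eigval_ge_4[OF k] t by (simp add: mult_right_mono)
  then show "\<bar>coord (heat t x) k\<bar> \<le> exp (- 4 * t) * \<bar>coord x k\<bar>"
    using t k by (simp add: coord_heat abs_mult mult_right_mono)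
qed simp

lemma norm_heat_le: "t \<ge> 0 \<Longrightarrow> norm (heat t x) \<le> norm x"
  using norm_heat_le_exp[of t x] mult_right_mono[of "exp (- 4 * t)" 1 "norm x"] by simp

lemma bounded_linear_heat: "t \<ge> 0 \<Longrightarrow> bounded_linear (heat t)"
  by (intro bounded_linear_intro[where K = 1]) (simp_all add: heat_add heat_scaleR norm_heat_le)

text \<open>Each multiplier 1 - exp (- t * eigval k) increases with t. In the error analysis this
  replaces the varying time left in a cell by the full step size.\<close>

lemma norm_heat_diff_mono:
  assumes "0 \<le> s" "s \<le> t"
  shows "norm (heat s x - x) \<le> norm (heat t x - x)"
proof -
  have "norm (heat s x - x) \<le> 1 * norm (heat t x - x)"
  proof (rule norm_le_coordI)
    fix k :: int assume k: "k \<noteq> 0"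
    have e: "exp (- eigval k * t) \<le> exp (- eigval k * s)" "exp (- eigval k * s) \<le> 1"
      using assms by (simp_all add: mult_left_mono)
    have c: "coord (heat r x - x) k = (exp (- eigval k * r) - 1) * coord x k" if "r \<ge> 0" for r
      using that k by (simp add: coord_heat coord_diff algebra_simps)
    show "\<bar>coord (heat s x - x) k\<bar> \<le> 1 * \<bar>coord (heat t x - x) k\<bar>"
      using e assms by (simp add: c abs_mult mult_right_mono)
  qed simp
  then show ?thesis by simp
qed

text \<open>Strong continuity is evident on finite combinations of basis vectors and extends to the
  closure because the operators are contractions.\<close>

lemma tendsto_heat_0: "((\<lambda>t. heat t x) \<longlongrightarrow> x) (at_right 0)"
proof (rule tendstoI)
  fix e :: real assume e: "e > 0"
  have "((\<lambda>F. \<Sum>k\<in>F. coord x k *\<^sub>R real_basis k) \<longlongrightarrow> x) (finite_subsets_at_top Zstar)"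
    using coord_has_sum[of x] by (simp add: has_sum_def)
  then have "\<forall>\<^sub>F F in finite_subsets_at_top Zstar. dist (\<Sum>k\<in>F. coord x k *\<^sub>R real_basis k) x < e / 3"
    using e by (intro tendstoD) auto
  then obtain F where F: "finite F" "F \<subseteq> Zstar" "dist (\<Sum>k\<in>F. coord x k *\<^sub>R real_basis k) x < e / 3"
    unfolding eventually_finite_subsets_at_top by blast
  define y where "y = (\<Sum>k\<in>F. coord x k *\<^sub>R real_basis k)"
  have hy: "heat t y = (\<Sum>k\<in>F. (exp (- eigval k * t) * coord x k) *\<^sub>R real_basis k)" if "t \<ge> 0" for t
    using that F unfolding y_def by (intro coord_eqI) (simp add: coord_heat coord_sum)
  have "((\<lambda>t. \<Sum>k\<in>F. (exp (- eigval k * t) * coord x k) *\<^sub>R real_basis k) \<longlongrightarrow>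
      (\<Sum>k\<in>F. (exp (- eigval k * 0) * coord x k) *\<^sub>R real_basis k)) (at_right 0)"
    by (intro tendsto_intros)
  then have "((\<lambda>t. \<Sum>k\<in>F. (exp (- eigval k * t) * coord x k) *\<^sub>R real_basis k) \<longlongrightarrow> y) (at_right 0)"
    by (simp add: y_def)
  then have "\<forall>\<^sub>F t in at_right 0. dist (\<Sum>k\<in>F. (exp (- eigval k * t) * coord x k) *\<^sub>R real_basis k) y < e / 3"
    using e by (intro tendstoD) auto
  moreover have "\<forall>\<^sub>F t in at_right 0. (0::real) < t" by (rule eventually_at_right_less)
  ultimately show "\<forall>\<^sub>F t in at_right 0. dist (heat t x) x < e"
  proof eventually_elim
    case (elim t)
    have "dist (heat t x) (heat t y) \<le> dist x y"
      using elim norm_heat_le[of t "x - y"] by (simp add: dist_norm heat_diff)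
    then show ?case
      using elim F(3) dist_triangle[of "heat t x" x "heat t y"] dist_triangle[of "heat t y" x y]
      by (simp add: hy dist_commute flip: y_def)
  qed
qed

lemma summable_on_powr_Zstar:
  assumes "p > 1"
  shows "(\<lambda>k::int. of_int \<bar>k\<bar> powr (- p) :: real) summable_on Zstar"
proof -
  have "summable (\<lambda>n. real n powr (- p))"
    using assms by (simp add: summable_real_powr_iff)
  then have B: "(\<Sum>n\<in>{1..m}. real n powr (- p)) \<le> (\<Sum>n. real n powr (- p))" for m
    by (intro sum_le_suminf) auto
  have "(\<Sum>k\<in>F. of_int \<bar>k\<bar> powr (- p)) \<le> 2 * (\<Sum>n. real n powr (- p))" if F: "finite F" "F \<subseteq> Zstar" for F :: "int set"
  proof -
    have "\<forall>\<^sub>F m in sequentially. finite (Zball m) \<and> F \<subseteq> Zball m \<and> Zball m \<subseteq> Zstar"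
      using filterlim_Zball F unfolding filterlim_finite_subsets_at_top by blast
    then obtain m where m: "F \<subseteq> Zball m"
      unfolding eventually_sequentially by blast
    have Z: "Zball m = int ` {1..m} \<union> (\<lambda>n. - int n) ` {1..m}"
    proof (intro set_eqI iffI)
      fix k assume "k \<in> Zball m"
      then have "nat \<bar>k\<bar> \<in> {1..m}" "k = int (nat \<bar>k\<bar>) \<or> k = - int (nat \<bar>k\<bar>)"
        by (auto simp: Zball_def)
      then show "k \<in> int ` {1..m} \<union> (\<lambda>n. - int n) ` {1..m}" by blast
    qed (auto simp: Zball_def)
    have "(\<Sum>k\<in>F. of_int \<bar>k\<bar> powr (- p)) \<le> (\<Sum>k\<in>Zball m. of_int \<bar>k\<bar> powr (- p))"
      by (intro sum_mono2 m) auto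
    also have "\<dots> = (\<Sum>k\<in>int ` {1..m}. of_int \<bar>k\<bar> powr (- p)) + (\<Sum>k\<in>(\<lambda>n. - int n) ` {1..m}. of_int \<bar>k\<bar> powr (- p))"
      unfolding Z by (intro sum.union_disjoint) auto
    also have "\<dots> = 2 * (\<Sum>n\<in>{1..m}. real n powr (- p))"
      by (subst (1 2) sum.reindex) (auto simp: inj_on_def)
    also have "\<dots> \<le> 2 * (\<Sum>n. real n powr (- p))" using B[of m] by simp
    finally show ?thesis .
  qed
  then show ?thesis
    by (intro nonneg_bdd_above_summable_on) (auto intro!: bdd_aboveI)
qed

lemma eigval_powr: "k \<noteq> 0 \<Longrightarrow> eigval k powr p = (4 * pi\<^sup>2) powr p * of_int \<bar>k\<bar> powr (2 * p)"
proof -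
  assume "k \<noteq> 0"
  then have "(of_int \<bar>k\<bar> :: real)\<^sup>2 = of_int \<bar>k\<bar> powr 2" by (simp add: powr_numeral)
  then show ?thesis unfolding eigval_def by (simp only: powr_mult powr_powr)
qed

lemma summable_on_eigval_powr: "p > 1 / 2 \<Longrightarrow> (\<lambda>k. eigval k powr (- p)) summable_on Zstar"
proof -
  assume "p > 1 / 2"
  then have "(\<lambda>k::int. (4 * pi\<^sup>2) powr (- p) * of_int \<bar>k\<bar> powr (- (2 * p))) summable_on Zstar"
    by (intro summable_on_cmult_right summable_on_powr_Zstar) simp
  then show ?thesis
    by (rule summable_on_cong[THEN iffD1, rotated]) (simp add: eigval_powr)
qed

text \<open>The square of the excess of the limit over \<open>B\<close> is almost everywhere at most
  the squared difference to \<open>s n\<close>. Its integral lies below every squared distance to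
  \<open>s n\<close> and is therefore 0.\<close>

lemma closed_bounded_fun_of:
  assumes "\<And>n. AE \<xi> in circle. \<bar>fun_of (s n) \<xi>\<bar> \<le> B" "s \<longlonglongrightarrow> x"
  shows "AE \<xi> in circle. \<bar>fun_of x \<xi>\<bar> \<le> B"
proof -
  define g where "g \<xi> = (max 0 (\<bar>fun_of x \<xi>\<bar> - B))\<^sup>2" for \<xi>
  have [measurable]: "g \<in> borel_measurable circle" unfolding g_def by measurable
  have i: "integrable circle (\<lambda>\<xi>. (fun_of x \<xi> - fun_of (s n) \<xi>)\<^sup>2)" for n
    using square_integrable_diff[OF square_integrable_fun_of[of x] square_integrable_fun_of[of "s n"]]
    by (simp add: square_integrable_def)
  have ae: "AE \<xi> in circle. g \<xi> \<le> (fun_of x \<xi> - fun_of (s n) \<xi>)\<^sup>2" for n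
    using assms(1)[of n]
  proof eventually_elim
    case (elim \<xi>)
    then have "\<bar>max 0 (\<bar>fun_of x \<xi>\<bar> - B)\<bar> \<le> \<bar>fun_of x \<xi> - fun_of (s n) \<xi>\<bar>" by linarith
    then show ?case unfolding g_def by (simp only: abs_le_square_iff)
  qed
  have ig: "integrable circle g"
    by (rule Bochner_Integration.integrable_bound[OF i[of 0]]) (use ae[of 0] in \<open>auto simp: g_def\<close>)
  have "(LINT \<xi>|circle. g \<xi>) \<le> (norm (x - s n))\<^sup>2" for n
    unfolding norm_diff_hspace_sq using ae by (intro integral_mono_AE ig i) auto
  moreover have "(\<lambda>n. (norm (x - s n))\<^sup>2) \<longlonglongrightarrow> (norm (x - x))\<^sup>2"
    using assms(2) by (intro tendsto_intros)
  ultimately have "(LINT \<xi>|circle. g \<xi>) \<le> (norm (x - x))\<^sup>2"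
    using LIMSEQ_le_const by blast
  then have "(LINT \<xi>|circle. g \<xi>) = 0"
    by (intro antisym) (auto intro: integral_nonneg simp: g_def)
  moreover have "AE \<xi> in circle. 0 \<le> g \<xi>" by (simp add: g_def)
  ultimately have "AE \<xi> in circle. g \<xi> = 0"
    using integral_nonneg_eq_0_iff_AE[OF ig] by simp
  then show ?thesis by eventually_elim (auto simp: g_def max_def split: if_splits)
qed

section \<open>The space V and its embedding into bounded functions\<close>

lemma V_norm_nonneg: "V_norm x \<ge> 0"
  unfolding V_norm_def by (auto intro!: infsum_nonneg)

lemma V_norm_sq: "(V_norm x)\<^sup>2 = (\<Sum>\<^sub>\<infinity>k\<in>Zstar. eigval k * (cmod (fourier_coeff x k))\<^sup>2)"
  unfolding V_norm_def by (auto intro!: infsum_nonneg real_sqrt_pow2)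

lemma cmod_add_sq: "(cmod (a + b))\<^sup>2 \<le> 2 * (cmod a)\<^sup>2 + 2 * (cmod b)\<^sup>2"
proof -
  have "(cmod (a + b))\<^sup>2 \<le> (cmod a + cmod b)\<^sup>2" by (intro power_mono norm_triangle_ineq) auto
  also have "\<dots> \<le> 2 * (cmod a)\<^sup>2 + 2 * (cmod b)\<^sup>2"
    using sum_squares_bound[of "cmod a" "cmod b"] by (simp add: power2_sum)
  finally show ?thesis .
qed

lemma V_space_diff:
  assumes "x \<in> V_space" "y \<in> V_space"
  shows "x - y \<in> V_space"
proof -
  have "(\<lambda>k. 2 * (eigval k * (cmod (fourier_coeff x k))\<^sup>2) + 2 * (eigval k * (cmod (fourier_coeff y k))\<^sup>2)) summable_on Zstar"
    using assms by (intro summable_on_add summable_on_cmult_right) (auto simp: V_space_def)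
  moreover have "eigval k * (cmod (fourier_coeff (x - y) k))\<^sup>2 \<le>
     2 * (eigval k * (cmod (fourier_coeff x k))\<^sup>2) + 2 * (eigval k * (cmod (fourier_coeff y k))\<^sup>2)" for k
    using mult_left_mono[OF cmod_add_sq[of "fourier_coeff x k" "- fourier_coeff y k"], of "eigval k"]
    by (simp add: fourier_coeff_diff algebra_simps)
  ultimately show ?thesis
    unfolding V_space_def by (auto intro: summable_on_comparison_test)
qed

text \<open>A triangle inequality for squares, with the factor 2 inherited from
  \<open>cmod_add_sq\<close>; it suffices to bound a path near a one-sided limit.\<close>

lemma V_norm_le_diff:
  assumes "x \<in> V_space" "y \<in> V_space"
  shows "(V_norm x)\<^sup>2 \<le> 2 * (V_norm (x - y))\<^sup>2 + 2 * (V_norm y)\<^sup>2"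
proof -
  have s: "((\<lambda>k. eigval k * (cmod (fourier_coeff z k))\<^sup>2) has_sum (V_norm z)\<^sup>2) Zstar" if "z \<in> V_space" for z
    using that unfolding V_norm_sq by (simp add: V_space_def)
  show ?thesis
  proof (rule has_sum_mono[OF s[OF assms(1)] has_sum_add[OF has_sum_cmult_right[OF s[OF V_space_diff[OF assms]]]
       has_sum_cmult_right[OF s[OF assms(2)]]]])
    show "eigval k * (cmod (fourier_coeff x k))\<^sup>2 \<le>
     2 * (eigval k * (cmod (fourier_coeff (x - y) k))\<^sup>2) + 2 * (eigval k * (cmod (fourier_coeff y k))\<^sup>2)" for k
      using mult_left_mono[OF cmod_add_sq[of "fourier_coeff (x - y) k" "fourier_coeff y k"], of "eigval k"]
      by (simp add: fourier_coeff_diff algebra_simps)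
  qed
qed

text \<open>The one-dimensional Sobolev embedding: Cauchy-Schwarz with the weights
  \<open>eigval k\<close>, whose reciprocals are summable. One factor sqrt 2 comes from the sup norm
  of the basis functions, the other from bounding a real coordinate by a complex
  coefficient.\<close>

lemma V_space_bounded:
  "\<exists>C\<ge>0. \<forall>x\<in>V_space. AE \<xi> in circle. \<bar>fun_of x \<xi>\<bar> \<le> C * V_norm x"
proof -
  define S where "S = (\<Sum>\<^sub>\<infinity>k\<in>Zstar. eigval k powr (- 1))"
  have sS: "(\<lambda>k. eigval k powr (- 1)) summable_on Zstar" by (rule summable_on_eigval_powr) simp
  have S: "S \<ge> 0" unfolding S_def by (intro infsum_nonneg) simp
  have "AE \<xi> in circle. \<bar>fun_of x \<xi>\<bar> \<le> 2 * sqrt S * V_norm x" if x: "x \<in> V_space" for x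
  proof (rule closed_bounded_fun_of)
    show "(\<lambda>n. \<Sum>k\<in>Zball n. coord x k *\<^sub>R real_basis k) \<longlonglongrightarrow> x"
      by (rule has_sum_Zball[OF coord_has_sum])
    fix n
    have "AE \<xi> in circle. \<forall>k\<in>Zball n. fun_of (coord x k *\<^sub>R real_basis k) \<xi> = coord x k * basis_fun k \<xi>"
    proof (rule AE_finite_allI)
      fix k assume "k \<in> Zball n"
      then have "k \<noteq> 0" by (simp add: Zball_def)
      from fun_of_scaleR[of "coord x k" "real_basis k"] fun_of_real_basis[OF this]
      show "AE \<xi> in circle. fun_of (coord x k *\<^sub>R real_basis k) \<xi> = coord x k * basis_fun k \<xi>"
        by eventually_elim simp
    qed simp
    moreover note fun_of_sum[OF finite_Zball, of "\<lambda>k. coord x k *\<^sub>R real_basis k" n]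
    ultimately show "AE \<xi> in circle. \<bar>fun_of (\<Sum>k\<in>Zball n. coord x k *\<^sub>R real_basis k) \<xi>\<bar> \<le> 2 * sqrt S * V_norm x"
    proof eventually_elim
      case (elim \<xi>)
      have "\<bar>fun_of (\<Sum>k\<in>Zball n. coord x k *\<^sub>R real_basis k) \<xi>\<bar> = \<bar>\<Sum>k\<in>Zball n. coord x k * basis_fun k \<xi>\<bar>"
        using elim by simp
      also have "\<dots> \<le> (\<Sum>k\<in>Zball n. \<bar>coord x k * basis_fun k \<xi>\<bar>)" by (rule sum_abs)
      also have "\<dots> \<le> (\<Sum>k\<in>Zball n. eigval k powr (- 1/2) * (sqrt 2 * (eigval k powr (1/2) * \<bar>coord x k\<bar>)))"
      proof (rule sum_mono)
        fix k assume "k \<in> Zball n"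
        then have "k \<noteq> 0" by (simp add: Zball_def)
        then have "eigval k powr (- 1/2) * eigval k powr (1/2) = 1"
          using eigval_pos[of k] by (simp flip: powr_add)
        moreover have "eigval k powr (- 1/2) * (sqrt 2 * (eigval k powr (1/2) * \<bar>coord x k\<bar>)) =
            (eigval k powr (- 1/2) * eigval k powr (1/2)) * (\<bar>coord x k\<bar> * sqrt 2)"
          by (simp only: mult_ac)
        ultimately have "eigval k powr (- 1/2) * (sqrt 2 * (eigval k powr (1/2) * \<bar>coord x k\<bar>)) = \<bar>coord x k\<bar> * sqrt 2"
          by simp
        then show "\<bar>coord x k * basis_fun k \<xi>\<bar> \<le> eigval k powr (- 1/2) * (sqrt 2 * (eigval k powr (1/2) * \<bar>coord x k\<bar>))"
          using mult_left_mono[OF basis_fun_bound[of k \<xi>], of "\<bar>coord x k\<bar>"] by (simp only: abs_mult abs_ge_zero)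
      qed
      finally have 1: "\<bar>fun_of (\<Sum>k\<in>Zball n. coord x k *\<^sub>R real_basis k) \<xi>\<bar> \<le>
          (\<Sum>k\<in>Zball n. eigval k powr (- 1/2) * (sqrt 2 * (eigval k powr (1/2) * \<bar>coord x k\<bar>)))" (is "_ \<le> ?R") .
      have "?R\<^sup>2 \<le> (\<Sum>k\<in>Zball n. (eigval k powr (- 1/2))\<^sup>2) * (\<Sum>k\<in>Zball n. (sqrt 2 * (eigval k powr (1/2) * \<bar>coord x k\<bar>))\<^sup>2)"
        by (rule Cauchy_Schwarz_ineq_sum)
      also have "\<dots> \<le> S * (4 * (V_norm x)\<^sup>2)"
      proof (rule mult_mono)
        have "(\<Sum>k\<in>Zball n. (eigval k powr (- 1/2))\<^sup>2) = (\<Sum>k\<in>Zball n. eigval k powr (- 1))"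
          by (intro sum.cong) (auto simp: power2_eq_square simp flip: powr_add)
        also have "\<dots> \<le> S" unfolding S_def
          using Zball_subset by (intro finite_sum_le_infsum sS) auto
        finally show "(\<Sum>k\<in>Zball n. (eigval k powr (- 1/2))\<^sup>2) \<le> S" .
        have "(\<Sum>k\<in>Zball n. (sqrt 2 * (eigval k powr (1/2) * \<bar>coord x k\<bar>))\<^sup>2) \<le>
            (\<Sum>k\<in>Zball n. 4 * (eigval k * (cmod (fourier_coeff x k))\<^sup>2))"
        proof (rule sum_mono)
          fix k assume "k \<in> Zball n"
          then have k: "k \<noteq> 0" by (simp add: Zball_def)
          have "(eigval k powr (1/2))\<^sup>2 = eigval k"
            using eigval_pos[OF k] by (simp add: powr_half_sqrt)
          then have "(sqrt 2 * (eigval k powr (1/2) * \<bar>coord x k\<bar>))\<^sup>2 = 2 * (eigval k * (coord x k)\<^sup>2)"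
            by (simp add: power_mult_distrib)
          also have "\<dots> \<le> 4 * (eigval k * (cmod (fourier_coeff x k))\<^sup>2)"
            unfolding cmod_fourier_coeff_sq[OF k] by (simp add: mult_left_mono)
          finally show "(sqrt 2 * (eigval k powr (1/2) * \<bar>coord x k\<bar>))\<^sup>2 \<le> 4 * (eigval k * (cmod (fourier_coeff x k))\<^sup>2)" .
        qed
        also have "\<dots> = 4 * (\<Sum>k\<in>Zball n. eigval k * (cmod (fourier_coeff x k))\<^sup>2)"
          by (simp add: sum_distrib_left)
        also have "\<dots> \<le> 4 * (V_norm x)\<^sup>2"
          unfolding V_norm_sq using x Zball_subset
          by (intro mult_left_mono finite_sum_le_infsum) (auto simp: V_space_def)
        finally show "(\<Sum>k\<in>Zball n. (sqrt 2 * (eigval k powr (1/2) * \<bar>coord x k\<bar>))\<^sup>2) \<le> 4 * (V_norm x)\<^sup>2" .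
      qed (use S in \<open>auto intro: sum_nonneg\<close>)
      also have "\<dots> = (2 * sqrt S * V_norm x)\<^sup>2" using S by (simp add: power_mult_distrib)
      finally have "?R \<le> 2 * sqrt S * V_norm x"
        by (rule power2_le_imp_le) (use S V_norm_nonneg in simp)
      with 1 show ?case by linarith
    qed
  qed
  then show ?thesis using S by (intro exI[of _ "2 * sqrt S"]) auto
qed

section \<open>The splitting scheme\<close>

text \<open>The flow of \<open>r' = r - r\<^sup>3\<close> at time \<open>h\<close> is \<open>e\<^sup>h r / sqrt (1 + (e\<^sup>2\<^sup>h - 1) r\<^sup>2)\<close>; \<open>phi h\<close> is the same
  expression with \<open>1 + 2h\<close> in place of \<open>e\<^sup>2\<^sup>h\<close>.\<close>

definition phi :: "real \<Rightarrow> real \<Rightarrow> real" where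
  "phi h r = r * sqrt (1 + 2 * h) / sqrt (1 + 2 * h * r\<^sup>2)"

text \<open>\<open>damp h\<close> is concave, so that the pointwise bound on \<open>(phi h a - phi h b)\<^sup>2\<close> passes to the norm
  of \<open>H\<close> by Jensen's inequality.\<close>

definition damp :: "real \<Rightarrow> real \<Rightarrow> real" where
  "damp h z = (1 + 2 * h) * z / (1 + h * z / 2)"

text \<open>Midpoint concavity on the nonnegative half-line: the derivative of x / sqrt (1 + q x^2)
  is (1 + q x^2)^(-3/2), which decreases there. The convexity criterion is applied to the negative
  \<open>f\<close>.\<close>

lemma sum_div_sqrt_concave:
  fixes a c q :: real
  assumes "a \<ge> 0" "c \<ge> 0" "q \<ge> 0"
  shows "a / sqrt (1 + q * a\<^sup>2) + c / sqrt (1 + q * c\<^sup>2) \<le> (a + c) / sqrt (1 + q * ((a + c) / 2)\<^sup>2)"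
proof -
  define f where "f x = - (x / sqrt (1 + q * x\<^sup>2))" for x
  have p: "1 + q * x\<^sup>2 > 0" for x using assms(3) by (simp add: add_pos_nonneg)
  have "convex_on {0..} f"
  proof (rule f''_ge0_imp_convex)
    fix x :: real
    define s where "s = sqrt (1 + q * x\<^sup>2)"
    have s: "s > 0" "s * s = 1 + q * x\<^sup>2" "s\<^sup>2 = 1 + q * x\<^sup>2" using p[of x] by (auto simp: s_def)
    have dS: "((\<lambda>x. sqrt (1 + q * x\<^sup>2)) has_real_derivative q * x / s) (at x)"
      unfolding s_def using p[of x] by (auto intro!: derivative_eq_intros simp: divide_simps)
    have "(f has_real_derivative - ((1 * s - x * (q * x / s)) / (s * s))) (at x)"
      unfolding f_def using dS s(1) unfolding s_def
      by (intro DERIV_minus DERIV_divide DERIV_ident) auto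
    also have "- ((1 * s - x * (q * x / s)) / (s * s)) = - (1 / (s * (s * s)))"
    proof -
      have "1 * s - x * (q * x / s) = (s * s - q * x\<^sup>2) / s"
        using s(1) by (simp add: field_simps power2_eq_square)
      then show ?thesis using s(2) by simp
    qed
    finally show "(f has_real_derivative - (1 / (sqrt (1 + q * x\<^sup>2) * (1 + q * x\<^sup>2)))) (at x)"
      unfolding s(2) by (simp add: s_def)
    have "((\<lambda>x. sqrt (1 + q * x\<^sup>2) * (1 + q * x\<^sup>2)) has_real_derivative
        q * x / s * (1 + q * x\<^sup>2) + (q * (2 * x)) * sqrt (1 + q * x\<^sup>2)) (at x)"
      by (rule DERIV_mult[OF dS]) (auto intro!: derivative_eq_intros)
    then have "((\<lambda>x. - inverse (sqrt (1 + q * x\<^sup>2) * (1 + q * x\<^sup>2))) has_real_derivative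
        - (- (inverse (s * (s * s)) * (q * x / s * (s * s) + q * (2 * x) * s) * inverse (s * (s * s))))) (at x)"
      using s(1) unfolding s(2) unfolding s_def
      by (intro DERIV_minus DERIV_inverse') (use p[of x] in auto)
    also have "- (- (inverse (s * (s * s)) * (q * x / s * (s * s) + q * (2 * x) * s) * inverse (s * (s * s))))
       = (q * x / s * (s * s) + s * (2 * q * x)) / (s * (s * s))\<^sup>2"
      by (simp add: divide_inverse power2_eq_square mult_ac)
    finally show "((\<lambda>x. - (1 / (sqrt (1 + q * x\<^sup>2) * (1 + q * x\<^sup>2)))) has_real_derivative
        (q * x / s * (s * s) + s * (2 * q * x)) / (s * (s * s))\<^sup>2) (at x)"
      by (simp add: inverse_eq_divide)
    show "0 \<le> (q * x / s * (s * s) + s * (2 * q * x)) / (s * (s * s))\<^sup>2" if "x \<in> {0..}"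
      using that s assms(3) by simp
  qed simp
  then have "f ((1 - 1/2) *\<^sub>R a + (1/2) *\<^sub>R c) \<le> (1 - 1/2) * f a + (1/2) * f c"
    by (rule convex_onD) (use assms in auto)
  moreover have "(1 - 1/2) *\<^sub>R a + (1/2) *\<^sub>R c = (a + c) / 2" by simp
  ultimately have "2 * f ((a + c) / 2) \<le> f a + f c" by (simp only:) simp
  moreover have "2 * f ((a + c) / 2) = - ((a + c) / sqrt (1 + q * ((a + c) / 2)\<^sup>2))"
    by (simp add: f_def add_divide_distrib)
  ultimately show ?thesis unfolding f_def by linarith
qed

text \<open>The constant 1/4 is sharp: equality holds for b = - a. If the signs differ, the
  difference is a sum of two values at nonnegative points and concavity applies; if they agree, a
  Cauchy-Schwarz argument controls the numerator.\<close>

lemma div_sqrt_diff_sq: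
  fixes a b q :: real
  assumes "q \<ge> 0"
  shows "(a / sqrt (1 + q * a\<^sup>2) - b / sqrt (1 + q * b\<^sup>2))\<^sup>2 \<le> (a - b)\<^sup>2 / (1 + q * (a - b)\<^sup>2 / 4)"
proof -
  have p: "1 + q * x\<^sup>2 > 0" for x using assms by (simp add: add_pos_nonneg)
  have opp: "(a / sqrt (1 + q * a\<^sup>2) - b / sqrt (1 + q * b\<^sup>2))\<^sup>2 \<le> (a - b)\<^sup>2 / (1 + q * (a - b)\<^sup>2 / 4)"
    if "a \<ge> 0" "b \<le> 0" for a b
  proof -
    have "0 \<le> a / sqrt (1 + q * a\<^sup>2) + (- b) / sqrt (1 + q * (- b)\<^sup>2)"
      using that p[of a] p[of b] by (intro add_nonneg_nonneg divide_nonneg_nonneg) auto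
    moreover have "a / sqrt (1 + q * a\<^sup>2) + (- b) / sqrt (1 + q * (- b)\<^sup>2) \<le> (a + - b) / sqrt (1 + q * ((a + - b) / 2)\<^sup>2)"
      by (rule sum_div_sqrt_concave) (use that assms in auto)
    ultimately have "(a / sqrt (1 + q * a\<^sup>2) + (- b) / sqrt (1 + q * (- b)\<^sup>2))\<^sup>2 \<le> ((a + - b) / sqrt (1 + q * ((a + - b) / 2)\<^sup>2))\<^sup>2"
      by (intro power_mono)
    also have "\<dots> = (a - b)\<^sup>2 / (1 + q * (a - b)\<^sup>2 / 4)"
      using p[of "(a - b) / 2"] by (simp add: power_divide)
    finally show ?thesis by simp
  qed
  have same: "(a / sqrt (1 + q * a\<^sup>2) - b / sqrt (1 + q * b\<^sup>2))\<^sup>2 \<le> (a - b)\<^sup>2 / (1 + q * (a - b)\<^sup>2 / 4)"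
    if "a * b \<ge> 0" for a b
  proof -
    define P where "P = sqrt (1 + q * a\<^sup>2)"
    define Q where "Q = sqrt (1 + q * b\<^sup>2)"
    have PQ: "P > 0" "Q > 0" "P\<^sup>2 = 1 + q * a\<^sup>2" "Q\<^sup>2 = 1 + q * b\<^sup>2"
      using p[of a] p[of b] by (auto simp: P_def Q_def)
    \<comment> \<open>Cauchy-Schwarz for the plane vectors (1, sqrt q a) and (1, sqrt q b), whose
      lengths are \<open>P\<close> and \<open>Q\<close>.\<close>
    have "1 + q * (a * b) \<le> P * Q"
    proof (rule power2_le_imp_le)
      have "(P * Q)\<^sup>2 - (1 + q * (a * b))\<^sup>2 = q * (a - b)\<^sup>2"
        unfolding power_mult_distrib PQ by (simp add: power2_eq_square algebra_simps)
      moreover have "0 \<le> q * (a - b)\<^sup>2" using assms by simp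
      ultimately show "(1 + q * (a * b))\<^sup>2 \<le> (P * Q)\<^sup>2" by linarith
    qed (use PQ in simp)
    then have "2 * (a * b) * (1 + q * (a * b)) \<le> 2 * (a * b) * (P * Q)"
      using that by (intro mult_left_mono) auto
    moreover have "(a * Q - b * P)\<^sup>2 = a\<^sup>2 * Q\<^sup>2 + b\<^sup>2 * P\<^sup>2 - 2 * (a * b) * (P * Q)"
      by (simp add: power2_eq_square algebra_simps)
    ultimately have "(a * Q - b * P)\<^sup>2 \<le> a\<^sup>2 * Q\<^sup>2 + b\<^sup>2 * P\<^sup>2 - 2 * (a * b) * (1 + q * (a * b))"
      by linarith
    also have "\<dots> = (a - b)\<^sup>2"
      unfolding PQ by (simp add: power2_eq_square algebra_simps)
    finally have 1: "(a * Q - b * P)\<^sup>2 \<le> (a - b)\<^sup>2" .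
    have "(a - b)\<^sup>2 \<le> 4 * (a\<^sup>2 + b\<^sup>2)"
      using that zero_le_power2[of a] zero_le_power2[of b] mult.assoc[of 2 a b] unfolding power2_diff distrib_left by linarith
    then have "q * (a - b)\<^sup>2 \<le> q * (4 * (a\<^sup>2 + b\<^sup>2))" by (rule mult_left_mono) (rule assms)
    moreover have "(P * Q)\<^sup>2 = 1 + q * (a\<^sup>2 + b\<^sup>2) + (q * (a * b))\<^sup>2"
      unfolding power_mult_distrib PQ by (simp add: power2_eq_square algebra_simps)
    ultimately have 2: "1 + q * (a - b)\<^sup>2 / 4 \<le> (P * Q)\<^sup>2"
      using zero_le_power2[of "q * (a * b)"] by linarith
    have "(a / P - b / Q)\<^sup>2 = (a * Q - b * P)\<^sup>2 / (P * Q)\<^sup>2"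
      using PQ by (simp add: diff_frac_eq power_divide)
    also have "\<dots> \<le> (a - b)\<^sup>2 / (1 + q * (a - b)\<^sup>2 / 4)"
      using 1 2 assms by (intro frac_le) (auto simp: add_pos_nonneg)
    finally show ?thesis by (simp add: P_def Q_def)
  qed
  show ?thesis
    using opp[of a b] opp[of b a] same[of a b]
    by (cases "a * b \<ge> 0") (auto simp: power2_commute[of a b] power2_commute[of "a / _"] zero_le_mult_iff not_le mult_less_0_iff)
qed

text \<open>The preceding inequality with q = 2 h; the denominator 1 + 2 h (a - b)^2 / 4 is the one
  that appears in \<open>damp h\<close>.\<close>

lemma phi_diff_sq:
  assumes "h \<ge> 0"
  shows "(phi h a - phi h b)\<^sup>2 \<le> damp h ((a - b)\<^sup>2)"
proof -
  have "phi h a - phi h b = sqrt (1 + 2 * h) * (a / sqrt (1 + 2 * h * a\<^sup>2) - b / sqrt (1 + 2 * h * b\<^sup>2))"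
    by (simp add: phi_def algebra_simps)
  then have "(phi h a - phi h b)\<^sup>2 = (1 + 2 * h) * (a / sqrt (1 + 2 * h * a\<^sup>2) - b / sqrt (1 + 2 * h * b\<^sup>2))\<^sup>2"
    using assms by (simp add: power_mult_distrib)
  also have "\<dots> \<le> (1 + 2 * h) * ((a - b)\<^sup>2 / (1 + 2 * h * (a - b)\<^sup>2 / 4))"
    using assms by (intro mult_left_mono div_sqrt_diff_sq) auto
  finally show ?thesis by (simp add: damp_def)
qed

lemma phi_0 [simp]: "phi h 0 = 0"
  by (simp add: phi_def)

lemma damp_le: "h \<ge> 0 \<Longrightarrow> z \<ge> 0 \<Longrightarrow> damp h z \<le> (1 + 2 * h) * z"
  unfolding damp_def by (rule divide_le_eq[THEN iffD2]) (auto simp: mult_left_le algebra_simps add_pos_nonneg)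

text \<open>Concavity in the form that Jensen's inequality requires: the slope is the derivative of
  \<open>damp h\<close> at \<open>y\<close>, and the gap between tangent and function is a
  nonnegative multiple of (z - y)^2.\<close>

lemma damp_tangent:
  assumes "h \<ge> 0" "z \<ge> 0" "y \<ge> 0"
  shows "damp h z \<le> damp h y + (1 + 2 * h) / (1 + h * y / 2)\<^sup>2 * (z - y)"
proof -
  define Y where "Y = 1 + h * y / 2"
  define Z where "Z = 1 + h * z / 2"
  have p: "Y > 0" "Z > 0" using assms by (auto simp: Y_def Z_def add_pos_nonneg)
  have "z / Z - y / Y = (z - y) / (Z * Y)"
    using p by (simp add: field_simps Y_def Z_def) 
  moreover have "(z - y) / Y\<^sup>2 - (z - y) / (Z * Y) = (h / 2) * (z - y)\<^sup>2 / (Z * Y\<^sup>2)"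
  proof -
    have "Z - Y = (h / 2) * (z - y)" by (simp add: Y_def Z_def algebra_simps)
    moreover have "(z - y) / Y\<^sup>2 - (z - y) / (Z * Y) = (z - y) * (Z - Y) / (Z * Y\<^sup>2)"
      using p by (simp add: field_simps power2_eq_square)
    ultimately show ?thesis by (simp only: power2_eq_square mult_ac)
  qed
  moreover have "(h / 2) * (z - y)\<^sup>2 / (Z * Y\<^sup>2) \<ge> 0" using p assms by simp
  ultimately have "z / Z \<le> y / Y + (z - y) / Y\<^sup>2" by linarith
  then have "(1 + 2 * h) * (z / Z) \<le> (1 + 2 * h) * (y / Y + (z - y) / Y\<^sup>2)"
    using assms by (intro mult_left_mono) auto
  then show ?thesis by (simp add: damp_def Y_def Z_def distrib_left)
qed

lemma div_one_plus_mono: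
  fixes h y z :: real
  assumes "h \<ge> 0" "0 \<le> y" "y \<le> z"
  shows "y / (1 + h * y / 2) \<le> z / (1 + h * z / 2)"
proof -
  have "y * (1 + h * z / 2) \<le> z * (1 + h * y / 2)"
    using assms by (simp add: algebra_simps)
  moreover have "1 + h * y / 2 > 0" "1 + h * z / 2 > 0" using assms by (auto intro!: add_pos_nonneg)
  ultimately show ?thesis by (simp only: pos_divide_le_eq pos_le_divide_eq times_divide_eq_left)
qed

lemma measurable_phi [measurable]: "phi h \<in> borel_measurable borel"
  unfolding phi_def by measurable

lemma phi_sq_le: "h \<ge> 0 \<Longrightarrow> (phi h r)\<^sup>2 \<le> (1 + 2 * h) * r\<^sup>2"
  using phi_diff_sq[of h r 0] damp_le[of h "r\<^sup>2"] by simp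

lemma square_integrable_phi:
  assumes "h \<ge> 0" "square_integrable f"
  shows "square_integrable (\<lambda>\<xi>. phi h (f \<xi>))"
proof -
  have [measurable]: "f \<in> borel_measurable circle" using assms by simp
  have "integrable circle (\<lambda>\<xi>. (phi h (f \<xi>))\<^sup>2)"
  proof (rule Bochner_Integration.integrable_bound)
    show "integrable circle (\<lambda>\<xi>. (1 + 2 * h) * (f \<xi>)\<^sup>2)"
      using assms by (simp add: square_integrable_def)
    show "AE \<xi> in circle. norm ((phi h (f \<xi>))\<^sup>2) \<le> norm ((1 + 2 * h) * (f \<xi>)\<^sup>2)"
      using phi_sq_le[OF assms(1)] assms(1) by simp
  qed measurable
  then show ?thesis by (simp add: square_integrable_def)
qed

section \<open>The scheme on H and its contraction estimates\<close>

definition reaction :: "real \<Rightarrow> hspace \<Rightarrow> hspace" where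
  "reaction h u = hproj (\<lambda>\<xi>. phi h (fun_of u \<xi>))"

text \<open>The projection does not increase norms, so the pointwise estimate may be integrated. The
  tangent of \<open>damp h\<close> is taken at the mean \<open>y\<close> of the squared difference;
  as the circle has measure 1, its linear part integrates to 0.\<close>

lemma reaction_diff_sq:
  assumes h: "h \<ge> 0"
  shows "(norm (reaction h u - reaction h v))\<^sup>2 \<le> damp h ((norm (u - v))\<^sup>2)"
proof -
  interpret prob_space circle by (rule prob_space_circle)
  define y where "y = (norm (u - v))\<^sup>2"
  define d where "d \<xi> = (fun_of u \<xi> - fun_of v \<xi>)\<^sup>2" for \<xi>
  define c where "c = (1 + 2 * h) / (1 + h * y / 2)\<^sup>2"
  have s: "square_integrable (\<lambda>\<xi>. phi h (fun_of u \<xi>))" "square_integrable (\<lambda>\<xi>. phi h (fun_of v \<xi>))"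
    by (intro square_integrable_phi h square_integrable_fun_of)+
  have id: "integrable circle d"
    using square_integrable_diff[OF square_integrable_fun_of[of u] square_integrable_fun_of[of v]]
    by (simp add: square_integrable_def d_def[abs_def])
  have y: "y = (LINT \<xi>|circle. d \<xi>)" by (simp add: y_def d_def norm_diff_hspace_sq)
  have y0: "y \<ge> 0" by (simp add: y_def)
  have "(norm (reaction h u - reaction h v))\<^sup>2 \<le> (LINT \<xi>|circle. (phi h (fun_of u \<xi>) - phi h (fun_of v \<xi>))\<^sup>2)"
    using norm_hproj_le[OF square_integrable_diff[OF s]] by (simp add: reaction_def hproj_diff[OF s])
  also have "\<dots> \<le> (LINT \<xi>|circle. damp h y + c * (d \<xi> - y))"
  proof (rule integral_mono)
    show "integrable circle (\<lambda>\<xi>. (phi h (fun_of u \<xi>) - phi h (fun_of v \<xi>))\<^sup>2)"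
      using square_integrable_diff[OF s] by (simp add: square_integrable_def)
    show "(phi h (fun_of u \<xi>) - phi h (fun_of v \<xi>))\<^sup>2 \<le> damp h y + c * (d \<xi> - y)" for \<xi>
      using phi_diff_sq[OF h, of "fun_of u \<xi>" "fun_of v \<xi>"] damp_tangent[OF h _ y0, of "d \<xi>"]
      by (simp add: c_def d_def)
  qed (use id in auto)
  also have "\<dots> = damp h y"
    using id by (simp add: y prob_space)
  finally show ?thesis by (simp add: y_def)
qed

text \<open>Lie splitting. The noise is added last, so it cancels in the difference of two runs. It
  is not smoothed by the heat step because the increments of the stochastic convolution inserted
  later already contain the semigroup.\<close>

primrec eul :: "real \<Rightarrow> nat \<Rightarrow> hspace \<Rightarrow> (nat \<Rightarrow> hspace) \<Rightarrow> hspace" where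
  "eul h 0 u w = u"
| "eul h (Suc n) u w = heat h (reaction h (eul h n u w)) + w n"

text \<open>The factor exp (- 8 h) is the square of the heat bound and 1 + 2 h the growth of the
  reaction. Keeping exp (- 2 h) of the product yields rate 1 for the norm.\<close>

lemma one_plus_le_exp: "(h::real) \<ge> 0 \<Longrightarrow> exp (- 8 * h) * (1 + 2 * h) \<le> exp (- 2 * h)"
proof -
  assume h: "h \<ge> 0"
  have "exp (- 8 * h) * (1 + 2 * h) \<le> exp (- 8 * h) * exp (2 * h)"
    by (intro mult_left_mono) (auto simp: exp_ge_add_one_self)
  also have "\<dots> \<le> exp (- 2 * h)" using h by (simp flip: exp_add)
  finally show ?thesis .
qed

lemma eul_step_sq:
  assumes h: "h \<ge> 0"
  shows "(norm (heat h (reaction h u) - heat h (reaction h v)))\<^sup>2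
    \<le> exp (- 2 * h) * ((norm (u - v))\<^sup>2 / (1 + h * (norm (u - v))\<^sup>2 / 2))"
proof -
  define z where "z = (norm (u - v))\<^sup>2"
  have z: "z \<ge> 0" by (simp add: z_def)
  have "norm (heat h (reaction h u) - heat h (reaction h v)) \<le> exp (- 4 * h) * norm (reaction h u - reaction h v)"
    using norm_heat_le_exp[OF h, of "reaction h u - reaction h v"] by (simp add: heat_diff[OF h])
  then have "(norm (heat h (reaction h u) - heat h (reaction h v)))\<^sup>2 \<le> (exp (- 4 * h) * norm (reaction h u - reaction h v))\<^sup>2"
    by (rule power_mono) simp
  also have "\<dots> = exp (- 8 * h) * (norm (reaction h u - reaction h v))\<^sup>2"
    by (simp add: power_mult_distrib flip: exp_of_nat_mult)
  also have "\<dots> \<le> exp (- 8 * h) * damp h z"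
    unfolding z_def by (intro mult_left_mono reaction_diff_sq h) auto
  also have "\<dots> = exp (- 8 * h) * (1 + 2 * h) * (z / (1 + h * z / 2))" by (simp add: damp_def)
  also have "\<dots> \<le> exp (- 2 * h) * (z / (1 + h * z / 2))"
    by (rule mult_right_mono[OF one_plus_le_exp[OF h]]) (use h z in simp)
  finally show ?thesis by (simp add: z_def)
qed

lemma div_one_plus_le: "h \<ge> 0 \<Longrightarrow> z \<ge> 0 \<Longrightarrow> z / (1 + h * z / 2) \<le> (z::real)"
  by (rule divide_le_eq[THEN iffD2]) (auto simp: algebra_simps add_pos_nonneg)

lemma eul_contract:
  assumes h: "h \<ge> 0"
  shows "norm (eul h n u w - eul h n v w) \<le> exp (- (real n * h)) * norm (u - v)"
proof (induction n)
  case (Suc n)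
  let ?a = "eul h n u w" and ?b = "eul h n v w"
  have "(norm (eul h (Suc n) u w - eul h (Suc n) v w))\<^sup>2 \<le> exp (- 2 * h) * ((norm (?a - ?b))\<^sup>2 / (1 + h * (norm (?a - ?b))\<^sup>2 / 2))"
    using eul_step_sq[OF h, of ?a ?b] by simp
  also have "\<dots> \<le> exp (- 2 * h) * (norm (?a - ?b))\<^sup>2"
    by (intro mult_left_mono div_one_plus_le h) auto
  also have "\<dots> = (exp (- h) * norm (?a - ?b))\<^sup>2"
    by (simp add: power_mult_distrib flip: exp_of_nat_mult)
  finally have "norm (eul h (Suc n) u w - eul h (Suc n) v w) \<le> exp (- h) * norm (?a - ?b)"
    by (rule power2_le_imp_le) simp
  also have "\<dots> \<le> exp (- h) * (exp (- (real n * h)) * norm (u - v))"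
    by (intro mult_left_mono Suc.IH) simp
  also have "\<dots> = exp (- (real (Suc n) * h)) * norm (u - v)"
    by (simp add: algebra_simps flip: exp_add)
  finally show ?case .
qed simp

lemma eul_nonexpansive: "h \<ge> 0 \<Longrightarrow> norm (eul h n u w - eul h n v w) \<le> norm (u - v)"
  using eul_contract[of h n u w v] mult_right_mono[of "exp (- (real n * h))" 1 "norm (u - v)"] by simp

text \<open>The map from z to z / (1 + h z / 2) adds h / 2 to 1 / z. After n steps 1 / z is at least
  n h / 2 whatever z was at the start; the exponential factor is estimated by 1.\<close>

lemma eul_bounded_diff:
  assumes h: "h > 0" and "n > 0"
  shows "(norm (eul h n u w - eul h n v w))\<^sup>2 \<le> 2 / (real n * h)"
  using \<open>n > 0\<close>
proof (induction n rule: nat_induct_non_zero)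
  case 1
  define z where "z = (norm (u - v))\<^sup>2"
  have z: "z \<ge> 0" by (simp add: z_def)
  have "(norm (eul h 1 u w - eul h 1 v w))\<^sup>2 \<le> exp (- 2 * h) * (z / (1 + h * z / 2))"
    using eul_step_sq[of h u v] h by (simp add: z_def)
  also have "\<dots> \<le> 1 * (z / (1 + h * z / 2))" using h z by (intro mult_right_mono) auto
  also have "\<dots> \<le> 2 / h"
    using h z by (simp add: divide_le_eq add_pos_nonneg) (simp add: field_simps)
  finally show ?case by simp
next
  case (Suc n)
  define z where "z = (norm (eul h n u w - eul h n v w))\<^sup>2"
  have z: "z \<ge> 0" by (simp add: z_def)
  have "(norm (eul h (Suc n) u w - eul h (Suc n) v w))\<^sup>2 \<le> exp (- 2 * h) * (z / (1 + h * z / 2))"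
    using eul_step_sq[of h] h by (simp add: z_def)
  also have "\<dots> \<le> 1 * (z / (1 + h * z / 2))" using h z by (intro mult_right_mono) auto
  also have "\<dots> \<le> (2 / (real n * h)) / (1 + h * (2 / (real n * h)) / 2)"
    using div_one_plus_mono[of h z "2 / (real n * h)"] h z Suc.IH by (simp add: z_def)
  also have "\<dots> = 2 / (real (Suc n) * h)"
    using h Suc.hyps by (simp add: field_simps)
  finally show ?case .
qed

text \<open>Writing \<open>phi h r\<close> as r sqrt y, the number 1 + a with a = h (1 - r^2) is an
  approximate square root of y: their squares differ by O(h^2 R^4), and the sum of the two is
  bounded away from 0.\<close>

lemma phi_consistency:
  assumes R: "R \<ge> 1" "\<bar>r\<bar> \<le> R" and h: "0 \<le> h" "h * R\<^sup>2 \<le> 1 / 2"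
  shows "\<bar>phi h r - r - h * (r - r ^ 3)\<bar> \<le> 10 * R ^ 5 * h\<^sup>2"
proof -
  define y where "y = (1 + 2 * h) / (1 + 2 * h * r\<^sup>2)"
  define a where "a = h * (1 - r\<^sup>2)"
  have r2: "r\<^sup>2 \<le> R\<^sup>2" using R by (metis abs_ge_zero power2_abs power_mono)
  have R2: "1 \<le> R\<^sup>2" using R by (simp add: one_le_power)
  have p: "1 + 2 * h * r\<^sup>2 > 0" using h by (simp add: add_pos_nonneg)
  have y: "y \<ge> 0" using h p by (simp add: y_def)
  have "\<bar>1 - r\<^sup>2\<bar> \<le> R\<^sup>2" using r2 R2 zero_le_power2[of r] by linarith
  then have a: "\<bar>a\<bar> \<le> h * R\<^sup>2" using h by (simp add: a_def abs_mult mult_left_mono)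
  have phi: "phi h r = r * sqrt y" by (simp add: phi_def y_def real_sqrt_divide)
  have "y - 1 = 2 * a / (1 + 2 * h * r\<^sup>2)"
    using p by (simp add: y_def a_def field_simps)
  then have "y - (1 + a)\<^sup>2 = 2 * a / (1 + 2 * h * r\<^sup>2) - 2 * a - a\<^sup>2"
    by (simp add: power2_eq_square algebra_simps)
  also have "\<dots> = - (4 * a * (h * r\<^sup>2) / (1 + 2 * h * r\<^sup>2)) - a\<^sup>2"
    using p by (simp add: field_simps)
  finally have e: "y - (1 + a)\<^sup>2 = - (4 * a * (h * r\<^sup>2) / (1 + 2 * h * r\<^sup>2)) - a\<^sup>2" .
  have hr: "0 \<le> h * r\<^sup>2" "h * r\<^sup>2 \<le> h * R\<^sup>2" using h r2 by (auto intro: mult_left_mono)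
  have "\<bar>4 * a * (h * r\<^sup>2) / (1 + 2 * h * r\<^sup>2)\<bar> \<le> 4 * (h * R\<^sup>2) * (h * R\<^sup>2) / 1"
  proof -
    have "\<bar>4 * a * (h * r\<^sup>2) / (1 + 2 * h * r\<^sup>2)\<bar> = 4 * \<bar>a\<bar> * \<bar>h * r\<^sup>2\<bar> / \<bar>1 + 2 * h * r\<^sup>2\<bar>"
      by (simp only: abs_mult[of "4 * a"] abs_mult[of 4 a] abs_divide abs_numeral)
    then have "\<bar>4 * a * (h * r\<^sup>2) / (1 + 2 * h * r\<^sup>2)\<bar> = 4 * \<bar>a\<bar> * (h * r\<^sup>2) / (1 + 2 * h * r\<^sup>2)"
      by (simp only: abs_of_nonneg[OF hr(1)] abs_of_pos[OF p])
    also have "\<dots> \<le> 4 * (h * R\<^sup>2) * (h * R\<^sup>2) / 1"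
    proof (rule frac_le)
      show "4 * \<bar>a\<bar> * (h * r\<^sup>2) \<le> 4 * (h * R\<^sup>2) * (h * R\<^sup>2)"
        by (rule mult_mono[OF mult_left_mono[OF a] hr(2)]) (use hr h in auto)
      show "0 \<le> 4 * (h * R\<^sup>2) * (h * R\<^sup>2)" using h by simp
      show "1 \<le> 1 + 2 * h * r\<^sup>2" using hr by simp
    qed simp
    finally show ?thesis .
  qed
  moreover have "\<bar>a\<^sup>2\<bar> \<le> (h * R\<^sup>2)\<^sup>2" using a by (metis abs_ge_zero power2_abs power_abs power_mono)
  ultimately have "\<bar>y - (1 + a)\<^sup>2\<bar> \<le> 5 * (h * R\<^sup>2)\<^sup>2"
  proof -
    have "4 * (h * R\<^sup>2) * (h * R\<^sup>2) / 1 = 4 * (h * R\<^sup>2)\<^sup>2" by (simp only: power2_eq_square mult.assoc div_by_1)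
    moreover assume "\<bar>4 * a * (h * r\<^sup>2) / (1 + 2 * h * r\<^sup>2)\<bar> \<le> 4 * (h * R\<^sup>2) * (h * R\<^sup>2) / 1"
      "\<bar>a\<^sup>2\<bar> \<le> (h * R\<^sup>2)\<^sup>2"
    moreover have "\<bar>x\<bar> \<le> 4 * z \<Longrightarrow> \<bar>y\<bar> \<le> z \<Longrightarrow> \<bar>- x - y\<bar> \<le> 5 * z" for x y z :: real by linarith
    ultimately show ?thesis unfolding e by (simp only:)
  qed
  moreover have "y - (1 + a)\<^sup>2 = (sqrt y - (1 + a)) * (sqrt y + (1 + a))"
    using y by (simp add: power2_eq_square algebra_simps)
  ultimately have 1: "\<bar>sqrt y - (1 + a)\<bar> * \<bar>sqrt y + (1 + a)\<bar> \<le> 5 * (h * R\<^sup>2)\<^sup>2" by (simp add: abs_mult)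
  \<comment> \<open>As h R^2 is at most 1/2, so is the modulus of \<open>a\<close>. Dividing the
    bound 5 (h R^2)^2 by 1/2 produces the constant 10.\<close>
  have "1 / 2 \<le> \<bar>sqrt y + (1 + a)\<bar>"
    using a h(2) real_sqrt_ge_zero[OF y] by linarith
  then have "\<bar>sqrt y - (1 + a)\<bar> * (1 / 2) \<le> \<bar>sqrt y - (1 + a)\<bar> * \<bar>sqrt y + (1 + a)\<bar>"
    by (rule mult_left_mono) simp
  from order_trans[OF this 1] have 2: "\<bar>sqrt y - (1 + a)\<bar> \<le> 10 * (h * R\<^sup>2)\<^sup>2" by simp
  have "phi h r - r - h * (r - r ^ 3) = r * (sqrt y - (1 + a))"
    by (simp add: phi a_def algebra_simps power2_eq_square power3_eq_cube)
  then have "\<bar>phi h r - r - h * (r - r ^ 3)\<bar> = \<bar>r\<bar> * \<bar>sqrt y - (1 + a)\<bar>" by (simp add: abs_mult)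
  also have "\<dots> \<le> R * (10 * (h * R\<^sup>2)\<^sup>2)" using 2 R by (intro mult_mono) auto
  also have "\<dots> = 10 * R ^ 5 * h\<^sup>2" by (simp add: power_mult_distrib power_numeral_reduce)
  finally show ?thesis .
qed

section \<open>Convergence of the scheme to the mild solution\<close>

definition bounded_by :: "real \<Rightarrow> hspace \<Rightarrow> bool" where
  "bounded_by R x \<longleftrightarrow> (AE \<xi> in circle. \<bar>fun_of x \<xi>\<bar> \<le> R)"

lemma square_integrable_AE_bounded:
  assumes [measurable]: "f \<in> borel_measurable circle" and "AE \<xi> in circle. \<bar>f \<xi>\<bar> \<le> B"
  shows "square_integrable f"
proof -
  interpret prob_space circle by (rule prob_space_circle)
  have "integrable circle (\<lambda>\<xi>. (f \<xi>)\<^sup>2)"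
  proof (rule integrable_const_bound)
    show "AE \<xi> in circle. norm ((f \<xi>)\<^sup>2) \<le> B\<^sup>2"
      using assms(2)
    proof eventually_elim
      case (elim \<xi>)
      then have "\<bar>f \<xi>\<bar> \<le> \<bar>B\<bar>" by simp
      then show ?case by (simp add: abs_le_square_iff)
    qed
  qed simp
  then show ?thesis by (simp add: square_integrable_def)
qed

lemma norm_hproj_le_const:
  assumes "square_integrable f" "AE \<xi> in circle. \<bar>f \<xi>\<bar> \<le> B" "B \<ge> 0"
  shows "norm (hproj f) \<le> B"
proof (rule power2_le_imp_le)
  interpret prob_space circle by (rule prob_space_circle)
  have "(norm (hproj f))\<^sup>2 \<le> (LINT \<xi>|circle. (f \<xi>)\<^sup>2)" by (rule norm_hproj_le[OF assms(1)])
  also have "\<dots> \<le> (LINT \<xi>|circle. B\<^sup>2)"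
  proof (rule integral_mono_AE)
    show "AE \<xi> in circle. (f \<xi>)\<^sup>2 \<le> B\<^sup>2"
      using assms(2) by eventually_elim (use assms(3) in \<open>simp add: abs_le_square_iff[symmetric]\<close>)
  qed (use assms(1) in \<open>auto simp: square_integrable_def\<close>)
  finally show "(norm (hproj f))\<^sup>2 \<le> B\<^sup>2" by (simp add: prob_space)
qed fact

lemma abs_cubic_le: "\<bar>r\<bar> \<le> R \<Longrightarrow> \<bar>- (r - r ^ 3)\<bar> \<le> R + R ^ 3" for r R :: real
proof -
  assume r: "\<bar>r\<bar> \<le> R"
  then have "\<bar>r ^ 3\<bar> \<le> R ^ 3" unfolding power_abs by (intro power_mono) auto
  with r show ?thesis by linarith
qed

lemma square_integrable_nonlin:
  assumes "bounded_by R u"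
  shows "square_integrable (\<lambda>\<xi>. - (fun_of u \<xi> - (fun_of u \<xi>) ^ 3))"
proof (rule square_integrable_AE_bounded)
  show "AE \<xi> in circle. \<bar>- (fun_of u \<xi> - (fun_of u \<xi>) ^ 3)\<bar> \<le> R + R ^ 3"
    using assms unfolding bounded_by_def
  proof eventually_elim
    case (elim \<xi>)
    then show ?case by (rule abs_cubic_le)
  qed
qed simp

text \<open>The cubic has difference quotient a^2 + a b + b^2 - 1, bounded on [-R, R]. Along a
  bounded path the nonlinearity thus inherits right continuity in H.\<close>

lemma nonlin_lipschitz:
  assumes u: "bounded_by R u" and v: "bounded_by R v"
  shows "norm (nonlin u - nonlin v) \<le> (3 * R\<^sup>2 + 1) * norm (u - v)"
proof (rule power2_le_imp_le)
  let ?N = "\<lambda>u \<xi>. - (fun_of u \<xi> - (fun_of u \<xi>) ^ 3)"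
  have s: "square_integrable (?N u)" "square_integrable (?N v)"
    by (rule square_integrable_nonlin[OF u], rule square_integrable_nonlin[OF v])
  have "(norm (nonlin u - nonlin v))\<^sup>2 \<le> (LINT \<xi>|circle. (?N u \<xi> - ?N v \<xi>)\<^sup>2)"
    using norm_hproj_le[OF square_integrable_diff[OF s]] by (simp only: nonlin_def hproj_diff[OF s])
  also have "\<dots> \<le> (LINT \<xi>|circle. (3 * R\<^sup>2 + 1)\<^sup>2 * (fun_of u \<xi> - fun_of v \<xi>)\<^sup>2)"
  proof (rule integral_mono_AE)
    show "integrable circle (\<lambda>\<xi>. (?N u \<xi> - ?N v \<xi>)\<^sup>2)"
      using square_integrable_diff[OF s] by (simp only: square_integrable_def)
    show "integrable circle (\<lambda>\<xi>. (3 * R\<^sup>2 + 1)\<^sup>2 * (fun_of u \<xi> - fun_of v \<xi>)\<^sup>2)"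
      using square_integrable_diff[OF square_integrable_fun_of[of u] square_integrable_fun_of[of v]]
      by (simp add: square_integrable_def)
    show "AE \<xi> in circle. (?N u \<xi> - ?N v \<xi>)\<^sup>2 \<le> (3 * R\<^sup>2 + 1)\<^sup>2 * (fun_of u \<xi> - fun_of v \<xi>)\<^sup>2"
      using u v unfolding bounded_by_def
    proof eventually_elim
      case (elim \<xi>)
      define a where "a = fun_of u \<xi>"
      define b where "b = fun_of v \<xi>"
      have ab: "\<bar>a\<bar> \<le> R" "\<bar>b\<bar> \<le> R" using elim by (auto simp: a_def b_def)
      then have sq: "a\<^sup>2 \<le> R\<^sup>2" "b\<^sup>2 \<le> R\<^sup>2" "\<bar>a * b\<bar> \<le> R\<^sup>2"
        using power_mono[of "\<bar>a\<bar>" R 2] power_mono[of "\<bar>b\<bar>" R 2] mult_mono[of "\<bar>a\<bar>" R "\<bar>b\<bar>" R]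
        by (auto simp: abs_mult power2_eq_square)
      have "- (a - a ^ 3) - - (b - b ^ 3) = (a\<^sup>2 + a * b + b\<^sup>2 - 1) * (a - b)"
        by (simp add: algebra_simps power2_eq_square power3_eq_cube)
      moreover have "\<bar>a\<^sup>2 + a * b + b\<^sup>2 - 1\<bar> \<le> 3 * R\<^sup>2 + 1"
        using sq zero_le_power2[of a] zero_le_power2[of b] by linarith
      then have "(a\<^sup>2 + a * b + b\<^sup>2 - 1)\<^sup>2 \<le> (3 * R\<^sup>2 + 1)\<^sup>2"
        by (simp add: abs_le_square_iff[symmetric])
      then have "(a\<^sup>2 + a * b + b\<^sup>2 - 1)\<^sup>2 * (a - b)\<^sup>2 \<le> (3 * R\<^sup>2 + 1)\<^sup>2 * (a - b)\<^sup>2"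
        by (rule mult_right_mono) simp
      ultimately show ?case by (simp only: a_def b_def power_mult_distrib)
    qed
  qed
  also have "\<dots> = ((3 * R\<^sup>2 + 1) * norm (u - v))\<^sup>2"
    by (simp add: norm_diff_hspace_sq power_mult_distrib)
  finally show "(norm (nonlin u - nonlin v))\<^sup>2 \<le> ((3 * R\<^sup>2 + 1) * norm (u - v))\<^sup>2" .
qed simp

lemma norm_nonlin_le:
  assumes "bounded_by R u" "R \<ge> 0"
  shows "norm (nonlin u) \<le> R + R ^ 3"
  unfolding nonlin_def
proof (rule norm_hproj_le_const[OF square_integrable_nonlin[OF assms(1)]])
  show "AE \<xi> in circle. \<bar>- (fun_of u \<xi> - (fun_of u \<xi>) ^ 3)\<bar> \<le> R + R ^ 3"
    using assms(1) unfolding bounded_by_def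
  proof eventually_elim
    case (elim \<xi>)
    then show ?case by (rule abs_cubic_le)
  qed
qed (use assms in simp)

lemma reaction_consistency:
  assumes u: "bounded_by R u" and R: "R \<ge> 1" and h: "0 \<le> h" "h * R\<^sup>2 \<le> 1 / 2"
  shows "norm (reaction h u - u + h *\<^sub>R nonlin u) \<le> 10 * R ^ 5 * h\<^sup>2"
proof -
  let ?N = "\<lambda>\<xi>. - (fun_of u \<xi> - (fun_of u \<xi>) ^ 3)"
  have s: "square_integrable (\<lambda>\<xi>. phi h (fun_of u \<xi>))" "square_integrable ?N" "square_integrable (fun_of u)"
    by (intro square_integrable_phi square_integrable_nonlin[OF u] square_integrable_fun_of h)+
  have eq: "reaction h u - u + h *\<^sub>R nonlin u = hproj (\<lambda>\<xi>. phi h (fun_of u \<xi>) - fun_of u \<xi> + h * ?N \<xi>)"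
  proof -
    have "hproj (\<lambda>\<xi>. phi h (fun_of u \<xi>) - fun_of u \<xi> + h * ?N \<xi>) =
      hproj (\<lambda>\<xi>. phi h (fun_of u \<xi>) - fun_of u \<xi>) + hproj (\<lambda>\<xi>. h * ?N \<xi>)"
      by (intro hproj_add square_integrable_diff square_integrable_cmult s)
    then show ?thesis
      by (simp only: hproj_cmult[OF s(2)] hproj_diff[OF s(1,3), symmetric] reaction_def nonlin_def hproj_fun_of)
  qed
  show ?thesis
    unfolding eq
  proof (rule norm_hproj_le_const)
    show "square_integrable (\<lambda>\<xi>. phi h (fun_of u \<xi>) - fun_of u \<xi> + h * ?N \<xi>)"
      by (intro square_integrable_add square_integrable_diff square_integrable_cmult s)
    show "AE \<xi> in circle. \<bar>phi h (fun_of u \<xi>) - fun_of u \<xi> + h * ?N \<xi>\<bar> \<le> 10 * R ^ 5 * h\<^sup>2"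
      using u unfolding bounded_by_def
    proof eventually_elim
      case (elim \<xi>)
      then show ?case using phi_consistency[OF R(1) elim h] by (simp add: algebra_simps)
    qed
  qed (use R in simp)
qed

lemma right_continuous_measurable:
  fixes f :: "real \<Rightarrow> 'b::metric_space"
  assumes "\<And>s. (f \<longlongrightarrow> f s) (at_right s)"
  shows "f \<in> borel_measurable borel"
proof (rule borel_measurable_LIMSEQ_metric)
  \<comment> \<open>Rounding to the floor plus one, not to the ceiling, lands strictly to the right
    of \<open>s\<close> even if \<open>s\<close> is a grid point, as the filter
    \<open>at_right s\<close> demands.\<close>
  define d where "d n s = (of_int \<lfloor>s * real (Suc n)\<rfloor> + 1) / real (Suc n)" for n s
  show "(\<lambda>s. f (d n s)) \<in> borel_measurable borel" for n
  proof -
    have "(\<lambda>k::int. f ((of_int k + 1) / real (Suc n))) \<in> measurable (count_space UNIV) borel" by simp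
    moreover have "(\<lambda>s. \<lfloor>s * real (Suc n)\<rfloor>) \<in> measurable borel (count_space UNIV)" by measurable
    ultimately show ?thesis
      unfolding d_def by (rule measurable_compose[rotated])
  qed
  fix s :: real
  have d: "s < d n s" "d n s \<le> s + 1 / real (Suc n)" for n
  proof -
    have "s * real (Suc n) < of_int \<lfloor>s * real (Suc n)\<rfloor> + 1" by linarith
    then show "s < d n s" by (simp only: d_def pos_less_divide_eq of_nat_0_less_iff zero_less_Suc)
    have "of_int \<lfloor>s * real (Suc n)\<rfloor> + 1 \<le> s * real (Suc n) + 1" by linarith
    then have "d n s \<le> (s * real (Suc n) + 1) / real (Suc n)"
      unfolding d_def by (intro divide_right_mono) auto
    then show "d n s \<le> s + 1 / real (Suc n)" by (simp add: add_divide_distrib del: of_nat_Suc)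
  qed
  have "(\<lambda>n. s + 1 / real (Suc n)) \<longlonglongrightarrow> s + 0"
    by (intro tendsto_intros LIMSEQ_Suc lim_1_over_n)
  then have "(\<lambda>n. d n s) \<longlonglongrightarrow> s"
    by (intro tendsto_sandwich[of "\<lambda>_. s" "\<lambda>n. d n s" _ "\<lambda>n. s + 1 / real (Suc n)"] always_eventually allI)
      (use d in \<open>auto intro: less_imp_le\<close>)
  then have "filterlim (\<lambda>n. d n s) (at_right s) sequentially"
    by (intro tendsto_imp_filterlim_at_right) (use d in auto)
  then show "(\<lambda>n. f (d n s)) \<longlonglongrightarrow> f s"
    by (rule filterlim_compose[OF assms])
qed

text \<open>Dominated convergence replaces uniform continuity, which a path with jumps does not
  have. Only displacements to the right are allowed, since the function is continuous from that
  side.\<close>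

lemma right_continuous_shift_L1:
  fixes f :: "real \<Rightarrow> 'b::{banach, second_countable_topology}"
  assumes rc: "\<And>s. (f \<longlongrightarrow> f s) (at_right s)"
    and B: "\<And>s. norm (f s) \<le> B" and supp: "\<And>s. s < a \<or> b < s \<Longrightarrow> f s = 0"
    and [measurable]: "\<And>n. d n \<in> borel_measurable borel"
    and d: "\<And>n s. s \<le> d n s" "\<And>n s. d n s \<le> s + c n" and c: "c \<longlonglongrightarrow> 0" "\<And>n. c n \<le> C"
  shows "(\<lambda>n. LINT s|lborel. norm (f (d n s) - f s)) \<longlonglongrightarrow> 0"
    and "integrable lborel (\<lambda>s. norm (f (d n s) - f s))"
proof -
  have [measurable]: "f \<in> borel_measurable borel" by (rule right_continuous_measurable[OF rc])
  define w where "w s = 2 * B * indicator {a - C..b} s" for s :: real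
  have iw: "integrable lborel w" unfolding w_def by (intro integrable_mult_right integrable_real_indicator) (auto simp: emeasure_lborel_Icc_eq)
  have le: "norm (norm (f (d n s) - f s)) \<le> w s" for n s
  proof (cases "s \<in> {a - C..b}")
    case True
    then show ?thesis using norm_triangle_ineq4[of "f (d n s)" "f s"] B[of s] B[of "d n s"] by (simp add: w_def)
  next
    case False
    then have "s < a \<or> b < s" "d n s < a \<or> b < d n s"
      using d(1)[where n = n and s = s] d(2)[where n = n and s = s] c(2)[of n] c(2)[of 0] order_trans[OF d(1) d(2), of s 0]
        order_trans[OF d(1) d(2), of s n]
      by auto
    then have "f s = 0" "f (d n s) = 0" by (auto intro: supp)
    moreover have "0 \<le> B" using B[of s] norm_ge_zero order_trans by blast
    ultimately show ?thesis by (simp add: w_def)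
  qed
  show "integrable lborel (\<lambda>s. norm (f (d n s) - f s))"
  proof (rule Bochner_Integration.integrable_bound[OF iw])
    show "(\<lambda>s. norm (f (d n s) - f s)) \<in> borel_measurable lborel" by measurable
    show "AE s in lborel. norm (norm (f (d n s) - f s)) \<le> norm (w s)"
      using le[where n = n] by (intro AE_I2) (metis abs_ge_self order_trans real_norm_def)
  qed
  have "(\<lambda>n. LINT s|lborel. norm (f (d n s) - f s)) \<longlonglongrightarrow> (LINT s|(lborel :: real measure). (0::real))"
  proof (rule integral_dominated_convergence[of "\<lambda>_. 0" lborel "\<lambda>n s. norm (f (d n s) - f s)" w])
    show "integrable lborel w" by (rule iw)
    show "AE s in lborel. (\<lambda>n. norm (f (d n s) - f s)) \<longlonglongrightarrow> 0"
    proof (rule AE_I2)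
      fix s
      have "(\<lambda>n. s + c n) \<longlonglongrightarrow> s + 0" by (intro tendsto_intros c)
      then have ds: "(\<lambda>n. d n s) \<longlonglongrightarrow> s"
        by (intro tendsto_sandwich[of "\<lambda>_. s" "\<lambda>n. d n s" _ "\<lambda>n. s + c n"]) (use d in auto)
      have "continuous (at s within {s..}) f"
        using rc[of s] by (simp add: continuous_within at_within_Ici_at_right)
      then have "(\<lambda>n. f (d n s)) \<longlonglongrightarrow> f s"
        using ds d(1) by (intro continuous_within_tendsto_compose'[of s "{s..}" f]) auto
      then show "(\<lambda>n. norm (f (d n s) - f s)) \<longlonglongrightarrow> 0"
        by (simp add: LIM_zero_iff tendsto_norm_zero_iff)
    qed
    show "AE s in lborel. norm (norm (f (d n s) - f s)) \<le> w s" for n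
      using le by auto
  qed measurable
  then show "(\<lambda>n. LINT s|lborel. norm (f (d n s) - f s)) \<longlonglongrightarrow> 0" by simp
qed

text \<open>One-sided limits in V bound the V-norm near every point, the interval principle
  \<open>Bolzano\<close> joins the local bounds, and the Sobolev embedding turns the result into a
  sup bound.\<close>

lemma cadlag_V_bounded:
  assumes c: "cadlag_V f" and ab: "0 < a" "a \<le> b"
  shows "\<exists>R\<ge>1. \<forall>s\<in>{a..b}. bounded_by R (f s)"
proof -
  have V: "f s \<in> V_space" if "s > 0" for s using c that by (auto simp: cadlag_V_def)
  have "0 < a \<longrightarrow> (\<exists>K. \<forall>s\<in>{a..b}. (V_norm (f s))\<^sup>2 \<le> K)"
  proof (rule Bolzano[OF ab(2), where P = "\<lambda>a b. 0 < a \<longrightarrow> (\<exists>K. \<forall>s\<in>{a..b}. (V_norm (f s))\<^sup>2 \<le> K)"])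
    fix p q r :: real
    assume "0 < p \<longrightarrow> (\<exists>K. \<forall>s\<in>{p..q}. (V_norm (f s))\<^sup>2 \<le> K)" "0 < q \<longrightarrow> (\<exists>K. \<forall>s\<in>{q..r}. (V_norm (f s))\<^sup>2 \<le> K)" "p \<le> q" "q \<le> r"
    then show "0 < p \<longrightarrow> (\<exists>K. \<forall>s\<in>{p..r}. (V_norm (f s))\<^sup>2 \<le> K)"
    proof (intro impI)
      assume p: "0 < p"
      then obtain K L where K: "\<forall>s\<in>{p..q}. (V_norm (f s))\<^sup>2 \<le> K" and L: "\<forall>s\<in>{q..r}. (V_norm (f s))\<^sup>2 \<le> L"
        using \<open>0 < p \<longrightarrow> _\<close> \<open>0 < q \<longrightarrow> _\<close> \<open>p \<le> q\<close> by auto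
      have "(V_norm (f s))\<^sup>2 \<le> max K L" if "s \<in> {p..r}" for s
        using that K L by (cases "s \<le> q") (auto intro: max.coboundedI1 max.coboundedI2)
      then show "\<exists>K. \<forall>s\<in>{p..r}. (V_norm (f s))\<^sup>2 \<le> K" by blast
    qed
  next
    fix x assume x: "a \<le> x" "x \<le> b"
    then have x0: "x > 0" using ab by simp
    obtain y where y: "y \<in> V_space" "((\<lambda>s. V_norm (f s - y)) \<longlongrightarrow> 0) (at_left x)"
      and r: "((\<lambda>s. V_norm (f s - f x)) \<longlongrightarrow> 0) (at_right x)"
      using c x0 by (auto simp: cadlag_V_def)
    from order_tendstoD(2)[OF y(2), of 1] obtain l where l: "l < x" "\<And>s. l < s \<Longrightarrow> s < x \<Longrightarrow> V_norm (f s - y) < 1"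
      unfolding eventually_at_left_field by auto
    from order_tendstoD(2)[OF r, of 1] obtain u where u: "u > x" "\<And>s. x < s \<Longrightarrow> s < u \<Longrightarrow> V_norm (f s - f x) < 1"
      unfolding eventually_at_right_field by auto
    \<comment> \<open>Near \<open>x\<close> the path is within distance 1 in V of the left limit
      \<open>y\<close> or of the value \<open>f x\<close>; \<open>V_norm_le_diff\<close> doubles
      both contributions.\<close>
    define K where "K = 2 + 2 * (V_norm y)\<^sup>2 + 2 * (V_norm (f x))\<^sup>2"
    have K: "(V_norm (f s))\<^sup>2 \<le> K" if "l < s" "s < u" "0 < s" for s
    proof -
      have sq1: "(V_norm z)\<^sup>2 \<le> 1" if "V_norm z < 1" for z
        using that V_norm_nonneg[of z] by (simp add: power_le_one)
      consider "s < x" | "s = x" | "s > x" by linarith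
      then show ?thesis
      proof cases
        case 1
        then show ?thesis
          using V_norm_le_diff[OF V[OF that(3)] y(1)] sq1[OF l(2)[of s]] that zero_le_power2[of "V_norm (f x)"]
          unfolding K_def by linarith
      next
        case 2
        then show ?thesis
          using zero_le_power2[of "V_norm (f x)"] zero_le_power2[of "V_norm y"] unfolding K_def by simp
      next
        case 3
        then show ?thesis
          using V_norm_le_diff[OF V[OF that(3)] V[OF x0]] sq1[OF u(2)[of s]] that zero_le_power2[of "V_norm y"]
          unfolding K_def by linarith
      qed
    qed
    show "\<exists>d>0. \<forall>a b. a \<le> x \<and> x \<le> b \<and> b - a < d \<longrightarrow> 0 < a \<longrightarrow> (\<exists>K. \<forall>s\<in>{a..b}. (V_norm (f s))\<^sup>2 \<le> K)"
    proof (rule exI[of _ "min (x - l) (u - x)"], intro conjI allI impI)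
      show "min (x - l) (u - x) > 0" using l u by simp
      fix a b assume "a \<le> x \<and> x \<le> b \<and> b - a < min (x - l) (u - x)" "0 < a"
      then show "\<exists>K. \<forall>s\<in>{a..b}. (V_norm (f s))\<^sup>2 \<le> K"
        by (intro exI[of _ K] ballI K) auto
    qed
  qed
  then obtain K where K: "\<forall>s\<in>{a..b}. (V_norm (f s))\<^sup>2 \<le> K" using ab by blast
  obtain C where C: "C \<ge> 0" "\<forall>x\<in>V_space. AE \<xi> in circle. \<bar>fun_of x \<xi>\<bar> \<le> C * V_norm x"
    using V_space_bounded by blast
  have "bounded_by (max 1 (C * sqrt K)) (f s)" if s: "s \<in> {a..b}" for s
  proof -
    have "V_norm (f s) \<le> sqrt K" using K s by (intro real_le_rsqrt) auto
    then have "C * V_norm (f s) \<le> C * sqrt K" by (rule mult_left_mono) (rule C(1))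
    moreover have "AE \<xi> in circle. \<bar>fun_of (f s) \<xi>\<bar> \<le> C * V_norm (f s)"
      using C(2) V[of s] s ab by auto
    ultimately show ?thesis
      unfolding bounded_by_def by (auto elim!: eventually_mono)
  qed
  then show ?thesis by (intro exI[of _ "max 1 (C * sqrt K)"]) auto
qed

lemma norm_heat_diff_le:
  assumes "0 \<le> \<tau>" "\<tau> \<le> h"
  shows "norm (heat h a - heat \<tau> b) \<le> norm (a - b) + norm (heat h b - b)"
proof -
  have "heat h a - heat \<tau> b = heat h (a - b) + heat \<tau> (heat (h - \<tau>) b - b)"
    using assms by (simp add: heat_diff heat_heat)
  also have "norm \<dots> \<le> norm (heat h (a - b)) + norm (heat \<tau> (heat (h - \<tau>) b - b))"
    by (rule norm_triangle_ineq)
  also have "\<dots> \<le> norm (a - b) + norm (heat (h - \<tau>) b - b)"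
    using assms by (intro add_mono norm_heat_le) auto
  also have "norm (heat (h - \<tau>) b - b) \<le> norm (heat h b - b)"
    using assms by (intro norm_heat_diff_mono) auto
  finally show ?thesis by simp
qed

text \<open>The reaction step differs from an explicit Euler step by O(h^2). What remains is the
  error of freezing the integrand at the left endpoint, and \<open>q\<close> bounds it by the change
  of the nonlinearity and by the defect of strong continuity.\<close>

lemma eul_local_error:
  fixes g :: "real \<Rightarrow> hspace"
  assumes h: "0 < h" "h * R\<^sup>2 \<le> 1 / 2" and R: "R \<ge> 1" "bounded_by R u"
    and g: "g r = nonlin u" and eq: "AE s in lborel. s \<in> {r..<r + h} \<longrightarrow> f s = heat (r + h - s) (g s)"
    and int: "set_integrable lborel {r..r + h} f"
    and iq: "integrable lborel q"
    and q: "\<And>s. s \<in> {r..<r + h} \<Longrightarrow> q s = norm (g r - g s) + norm (heat h (g s) - g s)"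
  shows "norm (heat h u - (LINT s:{r..r + h}|lborel. f s) - heat h (reaction h u))
    \<le> 10 * R ^ 5 * h\<^sup>2 + (LINT s|lborel. indicator {r..<r + h} s * q s)"
proof -
  define c where "c = (\<lambda>s. indicator {r..<r + h} s *\<^sub>R heat h (g r))"
  define k where "k = (\<lambda>s. indicator {r..r + h} s *\<^sub>R f s)"
  have ic: "integrable lborel c" using h by (simp add: c_def)
  have ik: "integrable lborel k" using int by (simp add: set_integrable_def k_def)
  have Ic: "(LINT s|lborel. c s) = h *\<^sub>R heat h (g r)"
    using h by (simp add: c_def)
  have "heat h u - (LINT s:{r..r + h}|lborel. f s) - heat h (reaction h u)
      = - heat h (reaction h u - u + h *\<^sub>R nonlin u) + (LINT s|lborel. c s - k s)"
    using ic ik Ic h g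
    by (simp add: heat_add heat_diff heat_scaleR set_lebesgue_integral_def k_def)
  also have "norm \<dots> \<le> norm (heat h (reaction h u - u + h *\<^sub>R nonlin u)) + norm (LINT s|lborel. c s - k s)"
    by (rule order_trans[OF norm_triangle_ineq]) simp
  also have "norm (heat h (reaction h u - u + h *\<^sub>R nonlin u)) \<le> 10 * R ^ 5 * h\<^sup>2"
    using norm_heat_le[of h] reaction_consistency[OF R(2,1) _ h(2)] h order_trans by (meson less_imp_le)
  also have "norm (LINT s|lborel. c s - k s) \<le> (LINT s|lborel. norm (c s - k s))"
    by (rule integral_norm_bound)
  also have "\<dots> \<le> (LINT s|lborel. indicator {r..<r + h} s * q s)"
  proof (rule integral_mono_AE)
    show "integrable lborel (\<lambda>s. norm (c s - k s))" using ic ik by simp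
    show "integrable lborel (\<lambda>s. indicator {r..<r + h} s * q s)"
      using integrable_mult_indicator[of "{r..<r + h}" lborel q] iq by simp
    have "AE s in lborel. s \<noteq> r + h" by (rule AE_lborel_singleton)
    with eq show "AE s in lborel. norm (c s - k s) \<le> indicator {r..<r + h} s * q s"
    proof eventually_elim
      case (elim s)
      show ?case
      proof (cases "s \<in> {r..<r + h}")
        case True
        then have "c s - k s = heat h (g r) - heat (r + h - s) (g s)"
          using elim by (simp add: c_def k_def)
        then show ?thesis
          using norm_heat_diff_le[of "r + h - s" h "g r" "g s"] True q[OF True] by simp
      qed (use elim in \<open>auto simp: c_def k_def split: split_indicator\<close>)
    qed
  qed
  finally show ?thesis by simp
qed

text \<open>Since a step is nonexpansive, global error is at most the sum of the local ones, without
  a Gronwall factor. The n + 1 consistency errors of order h^2 add up to O(h), and the freezing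
  errors add up to an integral over the whole interval, which tends to 0.\<close>

lemma eul_converges:
  fixes U :: "real \<Rightarrow> hspace"
  assumes t: "t > 0" and R: "R \<ge> 1" "\<And>s. s \<in> {r..r + t} \<Longrightarrow> bounded_by R (U s)"
    and rc: "\<And>s. s \<in> {r..<r + t} \<Longrightarrow> (U \<longlongrightarrow> U s) (at_right s)"
    and int: "\<And>n i. i < Suc n \<Longrightarrow> set_integrable lborel {r + i * (t / Suc n)..r + Suc i * (t / Suc n)}
       (\<lambda>s. heat (r + Suc i * (t / Suc n) - s) (nonlin (U s)))"
    and flow: "\<And>n i. i < Suc n \<Longrightarrow> U (r + Suc i * (t / Suc n)) = heat (t / Suc n) (U (r + i * (t / Suc n))) -
       (LINT s:{r + i * (t / Suc n)..r + Suc i * (t / Suc n)}|lborel. heat (r + Suc i * (t / Suc n) - s) (nonlin (U s))) + w n i"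
  shows "(\<lambda>n. eul (t / Suc n) (Suc n) (U r) (w n)) \<longlonglongrightarrow> U (r + t)"
proof -
  \<comment> \<open>Extension by 0 beyond a half-open interval keeps the function right continuous
    on the whole line, also at r + t, where it jumps to 0.\<close>
  define g where "g s = (if s \<in> {r..<r + t} then nonlin (U s) else 0)" for s
  have g_rc: "(g \<longlongrightarrow> g s) (at_right s)" for s
  proof -
    consider "s < r" | "s \<in> {r..<r + t}" | "s \<ge> r + t" by force
    then show ?thesis
    proof cases
      case 1
      then have "\<forall>\<^sub>F u in at_right s. u < r" by (intro eventually_at_right_field[THEN iffD2] exI[of _ r]) auto
      then have "\<forall>\<^sub>F u in at_right s. g u = g s" by eventually_elim (use 1 in \<open>auto simp: g_def\<close>)
      then show ?thesis by (rule tendsto_eventually)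
    next
      case 2
      have "\<forall>\<^sub>F u in at_right s. s < u \<and> u < r + t"
        using 2 by (intro eventually_at_right_field[THEN iffD2] exI[of _ "r + t"]) auto
      then have le: "\<forall>\<^sub>F u in at_right s. norm (g u - g s) \<le> (3 * R\<^sup>2 + 1) * norm (U u - U s)"
        by eventually_elim (use 2 in \<open>auto simp: g_def intro!: nonlin_lipschitz R\<close>)
      have "((\<lambda>u. (3 * R\<^sup>2 + 1) * norm (U u - U s)) \<longlongrightarrow> (3 * R\<^sup>2 + 1) * norm (U s - U s)) (at_right s)"
        by (intro tendsto_intros rc 2)
      then have "((\<lambda>u. (3 * R\<^sup>2 + 1) * norm (U u - U s)) \<longlongrightarrow> 0) (at_right s)" by simp
      from Lim_null_comparison[OF le this] show ?thesis by (simp add: LIM_zero_iff)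
    next
      case 3
      have "\<forall>\<^sub>F u in at_right s. s < u" by (rule eventually_at_right_less)
      then have "\<forall>\<^sub>F u in at_right s. g u = g s" by eventually_elim (use 3 in \<open>auto simp: g_def\<close>)
      then show ?thesis by (rule tendsto_eventually)
    qed
  qed
  have [measurable]: "g \<in> borel_measurable borel" by (rule right_continuous_measurable[OF g_rc])
  define B where "B = R + R ^ 3"
  have gB: "norm (g s) \<le> B" for s
    using norm_nonlin_le[OF R(2)[of s]] R(1) by (auto simp: g_def B_def)
  have supp: "g s = 0" if "s < r \<or> r + t < s" for s using that by (auto simp: g_def)
  define h where "h n = t / real (Suc n)" for n
  have h: "h n > 0" "h n \<le> t" for n using t by (auto simp: h_def field_simps)
  have hn: "real (Suc n) * h n = t" for n by (simp add: h_def)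
  have "(\<lambda>n. t * (1 / real (Suc n))) \<longlonglongrightarrow> t * 0" by (intro tendsto_intros LIMSEQ_Suc lim_1_over_n)
  then have h0: "h \<longlonglongrightarrow> 0" by (simp add: h_def[abs_def])
  \<comment> \<open>The left grid point lies to the wrong side for right continuity. After
    translation by h it lies in [s, s + h], so the error is split into a displacement to the grid
    (\<open>A1\<close>) and a pure translation (\<open>A2\<close>), and translation invariance of
    the integral undoes the shift.\<close>
  define fl where "fl n s = r + h n * of_int \<lfloor>(s - r) / h n\<rfloor>" for n s
  have [measurable]: "fl n \<in> borel_measurable borel" for n unfolding fl_def by measurable
  have fl_shift: "fl n (s + h n) = fl n s + h n" for n s
  proof -
    have "(s + h n - r) / h n = (s - r) / h n + of_int 1"
      using h(1)[of n] by (simp add: field_simps)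
    then have "\<lfloor>(s + h n - r) / h n\<rfloor> = \<lfloor>(s - r) / h n\<rfloor> + 1" by (simp only: floor_add_int)
    then show ?thesis by (simp add: fl_def algebra_simps)
  qed
  have fl: "fl n s \<le> s" "s \<le> fl n s + h n" for n s
  proof -
    have "of_int \<lfloor>(s - r) / h n\<rfloor> \<le> (s - r) / h n" "(s - r) / h n \<le> of_int \<lfloor>(s - r) / h n\<rfloor> + 1" by linarith+
    then have "of_int \<lfloor>(s - r) / h n\<rfloor> * h n \<le> s - r" "s - r \<le> (of_int \<lfloor>(s - r) / h n\<rfloor> + 1) * h n"
      by (simp_all only: pos_le_divide_eq[OF h(1)] pos_divide_le_eq[OF h(1)])
    then show "fl n s \<le> s" "s \<le> fl n s + h n"
      by (simp_all add: fl_def algebra_simps)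
  qed
  have fl_cell: "fl n s = r + real i * h n" if "s \<in> {r + real i * h n..<r + real (Suc i) * h n}" for n s i
  proof -
    have "\<lfloor>(s - r) / h n\<rfloor> = int i"
      using that h(1)[of n] by (intro floor_unique) (auto simp: field_simps)
    then show ?thesis by (simp add: fl_def)
  qed
  note sh1 = right_continuous_shift_L1[OF g_rc gB supp, where d = "\<lambda>n s. fl n (s + h n)" and c = h and C = t]
  note sh2 = right_continuous_shift_L1[OF g_rc gB supp, where d = "\<lambda>n s. s + h n" and c = h and C = t]
  define A1 where "A1 n = (LINT s|lborel. norm (g (fl n (s + h n)) - g s))" for n
  define A2 where "A2 n = (LINT s|lborel. norm (g (s + h n) - g s))" for n
  define A3 where "A3 n = (LINT s|lborel. norm (heat (h n) (g s) - g s))" for n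
  have A1: "A1 \<longlonglongrightarrow> 0" "integrable lborel (\<lambda>s. norm (g (fl n (s + h n)) - g s))" for n
    unfolding A1_def[abs_def] by (rule sh1; use fl fl_shift h h0 in auto)+
  have A2: "A2 \<longlonglongrightarrow> 0" "integrable lborel (\<lambda>s. norm (g (s + h n) - g s))" for n
    unfolding A2_def[abs_def]
    by (rule sh2(1), use h h0 less_imp_le[OF h(1)] in auto)
      (rule sh2(2), use h h0 less_imp_le[OF h(1)] in auto)
  have [measurable]: "heat (h n) \<in> borel_measurable borel" for n
    using h(1)[of n] by (intro borel_measurable_continuous_onI linear_continuous_on bounded_linear_heat) simp
  have w: "integrable lborel (\<lambda>s. 2 * B * indicator {r..r + t} s)"
    by (intro integrable_mult_right integrable_real_indicator) (auto simp: emeasure_lborel_Icc_eq)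
  have hB: "norm (norm (heat (h n) (g s) - g s)) \<le> 2 * B * indicator {r..r + t} s" for n s
  proof (cases "s \<in> {r..r + t}")
    case True
    then show ?thesis
      using norm_triangle_ineq4[of "heat (h n) (g s)" "g s"] norm_heat_le[of "h n" "g s"] gB[of s] h(1)[of n] by simp
  next
    case False
    then have "g s = 0" by (intro supp) auto
    moreover have "0 \<le> B" using gB[of s] norm_ge_zero order_trans by blast
    ultimately show ?thesis using heat_scaleR[of "h n" 0 0] h(1)[of n] by simp
  qed
  have A3i: "integrable lborel (\<lambda>s. norm (heat (h n) (g s) - g s))" for n
    by (rule Bochner_Integration.integrable_bound[OF w])
      (use hB[where n = n] in \<open>measurable, auto intro!: AE_I2 intro: order_trans[OF _ abs_ge_self]\<close>)
  have "A3 \<longlonglongrightarrow> (LINT s|(lborel :: real measure). (0::real))"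
    unfolding A3_def[abs_def]
  proof (rule integral_dominated_convergence[where w = "\<lambda>s. 2 * B * indicator {r..r + t} s"])
    show "integrable lborel (\<lambda>s. 2 * B * indicator {r..r + t} s)" by (rule w)
    have "filterlim h (at_right 0) sequentially"
      using h h0 by (intro tendsto_imp_filterlim_at_right) auto
    then have "(\<lambda>n. heat (h n) (g s)) \<longlonglongrightarrow> g s" for s
      by (rule filterlim_compose[OF tendsto_heat_0])
    then show "AE s in lborel. (\<lambda>n. norm (heat (h n) (g s) - g s)) \<longlonglongrightarrow> 0"
      by (simp add: LIM_zero_iff tendsto_norm_zero_iff)
  qed (use hB in \<open>measurable, auto\<close>)
  then have A3: "A3 \<longlonglongrightarrow> 0" by simp
  define q where "q n s = norm (g (fl n s) - g s) + norm (heat (h n) (g s) - g s)" for n s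
  have fl_int: "integrable lborel (\<lambda>s. norm (g (fl n s) - g s))" and fl_le: "(LINT s|lborel. norm (g (fl n s) - g s)) \<le> A1 n + A2 n" for n
  proof -
    have i1: "integrable lborel (\<lambda>s. norm (g (fl n s) - g (s - h n)))"
      using lborel_integrable_real_affine[OF A1(2)[of n], of 1 "- h n"] by (simp add: algebra_simps)
    have i2: "integrable lborel (\<lambda>s. norm (g s - g (s - h n)))"
      using lborel_integrable_real_affine[OF A2(2)[of n], of 1 "- h n"] by (simp add: algebra_simps)
    have e1: "(LINT s|lborel. norm (g (fl n s) - g (s - h n))) = A1 n"
      unfolding A1_def by (subst lborel_integral_real_affine[of 1 _ "h n"]) (simp_all add: algebra_simps)
    have e2: "(LINT s|lborel. norm (g s - g (s - h n))) = A2 n"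
      unfolding A2_def by (subst lborel_integral_real_affine[of 1 _ "h n"]) (simp_all add: algebra_simps)
    have tri: "norm (g (fl n s) - g s) \<le> norm (g (fl n s) - g (s - h n)) + norm (g s - g (s - h n))" for s
      using norm_triangle_ineq4[of "g (fl n s) - g (s - h n)" "g s - g (s - h n)"] by simp
    show i: "integrable lborel (\<lambda>s. norm (g (fl n s) - g s))"
      by (rule Bochner_Integration.integrable_bound[OF Bochner_Integration.integrable_add[OF i1 i2]]) (use tri in \<open>measurable, auto\<close>)
    have "(LINT s|lborel. norm (g (fl n s) - g s)) \<le> (LINT s|lborel. norm (g (fl n s) - g (s - h n)) + norm (g s - g (s - h n)))"
      by (intro integral_mono i Bochner_Integration.integrable_add i1 i2 tri)
    also have "\<dots> = A1 n + A2 n" using i1 i2 e1 e2 by simp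
    finally show "(LINT s|lborel. norm (g (fl n s) - g s)) \<le> A1 n + A2 n" .
  qed
  have qi: "integrable lborel (q n)" for n
    unfolding q_def[abs_def] by (intro Bochner_Integration.integrable_add fl_int A3i)
  have ql: "(LINT s|lborel. q n s) \<le> A1 n + A2 n + A3 n" for n
    unfolding q_def using fl_int[of n] A3i[of n] fl_le[of n] by (simp add: A3_def)
  define E where "E n = t * (10 * R ^ 5) * h n + (A1 n + A2 n + A3 n)" for n
  have "E \<longlonglongrightarrow> t * (10 * R ^ 5) * 0 + (0 + 0 + 0)"
    unfolding E_def[abs_def] by (intro tendsto_intros h0 A1 A2 A3)
  then have E: "E \<longlonglongrightarrow> 0" by simp
  have main: "norm (eul (h n) (Suc n) (U r) (w n) - U (r + t)) \<le> E n" if hR: "h n * R\<^sup>2 \<le> 1 / 2" for n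
  proof -
    define cell where "cell i = {r + real i * h n..<r + real (Suc i) * h n}" for i
    have cell_sub: "cell i \<subseteq> {r..<r + t}" if "i < Suc n" for i
    proof -
      have "real (Suc i) * h n \<le> real (Suc n) * h n" using that h(1)[of n] by (intro mult_right_mono) auto
      then show ?thesis using h(1)[of n] hn[of n] by (auto simp: cell_def)
    qed
    define I where "I i = (LINT s|lborel. indicator (cell i) s * q n s)" for i
    have local_err: "norm (heat (h n) (reaction (h n) (U (r + real i * h n))) + w n i - U (r + real (Suc i) * h n)) \<le> 10 * R ^ 5 * (h n)\<^sup>2 + I i"
      if i: "i < Suc n" for i
    proof -
      define u where "u = U (r + real i * h n)"
      let ?f = "\<lambda>s. heat (r + real (Suc i) * h n - s) (nonlin (U s))"
      have ri: "r + real i * h n \<in> cell i" using h(1)[of n] by (simp add: cell_def algebra_simps)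
      have Suc_eq: "r + real (Suc i) * h n = r + real i * h n + h n" by (simp add: algebra_simps)
      have "norm (heat (h n) u - (LINT s:{r + real i * h n..r + real i * h n + h n}|lborel. ?f s) - heat (h n) (reaction (h n) u))
        \<le> 10 * R ^ 5 * (h n)\<^sup>2 + (LINT s|lborel. indicator {r + real i * h n..<r + real i * h n + h n} s * q n s)"
      proof (rule eul_local_error[where g = g, OF h(1) hR R(1) _ _ _ _ qi])
        show "bounded_by R u" using cell_sub[OF i] ri unfolding u_def by (intro R(2)) auto
        show "g (r + real i * h n) = nonlin u" using cell_sub[OF i] ri by (auto simp: g_def u_def)
        show "AE s in lborel. s \<in> {r + real i * h n..<r + real i * h n + h n} \<longrightarrow>
            ?f s = heat (r + real i * h n + h n - s) (g s)"
        proof (intro AE_I2 impI)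
          fix s assume "s \<in> {r + real i * h n..<r + real i * h n + h n}"
          then have "s \<in> {r..<r + t}" using cell_sub[OF i] unfolding cell_def Suc_eq by blast
          then show "?f s = heat (r + real i * h n + h n - s) (g s)"
            unfolding Suc_eq by (simp add: g_def)
        qed
        show "set_integrable lborel {r + real i * h n..r + real i * h n + h n} ?f"
          using int[OF i] unfolding h_def[symmetric] Suc_eq .
        show "q n s = norm (g (r + real i * h n) - g s) + norm (heat (h n) (g s) - g s)"
          if "s \<in> {r + real i * h n..<r + real i * h n + h n}" for s
          using fl_cell[of s i n] that unfolding q_def Suc_eq by simp
      qed
      moreover have "U (r + real (Suc i) * h n) = heat (h n) u - (LINT s:{r + real i * h n..r + real i * h n + h n}|lborel. ?f s) + w n i"
        using flow[OF i] unfolding h_def[symmetric] u_def Suc_eq .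
      then have "heat (h n) (reaction (h n) u) + w n i - U (r + real (Suc i) * h n) =
          - (heat (h n) u - (LINT s:{r + real i * h n..r + real i * h n + h n}|lborel. ?f s) - heat (h n) (reaction (h n) u))"
        by simp
      ultimately show ?thesis
        unfolding I_def cell_def u_def[symmetric] by (simp only: norm_minus_cancel Suc_eq)
    qed
    have "norm (eul (h n) i (U r) (w n) - U (r + real i * h n)) \<le> (\<Sum>j<i. 10 * R ^ 5 * (h n)\<^sup>2 + I j)" if "i \<le> Suc n" for i
      using that
    proof (induction i)
      case (Suc i)
      let ?e = "eul (h n) i (U r) (w n)" and ?u = "U (r + real i * h n)"
      \<comment> \<open>One scheme step from the approximate state against the same step from the
        exact state, plus the local error. The common noise cancels in the first part, so it may be
        replaced by 0.\<close>
      have "eul (h n) (Suc i) (U r) (w n) - U (r + real (Suc i) * h n) =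
        (eul (h n) 1 ?e (\<lambda>_. 0) - eul (h n) 1 ?u (\<lambda>_. 0)) +
        (heat (h n) (reaction (h n) ?u) + w n i - U (r + real (Suc i) * h n))"
        by simp
      also have "norm \<dots> \<le> norm (?e - ?u) + (10 * R ^ 5 * (h n)\<^sup>2 + I i)"
        using eul_nonexpansive[of "h n" 1 ?e "\<lambda>_. 0" ?u] h(1)[of n] Suc.prems
        by (intro order_trans[OF norm_triangle_ineq] add_mono local_err) auto
      finally show ?case using Suc by simp
    qed simp
    from this[of "Suc n"] have "norm (eul (h n) (Suc n) (U r) (w n) - U (r + t)) \<le> (\<Sum>j<Suc n. 10 * R ^ 5 * (h n)\<^sup>2 + I j)"
      by (simp only: hn le_refl)
    also have "\<dots> = real (Suc n) * (10 * R ^ 5 * (h n)\<^sup>2) + (\<Sum>j<Suc n. I j)"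
      by (simp only: sum.distrib sum_constant card_lessThan)
    also have "real (Suc n) * (10 * R ^ 5 * (h n)\<^sup>2) = t * (10 * R ^ 5) * h n"
      by (simp only: hn[of n, symmetric] power2_eq_square mult_ac)
    also have "(\<Sum>j<Suc n. I j) \<le> A1 n + A2 n + A3 n"
    proof -
      have ii: "integrable lborel (\<lambda>s. indicator (cell j) s * q n s)" for j
        using integrable_mult_indicator[of "cell j" lborel "q n"] qi by (simp add: cell_def)
      have "(\<Sum>j<Suc n. I j) = (LINT s|lborel. (\<Sum>j<Suc n. indicator (cell j) s * q n s))"
        unfolding I_def by (rule Bochner_Integration.integral_sum[symmetric]) (rule ii)
      also have "\<dots> \<le> (LINT s|lborel. q n s)"
      proof (rule integral_mono)
        fix s
        have disj: "disjoint_family_on cell {..<Suc n}"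
          unfolding disjoint_family_on_def
        proof (intro ballI impI)
          fix i j :: nat assume "i \<noteq> j"
          have "i = j" if "s \<in> cell i" "s \<in> cell j" for s
            using fl_cell[of s i n] fl_cell[of s j n] that h(1)[of n] by (simp add: cell_def)
          with \<open>i \<noteq> j\<close> show "cell i \<inter> cell j = {}" by blast
        qed
        have "(\<Sum>j<Suc n. indicator (cell j) s * q n s) = (\<Sum>j<Suc n. indicator (cell j) s) * q n s"
          by (rule sum_distrib_right[symmetric])
        also have "(\<Sum>j<Suc n. indicator (cell j) s :: real) = indicator (\<Union>j<Suc n. cell j) s"
          by (rule indicator_UN_disjoint[OF _ disj, symmetric]) simp
        also have "indicator (\<Union>j<Suc n. cell j) s * q n s \<le> q n s"
          by (auto simp: q_def split: split_indicator)
        finally show "(\<Sum>j<Suc n. indicator (cell j) s * q n s) \<le> q n s" .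
      qed (rule Bochner_Integration.integrable_sum[OF ii] qi)+
      also note ql[of n]
      finally show ?thesis .
    qed
    finally show ?thesis by (simp add: E_def)
  qed
  have "(\<lambda>n. h n * R\<^sup>2) \<longlonglongrightarrow> 0 * R\<^sup>2" by (intro tendsto_intros h0)
  then have "\<forall>\<^sub>F n in sequentially. h n * R\<^sup>2 < 1 / 2" by (intro order_tendstoD(2)[of _ 0]) auto
  then have "\<forall>\<^sub>F n in sequentially. norm (eul (h n) (Suc n) (U r) (w n) - U (r + t)) \<le> E n"
    by eventually_elim (intro main, simp)
  from Lim_null_comparison[OF this E] show ?thesis
    by (simp add: LIM_zero_iff h_def)
qed

text \<open>Restarting at time \<open>s\<close>: applying \<open>heat (t - s)\<close> to the
  equation at \<open>s\<close> turns the integral up to \<open>s\<close> into the corresponding part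
  of the integral at \<open>t\<close>, and the noise leaves the residue
  \<open>Zt - heat (t - s) Zs\<close>.\<close>

lemma mild_flow:
  fixes N :: "real \<Rightarrow> hspace"
  assumes st: "0 \<le> s" "s \<le> t"
    and it: "set_integrable lborel {0..t} (\<lambda>u. heat (t - u) (N u))"
    and ist: "set_integrable lborel {0..s} (\<lambda>u. heat (s - u) (N u))"
    and Xt: "Xt = heat t x - (LINT u:{0..t}|lborel. heat (t - u) (N u)) + Zt"
    and Xs: "Xs = heat s x - (LINT u:{0..s}|lborel. heat (s - u) (N u)) + Zs"
  shows "set_integrable lborel {s..t} (\<lambda>u. heat (t - u) (N u))"
    and "Xt = heat (t - s) Xs - (LINT u:{s..t}|lborel. heat (t - u) (N u)) + (Zt - heat (t - s) Zs)"
proof -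
  have ts: "t - s \<ge> 0" using st by simp
  show i2: "set_integrable lborel {s..t} (\<lambda>u. heat (t - u) (N u))"
    by (rule set_integrable_subset[OF it]) (use st in auto)
  have i1: "set_integrable lborel {0..s} (\<lambda>u. heat (t - u) (N u))"
    by (rule set_integrable_subset[OF it]) (use st in auto)
  have "heat (t - s) (LINT u:{0..s}|lborel. heat (s - u) (N u)) =
      (LINT u|lborel. heat (t - s) (indicator {0..s} u *\<^sub>R heat (s - u) (N u)))"
    unfolding set_lebesgue_integral_def
    by (rule integral_bounded_linear[OF bounded_linear_heat[OF ts], symmetric])
      (use ist in \<open>simp add: set_integrable_def\<close>)
  also have "\<dots> = (LINT u:{0..s}|lborel. heat (t - u) (N u))"
    unfolding set_lebesgue_integral_def
    by (intro Bochner_Integration.integral_cong) (use ts in \<open>auto simp: heat_scaleR heat_heat split: split_indicator\<close>)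
  finally have h: "heat (t - s) (LINT u:{0..s}|lborel. heat (s - u) (N u)) = (LINT u:{0..s}|lborel. heat (t - u) (N u))" .
  have "(LINT u:{0..t}|lborel. heat (t - u) (N u)) = (LINT u:{0..s} \<union> {s..t}|lborel. heat (t - u) (N u))"
    using st by (simp add: ivl_disj_un)
  also have "\<dots> = (LINT u:{0..s}|lborel. heat (t - u) (N u)) + (LINT u:{s..t}|lborel. heat (t - u) (N u))"
  proof (rule set_integral_Un_AE[OF _ _ _ i1 i2])
    show "AE u in lborel. \<not> (u \<in> {0..s} \<and> u \<in> {s..t})"
      using AE_lborel_singleton[of s] by eventually_elim auto
  qed auto
  finally show "Xt = heat (t - s) Xs - (LINT u:{s..t}|lborel. heat (t - u) (N u)) + (Zt - heat (t - s) Zs)"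
    unfolding Xt Xs using ts st by (simp add: heat_add heat_diff heat_heat h)
qed

section \<open>Limits in probability of laws and of independent variables\<close>

text \<open>With range in [0,1] and constant at least 1, increments are bounded by L times the
  truncated distance min 1 dist, whose mean metrizes convergence in probability. The class is also
  stable under the transition operators.\<close>

definition test_fun :: "real \<Rightarrow> ('a::metric_space \<Rightarrow> real) \<Rightarrow> bool" where
  "test_fun L f \<longleftrightarrow> L \<ge> 1 \<and> (\<forall>x. 0 \<le> f x \<and> f x \<le> 1) \<and> (\<forall>x y. \<bar>f x - f y\<bar> \<le> L * dist x y)"

lemma test_fun_range: "test_fun L f \<Longrightarrow> 0 \<le> f x" "test_fun L f \<Longrightarrow> f x \<le> 1"
  by (auto simp: test_fun_def)

lemma test_fun_diff_le:
  assumes "test_fun L f"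
  shows "\<bar>f x - f y\<bar> \<le> L * min 1 (dist x y)"
proof -
  have "\<bar>f x - f y\<bar> \<le> 1" using test_fun_range[OF assms, of x] test_fun_range[OF assms, of y] by linarith
  moreover have "1 \<le> L" "\<bar>f x - f y\<bar> \<le> L * dist x y" using assms by (auto simp: test_fun_def)
  ultimately show ?thesis by (cases "1 \<le> dist x y") (auto simp: min_def)
qed

lemma test_fun_measurable:
  assumes "test_fun L f"
  shows "f \<in> borel_measurable borel"
proof (rule borel_measurable_continuous_onI)
  have "L-lipschitz_on UNIV f"
    using assms by (intro lipschitz_onI) (auto simp: test_fun_def dist_real_def)
  then show "continuous_on UNIV f" by (rule lipschitz_on_continuous_on)
qed

text \<open>Lipschitz functions decreasing to the indicator of a closed set. The empty set is
  treated separately because \<open>infdist\<close> to it is 0, which would give the constant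
  1.\<close>

definition bump :: "'a::metric_space set \<Rightarrow> nat \<Rightarrow> 'a \<Rightarrow> real" where
  "bump C m x = (if C = {} then 0 else max 0 (1 - real m * infdist x C))"

lemma test_fun_bump: "test_fun (real m + 1) (bump C m)"
  unfolding test_fun_def
proof (intro conjI allI)
  fix x y :: 'a
  have "real m * \<bar>infdist x C - infdist y C\<bar> \<le> real m * dist x y"
    by (intro mult_left_mono infdist_triangle_abs) simp
  then have "\<bar>real m * infdist x C - real m * infdist y C\<bar> \<le> real m * dist x y"
    by (simp add: abs_mult flip: right_diff_distrib)
  moreover have "\<bar>max 0 (1 - a) - max 0 (1 - b)\<bar> \<le> \<bar>a - b\<bar>" for a b :: real by linarith
  ultimately have "\<bar>bump C m x - bump C m y\<bar> \<le> real m * dist x y"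
    unfolding bump_def using order_trans by (simp del: infdist_zero) blast
  also have "\<dots> \<le> (real m + 1) * dist x y" by (intro mult_right_mono) auto
  finally show "\<bar>bump C m x - bump C m y\<bar> \<le> (real m + 1) * dist x y" .
qed (auto simp: bump_def infdist_nonneg)

lemma bump_LIMSEQ:
  assumes "closed C"
  shows "(\<lambda>m. bump C m x) \<longlonglongrightarrow> indicator C x"
proof (cases "x \<in> C \<or> C = {}")
  case True
  then show ?thesis
  proof
    assume "x \<in> C"
    then have "bump C m x = 1" for m by (auto simp: bump_def)
    then show ?thesis using \<open>x \<in> C\<close> by simp
  qed (simp add: bump_def)
next
  case False
  then have d: "infdist x C > 0" using assms infdist_pos_not_in_closed by blast
  obtain n0 :: nat where n0: "1 / infdist x C \<le> real n0" using real_arch_simple by blast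
  have "bump C m x = 0" if "m \<ge> n0" for m
  proof -
    have "1 / infdist x C \<le> real m" using n0 that by simp
    then have "1 \<le> real m * infdist x C" using d by (simp add: field_simps)
    then show ?thesis by (simp add: bump_def)
  qed
  then have "\<forall>\<^sub>F m in sequentially. bump C m x = 0" by (auto simp: eventually_sequentially)
  then show ?thesis using False by (intro tendsto_eventually) auto
qed

lemma (in prob_space) integrable_test_fun:
  assumes "test_fun L f" "Y \<in> borel_measurable M"
  shows "integrable M (\<lambda>\<omega>. f (Y \<omega>))"
proof (rule integrable_const_bound[of _ 1])
  show "(\<lambda>\<omega>. f (Y \<omega>)) \<in> borel_measurable M"
    using test_fun_measurable[OF assms(1)] assms(2) by measurable
qed (use test_fun_range[OF assms(1)] in auto)

lemma (in prob_space) bump_prob: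
  fixes Y :: "'a \<Rightarrow> 'b::metric_space"
  assumes "closed C" and [measurable]: "Y \<in> borel_measurable M"
  shows "(\<lambda>m. expectation (\<lambda>\<omega>. bump C m (Y \<omega>))) \<longlonglongrightarrow> prob (Y -` C \<inter> space M)"
proof -
  have [measurable]: "bump C m \<in> borel_measurable borel" for m by (rule test_fun_measurable[OF test_fun_bump])
  have [measurable]: "C \<in> sets borel" using assms by simp
  have "(\<lambda>m. expectation (\<lambda>\<omega>. bump C m (Y \<omega>))) \<longlonglongrightarrow> expectation (\<lambda>\<omega>. indicator C (Y \<omega>))"
  proof (rule integral_dominated_convergence[where w = "\<lambda>_. 1"])
    show "AE \<omega> in M. norm (bump C m (Y \<omega>)) \<le> 1" for m
      by (intro AE_I2) (simp add: test_fun_range[OF test_fun_bump])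
  qed (use bump_LIMSEQ[OF assms(1)] in auto)
  also have "expectation (\<lambda>\<omega>. indicator C (Y \<omega>)) = expectation (indicator (Y -` C \<inter> space M))"
    by (intro Bochner_Integration.integral_cong) (auto split: split_indicator)
  finally show ?thesis by simp
qed

text \<open>Bumps recover the measures of closed sets in the limit, and closed sets form an
  intersection-stable generator of the Borel sets.\<close>

lemma measure_eqI_test_fun:
  fixes \<mu> \<nu> :: "'a::metric_space measure"
  assumes "prob_space \<mu>" "prob_space \<nu>" and [simp]: "sets \<mu> = sets borel" "sets \<nu> = sets borel"
    and eq: "\<And>L f. test_fun L f \<Longrightarrow> integral\<^sup>L \<mu> f = integral\<^sup>L \<nu> f"
  shows "\<mu> = \<nu>"
proof (rule measure_eqI_generator_eq[where E = "Collect closed" and \<Omega> = UNIV and A = "\<lambda>_. UNIV"])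
  interpret m: prob_space \<mu> by fact
  interpret n: prob_space \<nu> by fact
  have sp: "space \<mu> = UNIV" "space \<nu> = UNIV" using sets_eq_imp_space_eq[of \<mu> borel] sets_eq_imp_space_eq[of \<nu> borel] by auto
  show "Int_stable (Collect (closed :: 'a set \<Rightarrow> bool))" by (auto simp: Int_stable_def)
  show "sets \<mu> = sigma_sets UNIV (Collect closed)" "sets \<nu> = sigma_sets UNIV (Collect closed)"
    by (simp_all add: borel_eq_closed)
  show "emeasure \<mu> UNIV \<noteq> \<infinity>" using m.emeasure_finite by simp
  fix C :: "'a set" assume "C \<in> Collect closed"
  then have C: "closed C" by simp
  have id: "(\<lambda>x. x) \<in> borel_measurable \<mu>" "(\<lambda>x. x) \<in> borel_measurable \<nu>"
    by (auto simp: measurable_def sp)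
  have "(\<lambda>m. integral\<^sup>L \<mu> (bump C m)) \<longlonglongrightarrow> measure \<mu> C"
    using m.bump_prob[OF C id(1)] sp by simp
  moreover have "(\<lambda>m. integral\<^sup>L \<nu> (bump C m)) \<longlonglongrightarrow> measure \<nu> C"
    using n.bump_prob[OF C id(2)] sp by simp
  ultimately have "measure \<mu> C = measure \<nu> C"
    using LIMSEQ_unique by (simp add: eq[OF test_fun_bump])
  then show "emeasure \<mu> C = emeasure \<nu> C"
    by (simp add: m.emeasure_eq_measure n.emeasure_eq_measure)
qed auto

section \<open>Convergence in probability, via the mean of the truncated distance\<close>

definition in_prob :: "'w measure \<Rightarrow> (nat \<Rightarrow> 'w \<Rightarrow> 'a::metric_space) \<Rightarrow> ('w \<Rightarrow> 'a) \<Rightarrow> bool" where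
  "in_prob M Y Z \<longleftrightarrow> (\<lambda>n. LINT \<omega>|M. min 1 (dist (Y n \<omega>) (Z \<omega>))) \<longlonglongrightarrow> 0"

context prob_space
begin

lemma integrable_min_dist:
  fixes Y Z :: "'a \<Rightarrow> 'b::{metric_space, second_countable_topology}"
  assumes [measurable]: "Y \<in> borel_measurable M" "Z \<in> borel_measurable M"
  shows "integrable M (\<lambda>\<omega>. min 1 (dist (Y \<omega>) (Z \<omega>)))"
  by (rule integrable_const_bound[of _ 1]) auto

lemma expectation_test_fun_diff_le:
  fixes Y Z :: "'a \<Rightarrow> 'b::{metric_space, second_countable_topology}"
  assumes f: "test_fun L f" and [measurable]: "Y \<in> borel_measurable M" "Z \<in> borel_measurable M"
  shows "\<bar>expectation (\<lambda>\<omega>. f (Y \<omega>)) - expectation (\<lambda>\<omega>. f (Z \<omega>))\<bar> \<le> L * expectation (\<lambda>\<omega>. min 1 (dist (Y \<omega>) (Z \<omega>)))"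
proof -
  have i: "integrable M (\<lambda>\<omega>. f (Y \<omega>))" "integrable M (\<lambda>\<omega>. f (Z \<omega>))"
    using integrable_test_fun[OF f] by auto
  have "\<bar>expectation (\<lambda>\<omega>. f (Y \<omega>)) - expectation (\<lambda>\<omega>. f (Z \<omega>))\<bar> = \<bar>expectation (\<lambda>\<omega>. f (Y \<omega>) - f (Z \<omega>))\<bar>"
    using i by simp
  also have "\<dots> \<le> expectation (\<lambda>\<omega>. \<bar>f (Y \<omega>) - f (Z \<omega>)\<bar>)"
    using integral_norm_bound[of M "\<lambda>\<omega>. f (Y \<omega>) - f (Z \<omega>)"] by simp
  also have "\<dots> \<le> expectation (\<lambda>\<omega>. L * min 1 (dist (Y \<omega>) (Z \<omega>)))"
  proof (rule integral_mono)
    show "integrable M (\<lambda>\<omega>. \<bar>f (Y \<omega>) - f (Z \<omega>)\<bar>)" using i by simp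
    show "integrable M (\<lambda>\<omega>. L * min 1 (dist (Y \<omega>) (Z \<omega>)))"
      by (intro integrable_mult_right integrable_min_dist) measurable
  qed (rule test_fun_diff_le[OF f])
  finally show ?thesis by simp
qed

lemma in_prob_test_fun:
  fixes Y :: "nat \<Rightarrow> 'a \<Rightarrow> 'b::{metric_space, second_countable_topology}"
  assumes f: "test_fun L f" and [measurable]: "\<And>n. Y n \<in> borel_measurable M" "Z \<in> borel_measurable M"
    and Y: "in_prob M Y Z"
  shows "(\<lambda>n. expectation (\<lambda>\<omega>. f (Y n \<omega>))) \<longlonglongrightarrow> expectation (\<lambda>\<omega>. f (Z \<omega>))"
proof -
  have "(\<lambda>n. L * expectation (\<lambda>\<omega>. min 1 (dist (Y n \<omega>) (Z \<omega>)))) \<longlonglongrightarrow> L * 0"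
    using Y unfolding in_prob_def by (intro tendsto_intros)
  then have l: "(\<lambda>n. L * expectation (\<lambda>\<omega>. min 1 (dist (Y n \<omega>) (Z \<omega>)))) \<longlonglongrightarrow> 0" by simp
  have "norm (expectation (\<lambda>\<omega>. f (Y n \<omega>)) - expectation (\<lambda>\<omega>. f (Z \<omega>))) \<le> L * expectation (\<lambda>\<omega>. min 1 (dist (Y n \<omega>) (Z \<omega>)))" for n
    unfolding real_norm_def by (rule expectation_test_fun_diff_le[OF f]) measurable
  then have "(\<lambda>n. expectation (\<lambda>\<omega>. f (Y n \<omega>)) - expectation (\<lambda>\<omega>. f (Z \<omega>))) \<longlonglongrightarrow> 0"
    by (intro Lim_null_comparison[OF _ l] always_eventually allI)
  then show ?thesis by (simp add: LIM_zero_iff)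
qed

lemma in_prob_AE:
  fixes Y :: "nat \<Rightarrow> 'a \<Rightarrow> 'b::{metric_space, second_countable_topology}"
  assumes [measurable]: "\<And>n. Y n \<in> borel_measurable M" "Z \<in> borel_measurable M"
    and "AE \<omega> in M. (\<lambda>n. Y n \<omega>) \<longlonglongrightarrow> Z \<omega>"
  shows "in_prob M Y Z"
proof -
  have "(\<lambda>n. expectation (\<lambda>\<omega>. min 1 (dist (Y n \<omega>) (Z \<omega>)))) \<longlonglongrightarrow> expectation (\<lambda>\<omega>. 0)"
  proof (rule integral_dominated_convergence[where w = "\<lambda>_. 1"])
    show "AE \<omega> in M. (\<lambda>n. min 1 (dist (Y n \<omega>) (Z \<omega>))) \<longlonglongrightarrow> 0"
      using assms(3)
    proof eventually_elim
      case (elim \<omega>)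
      then have "(\<lambda>n. min 1 (dist (Y n \<omega>) (Z \<omega>))) \<longlonglongrightarrow> min 1 (dist (Z \<omega>) (Z \<omega>))" by (intro tendsto_intros)
      then show ?case by simp
    qed
  qed auto
  then show ?thesis by (simp add: in_prob_def)
qed

lemma in_prob_AE_cong:
  fixes Y Z :: "'a \<Rightarrow> 'b::{metric_space, second_countable_topology}"
  assumes "Y \<in> borel_measurable M" "Z \<in> borel_measurable M" "AE \<omega> in M. Y \<omega> = Z \<omega>"
  shows "in_prob M (\<lambda>_. Y) Z"
  by (rule in_prob_AE) (use assms in auto)

text \<open>A comparison principle that serves as continuous mapping theorem for sums and
  nonexpansive images: the truncated distance inherits the triangle-type bound.\<close>

lemma in_prob_dist_le:
  fixes Y :: "nat \<Rightarrow> 'a \<Rightarrow> 'b::{metric_space, second_countable_topology}"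
    and Y' :: "nat \<Rightarrow> 'a \<Rightarrow> 'c::{metric_space, second_countable_topology}"
    and Y'' :: "nat \<Rightarrow> 'a \<Rightarrow> 'd::{metric_space, second_countable_topology}"
  assumes [measurable]: "\<And>n. Y n \<in> borel_measurable M" "Z \<in> borel_measurable M"
    "\<And>n. Y' n \<in> borel_measurable M" "Z' \<in> borel_measurable M"
    "\<And>n. Y'' n \<in> borel_measurable M" "Z'' \<in> borel_measurable M"
    and Y': "in_prob M Y' Z'" and Y'': "in_prob M Y'' Z''"
    and le: "\<And>n. AE \<omega> in M. dist (Y n \<omega>) (Z \<omega>) \<le> dist (Y' n \<omega>) (Z' \<omega>) + dist (Y'' n \<omega>) (Z'' \<omega>)"
  shows "in_prob M Y Z"
proof -
  have l: "(\<lambda>n. expectation (\<lambda>\<omega>. min 1 (dist (Y' n \<omega>) (Z' \<omega>))) + expectation (\<lambda>\<omega>. min 1 (dist (Y'' n \<omega>) (Z'' \<omega>)))) \<longlonglongrightarrow> 0 + 0"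
    using Y' Y'' unfolding in_prob_def by (intro tendsto_intros)
  have "expectation (\<lambda>\<omega>. min 1 (dist (Y n \<omega>) (Z \<omega>))) \<le>
      expectation (\<lambda>\<omega>. min 1 (dist (Y' n \<omega>) (Z' \<omega>))) + expectation (\<lambda>\<omega>. min 1 (dist (Y'' n \<omega>) (Z'' \<omega>)))" for n
  proof -
    have "expectation (\<lambda>\<omega>. min 1 (dist (Y n \<omega>) (Z \<omega>))) \<le>
      expectation (\<lambda>\<omega>. min 1 (dist (Y' n \<omega>) (Z' \<omega>)) + min 1 (dist (Y'' n \<omega>) (Z'' \<omega>)))"
    proof (rule integral_mono_AE)
      show "AE \<omega> in M. min 1 (dist (Y n \<omega>) (Z \<omega>)) \<le> min 1 (dist (Y' n \<omega>) (Z' \<omega>)) + min 1 (dist (Y'' n \<omega>) (Z'' \<omega>))"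
        using le[of n]
      proof eventually_elim
        case (elim \<omega>)
        then show ?case
          using zero_le_dist[of "Y' n \<omega>" "Z' \<omega>"] zero_le_dist[of "Y'' n \<omega>" "Z'' \<omega>"]
          by linarith
      qed
    qed (auto intro!: integrable_min_dist Bochner_Integration.integrable_add)
    also have "\<dots> = expectation (\<lambda>\<omega>. min 1 (dist (Y' n \<omega>) (Z' \<omega>))) + expectation (\<lambda>\<omega>. min 1 (dist (Y'' n \<omega>) (Z'' \<omega>)))"
      by (intro Bochner_Integration.integral_add integrable_min_dist) auto
    finally show ?thesis .
  qed
  moreover have "0 \<le> expectation (\<lambda>\<omega>. min 1 (dist (Y n \<omega>) (Z \<omega>)))" for n
    by (intro Bochner_Integration.integral_nonneg) simp
  ultimately have le: "norm (expectation (\<lambda>\<omega>. min 1 (dist (Y n \<omega>) (Z \<omega>)))) \<le>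
      expectation (\<lambda>\<omega>. min 1 (dist (Y' n \<omega>) (Z' \<omega>))) + expectation (\<lambda>\<omega>. min 1 (dist (Y'' n \<omega>) (Z'' \<omega>)))" for n
    unfolding real_norm_def by (simp only: abs_of_nonneg)
  show ?thesis
    unfolding in_prob_def using Lim_null_comparison[OF always_eventually[OF allI[OF le]]] l by simp
qed

lemma distr_eq_in_prob:
  fixes Y Y' :: "nat \<Rightarrow> 'a \<Rightarrow> 'b::{metric_space, second_countable_topology}"
  assumes [measurable]: "\<And>n. Y n \<in> borel_measurable M" "Z \<in> borel_measurable M"
    "\<And>n. Y' n \<in> borel_measurable M" "Z' \<in> borel_measurable M"
    and Y: "in_prob M Y Z" and Y': "in_prob M Y' Z'"
    and eq: "\<And>n. distr M borel (Y n) = distr M borel (Y' n)"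
  shows "distr M borel Z = distr M borel Z'"
proof (rule measure_eqI_test_fun)
  show "prob_space (distr M borel Z)" "prob_space (distr M borel Z')"
    by (intro prob_space_distr; measurable)+
  fix L and f :: "'b \<Rightarrow> real" assume f: "test_fun L f"
  have [measurable]: "f \<in> borel_measurable borel" by (rule test_fun_measurable[OF f])
  have "expectation (\<lambda>\<omega>. f (Y n \<omega>)) = expectation (\<lambda>\<omega>. f (Y' n \<omega>))" for n
    using arg_cong[OF eq[of n], of "\<lambda>m. integral\<^sup>L m f"] by (simp add: integral_distr)
  then have "expectation (\<lambda>\<omega>. f (Z \<omega>)) = expectation (\<lambda>\<omega>. f (Z' \<omega>))"
    using LIMSEQ_unique[OF in_prob_test_fun[OF f _ _ Y]] in_prob_test_fun[OF f _ _ Y'] by simp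
  then show "integral\<^sup>L (distr M borel Z) f = integral\<^sup>L (distr M borel Z') f"
    by (simp add: integral_distr)
qed auto

lemma distr_cong_AE:
  fixes Y Z :: "'a \<Rightarrow> 'b::{metric_space, second_countable_topology}"
  assumes "Y \<in> borel_measurable M" "Z \<in> borel_measurable M" "AE \<omega> in M. Y \<omega> = Z \<omega>"
  shows "distr M borel Y = distr M borel Z"
  by (rule distr_eq_in_prob[of "\<lambda>_. Z" Y "\<lambda>_. Z" Z])
    (use assms in \<open>auto intro!: in_prob_AE_cong\<close>)

text \<open>Product formulas for bumps pass to indicators of closed sets by dominated convergence,
  which gives independence of an intersection-stable family of generators.\<close>

lemma indep_vars_test_funI:
  fixes Z :: "'i \<Rightarrow> 'a \<Rightarrow> 'b::{metric_space, second_countable_topology}"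
  assumes Z [measurable]: "\<And>i. i \<in> I \<Longrightarrow> Z i \<in> borel_measurable M"
    and prod: "\<And>J f L. J \<subseteq> I \<Longrightarrow> finite J \<Longrightarrow> (\<And>i. i \<in> J \<Longrightarrow> test_fun (L i) (f i)) \<Longrightarrow>
      expectation (\<lambda>\<omega>. \<Prod>i\<in>J. f i (Z i \<omega>)) = (\<Prod>i\<in>J. expectation (\<lambda>\<omega>. f i (Z i \<omega>)))"
  shows "indep_vars (\<lambda>_. borel) Z I"
proof -
  define F where "F i = {Z i -` C \<inter> space M | C. C \<in> Collect closed}" for i
  have "indep_sets F I"
    unfolding indep_sets_def
  proof (intro conjI ballI allI impI)
    fix i assume "i \<in> I"
    then show "F i \<subseteq> events" by (auto simp: F_def intro!: measurable_sets[OF Z])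
  next
    fix J A assume J: "J \<subseteq> I" "J \<noteq> {}" "finite J" and A: "A \<in> Pi J F"
    then have "\<forall>i\<in>J. \<exists>C. closed C \<and> A i = Z i -` C \<inter> space M" by (auto simp: F_def Pi_iff)
    then obtain C where C: "\<And>i. i \<in> J \<Longrightarrow> closed (C i)" "\<And>i. i \<in> J \<Longrightarrow> A i = Z i -` C i \<inter> space M" by metis
    have [measurable]: "i \<in> J \<Longrightarrow> Z i \<in> borel_measurable M" for i using J by auto
    have [measurable]: "bump (C i) m \<in> borel_measurable borel" for i m by (rule test_fun_measurable[OF test_fun_bump])
    have [measurable]: "i \<in> J \<Longrightarrow> C i \<in> sets borel" for i using C(1) by auto
    have m1: "(\<lambda>\<omega>. \<Prod>i\<in>J. (indicator (C i) (Z i \<omega>) :: real)) \<in> borel_measurable M"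
      by (intro borel_measurable_prod) measurable
    have "(\<lambda>m. expectation (\<lambda>\<omega>. \<Prod>i\<in>J. bump (C i) m (Z i \<omega>))) \<longlonglongrightarrow> expectation (\<lambda>\<omega>. \<Prod>i\<in>J. indicator (C i) (Z i \<omega>))"
    proof (rule integral_dominated_convergence[where w = "\<lambda>_. 1"])
      show "AE \<omega> in M. (\<lambda>m. \<Prod>i\<in>J. bump (C i) m (Z i \<omega>)) \<longlonglongrightarrow> (\<Prod>i\<in>J. indicator (C i) (Z i \<omega>))"
        by (intro AE_I2 tendsto_prod bump_LIMSEQ C)
      show "AE \<omega> in M. norm (\<Prod>i\<in>J. bump (C i) m (Z i \<omega>)) \<le> 1" for m
        by (intro AE_I2) (auto simp: abs_prod test_fun_range[OF test_fun_bump] intro!: prod_le_1)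
    qed (use m1 in \<open>auto intro!: borel_measurable_prod\<close>)
    also have "expectation (\<lambda>\<omega>. \<Prod>i\<in>J. indicator (C i) (Z i \<omega>)) = expectation (indicat_real (\<Inter>(A ` J)))"
    proof (rule Bochner_Integration.integral_cong)
      fix \<omega> assume "\<omega> \<in> space M"
      then show "(\<Prod>i\<in>J. indicator (C i) (Z i \<omega>) :: real) = indicator (\<Inter>(A ` J)) \<omega>"
        using C(2) J by (cases "\<forall>i\<in>J. Z i \<omega> \<in> C i") (auto simp: indicator_def prod_zero_iff)
    qed simp
    also have "\<dots> = prob (\<Inter>(A ` J))"
    proof -
      have "\<Inter>(A ` J) \<in> events"
        using J C by (intro sets.finite_INT) (auto intro!: measurable_sets)
      then show ?thesis by simp
    qed
    finally have 1: "(\<lambda>m. expectation (\<lambda>\<omega>. \<Prod>i\<in>J. bump (C i) m (Z i \<omega>))) \<longlonglongrightarrow> prob (\<Inter>(A ` J))" .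
    have "(\<lambda>m. \<Prod>i\<in>J. expectation (\<lambda>\<omega>. bump (C i) m (Z i \<omega>))) \<longlonglongrightarrow> (\<Prod>i\<in>J. prob (A i))"
      using C J by (intro tendsto_prod) (auto intro!: bump_prob)
    moreover have "(\<Prod>i\<in>J. expectation (\<lambda>\<omega>. bump (C i) m (Z i \<omega>))) = expectation (\<lambda>\<omega>. \<Prod>i\<in>J. bump (C i) m (Z i \<omega>))" for m
      by (rule prod[symmetric]) (use J test_fun_bump in auto)
    ultimately show "prob (\<Inter>j\<in>J. A j) = (\<Prod>j\<in>J. prob (A j))"
      using LIMSEQ_unique[OF 1] by simp
  qed
  then have "indep_sets (\<lambda>i. sigma_sets (space M) (F i)) I"
  proof (rule indep_sets_sigma)
    show "Int_stable (F i)" for i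
      unfolding Int_stable_def F_def
    proof safe
      fix A B :: "'b set" assume "closed A" "closed B"
      then show "\<exists>C. Z i -` A \<inter> space M \<inter> (Z i -` B \<inter> space M) = Z i -` C \<inter> space M \<and> C \<in> Collect closed"
        by (intro exI[of _ "A \<inter> B"]) auto
    qed
  qed
  moreover have "sigma_sets (space M) (F i) = {Z i -` A \<inter> space M | A. A \<in> sets borel}" for i
    unfolding F_def borel_eq_closed by (simp add: sigma_sets_vimage_commute)
  ultimately show ?thesis using Z by (auto simp: indep_vars_def2)
qed

text \<open>The difference of two products of numbers in [0,1] is at most the sum of the differences
  of the factors, so product formulas for test functions survive the limit in probability.\<close>

lemma indep_vars_in_prob:
  fixes Z :: "'i \<Rightarrow> 'a \<Rightarrow> 'b::{metric_space, second_countable_topology}"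
  assumes Z [measurable]: "\<And>i. i \<in> I \<Longrightarrow> Z i \<in> borel_measurable M"
    and Y: "\<And>n. indep_vars (\<lambda>_. borel) (Y n) I"
    and lim: "\<And>i. i \<in> I \<Longrightarrow> in_prob M (\<lambda>n. Y n i) (Z i)"
  shows "indep_vars (\<lambda>_. borel) Z I"
proof (rule indep_vars_test_funI)
  fix J f L assume J: "J \<subseteq> I" "finite J" and f: "\<And>i. i \<in> J \<Longrightarrow> test_fun (L i) (f i :: 'b \<Rightarrow> real)"
  have Ym [measurable]: "i \<in> J \<Longrightarrow> Y n i \<in> borel_measurable M" for n i
    using Y[of n] J by (auto simp: indep_vars_def2)
  have Zm [measurable]: "i \<in> J \<Longrightarrow> Z i \<in> borel_measurable M" for i using J by auto
  have fm [measurable]: "i \<in> J \<Longrightarrow> f i \<in> borel_measurable borel" for i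
    by (rule test_fun_measurable[OF f])
  have "indep_vars (\<lambda>_. borel) (\<lambda>i \<omega>. f i (Y n i \<omega>)) J" for n
    by (rule indep_vars_compose2[OF indep_vars_subset[OF Y J(1)]]) simp
  then have eq: "expectation (\<lambda>\<omega>. \<Prod>i\<in>J. f i (Y n i \<omega>)) = (\<Prod>i\<in>J. expectation (\<lambda>\<omega>. f i (Y n i \<omega>)))" for n
    by (intro indep_vars_lebesgue_integral J) (auto intro!: integrable_test_fun[OF f])
  have r: "(\<lambda>n. \<Prod>i\<in>J. expectation (\<lambda>\<omega>. f i (Y n i \<omega>))) \<longlonglongrightarrow> (\<Prod>i\<in>J. expectation (\<lambda>\<omega>. f i (Z i \<omega>)))"
    using J lim by (intro tendsto_prod) (auto intro!: in_prob_test_fun[OF f])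
  have "(\<lambda>n. \<Sum>i\<in>J. L i * expectation (\<lambda>\<omega>. min 1 (dist (Y n i \<omega>) (Z i \<omega>)))) \<longlonglongrightarrow> (\<Sum>i\<in>J. L i * 0)"
    using J lim unfolding in_prob_def by (intro tendsto_intros) auto
  then have s0: "(\<lambda>n. \<Sum>i\<in>J. L i * expectation (\<lambda>\<omega>. min 1 (dist (Y n i \<omega>) (Z i \<omega>)))) \<longlonglongrightarrow> 0" by simp
  have mp: "(\<lambda>\<omega>. \<Prod>i\<in>J. f i (Y n i \<omega>)) \<in> borel_measurable M" "(\<lambda>\<omega>. \<Prod>i\<in>J. f i (Z i \<omega>)) \<in> borel_measurable M" for n
    by (auto intro!: borel_measurable_prod)
  have bd: "norm (\<Prod>i\<in>J. f i (X i)) \<le> 1" for X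
    unfolding real_norm_def abs_prod using test_fun_range[OF f] by (intro prod_le_1) auto
  have ip: "integrable M (\<lambda>\<omega>. \<Prod>i\<in>J. f i (Y n i \<omega>))" "integrable M (\<lambda>\<omega>. \<Prod>i\<in>J. f i (Z i \<omega>))" for n
    by (rule integrable_const_bound[of _ 1]; use mp bd in auto)+
  have prod_diff: "\<bar>(\<Prod>i\<in>K. a i) - (\<Prod>i\<in>K. c i)\<bar> \<le> (\<Sum>i\<in>K. \<bar>a i - c i\<bar>)"
    if "finite K" "\<And>i. i \<in> K \<Longrightarrow> \<bar>a i\<bar> \<le> 1 \<and> \<bar>c i\<bar> \<le> 1" for K :: "'i set" and a c :: "'i \<Rightarrow> real"
    using norm_prod_diff[of K a c] that by simp
  have "\<bar>expectation (\<lambda>\<omega>. \<Prod>i\<in>J. f i (Y n i \<omega>)) - expectation (\<lambda>\<omega>. \<Prod>i\<in>J. f i (Z i \<omega>))\<bar> \<le>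
      (\<Sum>i\<in>J. L i * expectation (\<lambda>\<omega>. min 1 (dist (Y n i \<omega>) (Z i \<omega>))))" for n
  proof -
    have "\<bar>expectation (\<lambda>\<omega>. \<Prod>i\<in>J. f i (Y n i \<omega>)) - expectation (\<lambda>\<omega>. \<Prod>i\<in>J. f i (Z i \<omega>))\<bar> =
        \<bar>expectation (\<lambda>\<omega>. (\<Prod>i\<in>J. f i (Y n i \<omega>)) - (\<Prod>i\<in>J. f i (Z i \<omega>)))\<bar>"
      using ip by simp
    also have "\<dots> \<le> expectation (\<lambda>\<omega>. \<bar>(\<Prod>i\<in>J. f i (Y n i \<omega>)) - (\<Prod>i\<in>J. f i (Z i \<omega>))\<bar>)"
      using integral_norm_bound[of M "\<lambda>\<omega>. (\<Prod>i\<in>J. f i (Y n i \<omega>)) - (\<Prod>i\<in>J. f i (Z i \<omega>))"] by simp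
    also have "\<dots> \<le> expectation (\<lambda>\<omega>. \<Sum>i\<in>J. L i * min 1 (dist (Y n i \<omega>) (Z i \<omega>)))"
    proof (rule integral_mono)
      fix \<omega>
      have "\<bar>(\<Prod>i\<in>J. f i (Y n i \<omega>)) - (\<Prod>i\<in>J. f i (Z i \<omega>))\<bar> \<le> (\<Sum>i\<in>J. \<bar>f i (Y n i \<omega>) - f i (Z i \<omega>)\<bar>)"
        using J test_fun_range[OF f] by (intro prod_diff) auto
      also have "\<dots> \<le> (\<Sum>i\<in>J. L i * min 1 (dist (Y n i \<omega>) (Z i \<omega>)))"
        by (intro sum_mono test_fun_diff_le f)
      finally show "\<bar>(\<Prod>i\<in>J. f i (Y n i \<omega>)) - (\<Prod>i\<in>J. f i (Z i \<omega>))\<bar> \<le> (\<Sum>i\<in>J. L i * min 1 (dist (Y n i \<omega>) (Z i \<omega>)))" .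
    next
      show "integrable M (\<lambda>\<omega>. \<Sum>i\<in>J. L i * min 1 (dist (Y n i \<omega>) (Z i \<omega>)))"
        by (intro Bochner_Integration.integrable_sum integrable_mult_right integrable_min_dist) auto
    qed (use ip in auto)
    also have "\<dots> = (\<Sum>i\<in>J. L i * expectation (\<lambda>\<omega>. min 1 (dist (Y n i \<omega>) (Z i \<omega>))))"
      by (subst Bochner_Integration.integral_sum) (auto intro!: integrable_min_dist)
    finally show ?thesis .
  qed
  then have "(\<lambda>n. expectation (\<lambda>\<omega>. \<Prod>i\<in>J. f i (Y n i \<omega>)) - expectation (\<lambda>\<omega>. \<Prod>i\<in>J. f i (Z i \<omega>))) \<longlonglongrightarrow> 0"
    by (intro Lim_null_comparison[OF _ s0]) auto
  then have "(\<lambda>n. expectation (\<lambda>\<omega>. \<Prod>i\<in>J. f i (Y n i \<omega>))) \<longlonglongrightarrow> expectation (\<lambda>\<omega>. \<Prod>i\<in>J. f i (Z i \<omega>))"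
    by (simp add: LIM_zero_iff)
  from LIMSEQ_unique[OF this r[folded eq]]
  show "expectation (\<lambda>\<omega>. \<Prod>i\<in>J. f i (Z i \<omega>)) = (\<Prod>i\<in>J. expectation (\<lambda>\<omega>. f i (Z i \<omega>)))" .
qed (rule Z)

lemma indep_vars_cong_AE:
  fixes Z :: "'i \<Rightarrow> 'a \<Rightarrow> 'b::{metric_space, second_countable_topology}"
  assumes Y: "indep_vars (\<lambda>_. borel) Y I" and Z: "\<And>i. i \<in> I \<Longrightarrow> Z i \<in> borel_measurable M"
    and eq: "\<And>i. i \<in> I \<Longrightarrow> AE \<omega> in M. Y i \<omega> = Z i \<omega>"
  shows "indep_vars (\<lambda>_. borel) Z I"
  by (rule indep_vars_in_prob[OF Z Y]) (use Y eq Z in \<open>auto simp: indep_vars_def2 intro!: in_prob_AE_cong\<close>)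

end

section \<open>The noise\<close>

text \<open>As \<open>exp (- x\<^sup>2 / 2)\<close> is the characteristic function of a standard normal variable \<open>g\<close>, the
  left-hand side is the mean of \<open>1 - char \<nu> (b g)\<close> over \<open>g\<close>.\<close>

lemma one_minus_exp_le:
  fixes \<nu> :: "real measure"
  assumes "real_distribution \<nu>" and \<alpha>: "0 < \<alpha>" "\<alpha> \<le> 2" and t: "t \<ge> 0"
    and c: "\<And>\<theta>. char \<nu> \<theta> = of_real (exp (- t * \<bar>\<theta>\<bar> powr \<alpha>))"
  shows "(LINT x|\<nu>. 1 - exp (- (b * x)\<^sup>2 / 2)) \<le> 2 * t * \<bar>b\<bar> powr \<alpha>"
proof -
  interpret \<nu>: real_distribution \<nu> by fact
  define \<gamma> :: "real measure" where "\<gamma> = std_normal_distribution"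
  interpret \<gamma>: real_distribution \<gamma> unfolding \<gamma>_def by (rule real_dist_normal_dist)
  have [simp]: "measure \<gamma> UNIV = 1" "measure \<nu> UNIV = 1"
    using \<gamma>.prob_space \<nu>.prob_space by simp_all
  interpret P: pair_sigma_finite \<nu> \<gamma> ..
  interpret PP: pair_prob_space \<nu> \<gamma> ..
  have ch: "char \<gamma> \<theta> = of_real (exp (- (\<theta>\<^sup>2) / 2))" for \<theta>
    unfolding \<gamma>_def by (simp add: char_std_normal_distribution)
  have i2: "integrable (\<nu> \<Otimes>\<^sub>M \<gamma>) (\<lambda>(x, g). iexp (b * x * g))"
    by (rule PP.P.integrable_const_bound[of _ 1]) (auto simp: split_beta')
  have "(CLINT x|\<nu>. of_real (exp (- (b * x)\<^sup>2 / 2))) = (CLINT x|\<nu>. char \<gamma> (b * x))"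
    by (simp add: ch)
  also have "\<dots> = (CLINT x|\<nu>. CLINT g|\<gamma>. iexp (b * x * g))" by (simp add: char_def)
  also have "\<dots> = (CLINT g|\<gamma>. CLINT x|\<nu>. iexp (b * x * g))"
    by (rule P.Fubini_integral[symmetric]) (use i2 in \<open>simp add: split_beta'\<close>)
  also have "\<dots> = (CLINT g|\<gamma>. char \<nu> (b * g))" by (simp add: char_def mult_ac)
  also have "\<dots> = (CLINT g|\<gamma>. of_real (exp (- t * \<bar>b * g\<bar> powr \<alpha>)))" by (simp add: c)
  finally have e: "(LINT x|\<nu>. exp (- (b * x)\<^sup>2 / 2)) = (LINT g|\<gamma>. exp (- t * \<bar>b * g\<bar> powr \<alpha>))"
    by (simp only: integral_complex_of_real of_real_eq_iff)
  have sq: "integrable \<gamma> (\<lambda>g. g\<^sup>2)" "(LINT g|\<gamma>. g\<^sup>2) = 1"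
    using std_normal_distribution_even_moments[of 1] unfolding \<gamma>_def by simp_all
  have i1: "integrable \<gamma> (\<lambda>g. exp (- t * \<bar>b * g\<bar> powr \<alpha>))"
    using t by (intro \<gamma>.integrable_const_bound[of _ 1]) auto
  have "(LINT x|\<nu>. 1 - exp (- (b * x)\<^sup>2 / 2)) = 1 - (LINT x|\<nu>. exp (- (b * x)\<^sup>2 / 2))"
    by (subst Bochner_Integration.integral_diff)
      (use \<nu>.prob_space in \<open>auto intro!: \<nu>.integrable_const_bound[of _ 1]\<close>)
  also have "\<dots> = (LINT g|\<gamma>. 1 - exp (- t * \<bar>b * g\<bar> powr \<alpha>))"
    unfolding e using i1 by (simp add: \<gamma>.prob_space)
  also have "\<dots> \<le> (LINT g|\<gamma>. t * \<bar>b\<bar> powr \<alpha> * (1 + g\<^sup>2))"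
  proof (rule integral_mono)
    show "integrable \<gamma> (\<lambda>g. t * \<bar>b\<bar> powr \<alpha> * (1 + g\<^sup>2))"
      using sq by auto
    fix g :: real
    \<comment> \<open>This needs \<alpha> at most 2. The right-hand side has Gaussian mean 2, the
      origin of the constant in the claim.\<close>
    have "\<bar>g\<bar> powr \<alpha> \<le> 1 + g\<^sup>2"
    proof (cases "\<bar>g\<bar> \<le> 1")
      case True
      then have "\<bar>g\<bar> powr \<alpha> \<le> 1 powr \<alpha>" using \<alpha> by (intro powr_mono2) auto
      then show ?thesis by (simp add: add_increasing2)
    next
      case False
      then have "\<bar>g\<bar> powr \<alpha> \<le> \<bar>g\<bar> powr 2" using \<alpha> by (intro powr_mono) auto
      also have "\<dots> = g\<^sup>2" using False by (simp add: powr_numeral)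
      finally show ?thesis by simp
    qed
    then have "t * \<bar>b\<bar> powr \<alpha> * \<bar>g\<bar> powr \<alpha> \<le> t * \<bar>b\<bar> powr \<alpha> * (1 + g\<^sup>2)"
      using t by (intro mult_left_mono) auto
    moreover have "1 - exp (- t * \<bar>b * g\<bar> powr \<alpha>) \<le> t * \<bar>b * g\<bar> powr \<alpha>"
      using exp_ge_add_one_self[of "- t * \<bar>b * g\<bar> powr \<alpha>"] by simp
    ultimately show "1 - exp (- t * \<bar>b * g\<bar> powr \<alpha>) \<le> t * \<bar>b\<bar> powr \<alpha> * (1 + g\<^sup>2)"
      by (simp add: abs_mult powr_mult mult.assoc)
  qed (use i1 in auto)
  also have "\<dots> = 2 * t * \<bar>b\<bar> powr \<alpha>"
    using sq by (simp add: \<gamma>.prob_space)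
  finally show ?thesis .
qed

section \<open>Regrouping of independent families\<close>

lemma (in prob_space) indep_vars_reindex_inj:
  assumes "indep_vars M' X I" "f ` J \<subseteq> I" "inj_on f J"
  shows "indep_vars (\<lambda>j. M' (f j)) (\<lambda>j. X (f j)) J"
proof -
  have "indep_vars (\<lambda>j. PiM {f j} M') (\<lambda>j \<omega>. restrict (\<lambda>i. X i \<omega>) {f j}) J"
    by (rule indep_vars_restrict[OF assms(1)])
      (use assms(2,3) in \<open>auto simp: disjoint_family_on_def inj_on_def\<close>)
  then have "indep_vars (\<lambda>j. M' (f j)) (\<lambda>j \<omega>. (restrict (\<lambda>i. X i \<omega>) {f j}) (f j)) J"
    by (rule indep_vars_compose2) (auto intro!: measurable_component_singleton)
  then show ?thesis by simp
qed

text \<open>Independence between the components k together with independence of the time increments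
  within each component makes the doubly indexed family independent. The array can then be regrouped
  by time instead of by component.\<close>

lemma (in prob_space) indep_vars_two_level:
  fixes X :: "'i \<Rightarrow> 'k \<Rightarrow> 'a \<Rightarrow> 'b"
  assumes I: "finite I"
    and outer: "indep_vars (\<lambda>_. PiM I (\<lambda>_. N)) (\<lambda>k \<omega>. \<lambda>i\<in>I. X i k \<omega>) K"
    and inner: "\<And>k. k \<in> K \<Longrightarrow> indep_vars (\<lambda>_. N) (\<lambda>i. X i k) I"
  shows "indep_vars (\<lambda>_. N) (\<lambda>(i, k). X i k) (I \<times> K)"
  unfolding indep_vars_def2
proof (intro conjI ballI)
  fix ik assume "ik \<in> I \<times> K"
  then show "random_variable N (case ik of (i, k) \<Rightarrow> X i k)"
    using inner by (auto simp: indep_vars_def2)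
next
  show "indep_sets (\<lambda>ik. {(case ik of (i, k) \<Rightarrow> X i k) -` A \<inter> space M |A. A \<in> sets N}) (I \<times> K)"
    unfolding indep_sets_def
  proof (intro conjI ballI allI impI)
    fix ik assume "ik \<in> I \<times> K"
    then show "{(case ik of (i, k) \<Rightarrow> X i k) -` A \<inter> space M |A. A \<in> sets N} \<subseteq> events"
      using inner by (auto simp: indep_vars_def2 intro!: measurable_sets)
  next
    fix J A assume J: "J \<subseteq> I \<times> K" "J \<noteq> {}" "finite J"
      and "A \<in> (\<Pi> ik\<in>J. {(case ik of (i, k) \<Rightarrow> X i k) -` A \<inter> space M |A. A \<in> sets N})"
    then have "\<forall>ik\<in>J. \<exists>B. B \<in> sets N \<and> A ik = X (fst ik) (snd ik) -` B \<inter> space M"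
      by (auto simp: Pi_iff split_beta')
    then obtain B where B: "\<And>ik. ik \<in> J \<Longrightarrow> B ik \<in> sets N"
      "\<And>ik. ik \<in> J \<Longrightarrow> A ik = X (fst ik) (snd ik) -` B ik \<inter> space M"
      by metis
    define K' where "K' = snd ` J"
    define J' where "J' k = {i. (i, k) \<in> J}" for k
    have K': "K' \<noteq> {}" "finite K'" "K' \<subseteq> K" using J by (auto simp: K'_def)
    have J': "J' k \<noteq> {}" "finite (J' k)" "J' k \<subseteq> I" if "k \<in> K'" for k
      using that J I by (auto simp: J'_def K'_def intro: finite_subset)
    \<comment> \<open>All conditions with the same second index become one event of the vector
      belonging to \<open>k\<close>, to which the outer independence applies; the inner one then
      splits its probability.\<close>
    define S where "S k = {f \<in> space (PiM I (\<lambda>_. N)). \<forall>i\<in>J' k. f i \<in> B (i, k)}" for k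
    have S: "S k \<in> sets (PiM I (\<lambda>_. N))" if "k \<in> K'" for k
    proof -
      have "S k = space (PiM I (\<lambda>_. N)) \<inter> (\<Inter>i\<in>J' k. (\<lambda>f. f i) -` B (i, k) \<inter> space (PiM I (\<lambda>_. N)))"
        using J'(1)[OF that] by (auto simp: S_def)
      also have "\<dots> \<in> sets (PiM I (\<lambda>_. N))"
        using J'[OF that] B(1)
        by (intro sets.Int sets.top sets.finite_INT measurable_sets[OF measurable_component_singleton])
          (auto simp: J'_def)
      finally show ?thesis .
    qed
    have E: "(\<lambda>\<omega>. \<lambda>i\<in>I. X i k \<omega>) -` S k \<inter> space M = (\<Inter>i\<in>J' k. X i k -` B (i, k) \<inter> space M)" if "k \<in> K'" for k
    proof -
      have "(\<lambda>i\<in>I. X i k \<omega>) \<in> space (PiM I (\<lambda>_. N))" if "\<omega> \<in> space M" for \<omega>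
        using inner[of k] K'(3) \<open>k \<in> K'\<close> that by (auto simp: indep_vars_def2 space_PiM dest: measurable_space)
      then show ?thesis
        using J'[OF that] by (auto simp: S_def subset_iff)
    qed
    have "(\<Inter>ik\<in>J. A ik) = (\<Inter>k\<in>K'. (\<lambda>\<omega>. \<lambda>i\<in>I. X i k \<omega>) -` S k \<inter> space M)"
    proof -
      have "(\<Inter>ik\<in>J. A ik) = (\<Inter>k\<in>K'. \<Inter>i\<in>J' k. X i k -` B (i, k) \<inter> space M)"
      proof (intro set_eqI iffI)
        fix \<omega> assume a: "\<omega> \<in> (\<Inter>ik\<in>J. A ik)"
        show "\<omega> \<in> (\<Inter>k\<in>K'. \<Inter>i\<in>J' k. X i k -` B (i, k) \<inter> space M)"
        proof (intro INT_I)
          fix k i assume "k \<in> K'" "i \<in> J' k"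
          then have "(i, k) \<in> J" by (simp add: J'_def)
          then show "\<omega> \<in> X i k -` B (i, k) \<inter> space M" using a B(2) by fastforce
        qed
      next
        fix \<omega> assume a: "\<omega> \<in> (\<Inter>k\<in>K'. \<Inter>i\<in>J' k. X i k -` B (i, k) \<inter> space M)"
        show "\<omega> \<in> (\<Inter>ik\<in>J. A ik)"
        proof (rule INT_I)
          fix ik assume ik: "ik \<in> J"
          then have "snd ik \<in> K'" "fst ik \<in> J' (snd ik)" by (auto simp: K'_def J'_def)
          then have "\<omega> \<in> X (fst ik) (snd ik) -` B (fst ik, snd ik) \<inter> space M" using a by blast
          then show "\<omega> \<in> A ik" using B(2)[OF ik] by simp
        qed
      qed
      then show ?thesis using E by simp
    qed
    then have "prob (\<Inter>ik\<in>J. A ik) = (\<Prod>k\<in>K'. prob ((\<lambda>\<omega>. \<lambda>i\<in>I. X i k \<omega>) -` S k \<inter> space M))"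
      using indep_varsD[OF outer K' S] by simp
    also have "\<dots> = (\<Prod>k\<in>K'. \<Prod>i\<in>J' k. prob (X i k -` B (i, k) \<inter> space M))"
    proof (rule prod.cong[OF refl])
      fix k assume k: "k \<in> K'"
      then have "k \<in> K" using K' by auto
      from indep_varsD[OF inner[OF this] J'[OF k], of "\<lambda>i. B (i, k)"]
      show "prob ((\<lambda>\<omega>. \<lambda>i\<in>I. X i k \<omega>) -` S k \<inter> space M) = (\<Prod>i\<in>J' k. prob (X i k -` B (i, k) \<inter> space M))"
        unfolding E[OF k] using B(1) by (auto simp: J'_def)
    qed
    also have "\<dots> = (\<Prod>(k, i)\<in>Sigma K' J'. prob (X i k -` B (i, k) \<inter> space M))"
      using K' J' by (intro prod.Sigma) auto
    also have "\<dots> = (\<Prod>ik\<in>J. prob (A ik))"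
      by (rule prod.reindex_bij_witness[where i = prod.swap and j = prod.swap])
        (use B(2) in \<open>auto simp: J'_def K'_def split: prod.splits\<close>, force)
    finally show "prob (\<Inter>ik\<in>J. A ik) = (\<Prod>ik\<in>J. prob (A ik))" .
  qed
qed

text \<open>Separates the deterministic summation from the random coefficients: values and
  increments of the noise become one fixed measurable function of independent families.\<close>

definition basis_series :: "(int \<Rightarrow> real) \<Rightarrow> hspace" where
  "basis_series c = (\<Sum>\<^sub>\<infinity>k\<in>Zstar. c k *\<^sub>R real_basis k)"

lemma basis_series_cong: "(\<And>k. k \<noteq> 0 \<Longrightarrow> c k = d k) \<Longrightarrow> basis_series c = basis_series d"
  unfolding basis_series_def by (rule infsum_cong) simp

text \<open>\<open>infsum\<close> is 0 for a divergent series, so that the case distinction is needed to see measurability.\<close>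

lemma basis_series_eq_lim:
  "basis_series c = (if \<exists>B::nat. \<forall>n. (\<Sum>k\<in>Zball n. (c k)\<^sup>2) \<le> real B
     then lim (\<lambda>n. \<Sum>k\<in>Zball n. c k *\<^sub>R real_basis k) else 0)"
proof (cases "(\<lambda>k. (c k)\<^sup>2) summable_on Zstar")
  case True
  obtain B :: nat where B: "infsum (\<lambda>k. (c k)\<^sup>2) Zstar \<le> real B" using real_arch_simple by blast
  have "(\<Sum>k\<in>Zball n. (c k)\<^sup>2) \<le> real B" for n
    by (rule order_trans[OF finite_sum_le_infsum[OF True] B]) (use Zball_subset in auto)
  moreover have "((\<lambda>k. c k *\<^sub>R real_basis k) has_sum basis_series c) Zstar"
    using True unfolding basis_series_def summable_on_basis_iff[symmetric] by simp
  then have "lim (\<lambda>n. \<Sum>k\<in>Zball n. c k *\<^sub>R real_basis k) = basis_series c"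
    by (intro limI has_sum_Zball)
  ultimately show ?thesis by auto
next
  case False
  have "\<not> (\<exists>B::nat. \<forall>n. (\<Sum>k\<in>Zball n. (c k)\<^sup>2) \<le> real B)"
  proof
    assume "\<exists>B::nat. \<forall>n. (\<Sum>k\<in>Zball n. (c k)\<^sup>2) \<le> real B"
    then obtain B :: nat where B: "\<And>n. (\<Sum>k\<in>Zball n. (c k)\<^sup>2) \<le> real B" by blast
    from exists_partial_sums_limit[OF B] obtain x where x: "\<And>k. k \<noteq> 0 \<Longrightarrow> coord x k = c k" by blast
    then have "(\<lambda>k. (c k)\<^sup>2) summable_on Zstar"
      using coord_sq_summable[of x] by (subst summable_on_cong[of _ _ "\<lambda>k. (coord x k)\<^sup>2"]) auto
    with False show False by simp
  qed
  moreover have "basis_series c = 0"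
    unfolding basis_series_def
    by (rule infsum_not_exists) (use False in \<open>simp add: summable_on_basis_iff\<close>)
  ultimately show ?thesis by (simp only: if_False)
qed

lemma basis_series_measurable:
  assumes [measurable]: "\<And>k. k \<noteq> 0 \<Longrightarrow> (\<lambda>\<omega>. c \<omega> k) \<in> borel_measurable M"
  shows "(\<lambda>\<omega>. basis_series (c \<omega>)) \<in> borel_measurable M"
proof -
  have [measurable]: "(\<lambda>\<omega>. \<Sum>k\<in>Zball n. (c \<omega> k)\<^sup>2) \<in> borel_measurable M" for n
    using Zball_subset[of n] by (intro borel_measurable_sum borel_measurable_power assms) auto
  have [measurable]: "(\<lambda>\<omega>. \<Sum>k\<in>Zball n. c \<omega> k *\<^sub>R real_basis k) \<in> borel_measurable M" for n
    using Zball_subset[of n] by (intro borel_measurable_sum borel_measurable_scaleR assms) auto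
  show ?thesis unfolding basis_series_eq_lim by measurable
qed

lemma basis_series_diff:
  assumes "(\<lambda>k. (c k)\<^sup>2) summable_on Zstar" "(\<lambda>k. (d k)\<^sup>2) summable_on Zstar"
  shows "basis_series c - basis_series d = basis_series (\<lambda>k. c k - d k)"
proof -
  have "coord (basis_series c - basis_series d) k = c k - d k" if "k \<noteq> 0" for k
    unfolding coord_diff basis_series_def using assms that by (simp add: coord_infsum)
  from infsumI[OF has_sum_basis[OF this]] show ?thesis by (simp add: basis_series_def)
qed

section \<open>The noise as an H-valued process with stationary independent increments\<close>

locale stable_noise = prob_space M for M :: "'w measure" +
  fixes \<alpha> :: real and b :: "int \<Rightarrow> real" and l :: "int \<Rightarrow> real \<Rightarrow> 'w \<Rightarrow> real"
  assumes alpha: "0 < \<alpha>" "\<alpha> \<le> 2"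
    and stable: "\<And>k. k \<noteq> 0 \<Longrightarrow> symmetric_stable_process M \<alpha> (l k)"
    and indep_l: "indep_processes M l"
    and b_summable: "(\<lambda>k. \<bar>b k\<bar> powr \<alpha>) summable_on Zstar"
begin

definition L :: "real \<Rightarrow> 'w \<Rightarrow> hspace" where
  "L = noise b l"

lemma L_eq: "L t \<omega> = basis_series (\<lambda>k. b k * l k t \<omega>)"
  by (simp add: L_def noise_def basis_series_def)

lemma l_measurable [measurable]: "k \<noteq> 0 \<Longrightarrow> 0 \<le> t \<Longrightarrow> l k t \<in> borel_measurable M"
  using stable[of k] by (auto simp: symmetric_stable_process_def)

lemma L_measurable [measurable]: "0 \<le> t \<Longrightarrow> L t \<in> borel_measurable M"
  unfolding L_eq[abs_def] by (rule basis_series_measurable) measurable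

text \<open>For \<open>\<alpha> < 2\<close> the \<open>l k t\<close> have no second moments, hence the detour through \<open>1 - exp (- x\<^sup>2 / 2)\<close>.\<close>

lemma noise_summable:
  assumes t: "t \<ge> 0"
  shows "AE \<omega> in M. (\<lambda>k. (b k * l k t \<omega>)\<^sup>2) summable_on Zstar"
proof -
  \<comment> \<open>An enumeration of the index set, so that sum and expectation can be exchanged in
    the form available for series over the naturals.\<close>
  define g where "g = from_nat_into Zstar"
  have inf: "infinite Zstar"
  proof -
    have "- {0::int} = Zstar" by auto
    then show ?thesis using finite_compl[of "{0::int}"] infinite_UNIV_int by auto
  qed
  have g: "bij_betw g UNIV Zstar" unfolding g_def by (rule bij_betw_from_nat_into) (use inf in auto)
  have g0: "g n \<noteq> 0" for n using g by (auto simp: bij_betw_def)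
  define e where "e n \<omega> = 1 - exp (- (b (g n) * l (g n) t \<omega>)\<^sup>2 / 2)" for n \<omega>
  have [measurable]: "e n \<in> borel_measurable M" for n
    unfolding e_def using g0 t by measurable
  have e01: "0 \<le> e n \<omega>" "e n \<omega> \<le> 1" for n \<omega> by (auto simp: e_def)
  have ie: "integrable M (e n)" for n
    by (rule integrable_const_bound[of _ 1]) (use e01 in auto)
  have Ee: "expectation (e n) \<le> 2 * t * \<bar>b (g n)\<bar> powr \<alpha>" for n
  proof -
    have [measurable]: "l (g n) t \<in> borel_measurable M" using g0 t by simp
    have "expectation (e n) = (LINT x|distr M borel (l (g n) t). 1 - exp (- (b (g n) * x)\<^sup>2 / 2))"
      unfolding e_def by (subst integral_distr) auto
    also have "\<dots> \<le> 2 * t * \<bar>b (g n)\<bar> powr \<alpha>"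
    proof (rule one_minus_exp_le[OF _ alpha t])
      show "real_distribution (distr M borel (l (g n) t))" by (rule real_distribution_distr) simp
      show "char (distr M borel (l (g n) t)) \<theta> = of_real (exp (- t * \<bar>\<theta>\<bar> powr \<alpha>))" for \<theta>
        using stable[OF g0[of n]] t by (simp add: symmetric_stable_process_def)
    qed
    finally show ?thesis .
  qed
  have "(\<lambda>n. \<bar>b (g n)\<bar> powr \<alpha>) summable_on UNIV"
    using summable_on_reindex_bij_betw[OF g, of "\<lambda>k. \<bar>b k\<bar> powr \<alpha>"] b_summable by simp
  then have sm: "summable (\<lambda>n. 2 * t * \<bar>b (g n)\<bar> powr \<alpha>)"
    by (intro summable_mult) (rule summable_on_imp_summable)
  have "(\<integral>\<^sup>+ \<omega>. (\<Sum>n. ennreal (e n \<omega>)) \<partial>M) = (\<Sum>n. \<integral>\<^sup>+ \<omega>. ennreal (e n \<omega>) \<partial>M)"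
    by (rule nn_integral_suminf) simp
  also have "\<dots> = (\<Sum>n. ennreal (expectation (e n)))"
    using ie e01 by (intro suminf_cong nn_integral_eq_integral) auto
  also have "\<dots> \<le> (\<Sum>n. ennreal (2 * t * \<bar>b (g n)\<bar> powr \<alpha>))"
    using Ee by (intro suminf_le ennreal_leI) auto
  also have "\<dots> = ennreal (\<Sum>n. 2 * t * \<bar>b (g n)\<bar> powr \<alpha>)"
    using sm t by (intro suminf_ennreal2) auto
  finally have "(\<integral>\<^sup>+ \<omega>. (\<Sum>n. ennreal (e n \<omega>)) \<partial>M) \<noteq> \<infinity>" by (auto simp: top_unique)
  then have "AE \<omega> in M. (\<Sum>n. ennreal (e n \<omega>)) \<noteq> \<infinity>"
    by (intro nn_integral_noteq_infinite) auto
  then show ?thesis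
  proof eventually_elim
    case (elim \<omega>)
    define y where "y n = (b (g n) * l (g n) t \<omega>)\<^sup>2" for n
    have se: "summable (\<lambda>n. e n \<omega>)" by (rule summable_suminf_not_top) (use elim e01 in auto)
    have ey: "e n \<omega> = 1 - exp (- (y n) / 2)" for n by (simp add: e_def y_def)
    have y0: "y n \<ge> 0" for n by (simp add: y_def)
    \<comment> \<open>Inverts 1 - exp (- y / 2) near 0: the condition forces y < 2, and there exp (y
      / 2) >= 1 + y / 2 gives exp (- y / 2) <= 1 - y / 4. As the terms \<open>e n \<omega>\<close>
      are summable, the condition holds for all large n.\<close>
    have bound: "y n \<le> 4 * e n \<omega>" if "e n \<omega> < 1 / 2" for n
    proof -
      have x: "exp (y n / 2) \<ge> 1 + y n / 2" by (rule exp_ge_add_one_self)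
      have lt: "exp (- (y n) / 2) > 1 / 2" using that by (simp add: ey)
      have ex: "exp (- (y n) / 2) * exp (y n / 2) = 1" by (simp flip: exp_add)
      have "1 / 2 * exp (y n / 2) < exp (- (y n) / 2) * exp (y n / 2)"
        by (rule mult_strict_right_mono[OF lt]) simp
      then have "1 / 2 * exp (y n / 2) < 1" unfolding ex .
      then have y2: "y n < 2" using x by linarith
      have "exp (- (y n) / 2) * (1 + y n / 2) \<le> exp (- (y n) / 2) * exp (y n / 2)"
        by (rule mult_left_mono[OF x]) simp
      then have "exp (- (y n) / 2) * (1 + y n / 2) \<le> 1" unfolding ex .
      moreover have "1 \<le> (1 - y n / 4) * (1 + y n / 2)"
      proof -
        have "(1 - y n / 4) * (1 + y n / 2) = 1 + y n * (2 - y n) / 8" by (simp add: field_simps)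
        moreover have "0 \<le> y n * (2 - y n)" using y0[of n] y2 by (intro mult_nonneg_nonneg) auto
        ultimately show ?thesis by simp
      qed
      ultimately have "exp (- (y n) / 2) * (1 + y n / 2) \<le> (1 - y n / 4) * (1 + y n / 2)" by linarith
      then have "exp (- (y n) / 2) \<le> 1 - y n / 4"
        using y0[of n] by (subst (asm) mult_le_cancel_right_pos) auto
      then show ?thesis by (simp add: ey)
    qed
    have "(\<lambda>n. e n \<omega>) \<longlonglongrightarrow> 0" by (rule summable_LIMSEQ_zero[OF se])
    then have "\<forall>\<^sub>F n in sequentially. e n \<omega> < 1 / 2" by (rule order_tendstoD) simp
    then have "\<forall>\<^sub>F n in sequentially. norm (y n) \<le> 4 * e n \<omega>"
      by eventually_elim (use bound y0 in simp)
    then have "summable y" using summable_mult[OF se, of 4] by (rule summable_comparison_test_ev)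
    then have "y summable_on UNIV" using y0 by (simp add: summable_on_UNIV_nonneg_real_iff)
    then show ?case
      using summable_on_reindex_bij_betw[OF g, of "\<lambda>k. (b k * l k t \<omega>)\<^sup>2"] by (simp add: y_def[abs_def])
  qed
qed

text \<open>Holds almost surely only: a divergent unordered sum has the default value 0, so
  subtraction term by term requires both series to converge.\<close>

lemma L_diff:
  assumes "0 \<le> s" "0 \<le> t"
  shows "AE \<omega> in M. basis_series (\<lambda>k. b k * (l k t \<omega> - l k s \<omega>)) = L t \<omega> - L s \<omega>"
  using noise_summable[OF assms(1)] noise_summable[OF assms(2)]
proof eventually_elim
  case (elim \<omega>)
  then show ?case unfolding L_eq by (subst basis_series_diff) (auto simp: right_diff_distrib)
qed

text \<open>The scalar increments form an array over time steps and components. Being independent as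
  a whole, they are grouped by time step, and each group is summed by
  \<open>basis_series\<close>.\<close>

lemma L_indep_increments:
  assumes p: "0 \<le> p 0" "\<And>i. i < n \<Longrightarrow> p i \<le> p (Suc i)"
  shows "indep_vars (\<lambda>_. borel) (\<lambda>i \<omega>. L (p (Suc i)) \<omega> - L (p i) \<omega>) {..<n}"
proof -
  have p0: "0 \<le> p i" if "i \<le> n" for i
    using that
  proof (induction i)
    case (Suc i)
    then show ?case using p(2)[of i] by simp
  qed (rule p)
  define X where "X i k \<omega> = l k (p (Suc i)) \<omega> - l k (p i) \<omega>" for i k \<omega>
  have outer: "indep_vars (\<lambda>_. PiM {..<n} (\<lambda>_. borel)) (\<lambda>k \<omega>. \<lambda>i\<in>{..<n}. X i k \<omega>) Zstar"
  proof -
    have "indep_vars (\<lambda>_. PiM {..<n} (\<lambda>_. borel))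
       (\<lambda>k \<omega>. (\<lambda>f. \<lambda>i\<in>{..<n}. f (p (Suc i)) - f (p i)) (\<lambda>t\<in>{0..}. l k t \<omega>)) Zstar"
      using p0 by (intro indep_vars_compose2[OF indep_l[unfolded indep_processes_def]] measurable_restrict
          borel_measurable_diff measurable_component_singleton) auto
    then show ?thesis
      by (rule indep_vars_cong[THEN iffD1, rotated -1]) (use p0 in \<open>auto simp: X_def fun_eq_iff\<close>)
  qed
  have inner: "indep_vars (\<lambda>_. borel) (\<lambda>i. X i k) {..<n}" if "k \<in> Zstar" for k
  proof -
    define p' where "p' i = p (min i n)" for i
    have "0 \<le> p' 0 \<and> (\<forall>i<n. p' i \<le> p' (Suc i))" using p by (auto simp: p'_def)
    then have "indep_vars (\<lambda>_. borel) (\<lambda>i \<omega>. l k (p' (Suc i)) \<omega> - l k (p' i) \<omega>) {..<n}"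
      using stable[of k] that by (auto simp: symmetric_stable_process_def)
    then show ?thesis
      by (rule indep_vars_cong[THEN iffD1, rotated -1]) (auto simp: X_def p'_def fun_eq_iff min_def)
  qed
  have "indep_vars (\<lambda>_. borel) (\<lambda>(i, k). X i k) ({..<n} \<times> Zstar)"
    by (rule indep_vars_two_level[OF _ outer inner]) auto
  then have "indep_vars (\<lambda>i. PiM ({i} \<times> Zstar) (\<lambda>_. borel))
     (\<lambda>i \<omega>. restrict (\<lambda>ik. (case ik of (i, k) \<Rightarrow> X i k) \<omega>) ({i} \<times> Zstar)) {..<n}"
    by (rule indep_vars_restrict) (auto simp: disjoint_family_on_def)
  then have "indep_vars (\<lambda>_. borel) (\<lambda>i \<omega>. basis_series (\<lambda>k. b k * (restrict (\<lambda>ik. (case ik of (i, k) \<Rightarrow> X i k) \<omega>) ({i} \<times> Zstar)) (i, k))) {..<n}"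
    by (rule indep_vars_compose2[where Y = "\<lambda>i w. basis_series (\<lambda>k. b k * w (i, k))"])
      (intro basis_series_measurable borel_measurable_times borel_measurable_const measurable_component_singleton, auto)
  moreover have "basis_series (\<lambda>k. b k * (restrict (\<lambda>ik. (case ik of (i, k) \<Rightarrow> X i k) \<omega>) ({i} \<times> Zstar)) (i, k)) =
      basis_series (\<lambda>k. b k * X i k \<omega>)" for i \<omega>
    by (rule basis_series_cong) simp
  ultimately have "indep_vars (\<lambda>_. borel) (\<lambda>i \<omega>. basis_series (\<lambda>k. b k * X i k \<omega>)) {..<n}" by simp
  then show ?thesis
  proof (rule indep_vars_cong_AE)
    fix i assume "i \<in> {..<n}"
    then have [simp]: "0 \<le> p i" "0 \<le> p (Suc i)" using p0 by auto
    show "(\<lambda>\<omega>. L (p (Suc i)) \<omega> - L (p i) \<omega>) \<in> borel_measurable M" by measurable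
    show "AE \<omega> in M. basis_series (\<lambda>k. b k * X i k \<omega>) = L (p (Suc i)) \<omega> - L (p i) \<omega>"
      unfolding X_def by (rule L_diff) auto
  qed
qed

text \<open>By independence both coefficient sequences have product laws, with equal factors because
  each component is stationary; the increment and the value are images of these laws under the same
  map \<open>F\<close>.\<close>

lemma L_stationary:
  assumes st: "0 \<le> s" "s \<le> t"
  shows "distr M borel (\<lambda>\<omega>. L t \<omega> - L s \<omega>) = distr M borel (L (t - s))"
proof -
  have t: "0 \<le> t" "0 \<le> t - s" using st by auto
  define F where "F w = basis_series (\<lambda>k. b k * w k)" for w
  have [measurable]: "F \<in> borel_measurable (PiM Zstar (\<lambda>_. borel))"
    unfolding F_def
    by (intro basis_series_measurable borel_measurable_times borel_measurable_const measurable_component_singleton) auto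
  have [measurable]: "(\<lambda>\<omega>. \<lambda>k\<in>Zstar. l k t \<omega> - l k s \<omega>) \<in> measurable M (PiM Zstar (\<lambda>_. borel))"
    "(\<lambda>\<omega>. \<lambda>k\<in>Zstar. l k (t - s) \<omega>) \<in> measurable M (PiM Zstar (\<lambda>_. borel))"
    using st t by (auto intro!: measurable_restrict borel_measurable_diff)
  have Fr: "F (\<lambda>k\<in>Zstar. w k) = F w" for w unfolding F_def by (rule basis_series_cong) simp
  have ne: "Zstar \<noteq> {}" by (auto intro: exI[of _ 1])
  have "distr M (PiM Zstar (\<lambda>_. borel)) (\<lambda>\<omega>. \<lambda>k\<in>Zstar. l k t \<omega> - l k s \<omega>) = (\<Pi>\<^sub>M k\<in>Zstar. distr M borel (\<lambda>\<omega>. l k t \<omega> - l k s \<omega>))"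
  proof (rule indep_vars_iff_distr_eq_PiM'[THEN iffD1, OF ne])
    have "indep_vars (\<lambda>_. borel) (\<lambda>k \<omega>. (\<lambda>f. f t - f s) (\<lambda>t\<in>{0..}. l k t \<omega>)) Zstar"
      using st by (intro indep_vars_compose2[OF indep_l[unfolded indep_processes_def]]
          borel_measurable_diff measurable_component_singleton) auto
    then show "indep_vars (\<lambda>_. borel) (\<lambda>k \<omega>. l k t \<omega> - l k s \<omega>) Zstar" using st by simp
    show "(\<lambda>\<omega>. l k t \<omega> - l k s \<omega>) \<in> borel_measurable M" if "k \<in> Zstar" for k using that st by simp
  qed
  also have "\<dots> = (\<Pi>\<^sub>M k\<in>Zstar. distr M borel (l k (t - s)))"
    by (rule PiM_cong) (use stable st in \<open>auto simp: symmetric_stable_process_def\<close>)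
  also have "\<dots> = distr M (PiM Zstar (\<lambda>_. borel)) (\<lambda>\<omega>. \<lambda>k\<in>Zstar. l k (t - s) \<omega>)"
  proof (rule indep_vars_iff_distr_eq_PiM'[THEN iffD1, OF ne, symmetric])
    have "indep_vars (\<lambda>_. borel) (\<lambda>k \<omega>. (\<lambda>f. f (t - s)) (\<lambda>t\<in>{0..}. l k t \<omega>)) Zstar"
      using t by (intro indep_vars_compose2[OF indep_l[unfolded indep_processes_def]] measurable_component_singleton) auto
    then show "indep_vars (\<lambda>_. borel) (\<lambda>k. l k (t - s)) Zstar" using t by simp
    show "l k (t - s) \<in> borel_measurable M" if "k \<in> Zstar" for k using that t by simp
  qed
  finally have "distr (distr M (PiM Zstar (\<lambda>_. borel)) (\<lambda>\<omega>. \<lambda>k\<in>Zstar. l k t \<omega> - l k s \<omega>)) borel F =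
    distr (distr M (PiM Zstar (\<lambda>_. borel)) (\<lambda>\<omega>. \<lambda>k\<in>Zstar. l k (t - s) \<omega>)) borel F" by simp
  then have "distr M borel (\<lambda>\<omega>. F (\<lambda>k. l k t \<omega> - l k s \<omega>)) = distr M borel (\<lambda>\<omega>. F (\<lambda>k. l k (t - s) \<omega>))"
    by (simp add: distr_distr o_def Fr)
  moreover have "distr M borel (\<lambda>\<omega>. F (\<lambda>k. l k t \<omega> - l k s \<omega>)) = distr M borel (\<lambda>\<omega>. L t \<omega> - L s \<omega>)"
  proof (rule distr_cong_AE)
    show "(\<lambda>\<omega>. F (\<lambda>k. l k t \<omega> - l k s \<omega>)) \<in> borel_measurable M"
      unfolding F_def using st t by (intro basis_series_measurable) measurable
    show "(\<lambda>\<omega>. L t \<omega> - L s \<omega>) \<in> borel_measurable M" using st t by measurable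
    show "AE \<omega> in M. F (\<lambda>k. l k t \<omega> - l k s \<omega>) = L t \<omega> - L s \<omega>"
      unfolding F_def using L_diff[of s t] st t by simp
  qed
  ultimately show ?thesis by (simp add: F_def L_eq[abs_def])
qed

section \<open>The stochastic convolution\<close>

lemma heat_measurable [measurable]: "0 \<le> t \<Longrightarrow> heat t \<in> borel_measurable borel"
  by (intro borel_measurable_continuous_onI linear_continuous_on bounded_linear_heat)

definition riemann :: "(nat \<Rightarrow> real) \<Rightarrow> nat \<Rightarrow> 'w \<Rightarrow> hspace" where
  "riemann p n \<omega> = (\<Sum>i<n. heat (p n - p i) (L (p (Suc i)) \<omega> - L (p i) \<omega>))"

lemma partition_mono:
  fixes p :: "nat \<Rightarrow> real"
  assumes "\<And>i. i < n \<Longrightarrow> p i \<le> p (Suc i)" "i \<le> j" "j \<le> n"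
  shows "p i \<le> p j"
  using assms(2,3)
proof (induction j rule: dec_induct)
  case (step j)
  then show ?case using assms(1)[of j] by simp
qed simp

lemma riemann_measurable:
  assumes "0 \<le> p 0" "\<And>i. i < n \<Longrightarrow> p i \<le> p (Suc i)"
  shows "riemann p n \<in> borel_measurable M"
proof -
  have m: "p i \<le> p j" if "i \<le> j" "j \<le> n" for i j by (rule partition_mono[of n p, OF assms(2) that])
  have "(\<lambda>\<omega>. heat (p n - p i) (L (p (Suc i)) \<omega> - L (p i) \<omega>)) \<in> borel_measurable M" if "i < n" for i
  proof -
    have "0 \<le> p n - p i" "0 \<le> p i" "0 \<le> p (Suc i)"
      using m[of i n] m[of 0 i] m[of 0 "Suc i"] assms(1) that by auto
    then have [measurable]: "heat (p n - p i) \<in> borel_measurable borel"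
      "L (p i) \<in> borel_measurable M" "L (p (Suc i)) \<in> borel_measurable M"
      by (auto intro: heat_measurable L_measurable)
    show ?thesis by measurable
  qed
  then show ?thesis unfolding riemann_def[abs_def] by (intro borel_measurable_sum) auto
qed

text \<open>Passes from the definition over all fine partitions to one sequence with mesh tending to
  0, the form in which laws and independence are transported.\<close>

lemma stoch_conv_in_prob:
  assumes Z: "stoch_conv M L t Z"
    and p: "\<And>m. p m 0 = 0" "\<And>m. p m (n m) = t" "\<And>m i. i < n m \<Longrightarrow> p m i \<le> p m (Suc i)"
    and mesh: "\<And>m i. i < n m \<Longrightarrow> p m (Suc i) - p m i \<le> c m" "c \<longlonglongrightarrow> 0"
  shows "in_prob M (\<lambda>m. riemann (p m) (n m)) Z"
proof -
  have [measurable]: "Z \<in> borel_measurable M" using Z by (simp add: stoch_conv_def)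
  have [measurable]: "riemann (p m) (n m) \<in> borel_measurable M" for m
    by (rule riemann_measurable) (use p in auto)
  show ?thesis
    unfolding in_prob_def
  proof (rule tendstoI)
    fix e :: real assume e: "e > 0"
    \<comment> \<open>The mean of the truncated distance is at most \<epsilon> plus the probability
      of a distance of at least \<epsilon>, together less than 2 \<epsilon>.\<close>
    define \<epsilon> where "\<epsilon> = e / 3"
    have \<epsilon>: "\<epsilon> > 0" using e by (simp add: \<epsilon>_def)
    obtain \<delta> where \<delta>: "\<delta> > 0" "\<And>n p. p 0 = 0 \<and> p n = t \<and> (\<forall>i<n. p i \<le> p (Suc i) \<and> p (Suc i) - p i < \<delta>) \<Longrightarrow>
        measure M {\<omega>\<in>space M. \<epsilon> \<le> dist (\<Sum>i<n. heat (t - p i) (L (p (Suc i)) \<omega> - L (p i) \<omega>)) (Z \<omega>)} < \<epsilon>"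
      using Z \<epsilon> unfolding stoch_conv_def by meson
    have "\<forall>\<^sub>F m in sequentially. c m < \<delta>" using mesh(2) \<delta>(1) by (rule order_tendstoD)
    then show "\<forall>\<^sub>F m in sequentially. dist (expectation (\<lambda>\<omega>. min 1 (dist (riemann (p m) (n m) \<omega>) (Z \<omega>)))) 0 < e"
    proof eventually_elim
      case (elim m)
      let ?Y = "riemann (p m) (n m)"
      define A where "A = {\<omega>\<in>space M. \<epsilon> \<le> dist (?Y \<omega>) (Z \<omega>)}"
      have A: "A \<in> sets M" unfolding A_def by measurable
      have "measure M A < \<epsilon>"
        unfolding A_def riemann_def p(2)
      proof (rule \<delta>(2), intro conjI allI impI)
        show "p m (Suc i) - p m i < \<delta>" if "i < n m" for i using mesh(1)[OF that] elim by simp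
      qed (use p in auto)
      have "expectation (\<lambda>\<omega>. min 1 (dist (?Y \<omega>) (Z \<omega>))) \<le> expectation (\<lambda>\<omega>. \<epsilon> + indicator A \<omega>)"
      proof (rule integral_mono)
        show "integrable M (\<lambda>\<omega>. \<epsilon> + indicator A \<omega>)"
          by (intro Bochner_Integration.integrable_add integrable_const integrable_real_indicator A)
            (simp add: emeasure_eq_measure)
        show "min 1 (dist (?Y \<omega>) (Z \<omega>)) \<le> \<epsilon> + indicator A \<omega>" if "\<omega> \<in> space M" for \<omega>
          using that \<epsilon> by (cases "\<omega> \<in> A") (auto simp: A_def)
      qed (intro integrable_min_dist; measurable)
      also have "\<dots> = \<epsilon> + measure M A"
      proof (subst Bochner_Integration.integral_add)
        show "integrable M (indicat_real A)"
          by (intro integrable_real_indicator A) (simp add: emeasure_eq_measure)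
      qed (use A sets.Int_space_eq2[OF A] prob_space in auto)
      finally have "expectation (\<lambda>\<omega>. min 1 (dist (?Y \<omega>) (Z \<omega>))) < e"
        using \<open>measure M A < \<epsilon>\<close> e unfolding \<epsilon>_def by linarith
      moreover have "0 \<le> expectation (\<lambda>\<omega>. min 1 (dist (?Y \<omega>) (Z \<omega>)))"
        by (intro Bochner_Integration.integral_nonneg) simp
      ultimately show ?case by (simp add: dist_real_def)
    qed
  qed
qed

lemma uniform_partition_in_prob:
  assumes "stoch_conv M L t Z" "0 \<le> t"
  shows "in_prob M (\<lambda>N. riemann (\<lambda>i. real i * (t / Suc N)) (Suc N)) Z"
proof (rule stoch_conv_in_prob[OF assms(1), where c = "\<lambda>N. t * (1 / Suc N)"])
  have "(\<lambda>N. t * (1 / Suc N)) \<longlonglongrightarrow> t * 0" by (intro tendsto_intros LIMSEQ_Suc lim_1_over_n)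
  then show "(\<lambda>N. t * (1 / Suc N)) \<longlonglongrightarrow> 0" by simp
  show "real i * (t / real (Suc N)) \<le> real (Suc i) * (t / real (Suc N))" for i N
    using assms(2) by (intro mult_right_mono) auto
  show "real (Suc i) * (t / real (Suc N)) - real i * (t / real (Suc N)) \<le> t * (1 / real (Suc N))" for i N
    by (simp add: algebra_simps add_divide_distrib)
qed auto

lemma in_prob_unique:
  fixes Z Z' :: "'w \<Rightarrow> hspace"
  assumes [measurable]: "Z \<in> borel_measurable M" "Z' \<in> borel_measurable M" "\<And>n. Y n \<in> borel_measurable M"
    and Y: "in_prob M Y Z" "in_prob M Y Z'"
  shows "AE \<omega> in M. Z \<omega> = Z' \<omega>"
proof -
  have "in_prob M (\<lambda>n. Z) Z'"
    by (rule in_prob_dist_le[OF _ _ _ _ _ _ Y])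
      (auto intro: dist_triangle3)
  then have "expectation (\<lambda>\<omega>. min 1 (dist (Z \<omega>) (Z' \<omega>))) = 0"
    by (simp add: in_prob_def LIMSEQ_const_iff)
  moreover have "integrable M (\<lambda>\<omega>. min 1 (dist (Z \<omega>) (Z' \<omega>)))" by (rule integrable_min_dist) auto
  ultimately have "AE \<omega> in M. min 1 (dist (Z \<omega>) (Z' \<omega>)) = 0"
    by (subst (asm) integral_nonneg_eq_0_iff_AE) auto
  then show ?thesis by eventually_elim (auto simp: min_def split: if_splits)
qed

text \<open>Every mild solution comes with its own version of the stochastic convolution. This lets
  one version serve all initial values.\<close>

lemma stoch_conv_unique:
  assumes "stoch_conv M L t Z" "stoch_conv M L t Z'" "0 \<le> t"
  shows "AE \<omega> in M. Z \<omega> = Z' \<omega>"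
proof (rule in_prob_unique[OF _ _ _ uniform_partition_in_prob[OF assms(1,3)] uniform_partition_in_prob[OF assms(2,3)]])
  show "riemann (\<lambda>i. real i * (t / real (Suc n))) (Suc n) \<in> borel_measurable M" for n
    using assms(3) by (intro riemann_measurable) (auto intro!: divide_right_mono mult_right_mono)
qed (use assms in \<open>auto simp: stoch_conv_def\<close>)

section \<open>Riemann sums over subintervals and refined partitions\<close>

definition block :: "real \<Rightarrow> real \<Rightarrow> nat \<Rightarrow> 'w \<Rightarrow> hspace" where
  "block s t N \<omega> = (\<Sum>i<N. heat ((t - s) - real i * ((t - s) / N))
     (L (s + real (Suc i) * ((t - s) / N)) \<omega> - L (s + real i * ((t - s) / N)) \<omega>))"

lemma block_measurable:
  assumes "0 \<le> s" "s \<le> t"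
  shows "block s t N \<in> borel_measurable M"
proof -
  have "(\<lambda>\<omega>. heat ((t - s) - real i * ((t - s) / N))
     (L (s + real (Suc i) * ((t - s) / N)) \<omega> - L (s + real i * ((t - s) / N)) \<omega>)) \<in> borel_measurable M" if i: "i < N" for i
  proof -
    have "real i * ((t - s) / N) \<le> real N * ((t - s) / N)" using assms i by (intro mult_right_mono) auto
    also have "\<dots> = t - s" using i by simp
    finally have "0 \<le> (t - s) - real i * ((t - s) / N)" by simp
    then have [measurable]: "heat ((t - s) - real i * ((t - s) / N)) \<in> borel_measurable borel"
      by (rule heat_measurable)
    have [measurable]: "L (s + real j * ((t - s) / N)) \<in> borel_measurable M" for j
      using assms by (intro L_measurable add_nonneg_nonneg mult_nonneg_nonneg) auto
    show ?thesis by measurable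
  qed
  then show ?thesis unfolding block_def[abs_def] by (intro borel_measurable_sum) auto
qed

text \<open>The sum is a fixed function of \<open>N\<close> independent increments over steps of
  equal length, and both the function and the common law of the increments depend on t - s
  alone.\<close>

lemma block_distr:
  assumes st: "0 \<le> s" "s \<le> t" and N: "N > 0"
  shows "distr M borel (block s t N) = distr M borel (block 0 (t - s) N)"
proof -
  define h where "h = (t - s) / N"
  have h: "h \<ge> 0" "real N * h = t - s" using st N by (auto simp: h_def)
  define F where "F w = (\<Sum>i<N. heat ((t - s) - real i * h) (w i))" for w :: "nat \<Rightarrow> hspace"
  have hi: "0 \<le> (t - s) - real i * h" if "i < N" for i
    using that h mult_right_mono[of "real i" "real N" h] by simp
  have F [measurable]: "F \<in> borel_measurable (PiM {..<N} (\<lambda>_. borel))"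
    unfolding F_def
  proof (rule borel_measurable_sum)
    fix i assume "i \<in> {..<N}"
    then have [measurable]: "heat ((t - s) - real i * h) \<in> borel_measurable borel" "(\<lambda>w. w i) \<in> borel_measurable (PiM {..<N} (\<lambda>_. borel))"
      using hi by auto
    show "(\<lambda>w. heat ((t - s) - real i * h) (w i)) \<in> borel_measurable (PiM {..<N} (\<lambda>_. borel))" by measurable
  qed
  have law: "distr M borel (block u (u + (t - s)) N) = distr (PiM {..<N} (\<lambda>_. distr M borel (L h))) borel F" if u: "0 \<le> u" for u
  proof -
    define D where "D i \<omega> = L (u + real (Suc i) * h) \<omega> - L (u + real i * h) \<omega>" for i \<omega>
    have uh: "0 \<le> u + real i * h" for i using u h by simp
    have [measurable]: "D i \<in> borel_measurable M" for i unfolding D_def using uh by measurable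
    have ind: "indep_vars (\<lambda>_. borel) D {..<N}"
      unfolding D_def
      by (rule L_indep_increments[of "\<lambda>i. u + real i * h"]) (use u h in \<open>auto intro!: mult_right_mono\<close>)
    have Dd: "distr M borel (D i) = distr M borel (L h)" for i
    proof -
      have "(u + real (Suc i) * h) - (u + real i * h) = h" by (simp add: algebra_simps)
      then show ?thesis
        unfolding D_def using L_stationary[of "u + real i * h" "u + real (Suc i) * h"] uh h
        by (simp add: mult_right_mono)
    qed
    have "distr M (PiM {..<N} (\<lambda>_. borel)) (\<lambda>\<omega>. \<lambda>i\<in>{..<N}. D i \<omega>) = PiM {..<N} (\<lambda>i. distr M borel (D i))"
      by (rule indep_vars_iff_distr_eq_PiM'[THEN iffD1, OF _ _ ind]) (use N in auto)
    also have "\<dots> = PiM {..<N} (\<lambda>_. distr M borel (L h))" by (simp add: Dd)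
    finally have e: "distr M (PiM {..<N} (\<lambda>_. borel)) (\<lambda>\<omega>. \<lambda>i\<in>{..<N}. D i \<omega>) = PiM {..<N} (\<lambda>_. distr M borel (L h))" .
    have m: "(\<lambda>\<omega>. \<lambda>i\<in>{..<N}. D i \<omega>) \<in> measurable M (PiM {..<N} (\<lambda>_. borel))" by measurable
    have "distr (PiM {..<N} (\<lambda>_. distr M borel (L h))) borel F = distr M borel (\<lambda>\<omega>. F (\<lambda>i\<in>{..<N}. D i \<omega>))"
      unfolding e[symmetric] using m by (simp add: distr_distr o_def)
    also have "(\<lambda>\<omega>. F (\<lambda>i\<in>{..<N}. D i \<omega>)) = block u (u + (t - s)) N"
      by (auto simp: F_def block_def D_def h_def fun_eq_iff)
    finally show ?thesis by simp
  qed
  show ?thesis using law[of s] law[of 0] st by simp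
qed

text \<open>Each interval of the partition \<open>r\<close> is cut into \<open>N\<close> equal
  pieces, numbered consecutively: index j N + i is the i-th point of the j-th interval.\<close>

definition refine :: "(nat \<Rightarrow> real) \<Rightarrow> nat \<Rightarrow> nat \<Rightarrow> real" where
  "refine r N q = r (q div N) + real (q mod N) * ((r (Suc (q div N)) - r (q div N)) / N)"

lemma refine_block: "i < N \<Longrightarrow> refine r N (j * N + i) = r j + real i * ((r (Suc j) - r j) / N)"
  by (simp add: refine_def)

lemma refine_block_Suc:
  assumes "i < N"
  shows "refine r N (Suc (j * N + i)) = r j + real (Suc i) * ((r (Suc j) - r j) / N)"
proof (cases "Suc i = N")
  case True
  then have e: "Suc (j * N + i) = Suc j * N + 0" by simp
  have "refine r N (Suc j * N + 0) = r (Suc j)"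
    using refine_block[of 0 N r "Suc j"] assms by simp
  moreover have "real (Suc i) * ((r (Suc j) - r j) / N) = r (Suc j) - r j"
    unfolding True using assms by simp
  ultimately show ?thesis unfolding e by simp
next
  case False
  then show ?thesis using refine_block[of "Suc i" N r j] assms by simp
qed

lemma refine_step:
  assumes "N > 0"
  shows "refine r N (Suc q) - refine r N q = (r (Suc (q div N)) - r (q div N)) / N"
proof -
  define j i where "j = q div N" and "i = q mod N"
  have q: "q = j * N + i" "i < N" using assms by (auto simp: j_def i_def)
  define X where "X = (r (Suc j) - r j) / N"
  have "refine r N q = r j + real i * X" "refine r N (Suc q) = r j + real (Suc i) * X"
    unfolding q(1) X_def by (rule refine_block[OF q(2)] refine_block_Suc[OF q(2)])+
  then have "refine r N (Suc q) - refine r N q = X" by (simp add: algebra_simps)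
  then show ?thesis by (simp add: X_def j_def)
qed

lemma sum_lessThan_add:
  "(\<Sum>q<a + k. f q) = (\<Sum>q<a. f q) + (\<Sum>i<k. f (a + i) :: 'b::comm_monoid_add)" for a k :: nat
  by (induction k) (simp_all add: add.assoc)

lemma block_eq_refine:
  "block (r j) (r (Suc j)) N \<omega> = (\<Sum>i<N. heat (r (Suc j) - refine r N (j * N + i))
     (L (refine r N (Suc (j * N + i))) \<omega> - L (refine r N (j * N + i)) \<omega>))"
  unfolding block_def by (intro sum.cong) (auto simp: refine_block refine_block_Suc diff_diff_eq)

text \<open>The flow property at the level of Riemann sums: the semigroup carries the sum up to
  \<open>r j\<close> forward, and the increments after \<open>r j\<close> form a block.\<close>

lemma riemann_refine_Suc:
  assumes N: "N > 0" and r: "\<And>i. i < Suc j \<Longrightarrow> r i \<le> r (Suc i)"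
  shows "riemann (refine r N) (Suc j * N) \<omega> = heat (r (Suc j) - r j) (riemann (refine r N) (j * N) \<omega>) + block (r j) (r (Suc j)) N \<omega>"
proof -
  define D where "D q = L (refine r N (Suc q)) \<omega> - L (refine r N q) \<omega>" for q
  have rj: "refine r N (k * N) = r k" for k using refine_block[of 0 N r k] N by simp
  have mono: "refine r N q \<le> refine r N (Suc q)" if "q < Suc j * N" for q
  proof -
    have "q div N < Suc j" using that by (simp add: less_mult_imp_div_less)
    then have "(r (Suc (q div N)) - r (q div N)) / N \<ge> 0" using r by simp
    then show ?thesis using refine_step[OF N, of r q] by linarith
  qed
  have le: "refine r N q \<le> r j" if "q < j * N" for q
    using partition_mono[of "j * N" "refine r N" q "j * N"] mono that by (simp add: rj)
  have "riemann (refine r N) (Suc j * N) \<omega> = (\<Sum>q<j * N + N. heat (r (Suc j) - refine r N q) (D q))"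
    unfolding riemann_def rj D_def by (simp add: add.commute)
  also have "\<dots> = (\<Sum>q<j * N. heat (r (Suc j) - refine r N q) (D q)) + (\<Sum>i<N. heat (r (Suc j) - refine r N (j * N + i)) (D (j * N + i)))"
    by (rule sum_lessThan_add)
  also have "(\<Sum>q<j * N. heat (r (Suc j) - refine r N q) (D q)) = heat (r (Suc j) - r j) (riemann (refine r N) (j * N) \<omega>)"
  proof -
    have "r (Suc j) - r j \<ge> 0" using r[of j] by simp
    then have "heat (r (Suc j) - r j) (riemann (refine r N) (j * N) \<omega>) =
        (\<Sum>q<j * N. heat (r (Suc j) - r j) (heat (r j - refine r N q) (D q)))"
      unfolding riemann_def rj D_def by (intro linear_sum bounded_linear.linear bounded_linear_heat)
    also have "\<dots> = (\<Sum>q<j * N. heat (r (Suc j) - refine r N q) (D q))"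
      using r[of j] le by (intro sum.cong) (auto simp: heat_heat)
    finally show ?thesis by simp
  qed
  finally show ?thesis by (simp add: block_eq_refine D_def)
qed

lemma riemann_refine_in_prob:
  assumes r: "r 0 = 0" "\<And>i. i < m \<Longrightarrow> r i \<le> r (Suc i)" and j: "j \<le> m"
    and Z: "stoch_conv M L (r j) Z"
  shows "in_prob M (\<lambda>N. riemann (refine r (Suc N)) (j * Suc N)) Z"
proof (rule stoch_conv_in_prob[OF Z, where c = "\<lambda>N. r m * (1 / Suc N)"])
  have le: "q div Suc N < m" if "q < j * Suc N" for q N
    using that j by (metis less_mult_imp_div_less order_less_le_trans)
  show "refine r (Suc N) 0 = 0" for N using refine_block[of 0 "Suc N" r 0] r by simp
  show "refine r (Suc N) (j * Suc N) = r j" for N using refine_block[of 0 "Suc N" r j] by simp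
  show "refine r (Suc N) q \<le> refine r (Suc N) (Suc q)" if "q < j * Suc N" for q N
  proof -
    have "0 \<le> (r (Suc (q div Suc N)) - r (q div Suc N)) / Suc N" using r(2)[OF le[OF that]] by simp
    then show ?thesis using refine_step[of "Suc N" r q] by linarith
  qed
  show "refine r (Suc N) (Suc q) - refine r (Suc N) q \<le> r m * (1 / Suc N)" if "q < j * Suc N" for q N
  proof -
    have "r (Suc (q div Suc N)) \<le> r m" "r 0 \<le> r (q div Suc N)"
      using partition_mono[of m r "Suc (q div Suc N)" m] partition_mono[of m r 0 "q div Suc N"] r(2) le[OF that]
      by auto
    then have "(r (Suc (q div Suc N)) - r (q div Suc N)) / Suc N \<le> r m / Suc N"
      using r by (intro divide_right_mono) auto
    then show ?thesis using refine_step[of "Suc N" r q] by simp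
  qed
  have "(\<lambda>N. r m * (1 / Suc N)) \<longlonglongrightarrow> r m * 0" by (intro tendsto_intros LIMSEQ_Suc lim_1_over_n)
  then show "(\<lambda>N. r m * (1 / Suc N)) \<longlonglongrightarrow> 0" by simp
qed

end

locale noise_conv = stable_noise M \<alpha> b l for M :: "'w measure" and \<alpha> b l +
  fixes Z :: "real \<Rightarrow> 'w \<Rightarrow> hspace"
  assumes Z: "\<And>t. 0 \<le> t \<Longrightarrow> stoch_conv M L t (Z t)"
begin

text \<open>The noise entering the mild equation when it is restarted at time \<open>s\<close>.\<close>

definition W :: "real \<Rightarrow> real \<Rightarrow> 'w \<Rightarrow> hspace" where
  "W s t \<omega> = Z t \<omega> - heat (t - s) (Z s \<omega>)"

lemma Z_measurable [measurable]: "0 \<le> t \<Longrightarrow> Z t \<in> borel_measurable M"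
  using Z[of t] by (simp add: stoch_conv_def)

lemma W_measurable: "0 \<le> s \<Longrightarrow> s \<le> t \<Longrightarrow> W s t \<in> borel_measurable M"
  unfolding W_def by measurable

text \<open>A block is the Riemann sum up to the right endpoint minus the heat image of the sum up
  to the left one. Both sums converge in probability, and heat is nonexpansive.\<close>

lemma block_in_prob:
  assumes r: "r 0 = 0" "\<And>i. i < m \<Longrightarrow> r i \<le> r (Suc i)" and j: "j < m"
  shows "in_prob M (\<lambda>N. block (r j) (r (Suc j)) (Suc N)) (W (r j) (r (Suc j)))"
proof -
  have r0: "0 \<le> r j" "r j \<le> r (Suc j)" "0 \<le> r (Suc j)"
    using partition_mono[of m r 0 j, OF r(2)] r(2)[of j] r(1) j by auto
  have rm: "riemann (refine r (Suc N)) (k * Suc N) \<in> borel_measurable M" if "k \<le> m" for k N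
  proof (rule riemann_measurable)
    show "0 \<le> refine r (Suc N) 0" using refine_block[of 0 "Suc N" r 0] r by simp
    fix q assume "q < k * Suc N"
    then have "q div Suc N < m" using that by (metis less_mult_imp_div_less order_less_le_trans)
    then have "0 \<le> (r (Suc (q div Suc N)) - r (q div Suc N)) / Suc N" using r(2) by simp
    then show "refine r (Suc N) q \<le> refine r (Suc N) (Suc q)" using refine_step[of "Suc N" r q] by linarith
  qed
  show ?thesis
  proof (rule in_prob_dist_le[where Y' = "\<lambda>N. riemann (refine r (Suc N)) (Suc j * Suc N)" and Z' = "Z (r (Suc j))"
        and Y'' = "\<lambda>N. riemann (refine r (Suc N)) (j * Suc N)" and Z'' = "Z (r j)"])
    show "in_prob M (\<lambda>N. riemann (refine r (Suc N)) (Suc j * Suc N)) (Z (r (Suc j)))"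
      by (rule riemann_refine_in_prob[OF r]) (use j r0 Z in auto)
    show "in_prob M (\<lambda>N. riemann (refine r (Suc N)) (j * Suc N)) (Z (r j))"
      by (rule riemann_refine_in_prob[OF r]) (use j r0 Z in auto)
    fix N
    show "AE \<omega> in M. dist (block (r j) (r (Suc j)) (Suc N) \<omega>) (W (r j) (r (Suc j)) \<omega>) \<le>
       dist (riemann (refine r (Suc N)) (Suc j * Suc N) \<omega>) (Z (r (Suc j)) \<omega>) + dist (riemann (refine r (Suc N)) (j * Suc N) \<omega>) (Z (r j) \<omega>)"
    proof (rule AE_I2)
      fix \<omega>
      define R where "R = riemann (refine r (Suc N)) (Suc j * Suc N) \<omega>"
      define R' where "R' = riemann (refine r (Suc N)) (j * Suc N) \<omega>"
      have d: "0 \<le> r (Suc j) - r j" using r0 by simp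
      have B: "block (r j) (r (Suc j)) (Suc N) \<omega> = R - heat (r (Suc j) - r j) R'"
        unfolding R_def R'_def by (subst riemann_refine_Suc) (use r(2) j in auto)
      have "dist (block (r j) (r (Suc j)) (Suc N) \<omega>) (W (r j) (r (Suc j)) \<omega>) =
         norm ((R - Z (r (Suc j)) \<omega>) - heat (r (Suc j) - r j) (R' - Z (r j) \<omega>))"
        unfolding B W_def dist_norm heat_diff[OF d] by (simp add: algebra_simps)
      also have "\<dots> \<le> norm (R - Z (r (Suc j)) \<omega>) + norm (heat (r (Suc j) - r j) (R' - Z (r j) \<omega>))"
        by (rule norm_triangle_ineq4)
      also have "\<dots> \<le> dist R (Z (r (Suc j)) \<omega>) + dist R' (Z (r j) \<omega>)"
        unfolding dist_norm by (intro add_left_mono norm_heat_le d)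
      finally show "dist (block (r j) (r (Suc j)) (Suc N) \<omega>) (W (r j) (r (Suc j)) \<omega>) \<le>
         dist (riemann (refine r (Suc N)) (Suc j * Suc N) \<omega>) (Z (r (Suc j)) \<omega>) + dist (riemann (refine r (Suc N)) (j * Suc N) \<omega>) (Z (r j) \<omega>)"
        by (simp only: R_def R'_def)
    qed
    show "riemann (refine r (Suc N)) (Suc j * Suc N) \<in> borel_measurable M" for N
      using j by (intro rm) simp
    show "riemann (refine r (Suc N)) (j * Suc N) \<in> borel_measurable M" for N
      using j by (intro rm) simp
  qed (use r0 block_measurable W_measurable in auto)
qed

text \<open>Blocks over successive intervals are functions of disjoint groups of independent noise
  increments, and independence passes to their limits in probability.\<close>

lemma W_indep:
  assumes r: "r 0 = 0" "\<And>i. i < m \<Longrightarrow> r i \<le> r (Suc i)"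
  shows "indep_vars (\<lambda>_. borel) (\<lambda>j. W (r j) (r (Suc j))) {..<m}"
proof (rule indep_vars_in_prob[where Y = "\<lambda>N j. block (r j) (r (Suc j)) (Suc N)"])
  have r0: "0 \<le> r j" "r j \<le> r (Suc j)" if "j < m" for j
    using partition_mono[of m r 0 j, OF r(2)] r(2)[of j] r(1) that by auto
  show "W (r j) (r (Suc j)) \<in> borel_measurable M" if "j \<in> {..<m}" for j
    using r0[of j] that by (intro W_measurable) auto
  show "in_prob M (\<lambda>N. block (r j) (r (Suc j)) (Suc N)) (W (r j) (r (Suc j)))" if "j \<in> {..<m}" for j
    using block_in_prob[OF r] that by auto
  fix N
  define p where "p = refine r (Suc N)"
  have "indep_vars (\<lambda>_. borel) (\<lambda>q \<omega>. L (p (Suc q)) \<omega> - L (p q) \<omega>) {..<m * Suc N}"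
  proof (rule L_indep_increments)
    show "0 \<le> p 0" using refine_block[of 0 "Suc N" r 0] r by (simp add: p_def)
    fix q assume "q < m * Suc N"
    then have "q div Suc N < m" by (rule less_mult_imp_div_less)
    then have "0 \<le> (r (Suc (q div Suc N)) - r (q div Suc N)) / Suc N" using r(2) by simp
    then show "p q \<le> p (Suc q)" using refine_step[of "Suc N" r q] unfolding p_def by linarith
  qed
  then have "indep_vars (\<lambda>j. PiM {j * Suc N..<j * Suc N + Suc N} (\<lambda>_. borel))
     (\<lambda>j \<omega>. restrict (\<lambda>q. L (p (Suc q)) \<omega> - L (p q) \<omega>) {j * Suc N..<j * Suc N + Suc N}) {..<m}"
  proof (rule indep_vars_restrict)
    fix j assume "j \<in> {..<m}"
    then have "Suc j * Suc N \<le> m * Suc N" by (intro mult_le_mono1) auto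
    then show "{j * Suc N..<j * Suc N + Suc N} \<subseteq> {..<m * Suc N}" by auto
  next
    show "disjoint_family_on (\<lambda>j. {j * Suc N..<j * Suc N + Suc N}) {..<m}"
      unfolding disjoint_family_on_def
    proof (intro ballI impI)
      fix i j :: nat assume "i \<noteq> j"
      have "q div Suc N = k" if "q \<in> {k * Suc N..<k * Suc N + Suc N}" for q k
        using that by (intro div_nat_eqI) (auto simp: mult.commute)
      then show "{i * Suc N..<i * Suc N + Suc N} \<inter> {j * Suc N..<j * Suc N + Suc N} = {}"
        using \<open>i \<noteq> j\<close> by blast
    qed
  qed
  then have "indep_vars (\<lambda>_. borel) (\<lambda>j \<omega>. (\<lambda>w. \<Sum>i<Suc N. heat (r (Suc j) - p (j * Suc N + i)) (w (j * Suc N + i)))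
     (restrict (\<lambda>q. L (p (Suc q)) \<omega> - L (p q) \<omega>) {j * Suc N..<j * Suc N + Suc N})) {..<m}"
  proof (rule indep_vars_compose2)
    fix j assume j: "j \<in> {..<m}"
    show "(\<lambda>w. \<Sum>i<Suc N. heat (r (Suc j) - p (j * Suc N + i)) (w (j * Suc N + i)))
      \<in> borel_measurable (PiM {j * Suc N..<j * Suc N + Suc N} (\<lambda>_. borel))"
    proof (rule borel_measurable_sum)
      fix i assume i: "i \<in> {..<Suc N}"
      have "real i * ((r (Suc j) - r j) / Suc N) \<le> real (Suc N) * ((r (Suc j) - r j) / Suc N)"
        using i r0(2)[of j] j by (intro mult_right_mono) auto
      then have "0 \<le> r (Suc j) - p (j * Suc N + i)"
        using i by (simp add: p_def refine_block del: of_nat_Suc mult_Suc_right)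
      then have [measurable]: "heat (r (Suc j) - p (j * Suc N + i)) \<in> borel_measurable borel"
        "(\<lambda>w. w (j * Suc N + i)) \<in> borel_measurable (PiM {j * Suc N..<j * Suc N + Suc N} (\<lambda>_. borel))"
        using i by (auto intro!: measurable_component_singleton)
      show "(\<lambda>w. heat (r (Suc j) - p (j * Suc N + i)) (w (j * Suc N + i)))
        \<in> borel_measurable (PiM {j * Suc N..<j * Suc N + Suc N} (\<lambda>_. borel))" by measurable
    qed
  qed
  then show "indep_vars (\<lambda>_. borel) (\<lambda>j. block (r j) (r (Suc j)) (Suc N)) {..<m}"
    by (rule indep_vars_cong[THEN iffD1, rotated -1])
      (auto simp: block_eq_refine p_def fun_eq_iff simp del: mult_Suc_right sum.lessThan_Suc intro!: sum.cong)
qed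

lemma W_distr:
  assumes st: "0 \<le> s" "s \<le> t"
  shows "distr M borel (W s t) = distr M borel (Z (t - s))"
proof (rule distr_eq_in_prob[where Y = "\<lambda>N. block s t (Suc N)" and Y' = "\<lambda>N. block 0 (t - s) (Suc N)"])
  show "distr M borel (block s t (Suc N)) = distr M borel (block 0 (t - s) (Suc N))" for N
    by (rule block_distr[OF st]) simp
  \<comment> \<open>The partition 0, s, t, in which [s, t] is the second interval; block convergence
    is stated for partitions that start at 0.\<close>
  define r where "r i = (if i = 0 then 0 else if i = 1 then s else t)" for i :: nat
  have "in_prob M (\<lambda>N. block (r 1) (r (Suc 1)) (Suc N)) (W (r 1) (r (Suc 1)))"
    by (rule block_in_prob[where m = 2]) (use st in \<open>auto simp: r_def\<close>)
  then show "in_prob M (\<lambda>N. block s t (Suc N)) (W s t)" by (simp add: r_def)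
  have "riemann (\<lambda>i. real i * ((t - s) / Suc N)) (Suc N) = block 0 (t - s) (Suc N)" for N
    by (auto simp: riemann_def block_def fun_eq_iff simp del: of_nat_Suc sum.lessThan_Suc)
  then show "in_prob M (\<lambda>N. block 0 (t - s) (Suc N)) (Z (t - s))"
    using uniform_partition_in_prob[OF Z[of "t - s"]] st by simp
qed (use st in \<open>auto intro!: block_measurable W_measurable\<close>)

end

section \<open>Contraction and the Markov property\<close>

locale sde = noise_conv M \<alpha> b l Z for M :: "'w measure" and \<alpha> b l Z +
  fixes X :: "hspace \<Rightarrow> real \<Rightarrow> 'w \<Rightarrow> hspace"
  assumes mild: "\<And>x. mild_solution M L x (X x)"
begin

lemma X_measurable [measurable]: "0 \<le> t \<Longrightarrow> X x t \<in> borel_measurable M"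
  using mild[of x] by (simp add: mild_solution_def)

lemma X_0: "AE \<omega> in M. X x 0 \<omega> = x"
  using mild[of x] by (simp add: mild_solution_def)

lemma X_cadlag: "AE \<omega> in M. cadlag (\<lambda>t. X x t \<omega>) \<and> cadlag_V (\<lambda>t. X x t \<omega>)"
  using mild[of x] by (simp add: mild_solution_def)

text \<open>The private convolution of the solution is exchanged for the common \<open>Z\<close> at
  the two times s and t. The exceptional set depends on these times, so later uses are confined to
  countably many of them.\<close>

lemma X_flow:
  assumes st: "0 \<le> s" "s \<le> t"
  shows "AE \<omega> in M. set_integrable lborel {s..t} (\<lambda>u. heat (t - u) (nonlin (X x u \<omega>))) \<and>
    X x t \<omega> = heat (t - s) (X x s \<omega>) - (LINT u:{s..t}|lborel. heat (t - u) (nonlin (X x u \<omega>))) + W s t \<omega>"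
proof -
  obtain Z' where Z': "\<And>t. t \<ge> 0 \<Longrightarrow> stoch_conv M L t (Z' t)"
    and eq: "AE \<omega> in M. \<forall>t\<ge>0. set_integrable lborel {0..t} (\<lambda>s. heat (t - s) (nonlin (X x s \<omega>))) \<and>
           X x t \<omega> = heat t x - (LINT s:{0..t}|lborel. heat (t - s) (nonlin (X x s \<omega>))) + Z' t \<omega>"
    using mild[of x] unfolding mild_solution_def by blast
  have t: "0 \<le> t" using st by simp
  from eq stoch_conv_unique[OF Z'[OF st(1)] Z[OF st(1)] st(1)] stoch_conv_unique[OF Z'[OF t] Z[OF t] t]
  show ?thesis
  proof eventually_elim
    case (elim \<omega>)
    from elim(1) st t have
      "set_integrable lborel {0..t} (\<lambda>u. heat (t - u) (nonlin (X x u \<omega>)))"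
      "set_integrable lborel {0..s} (\<lambda>u. heat (s - u) (nonlin (X x u \<omega>)))"
      "X x t \<omega> = heat t x - (LINT u:{0..t}|lborel. heat (t - u) (nonlin (X x u \<omega>))) + Z t \<omega>"
      "X x s \<omega> = heat s x - (LINT u:{0..s}|lborel. heat (s - u) (nonlin (X x u \<omega>))) + Z s \<omega>"
      using elim(2,3) by auto
    from mild_flow[OF st this] show ?case by (simp add: W_def)
  qed
qed

text \<open>All grid times for all step numbers are countable, so one null set suffices. The start
  \<open>r\<close> is positive because the path is bounded in the sup norm only on intervals away
  from 0.\<close>

lemma eul_conv:
  assumes r: "r > 0" and t: "t > 0"
  shows "AE \<omega> in M. (\<lambda>n. eul (t / Suc n) (Suc n) (X x r \<omega>)
     (\<lambda>i. W (r + real i * (t / Suc n)) (r + real (Suc i) * (t / Suc n)) \<omega>)) \<longlonglongrightarrow> X x (r + t) \<omega>"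
proof -
  have fl: "AE \<omega> in M. \<forall>n i. set_integrable lborel {r + real i * (t / Suc n)..r + real (Suc i) * (t / Suc n)}
         (\<lambda>u. heat (r + real (Suc i) * (t / Suc n) - u) (nonlin (X x u \<omega>))) \<and>
      X x (r + real (Suc i) * (t / Suc n)) \<omega> = heat (r + real (Suc i) * (t / Suc n) - (r + real i * (t / Suc n))) (X x (r + real i * (t / Suc n)) \<omega>)
        - (LINT u:{r + real i * (t / Suc n)..r + real (Suc i) * (t / Suc n)}|lborel. heat (r + real (Suc i) * (t / Suc n) - u) (nonlin (X x u \<omega>)))
        + W (r + real i * (t / Suc n)) (r + real (Suc i) * (t / Suc n)) \<omega>"
    unfolding AE_all_countable
  proof (intro allI X_flow)
    fix n i :: nat
    show "0 \<le> r + real i * (t / real (Suc n))" using r t by simp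
    show "r + real i * (t / real (Suc n)) \<le> r + real (Suc i) * (t / real (Suc n))"
      using t by (intro add_left_mono mult_right_mono) auto
  qed
  from fl X_cadlag[of x] show ?thesis
  proof eventually_elim
    case (elim \<omega>)
    have sub: "r + real (Suc i) * (t / Suc n) - (r + real i * (t / Suc n)) = t / Suc n" for i n
      by (simp add: algebra_simps add_divide_distrib)
    obtain R where R: "R \<ge> 1" "\<And>s. s \<in> {r..r + t} \<Longrightarrow> bounded_by R (X x s \<omega>)"
      using cadlag_V_bounded[of "\<lambda>t. X x t \<omega>" r "r + t"] elim(2) r t by auto
    show ?case
    proof (rule eul_converges[OF t R])
      show "((\<lambda>t. X x t \<omega>) \<longlongrightarrow> X x s \<omega>) (at_right s)" if "s \<in> {r..<r + t}" for s
        using elim(2) that r by (auto simp: cadlag_def)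
    next
      fix n i :: nat
      show "set_integrable lborel {r + real i * (t / Suc n)..r + real (Suc i) * (t / Suc n)}
         (\<lambda>u. heat (r + real (Suc i) * (t / Suc n) - u) (nonlin (X x u \<omega>)))"
        using elim(1) by blast
      show "X x (r + real (Suc i) * (t / Suc n)) \<omega> = heat (t / Suc n) (X x (r + real i * (t / Suc n)) \<omega>)
        - (LINT u:{r + real i * (t / Suc n)..r + real (Suc i) * (t / Suc n)}|lborel. heat (r + real (Suc i) * (t / Suc n) - u) (nonlin (X x u \<omega>)))
        + W (r + real i * (t / Suc n)) (r + real (Suc i) * (t / Suc n)) \<omega>"
        using elim(1)[THEN spec[of _ n], THEN spec[of _ i]] unfolding sub by blast
    qed
  qed
qed

lemma X_right_cont_0: "AE \<omega> in M. ((\<lambda>t. X x t \<omega>) \<longlongrightarrow> x) (at_right 0)"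
  using X_cadlag[of x] X_0[of x] by eventually_elim (auto simp: cadlag_def)

text \<open>A path is known to be \<open>V\<close>-valued, hence bounded, at positive times only. The scheme is therefore
  started at \<open>eps t j\<close>, and \<open>j\<close> tends to infinity afterwards.\<close>

definition eps :: "real \<Rightarrow> nat \<Rightarrow> real" where
  "eps t j = t / real (j + 2)"

lemma eps:
  assumes "t > 0"
  shows "0 < eps t j" "eps t j < t"
proof -
  show "0 < eps t j" using assms by (simp add: eps_def)
  have "t * 1 < t * real (j + 2)" using assms by (intro mult_strict_left_mono) auto
  then show "eps t j < t" by (simp add: eps_def pos_divide_less_eq)
qed

lemma eps_LIMSEQ: "eps t \<longlonglongrightarrow> 0"
proof -
  have "(\<lambda>j. t * (1 / real (j + 2))) \<longlonglongrightarrow> t * 0"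
    by (intro tendsto_intros LIMSEQ_ignore_initial_segment[OF lim_1_over_n])
  then show ?thesis by (simp add: eps_def[abs_def])
qed

lemma eps_at_right: "t > 0 \<Longrightarrow> filterlim (eps t) (at_right 0) sequentially"
  by (intro tendsto_imp_filterlim_at_right eps_LIMSEQ always_eventually allI eps)

text \<open>Both solutions are limits of the scheme with the same noise, so the two estimates pass
  to the limit n to infinity on [\<open>eps t j\<close>, t]; right continuity at 0 then allows j to
  tend to infinity.\<close>

lemma X_contract:
  assumes t: "t > 0"
  shows "AE \<omega> in M. norm (X x t \<omega> - X y t \<omega>) \<le> exp (- t) * norm (x - y) \<and> (norm (X x t \<omega> - X y t \<omega>))\<^sup>2 \<le> 2 / t"
proof -
  have "AE \<omega> in M. \<forall>j. (\<lambda>n. eul ((t - eps t j) / Suc n) (Suc n) (X x (eps t j) \<omega>)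
     (\<lambda>i. W (eps t j + real i * ((t - eps t j) / Suc n)) (eps t j + real (Suc i) * ((t - eps t j) / Suc n)) \<omega>)) \<longlonglongrightarrow> X x (eps t j + (t - eps t j)) \<omega>" for x
    unfolding AE_all_countable using eps[OF t] by (intro allI eul_conv) auto
  from this[of x] this[of y] X_right_cont_0[of x] X_right_cont_0[of y] show ?thesis
  proof eventually_elim
    case (elim \<omega>)
    define d where "d j = norm (X x (eps t j) \<omega> - X y (eps t j) \<omega>)" for j
    have c: "norm (X x t \<omega> - X y t \<omega>) \<le> exp (- (t - eps t j)) * d j \<and> (norm (X x t \<omega> - X y t \<omega>))\<^sup>2 \<le> 2 / (t - eps t j)" for j
    proof -
      define w where "w n = (\<lambda>i. W (eps t j + real i * ((t - eps t j) / Suc n)) (eps t j + real (Suc i) * ((t - eps t j) / Suc n)) \<omega>)" for n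
      define h where "h n = (t - eps t j) / Suc n" for n
      have h: "h n > 0" "real (Suc n) * h n = t - eps t j" for n using eps[OF t, of j] by (auto simp: h_def)
      have lim: "(\<lambda>n. eul (h n) (Suc n) (X x (eps t j) \<omega>) (w n)) \<longlonglongrightarrow> X x t \<omega>"
        "(\<lambda>n. eul (h n) (Suc n) (X y (eps t j) \<omega>) (w n)) \<longlonglongrightarrow> X y t \<omega>"
        using elim(1)[rule_format, of j] elim(2)[rule_format, of j] by (simp_all add: h_def w_def)
      have l1: "(\<lambda>n. norm (eul (h n) (Suc n) (X x (eps t j) \<omega>) (w n) - eul (h n) (Suc n) (X y (eps t j) \<omega>) (w n))) \<longlonglongrightarrow> norm (X x t \<omega> - X y t \<omega>)"
        by (intro tendsto_intros lim)
      have l2: "(\<lambda>n. (norm (eul (h n) (Suc n) (X x (eps t j) \<omega>) (w n) - eul (h n) (Suc n) (X y (eps t j) \<omega>) (w n)))\<^sup>2) \<longlonglongrightarrow> (norm (X x t \<omega> - X y t \<omega>))\<^sup>2"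
        by (intro tendsto_power l1)
      have "norm (eul (h n) (Suc n) (X x (eps t j) \<omega>) (w n) - eul (h n) (Suc n) (X y (eps t j) \<omega>) (w n)) \<le> exp (- (t - eps t j)) * d j" for n
        using eul_contract[of "h n" "Suc n" "X x (eps t j) \<omega>" "w n" "X y (eps t j) \<omega>"] h[of n] unfolding h(2) d_def by simp
      moreover have "(norm (eul (h n) (Suc n) (X x (eps t j) \<omega>) (w n) - eul (h n) (Suc n) (X y (eps t j) \<omega>) (w n)))\<^sup>2 \<le> 2 / (t - eps t j)" for n
        using eul_bounded_diff[OF h(1), of "Suc n" n] unfolding h(2) by simp
      ultimately show ?thesis
        using LIMSEQ_le_const2[OF l1] LIMSEQ_le_const2[OF l2] by blast
    qed
    have "d \<longlonglongrightarrow> norm (x - y)"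
      unfolding d_def using filterlim_compose[OF elim(3) eps_at_right[OF t]] filterlim_compose[OF elim(4) eps_at_right[OF t]]
      by (intro tendsto_intros)
    then have e1: "(\<lambda>j. exp (- (t - eps t j)) * d j) \<longlonglongrightarrow> exp (- (t - 0)) * norm (x - y)"
      by (intro tendsto_intros eps_LIMSEQ)
    have e2: "(\<lambda>j. 2 / (t - eps t j)) \<longlonglongrightarrow> 2 / (t - 0)"
      using t by (intro tendsto_intros eps_LIMSEQ) auto
    have "norm (X x t \<omega> - X y t \<omega>) \<le> exp (- (t - 0)) * norm (x - y)"
      by (rule LIMSEQ_le_const[OF e1]) (use c in blast)
    moreover have "(norm (X x t \<omega> - X y t \<omega>))\<^sup>2 \<le> 2 / (t - 0)"
      by (rule LIMSEQ_le_const[OF e2]) (use c in blast)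
    ultimately show ?case by simp
  qed
qed

lemma X_nonexpansive: "t > 0 \<Longrightarrow> AE \<omega> in M. dist (X x t \<omega>) (X y t \<omega>) \<le> dist x y"
proof -
  assume t: "t > 0"
  have "exp (- t) * norm (x - y) \<le> 1 * norm (x - y)" using t by (intro mult_right_mono) auto
  with X_contract[OF t, of x y] show ?thesis by (auto simp: dist_norm elim!: eventually_mono)
qed

abbreviation P :: "real \<Rightarrow> (hspace \<Rightarrow> real) \<Rightarrow> hspace \<Rightarrow> real" where
  "P t f y \<equiv> transition_op M X t f y"

text \<open>Two constants are kept apart: \<open>K\<close> records that \<open>f\<close> is a test
  function, while \<open>c\<close> is a Lipschitz constant that may be far smaller, as happens under
  iteration.\<close>

lemma P_contract:
  assumes t: "t > 0" and f: "test_fun K f" "\<And>x y. \<bar>f x - f y\<bar> \<le> c * dist x y" and c: "c \<ge> 0"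
  shows "\<bar>P t f x - P t f y\<bar> \<le> c * exp (- t) * dist x y" "\<bar>P t f x - P t f y\<bar> \<le> c * sqrt (2 / t)"
proof -
  have i: "integrable M (\<lambda>\<omega>. f (X x t \<omega>))" for x
    using t by (intro integrable_test_fun[OF f(1)]) simp
  have *: "\<bar>P t f x - P t f y\<bar> \<le> B" if "AE \<omega> in M. \<bar>f (X x t \<omega>) - f (X y t \<omega>)\<bar> \<le> B" for B
  proof -
    have "\<bar>P t f x - P t f y\<bar> = \<bar>expectation (\<lambda>\<omega>. f (X x t \<omega>) - f (X y t \<omega>))\<bar>"
      using i by (simp add: transition_op_def)
    also have "\<dots> \<le> expectation (\<lambda>\<omega>. \<bar>f (X x t \<omega>) - f (X y t \<omega>)\<bar>)"
      using integral_norm_bound[of M "\<lambda>\<omega>. f (X x t \<omega>) - f (X y t \<omega>)"] by simp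
    also have "\<dots> \<le> expectation (\<lambda>\<omega>. B)"
      by (rule integral_mono_AE) (use i that in auto)
    finally show ?thesis by (simp add: prob_space)
  qed
  show "\<bar>P t f x - P t f y\<bar> \<le> c * exp (- t) * dist x y"
  proof (rule *)
    from X_contract[OF t, of x y] show "AE \<omega> in M. \<bar>f (X x t \<omega>) - f (X y t \<omega>)\<bar> \<le> c * exp (- t) * dist x y"
    proof eventually_elim
      case (elim \<omega>)
      have "\<bar>f (X x t \<omega>) - f (X y t \<omega>)\<bar> \<le> c * dist (X x t \<omega>) (X y t \<omega>)" by (rule f(2))
      also have "\<dots> \<le> c * (exp (- t) * dist x y)" using elim c by (intro mult_left_mono) (auto simp: dist_norm)
      finally show ?case by (simp add: mult.assoc)
    qed
  qed
  show "\<bar>P t f x - P t f y\<bar> \<le> c * sqrt (2 / t)"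
  proof (rule *)
    from X_contract[OF t, of x y] show "AE \<omega> in M. \<bar>f (X x t \<omega>) - f (X y t \<omega>)\<bar> \<le> c * sqrt (2 / t)"
    proof eventually_elim
      case (elim \<omega>)
      have "\<bar>f (X x t \<omega>) - f (X y t \<omega>)\<bar> \<le> c * dist (X x t \<omega>) (X y t \<omega>)" by (rule f(2))
      also have "\<dots> \<le> c * sqrt (2 / t)"
        using elim c by (intro mult_left_mono) (auto simp: dist_norm intro: real_le_rsqrt)
      finally show ?case .
    qed
  qed
qed

lemma P_test_fun:
  assumes t: "t > 0" and f: "test_fun K f"
  shows "test_fun K (P t f)"
  unfolding test_fun_def
proof (intro conjI allI)
  have K: "K \<ge> 1" and fl: "\<And>x y. \<bar>f x - f y\<bar> \<le> K * dist x y" using f by (auto simp: test_fun_def)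
  then show "1 \<le> K" by simp
  fix x y :: hspace
  have "K * exp (- t) * dist x y \<le> K * 1 * dist x y"
    using K t by (intro mult_right_mono mult_left_mono) auto
  then have le: "K * exp (- t) * dist x y \<le> K * dist x y" by (simp only: mult_1_right)
  have "\<bar>P t f x - P t f y\<bar> \<le> K * exp (- t) * dist x y"
    by (rule P_contract(1)[OF t f fl]) (use K in simp)
  then show "\<bar>P t f x - P t f y\<bar> \<le> K * dist x y" using le by (rule order_trans)
  have i: "integrable M (\<lambda>\<omega>. f (X x t \<omega>))"
    using t by (intro integrable_test_fun[OF f]) simp
  show "0 \<le> P t f x"
    unfolding transition_op_def using test_fun_range[OF f] by (intro Bochner_Integration.integral_nonneg) auto
  have "P t f x \<le> expectation (\<lambda>\<omega>. 1)"
    unfolding transition_op_def using i test_fun_range[OF f] by (intro integral_mono) auto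
  then show "P t f x \<le> 1" by (simp add: prob_space)
qed

section \<open>Noise vectors over time grids\<close>

definition Wv :: "real \<Rightarrow> real \<Rightarrow> nat \<Rightarrow> 'w \<Rightarrow> nat \<Rightarrow> hspace" where
  "Wv a h m \<omega> = (\<lambda>i\<in>{..<m}. W (a + real i * h) (a + real (Suc i) * h) \<omega>)"

lemma Wv_measurable [measurable]: "0 \<le> a \<Longrightarrow> 0 \<le> h \<Longrightarrow> Wv a h m \<in> measurable M (PiM {..<m} (\<lambda>_. borel))"
  unfolding Wv_def by (intro measurable_restrict W_measurable) (auto intro!: mult_right_mono)

lemma reaction_measurable [measurable]: "h \<ge> 0 \<Longrightarrow> reaction h \<in> borel_measurable borel"
proof (rule borel_measurable_continuous_onI)
  assume h: "h \<ge> 0"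
  have "(sqrt (1 + 2 * h))-lipschitz_on UNIV (reaction h)"
  proof (rule lipschitz_onI)
    fix u v
    have "(norm (reaction h u - reaction h v))\<^sup>2 \<le> (1 + 2 * h) * (norm (u - v))\<^sup>2"
      by (rule order_trans[OF reaction_diff_sq[OF h] damp_le[OF h]]) simp
    also have "\<dots> = (sqrt (1 + 2 * h) * norm (u - v))\<^sup>2" using h by (simp add: power_mult_distrib)
    finally show "dist (reaction h u) (reaction h v) \<le> sqrt (1 + 2 * h) * dist u v"
      unfolding dist_norm by (rule power2_le_imp_le) (use h in simp)
  qed (use h in simp)
  then show "continuous_on UNIV (reaction h)" by (rule lipschitz_on_continuous_on)
qed

lemma eul_cong: "(\<And>i. i < n \<Longrightarrow> w i = w' i) \<Longrightarrow> eul h n u w = eul h n u w'"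
  by (induction n) auto

lemma eul_Wv: "eul h m u (Wv a h m \<omega>) = eul h m u (\<lambda>i. W (a + real i * h) (a + real (Suc i) * h) \<omega>)"
  by (rule eul_cong) (simp add: Wv_def)

lemma eul_measurable:
  assumes h: "h \<ge> 0" and n: "n \<le> m"
  shows "(\<lambda>p. eul h n (fst p) (snd p)) \<in> borel_measurable (borel \<Otimes>\<^sub>M PiM {..<m} (\<lambda>_. borel))"
  using n
proof (induction n)
  case (Suc n)
  then have [measurable]: "(\<lambda>p. eul h n (fst p) (snd p)) \<in> borel_measurable (borel \<Otimes>\<^sub>M PiM {..<m} (\<lambda>_. borel))" by simp
  have [measurable]: "(\<lambda>w. w n) \<in> borel_measurable (PiM {..<m} (\<lambda>_. borel))"
    using Suc.prems by (intro measurable_component_singleton) simp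
  have [measurable]: "reaction h \<in> borel_measurable borel" "heat h \<in> borel_measurable borel"
    using h by (auto intro: reaction_measurable heat_measurable)
  show ?case unfolding eul.simps by measurable
qed simp

lemma eul_measurable2:
  assumes "h \<ge> 0" "v \<in> borel_measurable N" "w \<in> measurable N (PiM {..<m} (\<lambda>_. borel))"
  shows "(\<lambda>\<omega>. eul h m (v \<omega>) (w \<omega>)) \<in> borel_measurable N"
  using measurable_compose[OF measurable_Pair[OF assms(2,3)] eul_measurable[OF assms(1), of m m]] by simp

lemma Wv_distr:
  assumes a: "0 \<le> a" and h: "0 \<le> h" and m: "m > 0"
  shows "distr M (PiM {..<m} (\<lambda>_. borel)) (Wv a h m) = PiM {..<m} (\<lambda>_. distr M borel (Z h))"
proof -
  \<comment> \<open>The point 0 is put in front of the grid because \<open>W_indep\<close> is about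
    partitions from 0; the increment over [0, a] is then dropped by reindexing with
    \<open>Suc\<close>.\<close>
  define r where "r i = (if i = 0 then 0 else a + real (i - 1) * h)" for i :: nat
  have ah: "0 \<le> a + real i * h" "a + real i * h \<le> a + real (Suc i) * h" for i
    using a h by (auto intro!: mult_right_mono)
  have "indep_vars (\<lambda>_. borel) (\<lambda>j. W (r j) (r (Suc j))) {..<Suc m}"
  proof (rule W_indep)
    show "r i \<le> r (Suc i)" for i
    proof (cases i)
      case (Suc k)
      then show ?thesis using ah(2)[of k] by (simp add: r_def)
    qed (use a in \<open>simp add: r_def\<close>)
  qed (simp add: r_def)
  from indep_vars_reindex_inj[OF this, of Suc "{..<m}"]
  have ind: "indep_vars (\<lambda>_. borel) (\<lambda>i. W (a + real i * h) (a + real (Suc i) * h)) {..<m}"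
    by (auto simp: r_def)
  have "distr M (PiM {..<m} (\<lambda>_. borel)) (Wv a h m) = PiM {..<m} (\<lambda>i. distr M borel (W (a + real i * h) (a + real (Suc i) * h)))"
    unfolding Wv_def
    by (rule indep_vars_iff_distr_eq_PiM'[THEN iffD1, OF _ _ ind]) (use m ah in \<open>auto intro!: W_measurable\<close>)
  also have "\<dots> = PiM {..<m} (\<lambda>_. distr M borel (Z h))"
  proof (rule PiM_cong[OF refl])
    fix i
    have "(a + real (Suc i) * h) - (a + real i * h) = h" by (simp add: algebra_simps)
    then show "distr M borel (W (a + real i * h) (a + real (Suc i) * h)) = distr M borel (Z h)"
      using W_distr[OF ah(1) ah(2), of i] by simp
  qed
  finally show ?thesis .
qed

lemma Wv_indep:
  assumes a: "0 \<le> a'" "a' + real m' * h' \<le> a" and h: "0 \<le> h'" "0 \<le> h"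
  shows "indep_var (PiM {..<m'} (\<lambda>_. borel)) (Wv a' h' m') (PiM {..<m} (\<lambda>_. borel)) (Wv a h m)"
proof -
  \<comment> \<open>One partition containing both grids. The increments with index 0 (before the
    first grid) and m' + 1 (between the grids) belong to neither vector, hence the offsets 1 and m'
    + 2.\<close>
  define r where "r i = (if i = 0 then 0 else if i \<le> Suc m' then a' + real (i - 1) * h' else a + real (i - (m' + 2)) * h)" for i :: nat
  have r1: "r (Suc i) = a' + real i * h'" if "i \<le> m'" for i using that by (simp add: r_def)
  have r2: "r (m' + 2 + i) = a + real i * h" for i by (simp add: r_def)
  have ah: "a' + real i * h' \<le> a' + real (Suc i) * h'" "a + real i * h \<le> a + real (Suc i) * h" for i
    using h by (auto intro!: mult_right_mono)
  have ind: "indep_vars (\<lambda>_. borel) (\<lambda>j. W (r j) (r (Suc j))) {..<m' + 2 + m}"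
  proof (rule W_indep)
    fix i
    consider "i = 0" | k where "i = Suc k" "k < m'" | "i = Suc m'" | k where "i = m' + 2 + k"
      by (metis add_2_eq_Suc' le_add_diff_inverse less_Suc_eq_le linorder_not_less not0_implies_Suc order_antisym_conv)
    then show "r i \<le> r (Suc i)"
    proof cases
      case 1
      then show ?thesis using r1[of 0] a(1) by (simp add: r_def)
    next
      case (2 k)
      then show ?thesis using ah(1)[of k] r1[of k] r1[of "Suc k"] by simp
    next
      case 3
      then show ?thesis using a(2) r1[of m'] r2[of 0] by simp
    next
      case (4 k)
      then show ?thesis using ah(2)[of k] r2[of k] r2[of "Suc k"] by simp
    qed
  qed (simp add: r_def)
  define A where "A = {1..<Suc m'}"
  define B where "B = {m' + 2..<m' + 2 + m}"
  let ?W = "\<lambda>S \<omega>. restrict (\<lambda>j. W (r j) (r (Suc j)) \<omega>) S"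
  have "indep_var (PiM A (\<lambda>_. borel)) (?W A) (PiM B (\<lambda>_. borel)) (?W B)"
    by (rule indep_var_restrict[OF ind]) (auto simp: A_def B_def)
  then have "indep_var (PiM {..<m'} (\<lambda>_. borel)) ((\<lambda>w. \<lambda>i\<in>{..<m'}. w (Suc i)) \<circ> ?W A)
     (PiM {..<m} (\<lambda>_. borel)) ((\<lambda>w. \<lambda>i\<in>{..<m}. w (m' + 2 + i)) \<circ> ?W B)"
    by (rule indep_var_compose) (auto intro!: measurable_restrict measurable_component_singleton simp: A_def B_def)
  moreover have "(\<lambda>w. \<lambda>i\<in>{..<m'}. w (Suc i)) \<circ> ?W A = Wv a' h' m'"
    using r1 by (auto simp: Wv_def A_def fun_eq_iff)
  moreover have "(\<lambda>w. \<lambda>i\<in>{..<m}. w (m' + 2 + i)) \<circ> ?W B = Wv a h m"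
    using r2 r2[of "Suc _"] by (auto simp: Wv_def B_def fun_eq_iff)
  ultimately show ?thesis by simp
qed

section \<open>Distance between the scheme and the solution\<close>

definition gap :: "('w \<Rightarrow> hspace) \<Rightarrow> ('w \<Rightarrow> hspace) \<Rightarrow> real" where
  "gap U V = expectation (\<lambda>\<omega>. min 1 (dist (U \<omega>) (V \<omega>)))"

lemma gap_nonneg: "0 \<le> gap U V"
  unfolding gap_def by (intro Bochner_Integration.integral_nonneg) simp

lemma gap_le_1: "U \<in> borel_measurable M \<Longrightarrow> V \<in> borel_measurable M \<Longrightarrow> gap U V \<le> 1"
proof -
  assume "U \<in> borel_measurable M" "V \<in> borel_measurable M"
  then have "gap U V \<le> expectation (\<lambda>\<omega>. 1)"
    unfolding gap_def by (intro integral_mono integrable_min_dist) auto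
  then show ?thesis by (simp add: prob_space)
qed

lemma gap_triangle:
  assumes [measurable]: "U \<in> borel_measurable M" "V \<in> borel_measurable M" "U' \<in> borel_measurable M" "V' \<in> borel_measurable M"
      "U'' \<in> borel_measurable M" "V'' \<in> borel_measurable M"
    and le: "AE \<omega> in M. dist (U \<omega>) (V \<omega>) \<le> dist (U' \<omega>) (V' \<omega>) + dist (U'' \<omega>) (V'' \<omega>)"
  shows "gap U V \<le> gap U' V' + gap U'' V''"
proof -
  have "gap U V \<le> expectation (\<lambda>\<omega>. min 1 (dist (U' \<omega>) (V' \<omega>)) + min 1 (dist (U'' \<omega>) (V'' \<omega>)))"
    unfolding gap_def
  proof (rule integral_mono_AE)
    show "AE \<omega> in M. min 1 (dist (U \<omega>) (V \<omega>)) \<le> min 1 (dist (U' \<omega>) (V' \<omega>)) + min 1 (dist (U'' \<omega>) (V'' \<omega>))"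
      using le
    proof eventually_elim
      case (elim \<omega>)
      then show ?case
        using zero_le_dist[of "U' \<omega>" "V' \<omega>"] zero_le_dist[of "U'' \<omega>" "V'' \<omega>"] by linarith
    qed
  qed (intro integrable_min_dist Bochner_Integration.integrable_add; measurable)+
  also have "\<dots> = gap U' V' + gap U'' V''"
    unfolding gap_def by (intro Bochner_Integration.integral_add integrable_min_dist; measurable)
  finally show ?thesis .
qed

text \<open>Two applications of the triangle inequality. It makes the error terms below Lipschitz,
  hence measurable, in the initial value.\<close>

lemma gap_diff_le:
  assumes [measurable]: "U \<in> borel_measurable M" "V \<in> borel_measurable M" "U' \<in> borel_measurable M" "V' \<in> borel_measurable M"
    and le: "AE \<omega> in M. dist (U \<omega>) (U' \<omega>) \<le> c" "AE \<omega> in M. dist (V \<omega>) (V' \<omega>) \<le> c"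
  shows "\<bar>gap U V - gap U' V'\<bar> \<le> 2 * c"
proof -
  have i: "integrable M (\<lambda>\<omega>. min 1 (dist (U \<omega>) (V \<omega>)))" "integrable M (\<lambda>\<omega>. min 1 (dist (U' \<omega>) (V' \<omega>)))"
    by (intro integrable_min_dist; measurable)+
  have "\<bar>gap U V - gap U' V'\<bar> = \<bar>expectation (\<lambda>\<omega>. min 1 (dist (U \<omega>) (V \<omega>)) - min 1 (dist (U' \<omega>) (V' \<omega>)))\<bar>"
    unfolding gap_def using i by simp
  also have "\<dots> \<le> expectation (\<lambda>\<omega>. \<bar>min 1 (dist (U \<omega>) (V \<omega>)) - min 1 (dist (U' \<omega>) (V' \<omega>))\<bar>)"
    using integral_norm_bound[of M "\<lambda>\<omega>. min 1 (dist (U \<omega>) (V \<omega>)) - min 1 (dist (U' \<omega>) (V' \<omega>))"] by simp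
  also have "\<dots> \<le> expectation (\<lambda>\<omega>. 2 * c)"
  proof (rule integral_mono_AE)
    show "AE \<omega> in M. \<bar>min 1 (dist (U \<omega>) (V \<omega>)) - min 1 (dist (U' \<omega>) (V' \<omega>))\<bar> \<le> 2 * c"
      using le
    proof eventually_elim
      case (elim \<omega>)
      have "dist (U \<omega>) (V \<omega>) \<le> dist (U \<omega>) (U' \<omega>) + dist (U' \<omega>) (V' \<omega>) + dist (V' \<omega>) (V \<omega>)"
        using dist_triangle[of "U \<omega>" "V \<omega>" "U' \<omega>"] dist_triangle[of "U' \<omega>" "V \<omega>" "V' \<omega>"] by linarith
      moreover have "dist (U' \<omega>) (V' \<omega>) \<le> dist (U' \<omega>) (U \<omega>) + dist (U \<omega>) (V \<omega>) + dist (V \<omega>) (V' \<omega>)"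
        using dist_triangle[of "U' \<omega>" "V' \<omega>" "U \<omega>"] dist_triangle[of "U \<omega>" "V' \<omega>" "V \<omega>"] by linarith
      ultimately have "\<bar>dist (U \<omega>) (V \<omega>) - dist (U' \<omega>) (V' \<omega>)\<bar> \<le> 2 * c"
        using elim dist_commute[of "V \<omega>" "V' \<omega>"] dist_commute[of "U \<omega>" "U' \<omega>"] by linarith
      then show ?case by linarith
    qed
  qed (use i in auto)
  finally show ?thesis by (simp add: prob_space)
qed

definition step :: "real \<Rightarrow> nat \<Rightarrow> nat \<Rightarrow> real" where
  "step t j n = (t - eps t j) / Suc n"

lemma step: "t > 0 \<Longrightarrow> 0 \<le> step t j n" "real (Suc n) * step t j n = t - eps t j"
  using eps(2)[of t j] by (simp_all add: step_def)

definition scheme :: "real \<Rightarrow> real \<Rightarrow> nat \<Rightarrow> nat \<Rightarrow> hspace \<Rightarrow> 'w \<Rightarrow> hspace" where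
  "scheme s t j n u \<omega> = eul (step t j n) (Suc n) u (Wv (s + eps t j) (step t j n) (Suc n) \<omega>)"

lemma scheme_measurable:
  assumes "0 \<le> s" "0 < t" "u \<in> borel_measurable M"
  shows "(\<lambda>\<omega>. scheme s t j n (u \<omega>) \<omega>) \<in> borel_measurable M"
  unfolding scheme_def
  using assms eps(1)[OF assms(2), of j] step(1)[OF assms(2)] by (intro eul_measurable2 Wv_measurable) auto

lemma scheme_nonexpansive: "0 < t \<Longrightarrow> dist (scheme s t j n u \<omega>) (scheme s t j n v \<omega>) \<le> dist u v"
  unfolding scheme_def dist_norm by (intro eul_nonexpansive step)

text \<open>Together with \<open>lag\<close> this splits the total error: \<open>err\<close> is pure
  discretization from the true state at time s + \<open>eps t j\<close> and vanishes as n grows,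
  while \<open>lag\<close> is the movement of the solution before the scheme starts and vanishes as
  j grows.\<close>

definition err :: "hspace \<Rightarrow> real \<Rightarrow> real \<Rightarrow> nat \<Rightarrow> nat \<Rightarrow> real" where
  "err x s t j n = gap (X x (s + t)) (\<lambda>\<omega>. scheme s t j n (X x (s + eps t j) \<omega>) \<omega>)"

definition lag :: "hspace \<Rightarrow> real \<Rightarrow> real \<Rightarrow> nat \<Rightarrow> real" where
  "lag x s t j = gap (X x (s + eps t j)) (X x s)"

lemma gap_scheme_le:
  assumes s: "0 \<le> s" and t: "0 < t" and u: "u \<in> borel_measurable M" "AE \<omega> in M. X x s \<omega> = u \<omega>"
  shows "gap (X x (s + t)) (\<lambda>\<omega>. scheme s t j n (u \<omega>) \<omega>) \<le> err x s t j n + lag x s t j"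
  unfolding err_def lag_def
proof (rule gap_triangle)
  show "AE \<omega> in M. dist (X x (s + t) \<omega>) (scheme s t j n (u \<omega>) \<omega>) \<le>
     dist (X x (s + t) \<omega>) (scheme s t j n (X x (s + eps t j) \<omega>) \<omega>) + dist (X x (s + eps t j) \<omega>) (X x s \<omega>)"
    using u(2)
  proof eventually_elim
    case (elim \<omega>)
    show ?case
      using dist_triangle[of "X x (s + t) \<omega>" "scheme s t j n (u \<omega>) \<omega>" "scheme s t j n (X x (s + eps t j) \<omega>) \<omega>"]
        scheme_nonexpansive[OF t, of s j n "X x (s + eps t j) \<omega>" \<omega> "u \<omega>"] elim by simp
  qed
qed (use s t eps[OF t, of j] u in \<open>auto intro!: scheme_measurable X_measurable\<close>)

lemma err_LIMSEQ:
  assumes s: "0 \<le> s" and t: "0 < t"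
  shows "(\<lambda>n. err x s t j n) \<longlonglongrightarrow> 0"
proof -
  have e: "0 < eps t j" "eps t j < t" using eps[OF t] by auto
  have "in_prob M (\<lambda>n \<omega>. scheme s t j n (X x (s + eps t j) \<omega>) \<omega>) (X x (s + t))"
  proof (rule in_prob_AE)
    have "AE \<omega> in M. (\<lambda>n. eul ((t - eps t j) / Suc n) (Suc n) (X x (s + eps t j) \<omega>)
       (\<lambda>i. W (s + eps t j + real i * ((t - eps t j) / Suc n)) (s + eps t j + real (Suc i) * ((t - eps t j) / Suc n)) \<omega>)) \<longlonglongrightarrow> X x (s + eps t j + (t - eps t j)) \<omega>"
      using s e by (intro eul_conv) auto
    then show "AE \<omega> in M. (\<lambda>n. scheme s t j n (X x (s + eps t j) \<omega>) \<omega>) \<longlonglongrightarrow> X x (s + t) \<omega>"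
      unfolding scheme_def eul_Wv step_def by simp
  qed (use s t e in \<open>auto intro!: scheme_measurable X_measurable\<close>)
  then show ?thesis by (simp add: in_prob_def err_def gap_def dist_commute)
qed

lemma lag_LIMSEQ:
  assumes s: "0 \<le> s" and t: "0 < t"
  shows "(\<lambda>j. lag x s t j) \<longlonglongrightarrow> 0"
proof -
  have "in_prob M (\<lambda>j. X x (s + eps t j)) (X x s)"
  proof (rule in_prob_AE)
    show "AE \<omega> in M. (\<lambda>j. X x (s + eps t j) \<omega>) \<longlonglongrightarrow> X x s \<omega>"
      using X_cadlag[of x]
    proof eventually_elim
      case (elim \<omega>)
      have "((\<lambda>t. X x t \<omega>) \<longlongrightarrow> X x s \<omega>) (at_right s)" using elim s by (auto simp: cadlag_def)
      moreover have "filterlim (\<lambda>j. s + eps t j) (at_right s) sequentially"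
      proof (rule tendsto_imp_filterlim_at_right)
        have "(\<lambda>j. s + eps t j) \<longlonglongrightarrow> s + 0" by (intro tendsto_intros eps_LIMSEQ)
        then show "(\<lambda>j. s + eps t j) \<longlonglongrightarrow> s" by simp
      qed (use eps[OF t] in auto)
      ultimately show ?case by (rule filterlim_compose)
    qed
  qed (use s eps(1)[OF t] in \<open>auto intro!: X_measurable intro: less_imp_le add_nonneg_nonneg\<close>)
  then show ?thesis by (simp add: in_prob_def lag_def gap_def)
qed

lemma borel_measurable_lipschitz:
  fixes g :: "hspace \<Rightarrow> real"
  assumes "\<And>x y. \<bar>g x - g y\<bar> \<le> K * dist x y" "K \<ge> 0"
  shows "g \<in> borel_measurable borel"
proof (rule borel_measurable_continuous_onI)
  have "K-lipschitz_on UNIV g" using assms by (intro lipschitz_onI) (auto simp: dist_real_def)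
  then show "continuous_on UNIV g" by (rule lipschitz_on_continuous_on)
qed

text \<open>Needed because the error is later evaluated at the random initial value
  \<open>X x s\<close>. Solution and scheme are both nonexpansive in the initial value.\<close>

lemma err_measurable [measurable]:
  assumes t: "0 < t"
  shows "(\<lambda>x. err x 0 t j n) \<in> borel_measurable borel"
proof (rule borel_measurable_lipschitz)
  have e: "0 < eps t j" using eps[OF t] by auto
  fix x y
  show "\<bar>err x 0 t j n - err y 0 t j n\<bar> \<le> 2 * dist x y"
    unfolding err_def
  proof (rule gap_diff_le)
    show "AE \<omega> in M. dist (X x (0 + t) \<omega>) (X y (0 + t) \<omega>) \<le> dist x y"
      using X_nonexpansive[OF t] by simp
    show "AE \<omega> in M. dist (scheme 0 t j n (X x (0 + eps t j) \<omega>) \<omega>) (scheme 0 t j n (X y (0 + eps t j) \<omega>) \<omega>) \<le> dist x y"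
      using X_nonexpansive[OF e, of x y]
    proof eventually_elim
      case (elim \<omega>)
      then show ?case by (simp add: order_trans[OF scheme_nonexpansive[OF t]])
    qed
  qed (use t e in \<open>auto intro!: scheme_measurable X_measurable\<close>)
qed simp

lemma lag_measurable [measurable]:
  assumes t: "0 < t"
  shows "(\<lambda>x. lag x 0 t j) \<in> borel_measurable borel"
proof (rule borel_measurable_lipschitz)
  have e: "0 < eps t j" using eps[OF t] by auto
  fix x y
  show "\<bar>lag x 0 t j - lag y 0 t j\<bar> \<le> 2 * dist x y"
    unfolding lag_def
  proof (rule gap_diff_le)
    show "AE \<omega> in M. dist (X x (0 + eps t j) \<omega>) (X y (0 + eps t j) \<omega>) \<le> dist x y"
      using X_nonexpansive[OF e] by simp
    show "AE \<omega> in M. dist (X x 0 \<omega>) (X y 0 \<omega>) \<le> dist x y"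
      using X_0[of x] X_0[of y] by eventually_elim simp
  qed (use e in \<open>auto intro!: X_measurable\<close>)
qed simp

text \<open>The one-time operator of the scheme, written with the product law of its noise rather
  than on the given probability space. No starting time occurs, which is the homogeneity behind the
  Markov property.\<close>

definition scheme_op :: "real \<Rightarrow> nat \<Rightarrow> nat \<Rightarrow> (hspace \<Rightarrow> real) \<Rightarrow> hspace \<Rightarrow> real" where
  "scheme_op t j n f v = (LINT w|PiM {..<Suc n} (\<lambda>_. distr M borel (Z (step t j n))). f (eul (step t j n) (Suc n) v w))"

lemma scheme_op_eq:
  assumes s: "0 \<le> s" and t: "0 < t" and f: "test_fun K f"
  shows "scheme_op t j n f v = expectation (\<lambda>\<omega>. f (scheme s t j n v \<omega>))"
proof -
  have [measurable]: "f \<in> borel_measurable borel" by (rule test_fun_measurable[OF f])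
  have e: "0 \<le> s + eps t j" using s eps[OF t, of j] by simp
  have [measurable]: "Wv (s + eps t j) (step t j n) (Suc n) \<in> measurable M (PiM {..<Suc n} (\<lambda>_. borel))"
    by (rule Wv_measurable[OF e step(1)[OF t]])
  have [measurable]: "(\<lambda>w. eul (step t j n) (Suc n) v w) \<in> borel_measurable (PiM {..<Suc n} (\<lambda>_. borel))"
    using eul_measurable2[OF step(1)[OF t], of "\<lambda>_. v" _ "\<lambda>w. w" "Suc n"] by simp
  show ?thesis
    unfolding scheme_op_def scheme_def Wv_distr[OF e step(1)[OF t], symmetric, of "Suc n", simplified]
    by (rule integral_distr) measurable
qed

lemma scheme_op_test_fun:
  assumes t: "0 < t" and f: "test_fun K f"
  shows "test_fun K (scheme_op t j n f)"
  unfolding test_fun_def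
proof (intro conjI allI)
  show "1 \<le> K" using f by (simp add: test_fun_def)
  have i: "integrable M (\<lambda>\<omega>. f (scheme 0 t j n v \<omega>))" for v
    by (intro integrable_test_fun[OF f] scheme_measurable t) auto
  fix x y
  show "0 \<le> scheme_op t j n f x"
    unfolding scheme_op_eq[OF order.refl t f] using test_fun_range[OF f]
    by (intro Bochner_Integration.integral_nonneg) auto
  have "scheme_op t j n f x \<le> expectation (\<lambda>\<omega>. 1)"
    unfolding scheme_op_eq[OF order.refl t f] using i test_fun_range[OF f] by (intro integral_mono) auto
  then show "scheme_op t j n f x \<le> 1" by (simp add: prob_space)
  have "\<bar>scheme_op t j n f x - scheme_op t j n f y\<bar> = \<bar>expectation (\<lambda>\<omega>. f (scheme 0 t j n x \<omega>) - f (scheme 0 t j n y \<omega>))\<bar>"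
    unfolding scheme_op_eq[OF order.refl t f] using i by simp
  also have "\<dots> \<le> expectation (\<lambda>\<omega>. \<bar>f (scheme 0 t j n x \<omega>) - f (scheme 0 t j n y \<omega>)\<bar>)"
    using integral_norm_bound[of M "\<lambda>\<omega>. f (scheme 0 t j n x \<omega>) - f (scheme 0 t j n y \<omega>)"] by simp
  also have "\<dots> \<le> expectation (\<lambda>\<omega>. K * dist x y)"
  proof (rule integral_mono)
    fix \<omega>
    have "\<bar>f (scheme 0 t j n x \<omega>) - f (scheme 0 t j n y \<omega>)\<bar> \<le> K * dist (scheme 0 t j n x \<omega>) (scheme 0 t j n y \<omega>)"
      using f by (simp add: test_fun_def)
    also have "\<dots> \<le> K * dist x y"
      using f by (intro mult_left_mono scheme_nonexpansive t) (simp add: test_fun_def)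
    finally show "\<bar>f (scheme 0 t j n x \<omega>) - f (scheme 0 t j n y \<omega>)\<bar> \<le> K * dist x y" .
  qed (use i in auto)
  finally show "\<bar>scheme_op t j n f x - scheme_op t j n f y\<bar> \<le> K * dist x y" by (simp add: prob_space)
qed

text \<open>Freezing the past: independence makes the joint law a product, and Fubini's theorem
  integrates the noise vector first.\<close>

lemma expectation_scheme_indep:
  assumes s: "0 \<le> s" and t: "0 < t" and f: "test_fun K f"
    and ind: "indep_var N U (PiM {..<Suc n} (\<lambda>_. borel)) (Wv (s + eps t j) (step t j n) (Suc n))"
    and F [measurable]: "F \<in> borel_measurable N"
  shows "expectation (\<lambda>\<omega>. f (scheme s t j n (F (U \<omega>)) \<omega>)) = expectation (\<lambda>\<omega>. scheme_op t j n f (F (U \<omega>)))"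
proof -
  let ?S = "PiM {..<Suc n} (\<lambda>_. borel :: hspace measure)"
  let ?w = "Wv (s + eps t j) (step t j n) (Suc n)"
  define g where "g p = f (eul (step t j n) (Suc n) (F (fst p)) (snd p))" for p
  have e: "0 \<le> s + eps t j" using s eps[OF t, of j] by simp
  have [measurable]: "f \<in> borel_measurable borel" by (rule test_fun_measurable[OF f])
  have [measurable]: "U \<in> measurable M N" using ind by (rule indep_var_rv1)
  have [measurable]: "?w \<in> measurable M ?S" by (rule Wv_measurable[OF e step(1)[OF t]])
  have [measurable]: "(\<lambda>p. eul (step t j n) (Suc n) (F (fst p)) (snd p)) \<in> borel_measurable (N \<Otimes>\<^sub>M ?S)"
    by (rule eul_measurable2[OF step(1)[OF t]]) measurable
  have gm [measurable]: "g \<in> borel_measurable (N \<Otimes>\<^sub>M ?S)" unfolding g_def by measurable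
  interpret U: prob_space "distr M N U" by (rule prob_space_distr) measurable
  interpret W': prob_space "distr M ?S ?w" by (rule prob_space_distr) measurable
  interpret UW: pair_prob_space "distr M N U" "distr M ?S ?w" ..
  have gm' [measurable]: "g \<in> borel_measurable (distr M N U \<Otimes>\<^sub>M distr M ?S ?w)"
    using gm by (simp cong: measurable_cong_sets sets_pair_measure_cong)
  have i: "integrable (distr M N U \<Otimes>\<^sub>M distr M ?S ?w) g"
  proof (rule UW.P.integrable_const_bound[of _ 1])
    show "AE p in distr M N U \<Otimes>\<^sub>M distr M ?S ?w. norm (g p) \<le> 1"
      using test_fun_range[OF f] by (auto simp: g_def simp del: eul.simps)
  qed measurable
  have "expectation (\<lambda>\<omega>. f (scheme s t j n (F (U \<omega>)) \<omega>)) = integral\<^sup>L (distr M (N \<Otimes>\<^sub>M ?S) (\<lambda>\<omega>. (U \<omega>, ?w \<omega>))) g"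
    by (subst integral_distr) (auto simp: g_def scheme_def simp del: eul.simps)
  also have "\<dots> = integral\<^sup>L (distr M N U \<Otimes>\<^sub>M distr M ?S ?w) g"
    using ind by (simp only: indep_var_distribution_eq)
  also have "\<dots> = (LINT u|distr M N U. LINT w|distr M ?S ?w. g (u, w))"
    by (rule UW.integral_fst'[symmetric]) (rule i)
  also have "\<dots> = (LINT u|distr M N U. scheme_op t j n f (F u))"
    unfolding Wv_distr[OF e step(1)[OF t] zero_less_Suc] by (simp add: scheme_op_def g_def del: eul.simps)
  also have "\<dots> = expectation (\<lambda>\<omega>. scheme_op t j n f (F (U \<omega>)))"
  proof (rule integral_distr)
    have [measurable]: "scheme_op t j n f \<in> borel_measurable borel"
      by (rule test_fun_measurable[OF scheme_op_test_fun[OF t f]])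
    show "(\<lambda>u. scheme_op t j n f (F u)) \<in> borel_measurable N" by measurable
  qed measurable
  finally show ?thesis .
qed

text \<open>\<open>X x s\<close> itself is replaced by the scheme on \<open>[0, s]\<close>, which uses noise increments over intervals
  disjoint from those used after time \<open>s\<close>.\<close>

lemma expectation_scheme_X:
  assumes s: "0 < s" and t: "0 < t" and f: "test_fun K f"
  shows "expectation (\<lambda>\<omega>. f (scheme s t j n (X x s \<omega>) \<omega>)) = expectation (\<lambda>\<omega>. scheme_op t j n f (X x s \<omega>))"
proof -
  define V where "V i k \<omega> = scheme 0 s i k x \<omega>" for i k \<omega>
  define a where "a = expectation (\<lambda>\<omega>. f (scheme s t j n (X x s \<omega>) \<omega>))"
  define b where "b = expectation (\<lambda>\<omega>. scheme_op t j n f (X x s \<omega>))"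
  have K: "K \<ge> 1" using f by (simp add: test_fun_def)
  have [measurable]: "V i k \<in> borel_measurable M" for i k
    unfolding V_def using s by (intro scheme_measurable) auto
  have [measurable]: "X x s \<in> borel_measurable M" using s by simp
  have g: "gap (X x s) (V i k) \<le> err x 0 s i k + lag x 0 s i" for i k
    using gap_scheme_le[OF order.refl s, of "\<lambda>_. x" x i k] X_0[of x] by (simp add: V_def[abs_def])
  have main: "\<bar>a - b\<bar> \<le> 2 * K * (err x 0 s i k + lag x 0 s i)" for i k
  proof -
    have ei: "0 < eps s i" using eps[OF s] by simp
    \<comment> \<open>The scheme on [0, s] uses noise up to time s exactly, and the later scheme
      starts only at s + \<open>eps t j\<close>.\<close>
    have le: "0 + eps s i + real (Suc k) * step s i k \<le> s + eps t j"
      unfolding step(2) using eps(1)[OF t, of j] by linarith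
    have ind: "indep_var (PiM {..<Suc k} (\<lambda>_. borel)) (Wv (0 + eps s i) (step s i k) (Suc k))
       (PiM {..<Suc n} (\<lambda>_. borel)) (Wv (s + eps t j) (step t j n) (Suc n))"
      by (rule Wv_indep) (use ei le step(1)[OF s, of i k] step(1)[OF t, of j n] in \<open>simp_all del: of_nat_Suc\<close>)
    have Fm: "(\<lambda>w. eul (step s i k) (Suc k) x w) \<in> borel_measurable (PiM {..<Suc k} (\<lambda>_. borel))"
      using eul_measurable2[OF step(1)[OF s], of "\<lambda>_. x" _ "\<lambda>w. w" "Suc k"] by simp
    have V_eq: "V i k \<omega> = eul (step s i k) (Suc k) x (Wv (0 + eps s i) (step s i k) (Suc k) \<omega>)" for \<omega>
      by (simp only: V_def scheme_def)
    have e: "expectation (\<lambda>\<omega>. f (scheme s t j n (V i k \<omega>) \<omega>)) = expectation (\<lambda>\<omega>. scheme_op t j n f (V i k \<omega>))"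
      unfolding V_eq by (rule expectation_scheme_indep[OF less_imp_le[OF s] t f ind Fm])
    have sm: "(\<lambda>\<omega>. scheme s t j n (X x s \<omega>) \<omega>) \<in> borel_measurable M" "(\<lambda>\<omega>. scheme s t j n (V i k \<omega>) \<omega>) \<in> borel_measurable M"
      using s t by (auto intro!: scheme_measurable)
    have "\<bar>a - expectation (\<lambda>\<omega>. f (scheme s t j n (V i k \<omega>) \<omega>))\<bar> \<le>
        K * expectation (\<lambda>\<omega>. min 1 (dist (scheme s t j n (X x s \<omega>) \<omega>) (scheme s t j n (V i k \<omega>) \<omega>)))"
      unfolding a_def by (rule expectation_test_fun_diff_le[OF f sm])
    also have "\<dots> \<le> K * gap (X x s) (V i k)"
      unfolding gap_def
    proof (intro mult_left_mono integral_mono)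
      show "min 1 (dist (scheme s t j n (X x s \<omega>) \<omega>) (scheme s t j n (V i k \<omega>) \<omega>)) \<le> min 1 (dist (X x s \<omega>) (V i k \<omega>))" for \<omega>
        by (intro min.mono scheme_nonexpansive t order.refl)
    qed (use K sm in \<open>auto intro!: integrable_min_dist\<close>)
    finally have 1: "\<bar>a - expectation (\<lambda>\<omega>. f (scheme s t j n (V i k \<omega>) \<omega>))\<bar> \<le> K * gap (X x s) (V i k)" .
    have 2: "\<bar>b - expectation (\<lambda>\<omega>. scheme_op t j n f (V i k \<omega>))\<bar> \<le> K * gap (X x s) (V i k)"
      unfolding b_def gap_def by (rule expectation_test_fun_diff_le[OF scheme_op_test_fun[OF t f]]) measurable
    have "K * gap (X x s) (V i k) \<le> K * (err x 0 s i k + lag x 0 s i)"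
      using g K by (intro mult_left_mono) auto
    with 1 2 e show ?thesis by linarith
  qed
  have l1: "\<bar>a - b\<bar> \<le> 2 * K * (0 + lag x 0 s i)" for i
  proof (rule LIMSEQ_le_const)
    show "(\<lambda>k. 2 * K * (err x 0 s i k + lag x 0 s i)) \<longlonglongrightarrow> 2 * K * (0 + lag x 0 s i)"
      by (intro tendsto_intros err_LIMSEQ s) simp
  qed (use main in blast)
  have "\<bar>a - b\<bar> \<le> 2 * K * (0 + 0)"
  proof (rule LIMSEQ_le_const)
    show "(\<lambda>i. 2 * K * (0 + lag x 0 s i)) \<longlonglongrightarrow> 2 * K * (0 + 0)"
      by (intro tendsto_intros lag_LIMSEQ s) simp
  qed (use l1 in blast)
  then show ?thesis by (simp add: a_def b_def)
qed

text \<open>For the scheme the property is exact. It is transferred by comparing the scheme started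
  at the true state \<open>X x s\<close> with the solution at s + t, and \<open>scheme_op\<close>
  with \<open>P t\<close> at the random point \<open>X x s\<close>; the errors vanish for n and then
  j to infinity.\<close>

lemma markov:
  assumes s: "0 < s" and t: "0 < t" and f: "test_fun K f"
  shows "P (s + t) f x = P s (P t f) x"
proof -
  define D where "D = \<bar>expectation (\<lambda>\<omega>. f (X x (s + t) \<omega>)) - expectation (\<lambda>\<omega>. P t f (X x s \<omega>))\<bar>"
  have K: "K \<ge> 1" using f by (simp add: test_fun_def)
  have [measurable]: "X x s \<in> borel_measurable M" "X x (s + t) \<in> borel_measurable M" using s t by auto
  have [measurable]: "(\<lambda>x. err x 0 t j n) \<in> borel_measurable borel" "(\<lambda>x. lag x 0 t j) \<in> borel_measurable borel" for j n
    using t by (auto intro: err_measurable lag_measurable)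
  have e01: "0 \<le> err y 0 t j n" "err y 0 t j n \<le> 1" "0 \<le> lag y 0 t j" "lag y 0 t j \<le> 1" for y j n
    using t eps(1)[OF t, of j] unfolding err_def lag_def
    by (auto intro!: gap_nonneg gap_le_1 scheme_measurable X_measurable)
  have ie: "integrable M (\<lambda>\<omega>. err (X x s \<omega>) 0 t j n)" "integrable M (\<lambda>\<omega>. lag (X x s \<omega>) 0 t j)" for j n
    by (rule integrable_const_bound[of _ 1]; use e01 in auto)+
  have op: "\<bar>scheme_op t j n f y - P t f y\<bar> \<le> K * (err y 0 t j n + lag y 0 t j)" for j n y
  proof -
    have sm: "(\<lambda>\<omega>. scheme 0 t j n y \<omega>) \<in> borel_measurable M" using t by (intro scheme_measurable) auto
    have "\<bar>P t f y - scheme_op t j n f y\<bar> \<le> K * gap (X y (0 + t)) (\<lambda>\<omega>. scheme 0 t j n y \<omega>)"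
      unfolding scheme_op_eq[OF order.refl t f] transition_op_def gap_def
      using expectation_test_fun_diff_le[OF f _ sm, of "X y t"] t by simp
    also have "\<dots> \<le> K * (err y 0 t j n + lag y 0 t j)"
      using gap_scheme_le[OF order.refl t, of "\<lambda>_. y" y j n] X_0[of y] K by (intro mult_left_mono) auto
    finally show ?thesis by (simp add: abs_minus_commute)
  qed
  have main: "D \<le> K * (err x s t j n + lag x s t j) + K * (expectation (\<lambda>\<omega>. err (X x s \<omega>) 0 t j n) + expectation (\<lambda>\<omega>. lag (X x s \<omega>) 0 t j))" for j n
  proof -
    have sm: "(\<lambda>\<omega>. scheme s t j n (X x s \<omega>) \<omega>) \<in> borel_measurable M" using s t by (intro scheme_measurable) auto
    have i1: "integrable M (\<lambda>\<omega>. scheme_op t j n f (X x s \<omega>))" by (intro integrable_test_fun[OF scheme_op_test_fun[OF t f]]) measurable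
    have i2: "integrable M (\<lambda>\<omega>. P t f (X x s \<omega>))" by (intro integrable_test_fun[OF P_test_fun[OF t f]]) measurable
    have "\<bar>expectation (\<lambda>\<omega>. f (X x (s + t) \<omega>)) - expectation (\<lambda>\<omega>. f (scheme s t j n (X x s \<omega>) \<omega>))\<bar> \<le>
        K * gap (X x (s + t)) (\<lambda>\<omega>. scheme s t j n (X x s \<omega>) \<omega>)"
      unfolding gap_def by (rule expectation_test_fun_diff_le[OF f _ sm]) measurable
    also have "\<dots> \<le> K * (err x s t j n + lag x s t j)"
      using s t K by (intro mult_left_mono gap_scheme_le) auto
    finally have 1: "\<bar>expectation (\<lambda>\<omega>. f (X x (s + t) \<omega>)) - expectation (\<lambda>\<omega>. scheme_op t j n f (X x s \<omega>))\<bar> \<le> K * (err x s t j n + lag x s t j)"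
      unfolding expectation_scheme_X[OF s t f] .
    have "\<bar>expectation (\<lambda>\<omega>. scheme_op t j n f (X x s \<omega>)) - expectation (\<lambda>\<omega>. P t f (X x s \<omega>))\<bar> =
        \<bar>expectation (\<lambda>\<omega>. scheme_op t j n f (X x s \<omega>) - P t f (X x s \<omega>))\<bar>"
      using i1 i2 by simp
    also have "\<dots> \<le> expectation (\<lambda>\<omega>. \<bar>scheme_op t j n f (X x s \<omega>) - P t f (X x s \<omega>)\<bar>)"
      using integral_norm_bound[of M "\<lambda>\<omega>. scheme_op t j n f (X x s \<omega>) - P t f (X x s \<omega>)"] by simp
    also have "\<dots> \<le> expectation (\<lambda>\<omega>. K * (err (X x s \<omega>) 0 t j n + lag (X x s \<omega>) 0 t j))"
      by (intro integral_mono op) (use i1 i2 ie in auto)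
    also have "\<dots> = K * (expectation (\<lambda>\<omega>. err (X x s \<omega>) 0 t j n) + expectation (\<lambda>\<omega>. lag (X x s \<omega>) 0 t j))"
      using ie by simp
    finally show ?thesis using 1 unfolding D_def by linarith
  qed
  \<comment> \<open>The errors tend to 0 for every fixed initial value and lie in [0,1], so
    dominated convergence covers the random one.\<close>
  have E1: "(\<lambda>n. expectation (\<lambda>\<omega>. err (X x s \<omega>) 0 t j n)) \<longlonglongrightarrow> expectation (\<lambda>\<omega>. 0)" for j
    by (rule integral_dominated_convergence[where w = "\<lambda>_. 1"])
      (use e01 in \<open>auto intro!: AE_I2 err_LIMSEQ t\<close>)
  have E2: "(\<lambda>j. expectation (\<lambda>\<omega>. lag (X x s \<omega>) 0 t j)) \<longlonglongrightarrow> expectation (\<lambda>\<omega>. 0)"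
    by (rule integral_dominated_convergence[where w = "\<lambda>_. 1"])
      (use e01 in \<open>auto intro!: AE_I2 lag_LIMSEQ t\<close>)
  have l1: "D \<le> K * (0 + lag x s t j) + K * (0 + expectation (\<lambda>\<omega>. lag (X x s \<omega>) 0 t j))" for j
  proof (rule LIMSEQ_le_const)
    show "(\<lambda>n. K * (err x s t j n + lag x s t j) + K * (expectation (\<lambda>\<omega>. err (X x s \<omega>) 0 t j n) + expectation (\<lambda>\<omega>. lag (X x s \<omega>) 0 t j)))
      \<longlonglongrightarrow> K * (0 + lag x s t j) + K * (0 + expectation (\<lambda>\<omega>. lag (X x s \<omega>) 0 t j))"
      using E1[of j] s t by (intro tendsto_intros err_LIMSEQ) auto
  qed (use main in blast)
  have "D \<le> K * (0 + 0) + K * (0 + 0)"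
  proof (rule LIMSEQ_le_const)
    show "(\<lambda>j. K * (0 + lag x s t j) + K * (0 + expectation (\<lambda>\<omega>. lag (X x s \<omega>) 0 t j))) \<longlonglongrightarrow> K * (0 + 0) + K * (0 + 0)"
      using E2 s t by (intro tendsto_intros lag_LIMSEQ) auto
  qed (use l1 in blast)
  then show ?thesis by (simp add: D_def transition_op_def)
qed

section \<open>Invariant measures\<close>

text \<open>\<open>X x t\<close> is only determined up to a null set that depends on \<open>x\<close>; a jointly measurable version is
  obtained as a limit along a countable dense set of initial values.\<close>

lemma exists_random_map:
  assumes t: "t > 0"
  shows "\<exists>F. (\<lambda>p. F (fst p) (snd p)) \<in> borel_measurable (borel \<Otimes>\<^sub>M M) \<and>
    (\<forall>\<omega> x y. norm (F x \<omega> - F y \<omega>) \<le> exp (- t) * norm (x - y) \<and> (norm (F x \<omega> - F y \<omega>))\<^sup>2 \<le> 2 / t) \<and>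
    (\<forall>x. AE \<omega> in M. F x \<omega> = X x t \<omega>)"
proof -
  obtain D :: "hspace set" where D: "countable D" "\<And>U. open U \<Longrightarrow> U \<noteq> {} \<Longrightarrow> \<exists>d\<in>D. d \<in> U"
    using countable_dense_setE by blast
  have "D \<noteq> {}" using D(2)[of UNIV] by auto
  define e where "e = from_nat_into D"
  have e: "\<exists>i. dist (e i) x < \<eta>" if "\<eta> > 0" for x \<eta>
  proof -
    have "x \<in> ball x \<eta>" using that by simp
    then obtain d where "d \<in> D" "d \<in> ball x \<eta>" using D(2)[OF open_ball, of x \<eta>] by blast
    then show ?thesis
      using from_nat_into_surj[OF D(1), of d] by (auto simp: e_def dist_commute)
  qed
  \<comment> \<open>Contraction for all pairs from the dense sequence at once, a countable
    conjunction of almost sure statements. Elsewhere the map is set to 0, so that the bounds hold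
    for every \<omega>.\<close>
  define good where "good \<omega> \<longleftrightarrow> (\<forall>i j. norm (X (e i) t \<omega> - X (e j) t \<omega>) \<le> exp (- t) * norm (e i - e j) \<and>
      (norm (X (e i) t \<omega> - X (e j) t \<omega>))\<^sup>2 \<le> 2 / t)" for \<omega>
  have [measurable]: "X x t \<in> borel_measurable M" for x using t by simp
  have [measurable]: "Measurable.pred M good" unfolding good_def by measurable
  have ae: "AE \<omega> in M. good \<omega>" unfolding good_def AE_all_countable by (intro allI X_contract t)
  \<comment> \<open>The least admissible index is a measurable choice of an approximant, which makes
    the approximating maps \<open>G n\<close> jointly measurable.\<close>
  define N where "N n x = (LEAST i. dist (e i) x < 1 / Suc n)" for n x
  have N: "dist (e (N n x)) x < 1 / Suc n" for n x
    unfolding N_def by (rule LeastI_ex) (rule e, simp)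
  have N_lim: "(\<lambda>n. e (N n x)) \<longlonglongrightarrow> x" for x
  proof (rule metric_LIMSEQ_I)
    fix r :: real assume "r > 0"
    then obtain n0 where n0: "1 / Suc n0 < r" using nat_approx_posE by blast
    have "dist (e (N n x)) x < r" if "n \<ge> n0" for n
    proof -
      have "1 / real (Suc n) \<le> 1 / real (Suc n0)" using that by (intro divide_left_mono) auto
      then show ?thesis using N[of n x] n0 by linarith
    qed
    then show "\<exists>no. \<forall>n\<ge>no. dist (e (N n x)) x < r" by blast
  qed
  have [measurable]: "N n \<in> measurable borel (count_space UNIV)" for n
    unfolding N_def by measurable
  define G where "G n x \<omega> = (if good \<omega> then X (e (N n x)) t \<omega> else 0)" for n x \<omega>
  define F where "F x \<omega> = lim (\<lambda>n. G n x \<omega>)" for x \<omega>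
  have Gm [measurable]: "(\<lambda>p. G n (fst p) (snd p)) \<in> borel_measurable (borel \<Otimes>\<^sub>M M)" for n
  proof -
    have "(\<lambda>p. X (e (N n (fst p))) t (snd p)) \<in> borel_measurable (borel \<Otimes>\<^sub>M M)"
    proof (rule measurable_compose_countable[where f = "\<lambda>i p. X (e i) t (snd p)" and g = "\<lambda>p. N n (fst p)"])
      show "(\<lambda>p. N n (fst p)) \<in> measurable (borel \<Otimes>\<^sub>M M) (count_space UNIV)" by measurable
    qed measurable
    then show ?thesis unfolding G_def by measurable
  qed
  have F_lim: "(\<lambda>n. G n x \<omega>) \<longlonglongrightarrow> F x \<omega>" for x \<omega>
  proof (cases "good \<omega>")
    case True
    have "Cauchy (\<lambda>n. G n x \<omega>)"
    proof (rule metric_CauchyI)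
      fix r :: real assume r: "r > 0"
      obtain n0 where n0: "\<And>m n. m \<ge> n0 \<Longrightarrow> n \<ge> n0 \<Longrightarrow> dist (e (N m x)) (e (N n x)) < r"
        using LIMSEQ_imp_Cauchy[OF N_lim[of x]] r unfolding Cauchy_def by blast
      have "dist (G m x \<omega>) (G n x \<omega>) < r" if "m \<ge> n0" "n \<ge> n0" for m n
      proof -
        have "norm (X (e (N m x)) t \<omega> - X (e (N n x)) t \<omega>) \<le> exp (- t) * norm (e (N m x) - e (N n x))"
          using True by (simp add: good_def)
        also have "\<dots> \<le> 1 * norm (e (N m x) - e (N n x))" using t by (intro mult_right_mono) auto
        finally show ?thesis using n0[OF that] True by (simp add: G_def dist_norm)
      qed
      then show "\<exists>M. \<forall>m\<ge>M. \<forall>n\<ge>M. dist (G m x \<omega>) (G n x \<omega>) < r" by blast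
    qed
    then show ?thesis unfolding F_def using Cauchy_convergent convergent_LIMSEQ_iff by blast
  qed (simp add: F_def G_def)
  have FG: "norm (F x \<omega> - F y \<omega>) \<le> exp (- t) * norm (x - y)" "(norm (F x \<omega> - F y \<omega>))\<^sup>2 \<le> 2 / t" for x y \<omega>
  proof -
    have g: "norm (G n x \<omega> - G n y \<omega>) \<le> exp (- t) * norm (e (N n x) - e (N n y)) \<and> (norm (G n x \<omega> - G n y \<omega>))\<^sup>2 \<le> 2 / t" for n
      using t by (cases "good \<omega>") (auto simp: G_def good_def)
    have l: "(\<lambda>n. norm (G n x \<omega> - G n y \<omega>)) \<longlonglongrightarrow> norm (F x \<omega> - F y \<omega>)" by (intro tendsto_intros F_lim)
    have l2: "(\<lambda>n. exp (- t) * norm (e (N n x) - e (N n y))) \<longlonglongrightarrow> exp (- t) * norm (x - y)" by (intro tendsto_intros N_lim)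
    show "norm (F x \<omega> - F y \<omega>) \<le> exp (- t) * norm (x - y)"
      by (rule LIMSEQ_le[OF l l2]) (use g in blast)
    show "(norm (F x \<omega> - F y \<omega>))\<^sup>2 \<le> 2 / t"
      by (rule LIMSEQ_le_const2[OF tendsto_power[OF l]]) (use g in blast)
  qed
  have FX: "AE \<omega> in M. F x \<omega> = X x t \<omega>" for x
  proof -
    have "AE \<omega> in M. \<forall>i. dist (X (e i) t \<omega>) (X x t \<omega>) \<le> dist (e i) x"
      unfolding AE_all_countable by (intro allI X_nonexpansive t)
    with ae show ?thesis
    proof eventually_elim
      case (elim \<omega>)
      have "(\<lambda>n. dist (e (N n x)) x) \<longlonglongrightarrow> 0" by (rule iffD1[OF tendsto_dist_iff N_lim])
      then have "(\<lambda>n. dist (G n x \<omega>) (X x t \<omega>)) \<longlonglongrightarrow> 0"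
        by (rule Lim_null_comparison[rotated]) (use elim in \<open>auto simp: G_def\<close>)
      then have "(\<lambda>n. G n x \<omega>) \<longlonglongrightarrow> X x t \<omega>" by (rule iffD2[OF tendsto_dist_iff])
      then show ?case using F_lim LIMSEQ_unique by blast
    qed
  qed
  have "(\<lambda>p. F (fst p) (snd p)) \<in> borel_measurable (borel \<Otimes>\<^sub>M M)"
    unfolding F_def by measurable
  with FG FX show ?thesis by (intro exI[of _ F]) auto
qed

section \<open>Iterates of the time-one operator\<close>

lemma P_iter_test_fun: "test_fun K f \<Longrightarrow> test_fun K ((P 1 ^^ n) f)"
  by (induction n) (auto intro: P_test_fun)

text \<open>The n inner applications shrink the Lipschitz constant by exp (- 1) each; the outermost
  one uses the estimate without initial distance, which turns the Lipschitz constant into a bound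
  uniform on H.\<close>

lemma P_iter_osc:
  assumes f: "test_fun K f"
  shows "\<bar>(P 1 ^^ Suc n) f x - (P 1 ^^ Suc n) f y\<bar> \<le> K * sqrt 2 * exp (- 1) ^ n"
proof -
  have K: "K \<ge> 1" and fl: "\<And>x y. \<bar>f x - f y\<bar> \<le> K * dist x y" using f by (auto simp: test_fun_def)
  have "\<bar>(P 1 ^^ n) f x - (P 1 ^^ n) f y\<bar> \<le> K * exp (- 1) ^ n * dist x y" for x y
  proof (induction n arbitrary: x y)
    case (Suc n)
    show ?case
      using P_contract(1)[OF _ P_iter_test_fun[OF f] Suc, of 1 x y] K by (simp add: mult_ac)
  qed (use fl in simp)
  from P_contract(2)[OF _ P_iter_test_fun[OF f] this, of 1 x y] K show ?thesis by (simp add: mult_ac)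
qed

lemma P_iter_commute:
  assumes t: "t > 0" and f: "test_fun K f"
  shows "(P 1 ^^ n) (P t f) = P t ((P 1 ^^ n) f)"
proof (induction n)
  case (Suc n)
  have g: "test_fun K ((P 1 ^^ n) f)" by (rule P_iter_test_fun[OF f])
  have "P 1 (P t ((P 1 ^^ n) f)) = P t (P 1 ((P 1 ^^ n) f))"
    using markov[OF zero_less_one t g] markov[OF t zero_less_one g] by (auto simp: fun_eq_iff add.commute)
  then show ?case using Suc by simp
qed simp

text \<open>A reduced form of invariance, tested at time 1 on test functions; it is what the
  contraction handles directly and is later shown to imply full invariance.\<close>

definition P1_invariant :: "hspace measure \<Rightarrow> bool" where
  "P1_invariant \<mu> \<longleftrightarrow> prob_space \<mu> \<and> sets \<mu> = sets borel \<and>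
     (\<forall>K f. test_fun K f \<longrightarrow> (LINT x|\<mu>. P 1 f x) = (LINT x|\<mu>. f x))"

text \<open>Invariance writes the integral as the \<mu>-average of the same iterate, from which the
  value at \<open>y\<close> deviates by at most the oscillation.\<close>

lemma P1_invariant_limit:
  assumes \<mu>: "P1_invariant \<mu>" and f: "test_fun K f"
  shows "\<bar>(P 1 ^^ Suc n) f y - (LINT x|\<mu>. f x)\<bar> \<le> K * sqrt 2 * exp (- 1) ^ n"
proof -
  interpret m: prob_space \<mu> using \<mu> by (simp add: P1_invariant_def)
  have s: "sets \<mu> = sets borel" using \<mu> by (simp add: P1_invariant_def)
  have id: "(\<lambda>x. x) \<in> borel_measurable \<mu>" by (simp add: measurable_ident_sets[OF s])
  have i: "integrable \<mu> ((P 1 ^^ n) f)" for n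
    using m.integrable_test_fun[OF P_iter_test_fun[OF f] id] by simp
  have e: "(LINT x|\<mu>. (P 1 ^^ n) f x) = (LINT x|\<mu>. f x)" for n
  proof (induction n)
    case (Suc n)
    have "(LINT x|\<mu>. P 1 ((P 1 ^^ n) f) x) = (LINT x|\<mu>. (P 1 ^^ n) f x)"
      using \<mu> P_iter_test_fun[OF f] unfolding P1_invariant_def by blast
    then show ?case using Suc by simp
  qed simp
  have "\<bar>(P 1 ^^ Suc n) f y - (LINT x|\<mu>. f x)\<bar> = \<bar>LINT x|\<mu>. (P 1 ^^ Suc n) f y - (P 1 ^^ Suc n) f x\<bar>"
    using i[of "Suc n"] e[of "Suc n"] m.prob_space by simp
  also have "\<dots> \<le> (LINT x|\<mu>. \<bar>(P 1 ^^ Suc n) f y - (P 1 ^^ Suc n) f x\<bar>)"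
    using integral_norm_bound[of \<mu> "\<lambda>x. (P 1 ^^ Suc n) f y - (P 1 ^^ Suc n) f x"] by simp
  also have "\<dots> \<le> (LINT x|\<mu>. K * sqrt 2 * exp (- 1) ^ n)"
    using i[of "Suc n"] P_iter_osc[OF f] by (intro integral_mono) auto
  finally show ?thesis by (simp add: m.prob_space)
qed

lemma exp_minus_one_power_LIMSEQ: "(\<lambda>n. c * exp (- 1) ^ n) \<longlonglongrightarrow> (0::real)"
proof -
  have "(\<lambda>n. c * exp (- 1) ^ n) \<longlonglongrightarrow> c * (0::real)"
    by (intro tendsto_intros LIMSEQ_power_zero) simp
  then show ?thesis by simp
qed

lemma P1_invariant_unique:
  assumes "P1_invariant \<mu>" "P1_invariant \<nu>"
  shows "\<mu> = \<nu>"
proof (rule measure_eqI_test_fun)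
  fix K and f :: "hspace \<Rightarrow> real" assume f: "test_fun K f"
  have "(\<lambda>n. (P 1 ^^ Suc n) f 0 - (LINT x|\<mu>. f x)) \<longlonglongrightarrow> 0"
    by (rule Lim_null_comparison[OF _ exp_minus_one_power_LIMSEQ[of "K * sqrt 2"]])
      (use P1_invariant_limit[OF assms(1) f] in \<open>simp del: funpow.simps\<close>)
  moreover have "(\<lambda>n. (P 1 ^^ Suc n) f 0 - (LINT x|\<nu>. f x)) \<longlonglongrightarrow> 0"
    by (rule Lim_null_comparison[OF _ exp_minus_one_power_LIMSEQ[of "K * sqrt 2"]])
      (use P1_invariant_limit[OF assms(2) f] in \<open>simp del: funpow.simps\<close>)
  ultimately show "(LINT x|\<mu>. f x) = (LINT x|\<nu>. f x)"
    unfolding LIM_zero_iff using LIMSEQ_unique by blast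
qed (use assms in \<open>auto simp: P1_invariant_def\<close>)

text \<open>Backward iteration of a random contraction. The stream space supplies independent copies
  of the whole probability space, one for each unit of time.\<close>

lemma exists_P1_invariant: "\<exists>\<mu>. P1_invariant \<mu>"
proof -
  obtain F where F_meas: "(\<lambda>p. F (fst p) (snd p)) \<in> borel_measurable (borel \<Otimes>\<^sub>M M)"
    and F: "\<And>\<omega> x y. norm (F x \<omega> - F y \<omega>) \<le> exp (- 1) * norm (x - y)" "\<And>\<omega> x y. (norm (F x \<omega> - F y \<omega>))\<^sup>2 \<le> 2"
    and FX: "\<And>x. AE \<omega> in M. F x \<omega> = X x 1 \<omega>"
    using exists_random_map[of 1] by auto
  interpret S: prob_space "stream_space M" by (rule prob_space_stream_space)
  interpret MS: pair_sigma_finite M "stream_space M" ..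
  \<comment> \<open>The head of the stream is applied last, so a longer composition only inserts
    noise further in the past. This order gives pointwise convergence rather than mere convergence
    of laws.\<close>
  define Y :: "nat \<Rightarrow> 'w stream \<Rightarrow> hspace" where
    "Y = rec_nat (\<lambda>_. 0) (\<lambda>_ y \<sigma>. F (y (stl \<sigma>)) (shd \<sigma>))"
  have Y: "Y 0 \<sigma> = 0" "Y (Suc n) \<sigma> = F (Y n (stl \<sigma>)) (shd \<sigma>)" for n \<sigma> by (simp_all add: Y_def)
  have Fc: "(\<lambda>\<omega>. F (u \<omega>) (v \<omega>)) \<in> borel_measurable N"
    if "u \<in> borel_measurable N" "v \<in> measurable N M" for u v and N :: "'n measure"
    using measurable_compose[OF measurable_Pair[OF that] F_meas] by simp
  have Ym [measurable]: "Y n \<in> borel_measurable (stream_space M)" for n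
  proof (induction n)
    case (Suc n)
    then have [measurable]: "Y n \<in> borel_measurable (stream_space M)" .
    show ?case unfolding Y(2)[abs_def] by (rule Fc) measurable
  qed (simp add: Y(1)[abs_def])
  \<comment> \<open>The index starts at 1: the difference between \<open>Y 1\<close> and
    \<open>Y 0\<close> has no uniform bound, whereas \<open>Y 2\<close> and \<open>Y 1\<close> are
    images under the same map and are within sqrt 2.\<close>
  have step: "norm (Y (Suc (Suc n)) \<sigma> - Y (Suc n) \<sigma>) \<le> exp (- 1) ^ n * sqrt 2" for n \<sigma>
  proof (induction n arbitrary: \<sigma>)
    case 0
    show ?case using F(2)[of "Y (Suc 0) (stl \<sigma>)" "shd \<sigma>" "Y 0 (stl \<sigma>)"]
      by (simp add: Y(2)[of "Suc 0"] Y(2)[of 0 \<sigma>] real_le_rsqrt)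
  next
    case (Suc n)
    have "norm (Y (Suc (Suc (Suc n))) \<sigma> - Y (Suc (Suc n)) \<sigma>) \<le> exp (- 1) * norm (Y (Suc (Suc n)) (stl \<sigma>) - Y (Suc n) (stl \<sigma>))"
      unfolding Y(2)[of "Suc (Suc n)"] Y(2)[of "Suc n" \<sigma>] by (rule F(1))
    also have "\<dots> \<le> exp (- 1) * (exp (- 1) ^ n * sqrt 2)" by (intro mult_left_mono Suc) simp
    finally show ?case by (simp add: mult.assoc)
  qed
  have conv: "convergent (\<lambda>n. Y n \<sigma>)" for \<sigma>
  proof -
    have "summable (\<lambda>n. exp (- 1) ^ n * sqrt 2 :: real)" by (intro summable_mult2 summable_geometric) simp
    then have "summable (\<lambda>n. Y (Suc (Suc n)) \<sigma> - Y (Suc n) \<sigma>)"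
      by (rule summable_comparison_test[rotated]) (use step in auto)
    then have "convergent (\<lambda>n. Y (Suc 0) \<sigma> + (\<Sum>i<n. Y (Suc (Suc i)) \<sigma> - Y (Suc i) \<sigma>))"
      by (intro convergent_add convergent_const) (simp add: summable_iff_convergent)
    moreover have "Y (Suc 0) \<sigma> + (\<Sum>i<n. Y (Suc (Suc i)) \<sigma> - Y (Suc i) \<sigma>) = Y (Suc n) \<sigma>" for n
      using sum_lessThan_telescope[of "\<lambda>n. Y (Suc n) \<sigma>" n] by simp
    ultimately show ?thesis using convergent_Suc_iff[of "\<lambda>n. Y n \<sigma>"] by simp
  qed
  define Yi where "Yi \<sigma> = lim (\<lambda>n. Y n \<sigma>)" for \<sigma>
  have Yi: "(\<lambda>n. Y n \<sigma>) \<longlonglongrightarrow> Yi \<sigma>" for \<sigma>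
    using conv unfolding Yi_def by (simp add: convergent_LIMSEQ_iff)
  have Yim [measurable]: "Yi \<in> borel_measurable (stream_space M)" unfolding Yi_def by measurable
  \<comment> \<open>The distributional fixed point: \<open>Yi (stl \<sigma>)\<close> has the law of
    \<open>Yi \<sigma>\<close> and is independent of the head, so one step of the random map
    preserves that law.\<close>
  have Yi_fixed: "Yi \<sigma> = F (Yi (stl \<sigma>)) (shd \<sigma>)" for \<sigma>
  proof (rule LIMSEQ_unique)
    show "(\<lambda>n. Y (Suc n) \<sigma>) \<longlonglongrightarrow> Yi \<sigma>" by (rule LIMSEQ_Suc[OF Yi])
    have "(\<lambda>n. norm (Y n (stl \<sigma>) - Yi (stl \<sigma>))) \<longlonglongrightarrow> norm (Yi (stl \<sigma>) - Yi (stl \<sigma>))"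
      by (intro tendsto_intros Yi)
    then have "(\<lambda>n. exp (- 1) * norm (Y n (stl \<sigma>) - Yi (stl \<sigma>))) \<longlonglongrightarrow> exp (- 1) * norm (Yi (stl \<sigma>) - Yi (stl \<sigma>))"
      by (rule tendsto_mult_left)
    then have "(\<lambda>n. exp (- 1) * norm (Y n (stl \<sigma>) - Yi (stl \<sigma>))) \<longlonglongrightarrow> 0" by simp
    then have "(\<lambda>n. F (Y n (stl \<sigma>)) (shd \<sigma>) - F (Yi (stl \<sigma>)) (shd \<sigma>)) \<longlonglongrightarrow> 0"
      by (rule Lim_null_comparison[rotated]) (intro always_eventually allI F(1))
    then show "(\<lambda>n. Y (Suc n) \<sigma>) \<longlonglongrightarrow> F (Yi (stl \<sigma>)) (shd \<sigma>)" by (simp add: Y LIM_zero_iff)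
  qed
  define \<mu> where "\<mu> = distr (stream_space M) borel Yi"
  have "P1_invariant \<mu>"
    unfolding P1_invariant_def
  proof (intro conjI allI impI)
    show "prob_space \<mu>" unfolding \<mu>_def by (rule S.prob_space_distr) measurable
    show "sets \<mu> = sets borel" by (simp add: \<mu>_def)
    fix K and f :: "hspace \<Rightarrow> real" assume f: "test_fun K f"
    have [measurable]: "f \<in> borel_measurable borel" "P 1 f \<in> borel_measurable borel"
      using test_fun_measurable[OF f] test_fun_measurable[OF P_test_fun[OF zero_less_one f]] by auto
    have Fm [measurable]: "(\<lambda>p. F (Yi (snd p)) (fst p)) \<in> borel_measurable (M \<Otimes>\<^sub>M stream_space M)"
      by (rule Fc) measurable
    have "ennreal (LINT x|\<mu>. f x) = ennreal (LINT \<sigma>|stream_space M. f (Yi \<sigma>))"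
      unfolding \<mu>_def by (simp add: integral_distr)
    also have "\<dots> = (\<integral>\<^sup>+ \<sigma>. ennreal (f (Yi \<sigma>)) \<partial>stream_space M)"
      using S.integrable_test_fun[OF f Yim] test_fun_range[OF f] by (intro nn_integral_eq_integral[symmetric]) auto
    also have "\<dots> = (\<integral>\<^sup>+ \<omega>. (\<integral>\<^sup>+ \<sigma>. ennreal (f (Yi (\<omega> ## \<sigma>))) \<partial>stream_space M) \<partial>M)"
      by (rule nn_integral_stream_space) measurable
    also have "\<dots> = (\<integral>\<^sup>+ \<omega>. (\<integral>\<^sup>+ \<sigma>. ennreal (f (F (Yi \<sigma>) \<omega>)) \<partial>stream_space M) \<partial>M)"
      by (subst Yi_fixed) simp
    also have "\<dots> = (\<integral>\<^sup>+ \<sigma>. (\<integral>\<^sup>+ \<omega>. ennreal (f (F (Yi \<sigma>) \<omega>)) \<partial>M) \<partial>stream_space M)"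
      using MS.Fubini'[of "\<lambda>\<omega> \<sigma>. ennreal (f (F (Yi \<sigma>) \<omega>))"] by (simp add: split_beta')
    also have "\<dots> = (\<integral>\<^sup>+ \<sigma>. ennreal (P 1 f (Yi \<sigma>)) \<partial>stream_space M)"
    proof (rule nn_integral_cong)
      fix \<sigma>
      have "(\<integral>\<^sup>+ \<omega>. ennreal (f (F (Yi \<sigma>) \<omega>)) \<partial>M) = (\<integral>\<^sup>+ \<omega>. ennreal (f (X (Yi \<sigma>) 1 \<omega>)) \<partial>M)"
        by (rule nn_integral_cong_AE) (use FX[of "Yi \<sigma>"] in \<open>auto elim: eventually_mono\<close>)
      also have "\<dots> = ennreal (P 1 f (Yi \<sigma>))"
        unfolding transition_op_def using test_fun_range[OF f]
        by (intro nn_integral_eq_integral integrable_test_fun[OF f]) auto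
      finally show "(\<integral>\<^sup>+ \<omega>. ennreal (f (F (Yi \<sigma>) \<omega>)) \<partial>M) = ennreal (P 1 f (Yi \<sigma>))" .
    qed
    also have "\<dots> = ennreal (LINT \<sigma>|stream_space M. P 1 f (Yi \<sigma>))"
      using S.integrable_test_fun[OF P_test_fun[OF zero_less_one f] Yim] test_fun_range[OF P_test_fun[OF zero_less_one f]]
      by (intro nn_integral_eq_integral) auto
    also have "\<dots> = ennreal (LINT x|\<mu>. P 1 f x)"
      unfolding \<mu>_def by (simp add: integral_distr)
    finally have "ennreal (LINT x|\<mu>. f x) = ennreal (LINT x|\<mu>. P 1 f x)" .
    moreover have "0 \<le> (LINT x|\<mu>. f x)" "0 \<le> (LINT x|\<mu>. P 1 f x)"
      using test_fun_range(1)[OF f] test_fun_range(1)[OF P_test_fun[OF zero_less_one f]]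
      by (auto intro!: Bochner_Integration.integral_nonneg)
    ultimately show "(LINT x|\<mu>. P 1 f x) = (LINT x|\<mu>. f x)" by simp
  qed
  then show ?thesis by blast
qed

text \<open>The sequence \<open>P t ((P 1 ^^ n) f) 0\<close> has two limits: iterates of
  \<open>f\<close> approach its \<mu>-mean uniformly, and after commuting they are iterates of
  \<open>P t f\<close>, which approach the mean of that function.\<close>

lemma P1_invariant_P:
  assumes \<mu>: "P1_invariant \<mu>" and t: "t > 0" and f: "test_fun K f"
  shows "(LINT x|\<mu>. P t f x) = (LINT x|\<mu>. f x)"
proof -
  have Pf: "test_fun K (P t f)" by (rule P_test_fun[OF t f])
  have le: "\<bar>P t ((P 1 ^^ Suc n) f) 0 - (LINT x|\<mu>. f x)\<bar> \<le> K * sqrt 2 * exp (- 1) ^ n" for n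
  proof -
    have i: "integrable M (\<lambda>\<omega>. (P 1 ^^ Suc n) f (X 0 t \<omega>))"
      using t by (intro integrable_test_fun[OF P_iter_test_fun[OF f]]) simp
    have "\<bar>P t ((P 1 ^^ Suc n) f) 0 - (LINT x|\<mu>. f x)\<bar> = \<bar>expectation (\<lambda>\<omega>. (P 1 ^^ Suc n) f (X 0 t \<omega>) - (LINT x|\<mu>. f x))\<bar>"
      using i by (simp add: transition_op_def prob_space del: funpow.simps)
    also have "\<dots> \<le> expectation (\<lambda>\<omega>. \<bar>(P 1 ^^ Suc n) f (X 0 t \<omega>) - (LINT x|\<mu>. f x)\<bar>)"
      using integral_norm_bound[of M "\<lambda>\<omega>. (P 1 ^^ Suc n) f (X 0 t \<omega>) - (LINT x|\<mu>. f x)"] by simp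
    also have "\<dots> \<le> expectation (\<lambda>\<omega>. K * sqrt 2 * exp (- 1) ^ n)"
      by (intro integral_mono P1_invariant_limit[OF \<mu> f]) (use i in \<open>auto simp del: funpow.simps\<close>)
    finally show ?thesis by (simp add: prob_space del: funpow.simps)
  qed
  have "(\<lambda>n. P t ((P 1 ^^ Suc n) f) 0 - (LINT x|\<mu>. f x)) \<longlonglongrightarrow> 0"
    by (rule Lim_null_comparison[OF _ exp_minus_one_power_LIMSEQ[of "K * sqrt 2"]])
      (use le in \<open>simp del: funpow.simps\<close>)
  moreover have "(\<lambda>n. (P 1 ^^ Suc n) (P t f) 0 - (LINT x|\<mu>. P t f x)) \<longlonglongrightarrow> 0"
    by (rule Lim_null_comparison[OF _ exp_minus_one_power_LIMSEQ[of "K * sqrt 2"]])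
      (use P1_invariant_limit[OF \<mu> Pf] in \<open>simp del: funpow.simps\<close>)
  ultimately show ?thesis
    unfolding LIM_zero_iff P_iter_commute[OF t f] using LIMSEQ_unique by blast
qed

text \<open>Passes from test functions to bounded measurable ones by an equality of measures. Time 0
  is separate because the random map exists for positive times.\<close>

lemma P1_invariant_imp_invariant:
  assumes \<mu>: "P1_invariant \<mu>"
  shows "invariant_measure M X \<mu>"
  unfolding invariant_measure_def
proof (intro conjI allI impI ballI)
  show "prob_space \<mu>" and s [measurable_cong]: "sets \<mu> = sets borel" using \<mu> by (auto simp: P1_invariant_def)
  interpret m: prob_space \<mu> by fact
  interpret mM: pair_prob_space \<mu> M ..
  fix t :: real and f :: "hspace \<Rightarrow> real"
  assume t: "0 \<le> t" and f [measurable]: "f \<in> borel_measurable borel" and bf: "bounded (range f)"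
  show "(LINT x|\<mu>. P t f x) = (LINT x|\<mu>. f x)"
  proof (cases "t = 0")
    case True
    have "P 0 f x = f x" for x
    proof -
      have "P 0 f x = expectation (\<lambda>\<omega>. f x)"
        unfolding transition_op_def
        by (rule integral_cong_AE) (use X_0[of x] X_measurable[of 0 x] in \<open>auto elim!: eventually_mono\<close>)
      then show ?thesis by (simp add: prob_space)
    qed
    then show ?thesis using True by simp
  next
    case False
    then have t: "t > 0" using t by simp
    obtain F where F [measurable]: "(\<lambda>p. F (fst p) (snd p)) \<in> borel_measurable (borel \<Otimes>\<^sub>M M)"
      and FX: "\<And>x. AE \<omega> in M. F x \<omega> = X x t \<omega>"
      using exists_random_map[OF t] by blast
    have Fm [measurable]: "(\<lambda>p. F (fst p) (snd p)) \<in> borel_measurable (\<mu> \<Otimes>\<^sub>M M)"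
      using F by (simp cong: measurable_cong_sets sets_pair_measure_cong add: s)
    \<comment> \<open>The law at time t started from \<mu>, realized through the jointly measurable
      version, since joint measurability of \<open>X\<close> in the initial value is not
      given.\<close>
    define \<nu> where "\<nu> = distr (\<mu> \<Otimes>\<^sub>M M) borel (\<lambda>p. F (fst p) (snd p))"
    have \<nu>: "(LINT x|\<nu>. g x) = (LINT x|\<mu>. P t g x)"
      if [measurable]: "g \<in> borel_measurable borel" and bg: "bounded (range g)" for g :: "hspace \<Rightarrow> real"
    proof -
      obtain B where B: "\<And>x. \<bar>g x\<bar> \<le> B" using bg by (auto simp: bounded_iff)
      have i: "integrable (\<mu> \<Otimes>\<^sub>M M) (\<lambda>p. g (F (fst p) (snd p)))"
        by (rule mM.P.integrable_const_bound[of _ B]) (use B in auto)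
      have "(LINT x|\<nu>. g x) = (LINT p|(\<mu> \<Otimes>\<^sub>M M). g (F (fst p) (snd p)))"
        unfolding \<nu>_def by (rule integral_distr) measurable
      also have "\<dots> = (LINT x|\<mu>. LINT \<omega>|M. g (F x \<omega>))"
        using mM.integral_fst'[OF i] by simp
      also have "\<dots> = (LINT x|\<mu>. P t g x)"
      proof (rule Bochner_Integration.integral_cong[OF refl])
        fix x
        have [measurable]: "F x \<in> borel_measurable M"
          using measurable_compose[OF measurable_Pair1' F, of x] by simp
        show "(LINT \<omega>|M. g (F x \<omega>)) = P t g x"
          unfolding transition_op_def
          by (rule integral_cong_AE) (use FX[of x] X_measurable[of t x] t in \<open>auto elim!: eventually_mono\<close>)
      qed
      finally show ?thesis .
    qed
    have "\<nu> = \<mu>"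
    proof (rule measure_eqI_test_fun)
      show "prob_space \<nu>" unfolding \<nu>_def by (rule mM.prob_space_distr) measurable
      show "sets \<nu> = sets borel" by (simp add: \<nu>_def)
      fix K and g :: "hspace \<Rightarrow> real" assume g: "test_fun K g"
      have "bounded (range g)" using test_fun_range[OF g] by (auto simp: bounded_iff intro!: exI[of _ 1])
      then show "(LINT x|\<nu>. g x) = (LINT x|\<mu>. g x)"
        using \<nu>[OF test_fun_measurable[OF g]] P1_invariant_P[OF \<mu> t g] by simp
    qed (use s \<open>prob_space \<mu>\<close> in auto)
    then show ?thesis using \<nu>[OF f bf] by simp
  qed
qed

lemma invariant_imp_P1_invariant:
  assumes "invariant_measure M X \<mu>"
  shows "P1_invariant \<mu>"
proof -
  have "(LINT x|\<mu>. P 1 f x) = (LINT x|\<mu>. f x)" if f: "test_fun K f" for K f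
  proof -
    have "bounded (range f)" using test_fun_range[OF f] by (auto simp: bounded_iff intro!: exI[of _ 1])
    then show ?thesis using assms test_fun_measurable[OF f] by (simp add: invariant_measure_def)
  qed
  then show ?thesis using assms by (simp add: P1_invariant_def invariant_measure_def)
qed

lemma unique_invariant_measure: "\<exists>!\<mu>. invariant_measure M X \<mu>"
  using exists_P1_invariant P1_invariant_imp_invariant invariant_imp_P1_invariant P1_invariant_unique by metis

end

theorem theorem2p4:
  fixes M :: "'w measure" and \<alpha> \<beta> C\<^sub>1 C\<^sub>2 :: real
    and b :: "int \<Rightarrow> real" and l :: "int \<Rightarrow> real \<Rightarrow> 'w \<Rightarrow> real"
    and X :: "hspace \<Rightarrow> real \<Rightarrow> 'w \<Rightarrow> hspace"
  assumes "prob_space M"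
    and "\<And>k. k \<in> Zstar \<Longrightarrow> symmetric_stable_process M \<alpha> (l k)"
    and "indep_processes M l"
    and "C\<^sub>1 > 0" and "C\<^sub>2 > 0"
    and "\<And>k. k \<in> Zstar \<Longrightarrow>
           C\<^sub>1 * eigval k powr (- \<beta>) \<le> \<bar>b k\<bar> \<and> \<bar>b k\<bar> \<le> C\<^sub>2 * eigval k powr (- \<beta>)"
    and "\<And>x. mild_solution M (noise b l) x (X x)"
    and "3 / 2 < \<alpha>" and "\<alpha> < 2"
    and "1 / 2 + 1 / (2 * \<alpha>) < \<beta>" and "\<beta> < 3 / 2 - 1 / \<alpha>"
  shows "\<exists>!\<mu>. invariant_measure M X \<mu>"
proof -
  interpret prob_space M by fact
  have a: "0 < \<alpha>" "\<alpha> \<le> 2" using assms(8,9) by auto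
  \<comment> \<open>The lower bound on \<beta> gives \<alpha> \<beta> > 1/2, the condition for the
    sum of \<open>eigval k powr (- (\<alpha> * \<beta>))\<close> to converge, as the eigenvalues
    grow quadratically.\<close>
  have "\<alpha> * \<beta> > \<alpha> * (1 / 2 + 1 / (2 * \<alpha>))" using a assms(10) by (intro mult_strict_left_mono) auto
  also have "\<alpha> * (1 / 2 + 1 / (2 * \<alpha>)) = \<alpha> / 2 + 1 / 2" using a by (simp add: field_simps)
  finally have ab: "\<alpha> * \<beta> > 1 / 2" using a by simp
  have "(\<lambda>k. \<bar>b k\<bar> powr \<alpha>) summable_on Zstar"
  proof (rule summable_on_comparison_test)
    show "(\<lambda>k. C\<^sub>2 powr \<alpha> * eigval k powr (- (\<alpha> * \<beta>))) summable_on Zstar"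
      by (intro summable_on_cmult_right summable_on_eigval_powr ab)
    fix k assume k: "k \<in> Zstar"
    have "\<bar>b k\<bar> powr \<alpha> \<le> (C\<^sub>2 * eigval k powr (- \<beta>)) powr \<alpha>"
      using assms(6)[OF k] a by (intro powr_mono2) auto
    also have "\<dots> = C\<^sub>2 powr \<alpha> * eigval k powr (- (\<alpha> * \<beta>))"
      using assms(5) by (simp add: powr_mult powr_powr mult.commute)
    finally show "\<bar>b k\<bar> powr \<alpha> \<le> C\<^sub>2 powr \<alpha> * eigval k powr (- (\<alpha> * \<beta>))" .
  qed simp
  then interpret stable_noise M \<alpha> b l
    using a assms(2,3) by unfold_locales auto
  \<comment> \<open>The convolution of the solution started at 0 is taken as the common version for
    all initial values.\<close>
  obtain Z where Z: "\<And>t. 0 \<le> t \<Longrightarrow> stoch_conv M (noise b l) t (Z t)"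
    using assms(7)[of 0] unfolding mild_solution_def by blast
  interpret sde M \<alpha> b l Z X
    by unfold_locales (use Z assms(7) in \<open>auto simp: L_def\<close>)
  show ?thesis by (rule unique_invariant_measure)
qed

end
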